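(* Assume $\sigma=\hat\sigma$ in the PML system. Let $(u,p,u^*,p^* )$ be the solution of the truncated PML problem $$ \begin{cases} \partial_t u+(\sigma+\hat\sigma)u+\sigma u^*+\nabla\cdot p=f & \text{in }\Omega_\rho^+\times(0,T),\\ \partial_t p^*=-\nabla u,\quad \partial_t u^*=\sigma u & \text{in }\Omega_\rho^+\times(0,T),\\ \partial_t p+\Lambda_1p=\partial_tp^*+\Lambda_2p^* & \text{in }\Omega_\rho^+\times(0,T),\\ u=0 & \text{on }(\partial D\cup\Gamma_0\cup\Gamma_\rho^+)\times(0,T),\\ u|_{t=0}=p|_{t=0}=u^*|_{t=0}=p^*|_{t=0}=0 & \text{in }\Omega_\rho^+ . \end{cases} $$ Then there is a constant $C>0$, not depending on $f$, such that $$\max_{0\le t\le T}\Big(\|\partial_tu\|_{L^2(\Omega_\rho^+)}+\|\partial_tp\|_{L^2(\Omega_\rho^+)}+\|\partial_tu^*\|_{L^2(\Omega_\rho^+)}+\|\partial_tp^*\|_{L^2(\Omega_\rho^+)}\Big)\le C\int_0^T\|\partial_tf+\sigma f\|_{L^2(\Omega_\rho^+)}\,dt.$$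
   Context: Geometry: $0<R<\rho$ and $T>0$ are fixed. $\Gamma_0\subset\mathbb{R}^2$ is a non-selfintersecting $C^2$-smooth curve, a local perturbation of the line $\{x_2=0\}$ coinciding with it for $|x_1|>R$. $\Omega\subset\mathbb{R}^2$ is the unbounded domain above $\Gamma_0$. $B_a^+=\{x\in\Omega:|x|<a\}$ for $a=R,\rho$. $D\subset B_R^+$ is a bounded domain with Lipschitz boundary and connected exterior. $\Omega_\rho^+=B_\rho^+\setminus\overline D$, $\Gamma_\rho^+=\{x\in\Omega:|x|=\rho\}$. On the boundary of $\Omega_\rho^+$, $\Gamma_0$ means $\Gamma_0\cap\{|x|\le\rho\}$. $(r,\theta)$ are polar coordinates. PML coefficients: $\sigma=\sigma(r)$ with $\sigma=0$ for $r\le R$, $\sigma>0$ for $r>R$, monotonically increasing on $[R,\rho]$ with $\sigma_R\le\sigma\le\sigma_\rho$ there. $\Lambda_1=M^{T}\mathrm{diag}\{\sigma,\hat\sigma\}M$, $\Lambda_2=M^{T}\mathrm{diag}\{\hat\sigma,\sigma\}M$, $M=\begin{pmatrix}\cos\theta&\sin\theta\\-\sin\theta&\cos\theta\end{pmatrix}$. In this result the second coefficient function $\hat\sigma$ in the system is taken equal to $\sigma$, so $\Lambda_1=\Lambda_2=\sigma I$. The unknowns $u,u^*$ are scalar and $p,p^*$ are $2$-vector valued, with $u\in L^2(0,T;H_0^1(\Omega_\rho^+))\cap H^1(0,T;L^2(\Omega_\rho^+))$, $p\in L^2(0,T;H(\mathrm{div},\Omega_\rho^+))\cap H^1(0,T;L^2(\Omega_\rho^+))$,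 $u^*,p^*\in H^1(0,T;L^2(\Omega_\rho^+))$, where $H(\mathrm{div},\Omega_\rho^+)=\{p\in L^2(\Omega_\rho^+):\nabla\cdot p\in L^2(\Omega_\rho^+)\}$. Source: $f$ is compactly supported in space in $B_R^+\setminus\overline D$; for every bounded domain $\Omega_0$, $f\in H^2(0,T;L^2(\Omega_0))$, $f|_{t=0}=0$, and $f=\tilde f|_{(0,T)}$ with $\tilde f\in H^2(0,\infty;L^2(\Omega_0))$, $\|\tilde f\|_{H^2(0,\infty;L^2(\Omega_0))}\le\|f\|_{H^2(0,T;L^2(\Omega_0))}$. *)

theory Defs
  imports "HOL-Analysis.Analysis"
begin

section \<open>Test functions and weak derivatives in space\<close>

text \<open>\<^term>\<open>C_on k S f\<close>: \<open>f\<close> is of class \<open>C\<^sup>k\<close> on the open set \<open>S\<close>, by recursion on the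
  directional derivatives.\<close>

primrec C_on :: "nat \<Rightarrow> 'a::euclidean_space set \<Rightarrow> ('a \<Rightarrow> 'b::real_normed_vector) \<Rightarrow> bool" where
  "C_on 0 S f \<longleftrightarrow> continuous_on S f"
| "C_on (Suc k) S f \<longleftrightarrow>
     (\<exists>f'. (\<forall>x\<in>S. (f has_derivative f' x) (at x)) \<and> (\<forall>v. C_on k S (\<lambda>x. f' x v)))"

definition test_functions :: "'a::euclidean_space set \<Rightarrow> ('a \<Rightarrow> real) set" where
  "test_functions S =
     {\<phi>. (\<forall>k. C_on k UNIV \<phi>) \<and> compact (closure {x. \<phi> x \<noteq> 0}) \<and> closure {x. \<phi> x \<noteq> 0} \<subseteq> S}"

definition gradient :: "(real^2 \<Rightarrow> real) \<Rightarrow> real^2 \<Rightarrow> real^2" where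
  "gradient \<phi> x = (\<chi> i. frechet_derivative \<phi> (at x) (axis i 1))"

definition is_weak_gradient ::
    "(real^2) set \<Rightarrow> (real^2 \<Rightarrow> real) \<Rightarrow> (real^2 \<Rightarrow> real^2) \<Rightarrow> bool" where
  "is_weak_gradient W u g \<longleftrightarrow>
     (\<forall>\<phi>\<in>test_functions W. \<forall>i.
        (\<integral>x. u x * gradient \<phi> x $ i \<partial>lebesgue_on W) = - (\<integral>x. g x $ i * \<phi> x \<partial>lebesgue_on W))"

definition is_weak_div ::
    "(real^2) set \<Rightarrow> (real^2 \<Rightarrow> real^2) \<Rightarrow> (real^2 \<Rightarrow> real) \<Rightarrow> bool" where
  "is_weak_div W p d \<longleftrightarrow>
     (\<forall>\<phi>\<in>test_functions W.
        (\<integral>x. p x \<bullet> gradient \<phi> x \<partial>lebesgue_on W) = - (\<integral>x. d x * \<phi> x \<partial>lebesgue_on W))"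


section \<open>The spaces L2, H10 and H(div)\<close>

text \<open>A normed function space is represented by its functions, not by classes of functions modulo
  equality almost everywhere; \<^term>\<open>fnorm\<close> is thus only a seminorm, and two functions are the same
  element iff \<^term>\<open>fnorm\<close> of their difference is zero. Outside \<^term>\<open>elems\<close> the value of
  \<^term>\<open>fnorm\<close> is meaningless.\<close>

record ('a, 'b) fspace =
  elems :: "('a \<Rightarrow> 'b) set"
  fnorm :: "('a \<Rightarrow> 'b) \<Rightarrow> real"

definition fdist :: "('a, 'b::minus) fspace \<Rightarrow> ('a \<Rightarrow> 'b) \<Rightarrow> ('a \<Rightarrow> 'b) \<Rightarrow> real" where
  "fdist X g h = fnorm X (\<lambda>x. g x - h x)"

definition L2_space :: "(real^2) set \<Rightarrow> (real^2, 'b::real_normed_vector) fspace" where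
  "L2_space W =
     \<lparr> elems = {g. g \<in> borel_measurable (lebesgue_on W) \<and>
                   integrable (lebesgue_on W) (\<lambda>x. (norm (g x))\<^sup>2)},
       fnorm = (\<lambda>g. sqrt (\<integral>x. (norm (g x))\<^sup>2 \<partial>lebesgue_on W)) \<rparr>"

definition weak_gradient :: "(real^2) set \<Rightarrow> (real^2 \<Rightarrow> real) \<Rightarrow> real^2 \<Rightarrow> real^2" where
  "weak_gradient W u = (SOME g. g \<in> elems (L2_space W) \<and> is_weak_gradient W u g)"

definition weak_div :: "(real^2) set \<Rightarrow> (real^2 \<Rightarrow> real^2) \<Rightarrow> real^2 \<Rightarrow> real" where
  "weak_div W p = (SOME d. d \<in> elems (L2_space W) \<and> is_weak_div W p d)"

definition H1_space :: "(real^2) set \<Rightarrow> (real^2, real) fspace" where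
  "H1_space W =
     \<lparr> elems = {u \<in> elems (L2_space W). \<exists>g\<in>elems (L2_space W). is_weak_gradient W u g},
       fnorm = (\<lambda>u. sqrt ((fnorm (L2_space W) u)\<^sup>2 +
                          (fnorm (L2_space W) (weak_gradient W u))\<^sup>2)) \<rparr>"

text \<open>The closure of the test functions in \<open>H\<^sup>1\<close>; membership is the homogeneous Dirichlet condition
  on the whole boundary of \<open>W\<close>.\<close>

definition H10_space :: "(real^2) set \<Rightarrow> (real^2, real) fspace" where
  "H10_space W =
     \<lparr> elems = {u \<in> elems (H1_space W).
                  \<forall>e>0. \<exists>\<phi>\<in>test_functions W. fdist (H1_space W) u \<phi> < e},
       fnorm = fnorm (H1_space W) \<rparr>"

definition Hdiv_space :: "(real^2) set \<Rightarrow> (real^2, real^2) fspace" where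
  "Hdiv_space W =
     \<lparr> elems = {p \<in> elems (L2_space W). \<exists>d\<in>elems (L2_space W). is_weak_div W p d},
       fnorm = (\<lambda>p. sqrt ((fnorm (L2_space W) p)\<^sup>2 +
                          (fnorm (L2_space W) (weak_div W p))\<^sup>2)) \<rparr>"


section \<open>Bochner spaces over a time interval\<close>

text \<open>The Bochner integral of HOL-Analysis needs a type of class \<open>banach\<close> as codomain. Here is the
  same construction (approximation by simple functions) for functions of time with values in an
  \<^typ>\<open>('a, 'b) fspace\<close>.\<close>

definition simple_into ::
    "real set \<Rightarrow> ('a, 'b::real_vector) fspace \<Rightarrow> (real \<Rightarrow> 'a \<Rightarrow> 'b) \<Rightarrow> bool" where
  "simple_into I X s \<longleftrightarrow>
     finite (s ` I) \<and> s ` I \<subseteq> elems X \<and>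
     (\<forall>y. {t \<in> I. s t = y} \<in> sets lebesgue) \<and>
     emeasure lebesgue {t \<in> I. s t \<noteq> (\<lambda>_. 0)} < \<infinity>"

definition simple_integral :: "real set \<Rightarrow> (real \<Rightarrow> 'a \<Rightarrow> 'b::real_vector) \<Rightarrow> 'a \<Rightarrow> 'b" where
  "simple_integral I s x = (\<Sum>y\<in>s ` I. measure lebesgue {t \<in> I. s t = y} *\<^sub>R y x)"

definition strongly_measurable ::
    "real set \<Rightarrow> ('a, 'b::real_vector) fspace \<Rightarrow> (real \<Rightarrow> 'a \<Rightarrow> 'b) \<Rightarrow> bool" where
  "strongly_measurable I X u \<longleftrightarrow>
     (\<exists>s. (\<forall>n::nat. simple_into I X (s n)) \<and>
          (AE t in lebesgue_on I. (\<lambda>n. fdist X (s n t) (u t)) \<longlonglongrightarrow> 0))"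

definition has_time_integral ::
    "real set \<Rightarrow> ('a, 'b::real_vector) fspace \<Rightarrow> (real \<Rightarrow> 'a \<Rightarrow> 'b) \<Rightarrow> ('a \<Rightarrow> 'b) \<Rightarrow> bool" where
  "has_time_integral I X u y \<longleftrightarrow>
     y \<in> elems X \<and>
     (AE t in lebesgue_on I. u t \<in> elems X) \<and>
     (\<exists>s. (\<forall>n::nat. simple_into I X (s n)) \<and>
          (\<forall>n. integrable (lebesgue_on I) (\<lambda>t. fdist X (s n t) (u t))) \<and>
          (\<lambda>n. \<integral>t. fdist X (s n t) (u t) \<partial>lebesgue_on I) \<longlonglongrightarrow> 0 \<and>
          (\<lambda>n. fdist X (simple_integral I (s n)) y) \<longlonglongrightarrow> 0)"

definition L2_time ::
    "real set \<Rightarrow> ('a, 'b::real_vector) fspace \<Rightarrow> (real \<Rightarrow> 'a \<Rightarrow> 'b) set" where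
  "L2_time I X =
     {u. strongly_measurable I X u \<and> (AE t in lebesgue_on I. u t \<in> elems X) \<and>
         integrable (lebesgue_on I) (\<lambda>t. (fnorm X (u t))\<^sup>2)}"

definition is_time_deriv ::
    "real set \<Rightarrow> ('a, 'b::real_vector) fspace \<Rightarrow> (real \<Rightarrow> 'a \<Rightarrow> 'b) \<Rightarrow> (real \<Rightarrow> 'a \<Rightarrow> 'b) \<Rightarrow> bool"
  where
  "is_time_deriv I X u v \<longleftrightarrow>
     (\<forall>\<phi>\<in>test_functions I. \<exists>y.
        has_time_integral I X (\<lambda>t x. deriv \<phi> t *\<^sub>R u t x) y \<and>
        has_time_integral I X (\<lambda>t x. \<phi> t *\<^sub>R v t x) (\<lambda>x. - y x))"

definition H1_time ::
    "real set \<Rightarrow> ('a, 'b::real_vector) fspace \<Rightarrow> (real \<Rightarrow> 'a \<Rightarrow> 'b) set" where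
  "H1_time I X = {u \<in> L2_time I X. \<exists>v\<in>L2_time I X. is_time_deriv I X u v}"

definition time_deriv ::
    "real set \<Rightarrow> ('a, 'b::real_vector) fspace \<Rightarrow> (real \<Rightarrow> 'a \<Rightarrow> 'b) \<Rightarrow> real \<Rightarrow> 'a \<Rightarrow> 'b" where
  "time_deriv I X u = (SOME v. v \<in> L2_time I X \<and> is_time_deriv I X u v)"

definition H2_time ::
    "real set \<Rightarrow> ('a, 'b::real_vector) fspace \<Rightarrow> (real \<Rightarrow> 'a \<Rightarrow> 'b) set" where
  "H2_time I X = {u \<in> H1_time I X. time_deriv I X u \<in> H1_time I X}"

definition L2_time_norm ::
    "real set \<Rightarrow> ('a, 'b::real_vector) fspace \<Rightarrow> (real \<Rightarrow> 'a \<Rightarrow> 'b) \<Rightarrow> real" where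
  "L2_time_norm I X u = sqrt (\<integral>t. (fnorm X (u t))\<^sup>2 \<partial>lebesgue_on I)"

definition H2_time_norm ::
    "real set \<Rightarrow> ('a, 'b::real_vector) fspace \<Rightarrow> (real \<Rightarrow> 'a \<Rightarrow> 'b) \<Rightarrow> real" where
  "H2_time_norm I X u =
     sqrt ((L2_time_norm I X u)\<^sup>2 + (L2_time_norm I X (time_deriv I X u))\<^sup>2 +
           (L2_time_norm I X (time_deriv I X (time_deriv I X u)))\<^sup>2)"

text \<open>\<open>v\<close> is a representative in \<open>C([0,T]; X)\<close> of the element \<open>u\<close> of a Bochner space over
  \<open>(0,T)\<close>. Values at a fixed time, such as initial values, refer to this representative.\<close>

definition continuous_version ::
    "real \<Rightarrow> ('a, 'b::real_vector) fspace \<Rightarrow> (real \<Rightarrow> 'a \<Rightarrow> 'b) \<Rightarrow> (real \<Rightarrow> 'a \<Rightarrow> 'b) \<Rightarrow> bool" where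
  "continuous_version T X u v \<longleftrightarrow>
     (\<forall>t\<in>{0..T}. v t \<in> elems X) \<and>
     (\<forall>t\<in>{0..T}. ((\<lambda>s. fdist X (v s) (v t)) \<longlongrightarrow> 0) (at t within {0..T})) \<and>
     (AE t in lebesgue_on {0<..<T}. u t \<in> elems X \<and> fdist X (u t) (v t) = 0)"

definition zero_initial_value ::
    "real \<Rightarrow> ('a, 'b::real_vector) fspace \<Rightarrow> (real \<Rightarrow> 'a \<Rightarrow> 'b) \<Rightarrow> bool" where
  "zero_initial_value T X u \<longleftrightarrow> (\<exists>v. continuous_version T X u v \<and> fnorm X (v 0) = 0)"


section \<open>Geometry\<close>

definition bounded_domain :: "(real^2) set \<Rightarrow> bool" where
  "bounded_domain W \<longleftrightarrow> open W \<and> connected W \<and> W \<noteq> {} \<and> bounded W"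

definition local_perturbation_of_line :: "real \<Rightarrow> (real^2) set \<Rightarrow> bool" where
  "local_perturbation_of_line R \<Gamma> \<longleftrightarrow>
     (\<exists>\<gamma>::real \<Rightarrow> real^2.
        inj \<gamma> \<and> C_on 2 UNIV \<gamma> \<and> (\<forall>s. vector_derivative \<gamma> (at s) \<noteq> 0) \<and> range \<gamma> = \<Gamma>) \<and>
     \<Gamma> \<inter> {x. \<bar>x $ 1\<bar> > R} = {x. x $ 2 = 0 \<and> \<bar>x $ 1\<bar> > R}"

definition is_domain_above :: "(real^2) set \<Rightarrow> (real^2) set \<Rightarrow> bool" where
  "is_domain_above \<Gamma> \<Omega> \<longleftrightarrow> open \<Omega> \<and> \<Omega> \<in> components (- \<Gamma>) \<and> (\<exists>h. {x. x $ 2 > h} \<subseteq> \<Omega>)"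

text \<open>Near each boundary point \<open>z\<close>, in suitable orthonormal coordinates centred at \<open>z\<close>, the set is
  the strict epigraph of a Lipschitz function.\<close>

definition lipschitz_boundary :: "(real^2) set \<Rightarrow> bool" where
  "lipschitz_boundary D \<longleftrightarrow>
     (\<forall>z\<in>frontier D. \<exists>(A::real^2 \<Rightarrow> real^2) (g::real \<Rightarrow> real) L a b.
        orthogonal_transformation A \<and> a > 0 \<and> b > 0 \<and>
        L-lipschitz_on {-a<..<a} g \<and> (\<forall>s\<in>{-a<..<a}. \<bar>g s\<bar> < b) \<and>
        (\<forall>y. \<bar>y $ 1\<bar> < a \<and> \<bar>y $ 2\<bar> < b \<longrightarrow> (z + A y \<in> D \<longleftrightarrow> g (y $ 1) < y $ 2)))"

definition half_ball :: "(real^2) set \<Rightarrow> real \<Rightarrow> (real^2) set" where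
  "half_ball \<Omega> a = {x \<in> \<Omega>. norm x < a}"

definition truncated_domain :: "(real^2) set \<Rightarrow> (real^2) set \<Rightarrow> real \<Rightarrow> (real^2) set" where
  "truncated_domain \<Omega> D \<rho> = half_ball \<Omega> \<rho> - closure D"


section \<open>The truncated PML problem\<close>

definition polar_angle :: "real^2 \<Rightarrow> real" where
  "polar_angle x = Arg (Complex (x $ 1) (x $ 2))"

definition rot_matrix :: "real \<Rightarrow> real^2^2" where
  "rot_matrix \<theta> = vector [vector [cos \<theta>, sin \<theta>], vector [- sin \<theta>, cos \<theta>]]"

definition diag_matrix :: "real \<Rightarrow> real \<Rightarrow> real^2^2" where
  "diag_matrix a b = vector [vector [a, 0], vector [0, b]]"

definition Lambda1 :: "(real \<Rightarrow> real) \<Rightarrow> (real \<Rightarrow> real) \<Rightarrow> real^2 \<Rightarrow> real^2^2" where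
  "Lambda1 \<sigma> \<sigma>h x =
     transpose (rot_matrix (polar_angle x)) ** diag_matrix (\<sigma> (norm x)) (\<sigma>h (norm x)) **
       rot_matrix (polar_angle x)"

definition Lambda2 :: "(real \<Rightarrow> real) \<Rightarrow> (real \<Rightarrow> real) \<Rightarrow> real^2 \<Rightarrow> real^2^2" where
  "Lambda2 \<sigma> \<sigma>h x =
     transpose (rot_matrix (polar_angle x)) ** diag_matrix (\<sigma>h (norm x)) (\<sigma> (norm x)) **
       rot_matrix (polar_angle x)"

text \<open>The source is regarded as extended by zero to the whole plane; the bounded domains \<open>W\<close> are
  arbitrary. The constant 1 in the bound on the extension \<open>f'\<close> is part of the assumption; with the
  norms used here it makes \<open>f'\<close> vanish for times after \<open>T\<close>.\<close>

definition admissible_source ::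
    "(real^2) set \<Rightarrow> (real^2) set \<Rightarrow> real \<Rightarrow> real \<Rightarrow> (real \<Rightarrow> real^2 \<Rightarrow> real) \<Rightarrow> bool" where
  "admissible_source \<Omega> D R T f \<longleftrightarrow>
     (\<exists>K. compact K \<and> K \<subseteq> half_ball \<Omega> R - closure D \<and>
          (AE t in lebesgue_on {0<..<T}. AE x in lebesgue_on (- K). f t x = 0)) \<and>
     (\<forall>W. bounded_domain W \<longrightarrow>
        f \<in> H2_time {0<..<T} (L2_space W) \<and>
        zero_initial_value T (L2_space W) f \<and>
        (\<exists>f'. (AE t in lebesgue_on {0<..<T}. AE x in lebesgue_on W. f t x = f' t x) \<and>
              f' \<in> H2_time {0<..} (L2_space W) \<and>
              H2_time_norm {0<..} (L2_space W) f' \<le> H2_time_norm {0<..<T} (L2_space W) f))"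

definition truncated_pml_solution ::
    "(real^2) set \<Rightarrow> real \<Rightarrow> (real \<Rightarrow> real) \<Rightarrow> (real \<Rightarrow> real) \<Rightarrow> (real \<Rightarrow> real^2 \<Rightarrow> real) \<Rightarrow>
     (real \<Rightarrow> real^2 \<Rightarrow> real) \<Rightarrow> (real \<Rightarrow> real^2 \<Rightarrow> real^2) \<Rightarrow>
     (real \<Rightarrow> real^2 \<Rightarrow> real) \<Rightarrow> (real \<Rightarrow> real^2 \<Rightarrow> real^2) \<Rightarrow> bool" where
  "truncated_pml_solution W T \<sigma> \<sigma>h f u p us ps \<longleftrightarrow>
     (let I = {0<..<T};
          dt = time_deriv I (L2_space W);
          dtv = time_deriv I (L2_space W)
      in
        u \<in> L2_time I (H10_space W) \<inter> H1_time I (L2_space W) \<and>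
        p \<in> L2_time I (Hdiv_space W) \<inter> H1_time I (L2_space W) \<and>
        us \<in> H1_time I (L2_space W) \<and>
        ps \<in> H1_time I (L2_space W) \<and>
        (AE t in lebesgue_on I. AE x in lebesgue_on W.
           dt u t x + (\<sigma> (norm x) + \<sigma>h (norm x)) * u t x + \<sigma> (norm x) * us t x
             + weak_div W (p t) x = f t x) \<and>
        (AE t in lebesgue_on I. AE x in lebesgue_on W.
           dtv ps t x = - weak_gradient W (u t) x) \<and>
        (AE t in lebesgue_on I. AE x in lebesgue_on W.
           dt us t x = \<sigma> (norm x) * u t x) \<and>
        (AE t in lebesgue_on I. AE x in lebesgue_on W.
           dtv p t x + Lambda1 \<sigma> \<sigma>h x *v p t x = dtv ps t x + Lambda2 \<sigma> \<sigma>h x *v ps t x) \<and>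
        zero_initial_value T (L2_space W) u \<and>
        zero_initial_value T (L2_space W) p \<and>
        zero_initial_value T (L2_space W) us \<and>
        zero_initial_value T (L2_space W) ps)"

end

theory Submission
  imports Defs "HOL-Analysis.Analysis"
begin

text \<open>
  Since \<open>\<Lambda>\<^sub>1 = \<Lambda>\<^sub>2 = \<sigma> I\<close>, the difference of \<open>p\<close> and \<open>p\<^sup>*\<close> solves \<open>w' = - \<sigma> w\<close> with zero initial
  value, so \<open>p = p\<^sup>*\<close> and the system reduces to
  \<open>u' + 2 \<sigma> u + \<sigma> u\<^sup>* + div p = f\<close>, \<open>p' = - grad u\<close>, \<open>u\<^sup>*' = \<sigma> u\<close>.
  It is dissipative: testing with \<open>(u, p, u\<^sup>*)\<close>, the divergence and the gradient cancel because \<open>u\<close>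
  vanishes on the boundary, the two terms \<open>\<sigma> u u\<^sup>*\<close> cancel, and \<open>- 2 \<sigma> u\<^sup>2\<close> has a sign
  (\<open>pml_rel_dissipative\<close>). Hence the energy identity bounds the \<open>L\<^sup>2\<close> norm of the triple by twice the
  time integral of \<open>\<parallel>f\<parallel>\<close> (\<open>energy_identity\<close>, \<open>energy_estimate\<close>).

  The estimate for the time derivatives comes from the same bound applied to difference quotients.
  Extended by zero to negative times the solution still solves the system, since its initial
  values vanish and \<open>f(0) = 0\<close>. So the backward difference quotients of the solution are solutions
  whose sources are the difference quotients of \<open>f\<close>. These converge in the mean to \<open>\<partial>\<^sub>t f\<close>, because \<open>f\<close>
  has a second time derivative and therefore a continuous first one. Consequently the difference
  quotients of the solution form a uniform Cauchy sequence; its limit is a continuous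
  representative of the time derivative and is bounded by twice the time integral of \<open>\<parallel>\<partial>\<^sub>t f\<parallel>\<close>
  (\<open>dissipative_evolution_time_derivative\<close>). Finally \<open>\<partial>\<^sub>t f = \<partial>\<^sub>t f + \<sigma> f\<close>, as \<open>\<sigma>\<close> vanishes on
  the support of \<open>f\<close>; adding the four norms gives the constant 8.

  Functions of time with values in \<open>L\<^sup>2\<close> are handled by testing. For fixed \<open>g\<close>, a weak time derivative
  becomes a scalar one (\<open>is_time_deriv_ip\<close>), and the lemma of du Bois-Reymond
  (\<open>du_Bois_Reymond\<close>) turns it into an integral. The exceptional null sets depend on \<open>g\<close>, but strongly
  measurable functions have essentially separable range, so countably many \<open>g\<close> suffice
  (\<open>approximable_bound\<close>, \<open>AE_eq_of_AE_ip_eq\<close>).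
\<close>

section \<open>Smooth bump functions\<close>

lemma C_on_Suc_imp: "C_on (Suc k) S f \<Longrightarrow> C_on k S f"
proof (induction k arbitrary: f)
  case 0
  then obtain f' where "\<forall>x\<in>S. (f has_derivative f' x) (at x)" by auto
  then have "\<forall>x\<in>S. isCont f x" using has_derivative_continuous by blast
  then show ?case by (simp add: continuous_at_imp_continuous_on)
next
  case (Suc k)
  then obtain f' where "\<forall>x\<in>S. (f has_derivative f' x) (at x)" "\<forall>v. C_on (Suc k) S (\<lambda>x. f' x v)"
    by (metis C_on.simps(2))
  then show ?case using Suc.IH by (metis C_on.simps(2))
qed

lemma C_on_SucI:
  assumes "\<And>x. x \<in> S \<Longrightarrow> (f has_derivative f' x) (at x)" "\<And>v. C_on k S (\<lambda>x. f' x v)"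
  shows "C_on (Suc k) S f"
  using assms by auto

lemma C_on_const: "C_on k S (\<lambda>_. c)"
proof (induction k arbitrary: c)
  case (Suc k)
  show ?case by (rule C_on_SucI[where f'="\<lambda>_ _. 0"]) (auto intro: Suc.IH)
qed auto

lemma C_on_add: "C_on k S f \<Longrightarrow> C_on k S g \<Longrightarrow> C_on k S (\<lambda>x. f x + g x)"
proof (induction k arbitrary: f g)
  case (Suc k)
  from Suc.prems(1) obtain f' where f': "\<forall>x\<in>S. (f has_derivative f' x) (at x)" "\<forall>v. C_on k S (\<lambda>x. f' x v)"
    by auto
  from Suc.prems(2) obtain g' where g': "\<forall>x\<in>S. (g has_derivative g' x) (at x)" "\<forall>v. C_on k S (\<lambda>x. g' x v)"
    by auto
  show ?case using f' g'
    by (intro C_on_SucI[where f'="\<lambda>x v. f' x v + g' x v"] Suc.IH has_derivative_add) simp_all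
qed (auto intro: continuous_intros)

text \<open>The derivative of the product contains the factors themselves; for the induction they must be
of class \<open>C\<^sup>k\<close>, which is where monotonicity in \<open>k\<close> is used.\<close>

lemma C_on_mult:
  fixes f g :: "'a::euclidean_space \<Rightarrow> real"
  shows "C_on k S f \<Longrightarrow> C_on k S g \<Longrightarrow> C_on k S (\<lambda>x. f x * g x)"
proof (induction k arbitrary: f g)
  case (Suc k)
  from Suc.prems(1) obtain f' where f': "\<forall>x\<in>S. (f has_derivative f' x) (at x)" "\<forall>v. C_on k S (\<lambda>x. f' x v)"
    by auto
  from Suc.prems(2) obtain g' where g': "\<forall>x\<in>S. (g has_derivative g' x) (at x)" "\<forall>v. C_on k S (\<lambda>x. g' x v)"
    by auto
  have "C_on k S f" "C_on k S g" using Suc.prems C_on_Suc_imp by blast+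
  with f' g' show ?case
    by (intro C_on_SucI[where f'="\<lambda>x v. f x * g' x v + f' x v * g x"] C_on_add Suc.IH has_derivative_mult)
       simp_all
qed (auto intro: continuous_intros)

lemma C_on_prod:
  fixes f :: "'i \<Rightarrow> 'a::euclidean_space \<Rightarrow> real"
  shows "finite A \<Longrightarrow> (\<And>i. i \<in> A \<Longrightarrow> C_on k S (f i)) \<Longrightarrow> C_on k S (\<lambda>x. \<Prod>i\<in>A. f i x)"
  by (induction A rule: finite_induct) (auto intro: C_on_const C_on_mult)

text \<open>The case \<open>m = 0\<close> is the usual smooth function that is flat at the origin. Its derivatives are
combinations of the functions with larger \<open>m\<close>, so that the whole family is treated at once.\<close>

definition flat :: "nat \<Rightarrow> real \<Rightarrow> real" where
  "flat m s = (if s > 0 then exp (- 1 / s) / s ^ m else 0)"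

lemma flat_tendsto_0: "(flat m \<longlongrightarrow> 0) (at 0)"
proof -
  have 1: "((\<lambda>x::real. x ^ m / exp x) \<longlongrightarrow> 0) at_top" by (rule tendsto_power_div_exp_0)
  have "((\<lambda>s::real. inverse s ^ m / exp (inverse s)) \<longlongrightarrow> 0) (at_right 0)"
    by (rule filterlim_compose[OF 1 filterlim_inverse_at_top_right])
  moreover have "eventually (\<lambda>s. inverse s ^ m / exp (inverse s) = flat m s) (at_right 0)"
    by (rule eventually_at_right_less[THEN eventually_mono])
       (simp add: flat_def exp_minus field_simps)
  ultimately have R: "(flat m \<longlongrightarrow> 0) (at_right 0)" by (rule Lim_transform_eventually)
  have "eventually (\<lambda>s. 0 = flat m s) (at_left 0)"
    unfolding eventually_at_filter by (auto simp: flat_def)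
  then have L: "(flat m \<longlongrightarrow> 0) (at_left 0)" by (rule Lim_transform_eventually[OF tendsto_const])
  from L R show ?thesis by (simp add: filterlim_split_at)
qed

lemma flat_deriv: "(flat m has_real_derivative (flat (m+2) s - m * flat (m+1) s)) (at s)"
proof -
  consider "s > 0" | "s < 0" | "s = 0" by linarith
  then show ?thesis
  proof cases
    case 1
    have "((\<lambda>s. exp (- 1 / s) / s ^ m) has_real_derivative (flat (m+2) s - m * flat (m+1) s)) (at s)"
      using 1 apply (auto intro!: derivative_eq_intros simp: flat_def)
      by (cases m; simp add: field_simps power2_eq_square)
    moreover have "eventually (\<lambda>s. exp (- 1 / s) / s ^ m = flat m s) (nhds s)"
      by (rule eventually_nhds_in_open[of "{0<..}", THEN eventually_mono]) (use 1 in \<open>auto simp: flat_def\<close>)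
    ultimately show ?thesis by (subst (asm) DERIV_cong_ev[OF refl _ refl]) auto
  next
    case 2
    have "((\<lambda>s. 0) has_real_derivative 0) (at s)" by simp
    moreover have "eventually (\<lambda>s. 0 = flat m s) (nhds s)"
      by (rule eventually_nhds_in_open[of "{..<0}", THEN eventually_mono]) (use 2 in \<open>auto simp: flat_def\<close>)
    ultimately show ?thesis using 2 by (subst (asm) DERIV_cong_ev[OF refl _ refl]) (auto simp: flat_def)
  next
    case 3
    have "flat m y / y = flat (Suc m) y" for y by (auto simp: flat_def)
    then have "(flat m has_real_derivative 0) (at 0)"
      using flat_tendsto_0[of "Suc m"] by (simp add: has_field_derivative_iff flat_def[of m 0])
    then show ?thesis using 3 by (simp add: flat_def)
  qed
qed

text \<open>The derivative of a member of the family is a combination of two members; a single induction on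
\<open>k\<close>, for all \<open>m\<close> together, gives smoothness.\<close>

lemma C_on_flat_affine: "C_on k UNIV (\<lambda>x::'a::euclidean_space. flat m (c * (x \<bullet> i) + d))"
proof (induction k arbitrary: m)
  case 0
  have "isCont (flat m) s" for s using flat_deriv[of m s] by (rule DERIV_isCont)
  then have "continuous_on UNIV (flat m)" by (simp add: continuous_at_imp_continuous_on)
  then have "continuous_on UNIV (\<lambda>x::'a. flat m (c * (x \<bullet> i) + d))"
    by (rule continuous_on_compose2) (auto intro!: continuous_intros)
  then show ?case by simp
next
  case (Suc k)
  let ?D = "\<lambda>s. flat (m+2) s - m * flat (m+1) s"
  show ?case
  proof (rule C_on_SucI)
    fix x :: 'a
    show "((\<lambda>x. flat m (c * (x \<bullet> i) + d)) has_derivative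
      (\<lambda>v. (c * (v \<bullet> i)) * flat (m+2) (c * (x \<bullet> i) + d) + (- m * c * (v \<bullet> i)) * flat (m+1) (c * (x \<bullet> i) + d))) (at x)"
      by (rule has_derivative_eq_rhs[OF has_derivative_compose[OF _ flat_deriv[unfolded has_field_derivative_def]]])
         (auto intro!: derivative_eq_intros simp: algebra_simps)
  next
    fix v :: 'a
    show "C_on k UNIV (\<lambda>x. (c * (v \<bullet> i)) * flat (m+2) (c * (x \<bullet> i) + d) + (- m * c * (v \<bullet> i)) * flat (m+1) (c * (x \<bullet> i) + d))"
      by (intro C_on_add C_on_mult C_on_const Suc.IH)
  qed
qed

lemma flat_0_bounds: "0 \<le> flat 0 s" "flat 0 s \<le> 1" "flat 0 s = 0 \<longleftrightarrow> s \<le> 0"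
  by (auto simp: flat_def)

lemma flat_scaled_tendsto: "s > 0 \<Longrightarrow> (\<lambda>n. flat 0 (real (Suc n) * s)) \<longlonglongrightarrow> 1"
proof -
  assume s: "s > 0"
  have "(\<lambda>n. exp (- (1 / s) * inverse (real (Suc n)))) \<longlonglongrightarrow> exp (- (1/s) * 0)"
    by (intro tendsto_intros LIMSEQ_inverse_real_of_nat)
  moreover have "exp (- (1 / s) * inverse (real (Suc n))) = flat 0 (real (Suc n) * s)" for n
    using s by (simp add: flat_def field_simps add_pos_nonneg)
  ultimately show ?thesis by simp
qed

text \<open>As \<open>n\<close> grows these functions increase to the indicator of the open box, while their support stays
the closed box.\<close>

definition box_bump :: "nat \<Rightarrow> 'a::euclidean_space \<Rightarrow> 'a \<Rightarrow> 'a \<Rightarrow> real" where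
  "box_bump n a b x = (\<Prod>i\<in>Basis. flat 0 (real (Suc n) * ((x - a) \<bullet> i)) * flat 0 (real (Suc n) * ((b - x) \<bullet> i)))"

lemma box_bump_C_on: "C_on k UNIV (box_bump n a b)"
proof -
  have *: "real (Suc n) * ((x - a) \<bullet> i) = real (Suc n) * (x \<bullet> i) + (- real (Suc n) * (a \<bullet> i))"
    "real (Suc n) * ((b - x) \<bullet> i) = - real (Suc n) * (x \<bullet> i) + (real (Suc n) * (b \<bullet> i))" for x i
    by (auto simp: algebra_simps)
  show ?thesis unfolding box_bump_def[abs_def] *
    by (intro C_on_prod C_on_mult C_on_flat_affine) auto
qed

lemma box_bump_nonzero: "box_bump n a b x \<noteq> 0 \<longleftrightarrow> x \<in> box a b"
  by (force simp: box_bump_def flat_0_bounds mem_box mult_le_0_iff inner_diff_left)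

lemma box_bump_bounds: "0 \<le> box_bump n a b x" "box_bump n a b x \<le> 1"
  by (auto simp: box_bump_def flat_0_bounds intro!: prod_nonneg prod_le_1 mult_le_one)

lemma box_bump_tendsto: "(\<lambda>n. box_bump n a b x) \<longlonglongrightarrow> indicator (box a b) x"
proof (cases "x \<in> box a b")
  case True
  then have "(\<lambda>n. box_bump n a b x) \<longlonglongrightarrow> (\<Prod>i\<in>(Basis::'a set). 1 * 1)"
    unfolding box_bump_def
    by (intro tendsto_intros flat_scaled_tendsto) (auto simp: mem_box inner_diff_left)
  then show ?thesis using True by simp
next
  case False
  then have "box_bump n a b x = 0" for n using box_bump_nonzero[of n a b x] by blast
  then show ?thesis using False by simp
qed

lemma box_bump_test:
  assumes "cbox a b \<subseteq> S" shows "box_bump n a b \<in> test_functions S"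
proof -
  have "closure {x. box_bump n a b x \<noteq> 0} \<subseteq> cbox a b"
    by (rule closure_minimal) (auto simp: box_bump_nonzero intro: box_subset_cbox[THEN subsetD])
  moreover from this have "compact (closure {x. box_bump n a b x \<noteq> 0})"
    by (meson bounded_cbox bounded_subset closed_closure compact_eq_bounded_closed)
  ultimately show ?thesis using assms by (auto simp: test_functions_def box_bump_C_on)
qed

lemma test_function_measurable:
  assumes "\<phi> \<in> test_functions S" shows "\<phi> \<in> borel_measurable borel"
proof -
  have "C_on 0 UNIV \<phi>" using assms unfolding test_functions_def by blast
  then show ?thesis by (simp add: borel_measurable_continuous_onI)
qed

section \<open>The fundamental lemma of the calculus of variations\<close>

text \<open>The measures with the positive and the negative part of \<open>g\<close> as densities agree on open boxes,
which form a generator stable under intersection; so they agree, and so do their densities.\<close>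

lemma integral_zero_on_boxes_imp_zero:
  fixes g :: "'a::euclidean_space \<Rightarrow> real"
  assumes g: "integrable lebesgue g"
    and 0: "\<And>a b. (\<integral>x. g x * indicator (box a b) x \<partial>lebesgue) = 0"
  shows "AE x in lebesgue. g x = 0"
proof -
  obtain h where h[measurable]: "h \<in> borel_measurable lborel" and gh: "AE x in lborel. g x = h x"
    using completion_ex_borel_measurable_real[of g lborel] g by (auto simp: borel_measurable_integrable)
  have gh': "AE x in lebesgue. g x = h x" using gh by (rule AE_completion)
  have hl[measurable]: "h \<in> borel_measurable lebesgue" using h by (rule measurable_completion)
  have gm[measurable]: "g \<in> borel_measurable lebesgue" using g by auto
  have hi: "integrable lebesgue h" using g gh' by (subst (asm) integrable_cong_AE) auto
  have hi': "integrable lborel h" using hi h by (simp add: integrable_completion)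
  have h0: "(\<integral>x. h x * indicator (box a b) x \<partial>lborel) = 0" for a b
  proof -
    have "(\<integral>x. h x * indicator (box a b) x \<partial>lborel) = (\<integral>x. h x * indicator (box a b) x \<partial>lebesgue)"
      by (subst integral_completion) auto
    also have "\<dots> = (\<integral>x. g x * indicator (box a b) x \<partial>lebesgue)"
      using gh' by (intro integral_cong_AE borel_measurable_times borel_measurable_indicator gm hl) auto
    finally show ?thesis using 0 by simp
  qed
  have fin: "integral\<^sup>N lborel (\<lambda>x. ennreal (h x)) \<noteq> \<infinity>" "integral\<^sup>N lborel (\<lambda>x. ennreal (- h x)) \<noteq> \<infinity>"
    using hi' by (auto simp: real_integrable_def)
  have "density lborel (\<lambda>x. ennreal (h x)) = density lborel (\<lambda>x. ennreal (- h x))"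
  proof (rule measure_eqI_generator_eq[where E="range (\<lambda>(a, b). box a b)" and \<Omega>=UNIV and A="\<lambda>n. box (- (real n *\<^sub>R One)) (real n *\<^sub>R One)"])
    show "Int_stable (range (\<lambda>(a, b). box a b::'a set))"
      by (auto simp: Int_stable_def box_Int_box)
    fix X :: "'a set" assume "X \<in> range (\<lambda>(a, b). box a b)"
    then obtain a b where X: "X = box a b" by auto
    have iX: "integrable lborel (\<lambda>x. h x * indicator X x)"
      using hi' by (intro integrable_real_mult_indicator) (auto simp: X)
    have pos: "integral\<^sup>N lborel (\<lambda>x. ennreal (h x * indicator X x)) \<noteq> \<infinity>" "integral\<^sup>N lborel (\<lambda>x. ennreal (- (h x * indicator X x))) \<noteq> \<infinity>"
      using iX by (auto simp: real_integrable_def)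
    have "enn2real (integral\<^sup>N lborel (\<lambda>x. ennreal (h x * indicator X x))) = enn2real (integral\<^sup>N lborel (\<lambda>x. ennreal (- (h x * indicator X x))))"
      using real_lebesgue_integral_def[OF iX] h0[of a b] X by simp
    moreover have "c = d" if "enn2real c = enn2real d" "c \<noteq> \<infinity>" "d \<noteq> \<infinity>" for c d
      using that by (cases c; cases d; simp)
    ultimately have "integral\<^sup>N lborel (\<lambda>x. ennreal (h x * indicator X x)) = integral\<^sup>N lborel (\<lambda>x. ennreal (- (h x * indicator X x)))"
      using pos by blast
    moreover have "ennreal (h x * indicator X x) = ennreal (h x) * indicator X x"
      "ennreal (- (h x * indicator X x)) = ennreal (- h x) * indicator X x" for x :: 'a
      by (auto simp: indicator_def)
    ultimately show "emeasure (density lborel (\<lambda>x. ennreal (h x))) X = emeasure (density lborel (\<lambda>x. ennreal (- h x))) X"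
      using X by (simp add: emeasure_density)
  next
    show "(\<Union>i. box (- (real i *\<^sub>R One)) (real i *\<^sub>R One)) = (UNIV::'a set)" by (rule UN_box_eq_UNIV)
  next
    fix n
    have "emeasure (density lborel (\<lambda>x. ennreal (h x))) (box (- (real n *\<^sub>R One)) (real n *\<^sub>R One)) \<le> integral\<^sup>N lborel (\<lambda>x. ennreal (h x))"
      by (simp add: emeasure_density) (intro nn_integral_mono, auto simp: indicator_def)
    then show "emeasure (density lborel (\<lambda>x. ennreal (h x))) (box (- (real n *\<^sub>R One)) (real n *\<^sub>R One)) \<noteq> \<infinity>"
      using fin by (metis infinity_ennreal_def neq_top_trans)
  qed (auto simp: borel_eq_box)
  then have "AE x in lborel. ennreal (h x) = ennreal (- h x)"
    using fin by (subst (asm) sigma_finite_measure.density_unique_iff) (auto simp: lborel.sigma_finite_measure_axioms)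
  then have "AE x in lborel. h x = 0"
  proof (rule AE_mp, intro AE_I2 impI)
    fix x assume "ennreal (h x) = ennreal (- h x)"
    then show "h x = 0" by (metis ennreal_eq_0_iff ennreal_neg less_eq_real_def linorder_not_le neg_0_less_iff_less not_le_imp_less order_antisym_conv neg_le_0_iff_le ennreal_0)
  qed
  then have "AE x in lebesgue. h x = 0" by (rule AE_completion)
  with gh' show ?thesis by eventually_elim simp
qed

lemma lebesgue_on_integrable_iff:
  fixes f :: "'a::euclidean_space \<Rightarrow> 'b::{banach, second_countable_topology}"
  shows "S \<in> sets lebesgue \<Longrightarrow> integrable (lebesgue_on S) f \<longleftrightarrow> integrable lebesgue (\<lambda>x. indicator S x *\<^sub>R f x)"
  by (simp add: integrable_restrict_space)

text \<open>Testing with bumps that increase to the indicator of a box shows that \<open>g\<close> has integral zero over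
every box whose closure lies in \<open>S\<close>; and \<open>S\<close> is a countable union of closed boxes.\<close>

lemma fundamental_lemma_calculus_of_variations:
  fixes g :: "'a::euclidean_space \<Rightarrow> real"
  assumes S: "open S" and g: "integrable (lebesgue_on S) g"
    and test: "\<And>\<phi>. \<phi> \<in> test_functions S \<Longrightarrow> (\<integral>x. g x * \<phi> x \<partial>lebesgue_on S) = 0"
  shows "AE x in lebesgue_on S. g x = 0"
proof -
  have Sl[simp]: "S \<in> sets lebesgue" using S by (simp add: borel_open sets_completionI_sets)
  define h where "h x = indicator S x * g x" for x
  have hi: "integrable lebesgue h" using g unfolding h_def by (simp add: lebesgue_on_integrable_iff)
  then have hm[measurable]: "h \<in> borel_measurable lebesgue" by auto
  have toh: "(\<integral>x. g x * k x \<partial>lebesgue_on S) = (\<integral>x. h x * k x \<partial>lebesgue)" for k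
    by (simp add: integral_restrict_space h_def mult_ac)
  have box0: "(\<integral>x. h x * indicator (box e f) x \<partial>lebesgue) = 0" if "box e f = {} \<or> cbox e f \<subseteq> S" for e f
  proof (cases "box e f = {}")
    case False
    with that have sub: "cbox e f \<subseteq> S" by blast
    have "(\<lambda>n. \<integral>x. h x * box_bump n e f x \<partial>lebesgue) \<longlonglongrightarrow> (\<integral>x. h x * indicator (box e f) x \<partial>lebesgue)"
    proof (rule integral_dominated_convergence[where w="\<lambda>x. \<bar>h x\<bar>"])
      show "(\<lambda>x. h x * box_bump n e f x) \<in> borel_measurable lebesgue" for n
        using test_function_measurable[OF box_bump_test[OF sub, of n]]
        by (intro borel_measurable_times hm) (simp add: measurable_completion)
      show "AE x in lebesgue. (\<lambda>n. h x * box_bump n e f x) \<longlonglongrightarrow> h x * indicator (box e f) x"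
        by (intro AE_I2 tendsto_mult_left box_bump_tendsto)
      show "AE x in lebesgue. norm (h x * box_bump n e f x) \<le> \<bar>h x\<bar>" for n
        using box_bump_bounds[of n e f] by (intro AE_I2) (auto simp: abs_mult intro!: mult_left_le)
      show "(\<lambda>x. h x * indicator (box e f) x) \<in> borel_measurable lebesgue"
        by (intro borel_measurable_times hm borel_measurable_indicator) simp
    qed (use hi in auto)
    moreover have "(\<integral>x. h x * box_bump n e f x \<partial>lebesgue) = 0" for n
      using test[OF box_bump_test[OF sub, of n]] toh by simp
    ultimately show ?thesis by (simp add: LIMSEQ_const_iff)
  qed simp
  obtain \<D> where \<D>: "countable \<D>" "\<D> \<subseteq> Pow S" "\<And>X. X \<in> \<D> \<Longrightarrow> \<exists>a b. X = cbox a b" "\<Union>\<D> = S"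
    using open_countable_Union_open_cbox[OF S] by blast
  have "AE x in lebesgue. x \<in> X \<longrightarrow> h x = 0" if X: "X \<in> \<D>" for X
  proof -
    obtain a b where ab: "X = cbox a b" using \<D>(3) X by blast
    have "AE x in lebesgue. h x * indicator (box a b) x = 0"
    proof (rule integral_zero_on_boxes_imp_zero)
      show "integrable lebesgue (\<lambda>x. h x * indicator (box a b) x)"
        by (intro integrable_real_mult_indicator hi) simp
      fix c d
      obtain e f where ef: "box a b \<inter> box c d = box e f" using box_Int_box by blast
      have "cbox e f \<subseteq> S" if "box e f \<noteq> {}"
      proof -
        have "closure (box e f) \<subseteq> cbox a b"
          using box_subset_cbox[of a b] unfolding ef[symmetric] by (intro closure_minimal) auto
        then show ?thesis using that X ab \<D>(2) by auto
      qed
      moreover have "h x * indicator (box a b) x * indicator (box c d) x = h x * indicator (box e f) x" for x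
        using ef by (auto simp: indicator_def)
      ultimately show "(\<integral>x. h x * indicator (box a b) x * indicator (box c d) x \<partial>lebesgue) = 0"
        using box0[of e f] by (simp only:) blast
    qed
    moreover have "AE x in lebesgue. x \<notin> cbox a b - box a b"
      by (rule AE_not_in) (simp add: negligible_iff_null_sets[symmetric] negligible_frontier_interval)
    ultimately show ?thesis unfolding ab
      by eventually_elim (auto simp: indicator_def)
  qed
  then have "AE x in lebesgue. \<forall>X\<in>\<D>. x \<in> X \<longrightarrow> h x = 0"
    by (subst AE_ball_countable[OF \<D>(1)]) blast
  then show ?thesis using \<D>(4)
    by (simp add: AE_restrict_space_iff) (elim AE_mp, intro AE_I2, auto simp: h_def indicator_def)
qed

section \<open>Square-integrable functions\<close>

text \<open>Lebesgue measure is complete.\<close>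

lemma borel_measurable_AE_lebesgue_on:
  fixes f g :: "'a::euclidean_space \<Rightarrow> 'b::euclidean_space"
  assumes S: "S \<in> sets lebesgue" and f: "f \<in> borel_measurable (lebesgue_on S)"
    and ae: "AE x in lebesgue_on S. f x = g x"
  shows "g \<in> borel_measurable (lebesgue_on S)"
proof -
  have "(\<lambda>x. if x \<in> S then f x else 0) \<in> borel_measurable lebesgue"
    using f S by (simp add: borel_measurable_if)
  moreover have "AE x in lebesgue. (if x \<in> S then f x else 0) = (if x \<in> S then g x else 0)"
    using ae S by (auto simp: AE_restrict_space_iff elim!: eventually_mono)
  ultimately have "(\<lambda>x. if x \<in> S then g x else 0) \<in> borel_measurable lebesgue"
    by (rule borel_measurable_AE)
  then show ?thesis using S by (simp add: borel_measurable_if)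
qed

text \<open>The elements are functions and not classes modulo null sets, so \<open>nrm\<close> is a seminorm and
\<open>dst W g h = 0\<close> plays the role of equality. Linear combinations are pointwise, hence every
algebraic identity below is an identity of functions.\<close>

abbreviation L2 :: "(real^2) set \<Rightarrow> (real^2 \<Rightarrow> 'b::real_normed_vector) set" where
  "L2 W \<equiv> elems (L2_space W)"

abbreviation nrm :: "(real^2) set \<Rightarrow> (real^2 \<Rightarrow> 'b::real_normed_vector) \<Rightarrow> real" where
  "nrm W \<equiv> fnorm (L2_space W)"

abbreviation dst :: "(real^2) set \<Rightarrow> (real^2 \<Rightarrow> 'b::real_normed_vector) \<Rightarrow> (real^2 \<Rightarrow> 'b) \<Rightarrow> real" where
  "dst W g h \<equiv> nrm W (\<lambda>x. g x - h x)"

definition ip :: "(real^2) set \<Rightarrow> (real^2 \<Rightarrow> 'b::real_inner) \<Rightarrow> (real^2 \<Rightarrow> 'b) \<Rightarrow> real" where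
  "ip W g h = (\<integral>x. g x \<bullet> h x \<partial>lebesgue_on W)"

lemma L2_iff: "g \<in> L2 W \<longleftrightarrow> g \<in> borel_measurable (lebesgue_on W) \<and> integrable (lebesgue_on W) (\<lambda>x. (norm (g x))\<^sup>2)"
  by (simp add: L2_space_def)

lemma nrm_def': "nrm W g = sqrt (\<integral>x. (norm (g x))\<^sup>2 \<partial>lebesgue_on W)"
  by (simp add: L2_space_def)

lemma fdist_L2: "fdist (L2_space W) g h = dst W g h"
  by (simp add: fdist_def)

lemma L2_measurable: "g \<in> L2 W \<Longrightarrow> g \<in> borel_measurable (lebesgue_on W)"
  by (simp add: L2_iff)

lemma nrm_nonneg[simp]: "0 \<le> nrm W g"
  by (simp add: nrm_def')

lemma nrm_sq: "(nrm W g)\<^sup>2 = ip W g g"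
  by (simp add: nrm_def' ip_def power2_norm_eq_inner)

lemma ip_commute: "ip W g h = ip W h g"
  by (simp add: ip_def inner_commute)

lemma ip_integrable:
  fixes g h :: "real^2 \<Rightarrow> 'b::euclidean_space"
  assumes "g \<in> L2 W" "h \<in> L2 W"
  shows "integrable (lebesgue_on W) (\<lambda>x. g x \<bullet> h x)"
proof (rule Bochner_Integration.integrable_bound[where f="\<lambda>x. (norm (g x))\<^sup>2 + (norm (h x))\<^sup>2"])
  show "integrable (lebesgue_on W) (\<lambda>x. (norm (g x))\<^sup>2 + (norm (h x))\<^sup>2)"
    using assms by (simp add: L2_iff)
  show "(\<lambda>x. g x \<bullet> h x) \<in> borel_measurable (lebesgue_on W)"
    using assms by (intro borel_measurable_inner) (auto simp: L2_iff)
  show "AE x in lebesgue_on W. norm (g x \<bullet> h x) \<le> norm ((norm (g x))\<^sup>2 + (norm (h x))\<^sup>2)"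
  proof (rule AE_I2)
    fix x
    have "\<bar>g x \<bullet> h x\<bar> \<le> norm (g x) * norm (h x)" by (rule Cauchy_Schwarz_ineq2)
    also have "\<dots> \<le> (norm (g x))\<^sup>2 + (norm (h x))\<^sup>2"
      using sum_squares_bound[of "norm (g x)" "norm (h x)"] mult_nonneg_nonneg[OF norm_ge_zero norm_ge_zero, of "g x" "h x"]
      by linarith
    finally show "norm (g x \<bullet> h x) \<le> norm ((norm (g x))\<^sup>2 + (norm (h x))\<^sup>2)" by simp
  qed
qed

lemma L2_zero[simp]: "(\<lambda>_. 0) \<in> L2 W"
  by (simp add: L2_iff)

lemma L2_scale: "g \<in> L2 W \<Longrightarrow> (\<lambda>x. c *\<^sub>R g x) \<in> L2 W" for g :: "real^2 \<Rightarrow> 'b::euclidean_space"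
  by (auto simp: L2_iff power_mult_distrib)

lemma L2_add:
  fixes g h :: "real^2 \<Rightarrow> 'b::euclidean_space"
  assumes "g \<in> L2 W" "h \<in> L2 W" shows "(\<lambda>x. g x + h x) \<in> L2 W"
proof -
  have "integrable (lebesgue_on W) (\<lambda>x. (norm (g x))\<^sup>2 + 2 * (g x \<bullet> h x) + (norm (h x))\<^sup>2)"
    using assms ip_integrable[OF assms] by (simp add: L2_iff)
  moreover have "(norm (g x + h x))\<^sup>2 = (norm (g x))\<^sup>2 + 2 * (g x \<bullet> h x) + (norm (h x))\<^sup>2" for x
    by (simp add: power2_norm_eq_inner inner_simps inner_commute)
  ultimately show ?thesis using borel_measurable_add[OF assms[THEN L2_measurable]] by (simp add: L2_iff)
qed

lemma L2_diff:
  fixes g h :: "real^2 \<Rightarrow> 'b::euclidean_space"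
  assumes "g \<in> L2 W" "h \<in> L2 W" shows "(\<lambda>x. g x - h x) \<in> L2 W"
  using L2_add[OF assms(1) L2_scale[OF assms(2), of "-1"]] by simp

lemma L2_minus: "g \<in> L2 W \<Longrightarrow> (\<lambda>x. - g x) \<in> L2 W" for g :: "real^2 \<Rightarrow> 'b::euclidean_space"
  using L2_scale[of g W "-1"] by simp

lemma L2_sum:
  fixes g :: "'i \<Rightarrow> real^2 \<Rightarrow> 'b::euclidean_space"
  shows "(\<And>i. i \<in> A \<Longrightarrow> g i \<in> L2 W) \<Longrightarrow> (\<lambda>x. \<Sum>i\<in>A. g i x) \<in> L2 W"
  by (induction A rule: infinite_finite_induct) (auto intro: L2_add)

context
  fixes W :: "(real^2) set" and g h k :: "real^2 \<Rightarrow> 'b::euclidean_space"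
  assumes L: "g \<in> L2 W" "h \<in> L2 W" "k \<in> L2 W"
begin

lemma ip_add_left: "ip W (\<lambda>x. g x + h x) k = ip W g k + ip W h k"
  using L by (simp add: ip_def inner_add_left ip_integrable)

lemma ip_diff_left: "ip W (\<lambda>x. g x - h x) k = ip W g k - ip W h k"
  using L by (simp add: ip_def inner_diff_left ip_integrable)

lemma ip_add_right: "ip W k (\<lambda>x. g x + h x) = ip W k g + ip W k h"
  using L by (simp add: ip_def inner_add_right ip_integrable)

lemma ip_diff_right: "ip W k (\<lambda>x. g x - h x) = ip W k g - ip W k h"
  using L by (simp add: ip_def inner_diff_right ip_integrable)

end

lemma ip_scale_left: "ip W (\<lambda>x. c *\<^sub>R g x) h = c * ip W g h"
  by (simp add: ip_def)

lemma ip_scale_right: "ip W h (\<lambda>x. c *\<^sub>R g x) = c * ip W h g"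
  by (simp add: ip_def)

lemma ip_zero_left[simp]: "ip W (\<lambda>_. 0) h = 0"
  and ip_zero_right[simp]: "ip W h (\<lambda>_. 0) = 0"
  by (simp_all add: ip_def)

lemma nrm_0[simp]: "nrm W (\<lambda>_. 0) = 0"
  by (simp add: nrm_def')

lemma nrm_scale: "nrm W (\<lambda>x. c *\<^sub>R g x) = \<bar>c\<bar> * nrm W g"
  by (simp add: nrm_def' power_mult_distrib real_sqrt_mult)

lemma nrm_minus: "nrm W (\<lambda>x. - g x) = nrm W g"
  by (simp add: nrm_def')

lemma nrm_minus_commute: "dst W g h = dst W h g"
  by (simp add: nrm_def' norm_minus_commute)

lemma nrm_zero_iff:
  fixes g :: "real^2 \<Rightarrow> 'b::euclidean_space"
  shows "g \<in> L2 W \<Longrightarrow> nrm W g = 0 \<longleftrightarrow> (AE x in lebesgue_on W. g x = 0)"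
  by (simp add: nrm_def' L2_iff integral_nonneg_eq_0_iff_AE)

lemma nrm_AE_zero: "AE x in lebesgue_on W. g x = 0 \<Longrightarrow> nrm W g = 0"
  unfolding nrm_def' by (subst integral_eq_zero_AE) auto

lemma ip_AE_zero: "AE x in lebesgue_on W. g x = 0 \<Longrightarrow> ip W g h = 0"
  unfolding ip_def by (subst integral_eq_zero_AE) auto

lemma ip_Cauchy_Schwarz:
  fixes g h :: "real^2 \<Rightarrow> 'b::euclidean_space"
  assumes L: "g \<in> L2 W" "h \<in> L2 W"
  shows "\<bar>ip W g h\<bar> \<le> nrm W g * nrm W h"
proof -
  have main: "ip W g h \<le> nrm W g * nrm W h" if L: "g \<in> L2 W" "h \<in> L2 W" for g h :: "real^2 \<Rightarrow> 'b"
  proof (cases "nrm W g = 0 \<or> nrm W h = 0")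
    case True
    then have "ip W g h = 0"
      using L nrm_zero_iff ip_AE_zero ip_commute by metis
    then show ?thesis by simp
  next
    case False
    define a b where "a = nrm W g" and "b = nrm W h"
    have ab: "a > 0" "b > 0" using False unfolding a_def b_def by (simp_all add: less_le)
    have "0 \<le> (nrm W (\<lambda>x. b *\<^sub>R g x - a *\<^sub>R h x))\<^sup>2" by simp
    also have "\<dots> = b\<^sup>2 * (nrm W g)\<^sup>2 - 2 * (a * b) * ip W g h + a\<^sup>2 * (nrm W h)\<^sup>2"
      using L ip_commute[of W h g] unfolding nrm_sq
      by (simp add: ip_diff_left ip_diff_right L2_diff L2_scale ip_scale_left ip_scale_right power2_eq_square algebra_simps)
    also have "\<dots> = 2 * (a * b) * (a * b - ip W g h)"
      by (simp add: a_def[symmetric] b_def[symmetric] power2_eq_square algebra_simps)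
    finally have "0 \<le> a * b - ip W g h"
      using ab by (smt (verit) mult_pos_neg mult_pos_pos)
    then show ?thesis by (simp add: a_def b_def)
  qed
  have "- ip W g h \<le> nrm W g * nrm W h"
    using main[OF L2_minus[OF L(1)] L(2)] nrm_minus[of W g] by (simp add: ip_def)
  with main[OF L] show ?thesis by linarith
qed

lemma nrm_triangle:
  fixes g h :: "real^2 \<Rightarrow> 'b::euclidean_space"
  assumes L: "g \<in> L2 W" "h \<in> L2 W"
  shows "nrm W (\<lambda>x. g x + h x) \<le> nrm W g + nrm W h"
proof (rule power2_le_imp_le)
  have "(nrm W (\<lambda>x. g x + h x))\<^sup>2 = (nrm W g)\<^sup>2 + 2 * ip W g h + (nrm W h)\<^sup>2"
    using L ip_commute[of W h g] unfolding nrm_sq by (simp add: ip_add_left ip_add_right L2_add)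
  also have "\<dots> \<le> (nrm W g + nrm W h)\<^sup>2"
    using ip_Cauchy_Schwarz[OF L] by (simp add: power2_eq_square algebra_simps)
  finally show "(nrm W (\<lambda>x. g x + h x))\<^sup>2 \<le> (nrm W g + nrm W h)\<^sup>2" .
qed simp

lemma nrm_triangle_diff:
  fixes g h :: "real^2 \<Rightarrow> 'b::euclidean_space"
  assumes L: "g \<in> L2 W" "h \<in> L2 W"
  shows "dst W g h \<le> nrm W g + nrm W h"
  using nrm_triangle[OF L(1) L2_minus[OF L(2)]] by (simp add: nrm_minus)

lemma nrm_triangle3:
  fixes g h k :: "real^2 \<Rightarrow> 'b::euclidean_space"
  assumes L: "g \<in> L2 W" "h \<in> L2 W" "k \<in> L2 W"
  shows "dst W g k \<le> dst W g h + dst W h k"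
  using nrm_triangle[OF L2_diff[OF L(1,2)] L2_diff[OF L(2,3)]] by simp

lemma nrm_diff_abs:
  fixes g h :: "real^2 \<Rightarrow> 'b::euclidean_space"
  assumes L: "g \<in> L2 W" "h \<in> L2 W"
  shows "\<bar>nrm W g - nrm W h\<bar> \<le> dst W g h"
  using nrm_triangle[OF L2_diff[OF L] L(2)] nrm_triangle[OF L2_diff[OF L(2,1)] L(1)]
    nrm_minus_commute[of W g h] by simp

lemma AE_eq_of_nrm_zero:
  fixes g h :: "real^2 \<Rightarrow> 'b::euclidean_space"
  assumes "g \<in> L2 W" "h \<in> L2 W" "dst W g h = 0"
  shows "AE x in lebesgue_on W. g x = h x"
  using nrm_zero_iff[OF L2_diff[OF assms(1,2)]] assms(3) by simp

lemma nrm_eq_0_of_AE_eq: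
  assumes "AE x in lebesgue_on W. g x = h x" shows "dst W g h = 0"
  using assms by (intro nrm_AE_zero) (auto elim: eventually_mono)

lemma L2_cong_AE:
  fixes g h :: "real^2 \<Rightarrow> 'b::euclidean_space"
  assumes W: "W \<in> sets lebesgue" and g: "g \<in> L2 W" and ae: "AE x in lebesgue_on W. g x = h x"
  shows "h \<in> L2 W"
proof -
  have h: "h \<in> borel_measurable (lebesgue_on W)"
    using borel_measurable_AE_lebesgue_on[OF W L2_measurable[OF g] ae] .
  have "integrable (lebesgue_on W) (\<lambda>x. (norm (h x))\<^sup>2)"
  proof (rule integrable_cong_AE_imp)
    show "integrable (lebesgue_on W) (\<lambda>x. (norm (g x))\<^sup>2)" using g by (simp add: L2_iff)
    show "(\<lambda>x. (norm (h x))\<^sup>2) \<in> borel_measurable (lebesgue_on W)" using h by measurable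
    show "AE x in lebesgue_on W. (norm (g x))\<^sup>2 = (norm (h x))\<^sup>2" using ae by eventually_elim simp
  qed
  with h show ?thesis by (simp add: L2_iff)
qed

lemma nrm_cong_dist0:
  fixes g h :: "real^2 \<Rightarrow> 'b::euclidean_space"
  assumes L: "g \<in> L2 W" "h \<in> L2 W" and 0: "dst W g h = 0"
  shows "nrm W g = nrm W h"
  using nrm_diff_abs[OF L] 0 by simp

lemma ip_cong_dist0:
  fixes g h :: "real^2 \<Rightarrow> 'b::euclidean_space"
  assumes L: "g \<in> L2 W" "h \<in> L2 W" "k \<in> L2 W" and 0: "dst W g h = 0"
  shows "ip W g k = ip W h k"
  using ip_Cauchy_Schwarz[OF L2_diff[OF L(1,2)] L(3)] 0 ip_diff_left[OF L] by simp

text \<open>Along a subsequence the increments \<open>d k\<close> have norm below \<open>4\<^sup>-\<^sup>k\<close>. Then \<open>4\<^sup>k (d k)\<^sup>2\<close> has a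
convergent sum of integrals, so almost everywhere \<open>d k\<close> decays like \<open>2\<^sup>-\<^sup>k\<close> and the subsequence
converges; Fatou's lemma shows that its limit is the limit in the mean.\<close>

lemma L2_complete:
  fixes f :: "nat \<Rightarrow> real^2 \<Rightarrow> 'b::euclidean_space"
  assumes f: "\<And>n. f n \<in> L2 W"
    and Cauchy: "\<And>e. e > 0 \<Longrightarrow> \<exists>N. \<forall>m\<ge>N. \<forall>n\<ge>N. dst W (f m) (f n) < e"
  obtains g where "g \<in> L2 W" "(\<lambda>n. dst W (f n) g) \<longlonglongrightarrow> 0"
proof -
  let ?M = "lebesgue_on W"
  have "\<forall>k. \<exists>N. \<forall>m\<ge>N. \<forall>n\<ge>N. dst W (f m) (f n) < 1 / 4 ^ k"
    using Cauchy by simp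
  then obtain N where N: "\<And>k m n. m \<ge> N k \<Longrightarrow> n \<ge> N k \<Longrightarrow> dst W (f m) (f n) < 1 / 4 ^ k"
    by metis
  \<comment> \<open>adding \<open>k\<close> ensures \<open>r k \<ge> k\<close>, so that the indices \<open>r k\<close> tend to infinity\<close>
  define r where "r k = k + Max (N ` {..k})" for k
  have rN: "r k \<ge> N k" for k unfolding r_def by (simp add: trans_le_add2)
  have rk: "r k \<ge> k" for k by (simp add: r_def)
  have rS: "r (Suc k) \<ge> N k" for k
    unfolding r_def by (rule trans_le_add2, rule Max_ge) auto
  define d where "d k x = norm (f (r (Suc k)) x - f (r k) x)" for k x
  have fm[measurable]: "f n \<in> borel_measurable ?M" for n using f by (simp add: L2_iff)
  have dm[measurable]: "d k \<in> borel_measurable ?M" for k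
    unfolding d_def[abs_def] by (intro measurable_compose[OF borel_measurable_diff[OF fm fm] borel_measurable_norm])
  have dint: "(\<integral>\<^sup>+x. ennreal (4 ^ k * (d k x)\<^sup>2) \<partial>?M) \<le> ennreal ((1/4) ^ k)" for k
  proof -
    have "dst W (f (r (Suc k))) (f (r k)) < 1 / 4 ^ k" using N rN rS by blast
    then have "(dst W (f (r (Suc k))) (f (r k)))\<^sup>2 \<le> (1 / 4 ^ k)\<^sup>2"
      by (intro power_mono) auto
    then have le: "(\<integral>x. (d k x)\<^sup>2 \<partial>?M) \<le> (1 / 4 ^ k)\<^sup>2" by (simp add: nrm_def' d_def)
    have i: "integrable ?M (\<lambda>x. (d k x)\<^sup>2)" using L2_diff[OF f f] by (simp add: L2_iff d_def)
    have "(\<integral>\<^sup>+x. ennreal (4 ^ k * (d k x)\<^sup>2) \<partial>?M) = ennreal (\<integral>x. 4 ^ k * (d k x)\<^sup>2 \<partial>?M)"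
      using i by (intro nn_integral_eq_integral) auto
    also have "\<dots> \<le> ennreal (4 ^ k * (1 / 4 ^ k)\<^sup>2)"
      using le by (intro ennreal_leI) simp
    also have "4 ^ k * (1 / 4 ^ k)\<^sup>2 = (1/4::real) ^ k" by (simp add: power2_eq_square power_divide)
    finally show ?thesis .
  qed
  have "(\<integral>\<^sup>+x. (\<Sum>k. ennreal (4 ^ k * (d k x)\<^sup>2)) \<partial>?M) = (\<Sum>k. \<integral>\<^sup>+x. ennreal (4 ^ k * (d k x)\<^sup>2) \<partial>?M)"
    by (intro nn_integral_suminf) measurable
  also have "\<dots> \<le> (\<Sum>k. ennreal ((1/4) ^ k))" by (intro suminf_le dint) auto
  also have "\<dots> < \<infinity>" by (simp add: suminf_ennreal2 summable_geometric)
  finally have "AE x in ?M. (\<Sum>k. ennreal (4 ^ k * (d k x)\<^sup>2)) \<noteq> \<infinity>"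
    by (intro nn_integral_PInf_AE) auto
  then have conv: "AE x in ?M. convergent (\<lambda>k. f (r k) x)"
  proof eventually_elim
    fix x assume fin: "(\<Sum>k. ennreal (4 ^ k * (d k x)\<^sup>2)) \<noteq> \<infinity>"
    have "summable (\<lambda>k. 4 ^ k * (d k x)\<^sup>2)"
      using fin by (intro summable_suminf_not_top) auto
    then have "bounded (range (\<lambda>k. 4 ^ k * (d k x)\<^sup>2))"
      by (simp add: summable_imp_bounded)
    then obtain B where "\<And>k. \<bar>4 ^ k * (d k x)\<^sup>2\<bar> \<le> B" by (auto simp: bounded_iff)
    then have B: "4 ^ k * (d k x)\<^sup>2 \<le> B" for k by (metis abs_le_D1)
    then have "d k x \<le> sqrt B * (1/2) ^ k" for k
    proof -
      have "(2 ^ k * d k x)\<^sup>2 \<le> B"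
      proof -
        have "((2::real) ^ k)\<^sup>2 = (2\<^sup>2) ^ k" by (simp only: power_mult[symmetric] mult.commute)
        then have "((2::real) ^ k)\<^sup>2 = 4 ^ k" by simp
        then show ?thesis using B[of k] by (simp add: power_mult_distrib)
      qed
      then have "2 ^ k * d k x \<le> sqrt B" by (rule real_le_rsqrt)
      then show ?thesis by (simp add: field_simps)
    qed
    moreover have "norm (d k x) = d k x" for k by (simp add: d_def)
    moreover have "summable (\<lambda>k. sqrt B * (1/2) ^ k)" by (intro summable_mult summable_geometric) simp
    ultimately have "summable (\<lambda>k. d k x)"
      using summable_comparison_test'[where N=0 and f="\<lambda>k. d k x" and g="\<lambda>k. sqrt B * (1/2) ^ k"] by presburger
    then have "summable (\<lambda>k. f (r (Suc k)) x - f (r k) x)"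
      unfolding d_def by (rule summable_norm_cancel)
    then have "convergent (\<lambda>n. \<Sum>k<n. f (r (Suc k)) x - f (r k) x)"
      by (simp add: summable_iff_convergent)
    then have "convergent (\<lambda>n. f (r n) x - f (r 0) x)"
      by (simp add: sum_lessThan_telescope[where f="\<lambda>k. f (r k) x"])
    from convergent_add[OF this convergent_const[of "f (r 0) x"]]
    show "convergent (\<lambda>k. f (r k) x)" by simp
  qed
  define g where "g x = lim (\<lambda>k. f (r k) x)" for x
  have gm[measurable]: "g \<in> borel_measurable ?M" unfolding g_def[abs_def]
    by (intro borel_measurable_lim_metric fm)
  have lim: "AE x in ?M. (\<lambda>k. f (r k) x) \<longlonglongrightarrow> g x"
    using conv by eventually_elim (simp add: g_def convergent_LIMSEQ_iff)
  have key: "(\<integral>\<^sup>+x. ennreal ((norm (f n x - g x))\<^sup>2) \<partial>?M) \<le> ennreal (e\<^sup>2)"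
    if e: "e > 0" and n: "\<And>m. m \<ge> n \<Longrightarrow> dst W (f n) (f m) < e" for e n
  proof -
    have "(\<integral>\<^sup>+x. ennreal ((norm (f n x - g x))\<^sup>2) \<partial>?M) = (\<integral>\<^sup>+x. liminf (\<lambda>k. ennreal ((norm (f n x - f (r k) x))\<^sup>2)) \<partial>?M)"
    proof (rule nn_integral_cong_AE)
      show "AE x in ?M. ennreal ((norm (f n x - g x))\<^sup>2) = liminf (\<lambda>k. ennreal ((norm (f n x - f (r k) x))\<^sup>2))"
        using lim
      proof eventually_elim
        fix x assume "(\<lambda>k. f (r k) x) \<longlonglongrightarrow> g x"
        then have "(\<lambda>k. ennreal ((norm (f n x - f (r k) x))\<^sup>2)) \<longlonglongrightarrow> ennreal ((norm (f n x - g x))\<^sup>2)"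
          by (intro tendsto_intros tendsto_ennrealI)
        then show "ennreal ((norm (f n x - g x))\<^sup>2) = liminf (\<lambda>k. ennreal ((norm (f n x - f (r k) x))\<^sup>2))"
          using lim_imp_Liminf[OF sequentially_bot] by metis
      qed
    qed
    also have "\<dots> \<le> liminf (\<lambda>k. \<integral>\<^sup>+x. ennreal ((norm (f n x - f (r k) x))\<^sup>2) \<partial>?M)"
      by (rule nn_integral_liminf) measurable
    also have "\<dots> \<le> liminf (\<lambda>k. ennreal (e\<^sup>2))"
    proof (rule Liminf_mono, rule eventually_sequentiallyI[of n])
      fix k assume "n \<le> k"
      then have lt: "dst W (f n) (f (r k)) < e" using n rk[of k] by simp
      have "(\<integral>\<^sup>+x. ennreal ((norm (f n x - f (r k) x))\<^sup>2) \<partial>?M) = ennreal (\<integral>x. (norm (f n x - f (r k) x))\<^sup>2 \<partial>?M)"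
        using L2_diff[OF f f] by (intro nn_integral_eq_integral) (auto simp: L2_iff)
      also have "\<dots> = ennreal ((dst W (f n) (f (r k)))\<^sup>2)" by (simp add: nrm_def')
      also have "\<dots> \<le> ennreal (e\<^sup>2)" using lt by (intro ennreal_leI power_mono) auto
      finally show "(\<integral>\<^sup>+x. ennreal ((norm (f n x - f (r k) x))\<^sup>2) \<partial>?M) \<le> ennreal (e\<^sup>2)" .
    qed
    also have "\<dots> = ennreal (e\<^sup>2)" by (simp add: Liminf_const)
    finally show ?thesis .
  qed
  have fg: "(\<lambda>x. f n x - g x) \<in> L2 W \<and> dst W (f n) g \<le> e"
    if e: "e > 0" and n: "\<And>m. m \<ge> n \<Longrightarrow> dst W (f n) (f m) < e" for e n
  proof -
    note k = key[OF that]
    have i: "integrable ?M (\<lambda>x. (norm (f n x - g x))\<^sup>2)"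
      unfolding integrable_iff_bounded using k by (auto simp: le_less_trans)
    then have "ennreal (\<integral>x. (norm (f n x - g x))\<^sup>2 \<partial>?M) \<le> ennreal (e\<^sup>2)"
      using k by (subst nn_integral_eq_integral[symmetric]) auto
    then have "(\<integral>x. (norm (f n x - g x))\<^sup>2 \<partial>?M) \<le> e\<^sup>2" by (simp add: ennreal_le_iff)
    then have "dst W (f n) g \<le> e" using e unfolding nrm_def' by (intro real_le_lsqrt) auto
    with i show ?thesis by (simp add: L2_iff)
  qed
  show thesis
  proof
    obtain N0 where "\<forall>m\<ge>N0. \<forall>n\<ge>N0. dst W (f m) (f n) < 1" using Cauchy[of 1] by auto
    then have "(\<lambda>x. f N0 x - g x) \<in> L2 W" using fg[of 1 N0] by auto
    from L2_diff[OF f[of N0] this] show "g \<in> L2 W" by simp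
    show "(\<lambda>n. dst W (f n) g) \<longlonglongrightarrow> 0"
    proof (rule LIMSEQ_I)
      fix e :: real assume e: "e > 0"
      obtain N1 where N1: "\<forall>m\<ge>N1. \<forall>n\<ge>N1. dst W (f m) (f n) < e / 2" using Cauchy[of "e/2"] e by auto
      have "dst W (f n) g < e" if "n \<ge> N1" for n
      proof -
        have "dst W (f n) g \<le> e / 2" using fg[of "e/2" n] N1 that e by simp
        then show ?thesis using e by linarith
      qed
      then show "\<exists>no. \<forall>n\<ge>no. norm (dst W (f n) g - 0) < e" by auto
    qed
  qed
qed

lemma tendsto_ip:
  fixes b g :: "real^2 \<Rightarrow> 'b::euclidean_space"
  assumes L: "\<And>n. a n \<in> L2 W" "b \<in> L2 W" "g \<in> L2 W" and lim: "(\<lambda>n. dst W (a n) b) \<longlonglongrightarrow> 0"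
  shows "(\<lambda>n. ip W (a n) g) \<longlonglongrightarrow> ip W b g"
proof (rule LIM_zero_cancel, rule Lim_null_comparison)
  show "(\<lambda>n. dst W (a n) b * nrm W g) \<longlonglongrightarrow> 0" using tendsto_mult_right[OF lim, of "nrm W g"] by simp
  have "\<bar>ip W (a n) g - ip W b g\<bar> \<le> dst W (a n) b * nrm W g" for n
    using ip_Cauchy_Schwarz[OF L2_diff[OF L(1,2)] L(3)] ip_diff_left[OF L] by simp
  then show "\<forall>\<^sub>F n in sequentially. norm (ip W (a n) g - ip W b g) \<le> dst W (a n) b * nrm W g" by simp
qed

lemma tendsto_nrm:
  fixes b :: "real^2 \<Rightarrow> 'b::euclidean_space"
  assumes L: "\<And>n. a n \<in> L2 W" "b \<in> L2 W" and lim: "(\<lambda>n. dst W (a n) b) \<longlonglongrightarrow> 0"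
  shows "(\<lambda>n. nrm W (a n)) \<longlonglongrightarrow> nrm W b"
proof (rule LIM_zero_cancel, rule Lim_null_comparison[OF _ lim])
  show "\<forall>\<^sub>F n in sequentially. norm (nrm W (a n) - nrm W b) \<le> dst W (a n) b"
    using nrm_diff_abs[OF L] by simp
qed

definition L2_continuous :: "(real^2) set \<Rightarrow> real set \<Rightarrow> (real \<Rightarrow> real^2 \<Rightarrow> 'b::real_normed_vector) \<Rightarrow> bool" where
  "L2_continuous W A U \<longleftrightarrow> (\<forall>t\<in>A. U t \<in> L2 W) \<and>
     (\<forall>t\<in>A. ((\<lambda>s. dst W (U s) (U t)) \<longlongrightarrow> 0) (at t within A))"

lemma L2_continuous_subset: "L2_continuous W A U \<Longrightarrow> B \<subseteq> A \<Longrightarrow> L2_continuous W B U"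
  unfolding L2_continuous_def by (blast intro: tendsto_within_subset)

lemma L2_continuous_nrm:
  fixes U :: "real \<Rightarrow> real^2 \<Rightarrow> 'b::euclidean_space"
  assumes U: "L2_continuous W A U" shows "continuous_on A (\<lambda>t. nrm W (U t))"
  unfolding continuous_on_def
proof
  fix t assume t: "t \<in> A"
  have L: "\<And>s. s \<in> A \<Longrightarrow> U s \<in> L2 W" and lim: "((\<lambda>s. dst W (U s) (U t)) \<longlongrightarrow> 0) (at t within A)"
    using U t by (auto simp: L2_continuous_def)
  show "((\<lambda>t. nrm W (U t)) \<longlongrightarrow> nrm W (U t)) (at t within A)"
    by (rule LIM_zero_cancel, rule Lim_null_comparison[OF _ lim])
       (use nrm_diff_abs[OF L L[OF t]] in \<open>auto simp: eventually_at_filter\<close>)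
qed

lemma L2_continuous_ip:
  fixes U :: "real \<Rightarrow> real^2 \<Rightarrow> 'b::euclidean_space"
  assumes U: "L2_continuous W A U" and g: "g \<in> L2 W" shows "continuous_on A (\<lambda>t. ip W (U t) g)"
  unfolding continuous_on_def
proof
  fix t assume t: "t \<in> A"
  have L: "\<And>s. s \<in> A \<Longrightarrow> U s \<in> L2 W" and lim: "((\<lambda>s. dst W (U s) (U t)) \<longlongrightarrow> 0) (at t within A)"
    using U t by (auto simp: L2_continuous_def)
  have lim': "((\<lambda>s. dst W (U s) (U t) * nrm W g) \<longlongrightarrow> 0) (at t within A)"
    using tendsto_mult_right[OF lim, of "nrm W g"] by simp
  have "\<bar>ip W (U s) g - ip W (U t) g\<bar> \<le> dst W (U s) (U t) * nrm W g" if s: "s \<in> A" for s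
    using ip_Cauchy_Schwarz[OF L2_diff[OF L[OF s] L[OF t]] g] ip_diff_left[OF L[OF s] L[OF t] g] by simp
  then show "((\<lambda>t. ip W (U t) g) \<longlongrightarrow> ip W (U t) g) (at t within A)"
    by (intro LIM_zero_cancel[OF Lim_null_comparison[OF _ lim']]) (auto simp: eventually_at_filter)
qed

lemma L2_continuous_diff:
  fixes U V :: "real \<Rightarrow> real^2 \<Rightarrow> 'b::euclidean_space"
  assumes U: "L2_continuous W A U" and V: "L2_continuous W A V"
  shows "L2_continuous W A (\<lambda>t x. U t x - V t x)"
  unfolding L2_continuous_def
proof (intro conjI ballI)
  have L: "U t \<in> L2 W" "V t \<in> L2 W" if "t \<in> A" for t using U V that by (auto simp: L2_continuous_def)
  fix t assume t: "t \<in> A"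
  show "(\<lambda>x. U t x - V t x) \<in> L2 W" by (intro L2_diff L t)
  have lim: "((\<lambda>s. dst W (U s) (U t) + dst W (V s) (V t)) \<longlongrightarrow> 0) (at t within A)"
    using tendsto_add[of _ 0 _ _ 0] U V t by (fastforce simp: L2_continuous_def)
  show "((\<lambda>s. nrm W (\<lambda>x. (U s x - V s x) - (U t x - V t x))) \<longlongrightarrow> 0) (at t within A)"
  proof (rule Lim_null_comparison[OF _ lim])
    have "nrm W (\<lambda>x. (U s x - V s x) - (U t x - V t x)) \<le> dst W (U s) (U t) + dst W (V s) (V t)" if s: "s \<in> A" for s
    proof -
      have "(\<lambda>x. (U s x - V s x) - (U t x - V t x)) = (\<lambda>x. (U s x - U t x) - (V s x - V t x))" by (simp add: algebra_simps)
      then show ?thesis using nrm_triangle_diff[OF L2_diff[OF L(1)[OF s] L(1)[OF t]] L2_diff[OF L(2)[OF s] L(2)[OF t]]] by simp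
    qed
    then show "\<forall>\<^sub>F s in at t within A. norm (nrm W (\<lambda>x. (U s x - V s x) - (U t x - V t x))) \<le> dst W (U s) (U t) + dst W (V s) (V t)"
      by (auto simp: eventually_at_filter)
  qed
qed

lemma continuous_version_L2_continuous:
  "continuous_version T (L2_space W) u w \<Longrightarrow> L2_continuous W {0..T} w"
  by (simp add: continuous_version_def L2_continuous_def fdist_L2)

section \<open>Weak gradients and weak divergences\<close>

lemma test_function_C1:
  assumes "\<phi> \<in> test_functions S"
  obtains f' where "\<And>x. (\<phi> has_derivative f' x) (at x)" "\<And>v. continuous_on UNIV (\<lambda>x. f' x v)"
proof -
  have "C_on (Suc 0) UNIV \<phi>" using assms unfolding test_functions_def by blast
  then show thesis using that by auto
qed

lemma test_function_continuous: "\<phi> \<in> test_functions S \<Longrightarrow> continuous_on UNIV \<phi>"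
  by (auto simp: test_functions_def dest!: spec[of _ 0])

lemma test_function_supp:
  assumes "\<phi> \<in> test_functions S"
  obtains K where "compact K" "K \<subseteq> S" "\<And>x. x \<notin> K \<Longrightarrow> \<phi> x = 0" "K = closure {x. \<phi> x \<noteq> 0}"
proof (rule that[of "closure {x. \<phi> x \<noteq> 0}"])
  fix x assume "x \<notin> closure {x. \<phi> x \<noteq> 0}"
  then show "\<phi> x = 0" using closure_subset[of "{x. \<phi> x \<noteq> 0}"] by blast
next
  show "compact (closure {x. \<phi> x \<noteq> 0})" "closure {x. \<phi> x \<noteq> 0} \<subseteq> S"
    using assms unfolding test_functions_def by blast+
qed (rule refl)

lemma gradient_eq:
  assumes "(\<phi> has_derivative f') (at x)"
  shows "gradient \<phi> x $ i = f' (axis i 1)"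
  using frechet_derivative_at[OF assms] by (simp add: gradient_def)

lemma gradient_continuous:
  assumes "\<phi> \<in> test_functions S" shows "continuous_on UNIV (gradient \<phi>)"
proof -
  obtain f' where f': "\<And>x. (\<phi> has_derivative f' x) (at x)" "\<And>v. continuous_on UNIV (\<lambda>x. f' x v)"
    using test_function_C1[OF assms] by blast
  have "gradient \<phi> = (\<lambda>x. \<chi> i. f' x (axis i 1))"
    by (auto simp: vec_eq_iff gradient_eq[OF f'(1)])
  then show ?thesis using f'(2) by (auto intro!: continuous_on_vec_lambda)
qed

lemma gradient_supp:
  assumes "x \<notin> closure {x. \<phi> x \<noteq> 0}" shows "gradient \<phi> x = 0"
proof -
  have 0: "0 = \<phi> y" if "y \<in> - closure {x. \<phi> x \<noteq> 0}" for y
    using that closure_subset[of "{x. \<phi> x \<noteq> 0}"] by auto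
  have "((\<lambda>_. 0) has_derivative (\<lambda>_. 0)) (at x)" by simp
  then have "(\<phi> has_derivative (\<lambda>_. 0)) (at x)"
    by (rule has_derivative_transform_within_open[of _ _ _ _ "- closure {x. \<phi> x \<noteq> 0}"])
       (use assms 0 in blast)+
  then show ?thesis by (auto simp: vec_eq_iff gradient_eq)
qed

lemma integrable_continuous_compact_supp:
  fixes g :: "'a::euclidean_space \<Rightarrow> real"
  assumes "continuous_on UNIV g" "compact K" "\<And>x. x \<notin> K \<Longrightarrow> g x = 0"
  shows "integrable lborel g"
proof -
  have "integrable lborel (\<lambda>x. indicator K x *\<^sub>R g x)"
    using assms by (intro borel_integrable_compact) (auto intro: continuous_on_subset)
  moreover have "(\<lambda>x. indicator K x *\<^sub>R g x) = g" using assms(3) by (auto simp: indicator_def fun_eq_iff)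
  ultimately show ?thesis by (simp only:)
qed

text \<open>The integral of a difference quotient vanishes by translation invariance, and the difference
quotients converge to \<open>D\<close>, dominated by a bound of \<open>D\<close> on a ball around the support.\<close>

lemma integral_directional_derivative_zero:
  fixes F D :: "'a::euclidean_space \<Rightarrow> real"
  assumes D: "\<And>x. ((\<lambda>t. F (x + t *\<^sub>R e)) has_real_derivative D x) (at 0)"
    and cD: "continuous_on UNIV D" and cF: "continuous_on UNIV F"
    and K: "compact K" "\<And>x. x \<notin> K \<Longrightarrow> F x = 0" and e: "norm e \<le> 1"
  shows "(\<integral>x. D x \<partial>lborel) = 0"
proof -
  obtain r where r: "\<And>x. x \<in> K \<Longrightarrow> norm x \<le> r" using compact_imp_bounded[OF K(1)] by (auto simp: bounded_iff)
  obtain B where B: "\<And>x. norm x \<le> r + 2 \<Longrightarrow> \<bar>D x\<bar> \<le> B"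
    using compact_imp_bounded[OF compact_continuous_image[OF continuous_on_subset[OF cD] compact_cball[of 0 "r+2"]]]
    by (force simp: bounded_iff)
  define h where "h n = 1 / real (Suc n)" for n
  have h: "0 < h n" "h n \<le> 1" for n by (auto simp: h_def)
  define q where "q n x = (F (x + h n *\<^sub>R e) - F x) / h n" for n x
  have mF[measurable]: "F \<in> borel_measurable borel" using cF by (rule borel_measurable_continuous_onI)
  have mD[measurable]: "D \<in> borel_measurable borel" using cD by (rule borel_measurable_continuous_onI)
  have iF: "integrable lborel F" by (rule integrable_continuous_compact_supp[OF cF K])
  have "(\<lambda>n. \<integral>x. q n x \<partial>lborel) \<longlonglongrightarrow> (\<integral>x. D x \<partial>lborel)"
  proof (rule integral_dominated_convergence[where w="\<lambda>x. indicator (cball 0 (r+1)) x *\<^sub>R \<bar>B\<bar>"])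
    show "q n \<in> borel_measurable lborel" for n unfolding q_def[abs_def] by measurable
    show "integrable lborel (\<lambda>x::'a. indicator (cball 0 (r+1)) x *\<^sub>R \<bar>B\<bar>)"
      by (rule borel_integrable_compact) auto
    show "AE x in lborel. (\<lambda>n. q n x) \<longlonglongrightarrow> D x"
    proof (rule AE_I2)
      fix x
      have "((\<lambda>t. (F (x + t *\<^sub>R e) - F (x + 0 *\<^sub>R e)) / t) \<longlongrightarrow> D x) (at 0)"
        using D[of x] by (simp add: has_field_derivative_iff)
      moreover have "filterlim h (at 0) sequentially"
        unfolding filterlim_at h_def using LIMSEQ_inverse_real_of_nat by (auto simp: inverse_eq_divide)
      ultimately show "(\<lambda>n. q n x) \<longlonglongrightarrow> D x"
        unfolding q_def by (auto dest: filterlim_compose)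
    qed
    show "AE x in lborel. norm (q n x) \<le> indicator (cball 0 (r+1)) x *\<^sub>R \<bar>B\<bar>" for n
    proof (rule AE_I2)
      fix x
      have he: "norm (h n *\<^sub>R e) \<le> 1" using h[of n] e by (simp add: mult_le_one)
      show "norm (q n x) \<le> indicator (cball 0 (r+1)) x *\<^sub>R \<bar>B\<bar>"
      proof (cases "norm x \<le> r + 1")
        case False
        then have "norm (x + h n *\<^sub>R e) > r"
          using he norm_diff_ineq[of x "h n *\<^sub>R e"] by linarith
        then have "F x = 0" "F (x + h n *\<^sub>R e) = 0" using K(2) r False by force+
        then show ?thesis using False by (simp add: q_def)
      next
        case True
        have "\<exists>z. 0 < z \<and> z < h n \<and> F (x + h n *\<^sub>R e) - F (x + 0 *\<^sub>R e) = (h n - 0) * D (x + z *\<^sub>R e)"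
        proof (rule MVT2)
          fix t
          have "((\<lambda>s. F (x + t *\<^sub>R e + s *\<^sub>R e)) has_real_derivative D (x + t *\<^sub>R e)) (at 0)" by (rule D)
          then have "((\<lambda>s. F (x + (s + t) *\<^sub>R e)) has_real_derivative D (x + t *\<^sub>R e)) (at 0)"
            by (simp add: algebra_simps)
          then show "((\<lambda>s. F (x + s *\<^sub>R e)) has_real_derivative D (x + t *\<^sub>R e)) (at t)"
            using DERIV_shift[of "\<lambda>s. F (x + s *\<^sub>R e)" _ 0 t] by simp
        qed (use h in auto)
        then obtain z where z: "0 < z" "z < h n" "q n x = D (x + z *\<^sub>R e)"
          using h[of n] by (auto simp: q_def field_simps)
        have "norm (z *\<^sub>R e) \<le> 1" using z h[of n] e by (simp add: mult_le_one)
        then have "norm (x + z *\<^sub>R e) \<le> r + 2" using norm_triangle_ineq[of x "z *\<^sub>R e"] True by linarith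
        from B[OF this] z show ?thesis using True by simp
      qed
    qed
  qed auto
  moreover have "(\<integral>x. q n x \<partial>lborel) = 0" for n
  proof -
    have d: "distr lborel borel (\<lambda>x. h n *\<^sub>R e + x) = lborel" by (rule lborel_distr_plus)
    have "(\<integral>x. F (h n *\<^sub>R e + x) \<partial>lborel) = (\<integral>x. F x \<partial>lborel)"
      by (subst (2) d[symmetric]) (rule integral_distr[symmetric]; measurable)
    moreover have "integrable lborel (\<lambda>x. F (h n *\<^sub>R e + x))"
      using iF by (subst (asm) d[symmetric]) (simp add: integrable_distr_eq)
    ultimately show ?thesis using iF by (simp add: q_def add.commute)
  qed
  ultimately show ?thesis by (simp add: LIMSEQ_const_iff)
qed

lemma test_function_measurable_lebesgue_on:
  assumes "continuous_on UNIV g" shows "g \<in> borel_measurable (lebesgue_on W)"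
  using borel_measurable_continuous_onI[OF assms]
  by (simp add: measurable_completion measurable_restrict_space1)

lemma integral_lebesgue_on_supp:
  fixes g :: "'a::euclidean_space \<Rightarrow> real"
  assumes W: "open W" and g: "continuous_on UNIV g" "\<And>x. x \<notin> W \<Longrightarrow> g x = 0"
  shows "(\<integral>x. g x \<partial>lebesgue_on W) = (\<integral>x. g x \<partial>lborel)"
proof -
  have "W \<in> sets lebesgue" using W by (simp add: borel_open sets_completionI_sets)
  then have "(\<integral>x. g x \<partial>lebesgue_on W) = (\<integral>x. indicator W x *\<^sub>R g x \<partial>lebesgue)"
    by (simp add: integral_restrict_space)
  also have "(\<lambda>x. indicator W x *\<^sub>R g x) = g" using g(2) by (auto simp: indicator_def fun_eq_iff)
  also have "(\<integral>x. g x \<partial>lebesgue) = (\<integral>x. g x \<partial>lborel)"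
    using borel_measurable_continuous_onI[OF g(1)] by (intro integral_completion) simp
  finally show ?thesis .
qed

lemma L2_continuous_compact_supp:
  fixes g :: "real^2 \<Rightarrow> 'b::euclidean_space"
  assumes W: "W \<in> sets lebesgue" and g: "continuous_on UNIV g" "compact K" "\<And>x. x \<notin> K \<Longrightarrow> g x = 0"
  shows "g \<in> L2 W"
proof -
  have "integrable lborel (\<lambda>x. (norm (g x))\<^sup>2)"
    by (rule integrable_continuous_compact_supp[OF _ g(2)]) (use g in \<open>auto intro!: continuous_intros\<close>)
  then have "integrable lebesgue (\<lambda>x. (norm (g x))\<^sup>2)" using borel_measurable_continuous_onI[OF g(1)] by (subst integrable_completion) auto
  then have "integrable lebesgue (\<lambda>x. indicator W x *\<^sub>R (norm (g x))\<^sup>2)"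
    using W integrable_mult_indicator by blast
  then show ?thesis using W test_function_measurable_lebesgue_on[OF g(1)]
    by (simp add: L2_iff lebesgue_on_integrable_iff)
qed

lemma test_function_L2:
  assumes "W \<in> sets lebesgue" "\<phi> \<in> test_functions S" shows "\<phi> \<in> L2 W" 
proof -
  obtain K where "compact K" "\<And>x. x \<notin> K \<Longrightarrow> \<phi> x = 0" using test_function_supp[OF assms(2)] by metis
  then show ?thesis using L2_continuous_compact_supp[OF assms(1) test_function_continuous[OF assms(2)]] by blast
qed

lemma gradient_L2:
  assumes "W \<in> sets lebesgue" "\<phi> \<in> test_functions S" shows "gradient \<phi> \<in> L2 W"
proof -
  obtain K where "compact K" "K = closure {x. \<phi> x \<noteq> 0}" using test_function_supp[OF assms(2)] by metis
  then show ?thesis using L2_continuous_compact_supp[OF assms(1) gradient_continuous[OF assms(2)]] gradient_supp by blast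
qed

text \<open>The integral of a partial derivative of the product \<open>\<phi> \<psi>\<close> is zero.\<close>

lemma gradient_is_weak_gradient:
  assumes W: "open W" and \<phi>: "\<phi> \<in> test_functions W"
  shows "is_weak_gradient W \<phi> (gradient \<phi>)"
  unfolding is_weak_gradient_def
proof (intro ballI allI)
  fix \<psi> i assume \<psi>: "\<psi> \<in> test_functions W"
  obtain f' where f': "\<And>x. (\<phi> has_derivative f' x) (at x)" "\<And>v. continuous_on UNIV (\<lambda>x. f' x v)"
    using test_function_C1[OF \<phi>] by blast
  obtain g' where g': "\<And>x. (\<psi> has_derivative g' x) (at x)" "\<And>v. continuous_on UNIV (\<lambda>x. g' x v)"
    using test_function_C1[OF \<psi>] by blast
  obtain K where K: "compact K" "K \<subseteq> W" "\<And>x. x \<notin> K \<Longrightarrow> \<psi> x = 0" "K = closure {x. \<psi> x \<noteq> 0}"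
    using test_function_supp[OF \<psi>] by blast
  note c = test_function_continuous[OF \<phi>] test_function_continuous[OF \<psi>]
    gradient_continuous[OF \<phi>] gradient_continuous[OF \<psi>]
  let ?A = "\<lambda>x. \<phi> x * gradient \<psi> x $ i" and ?B = "\<lambda>x. gradient \<phi> x $ i * \<psi> x"
  have cA: "continuous_on UNIV ?A" and cB: "continuous_on UNIV ?B"
    using c by (auto intro!: continuous_intros)
  have zA: "?A x = 0" and zB: "?B x = 0" if "x \<notin> K" for x
    using K(3)[OF that] gradient_supp[of x \<psi>] that K(4) by auto
  have "(\<integral>x. ?A x + ?B x \<partial>lborel) = 0"
  proof (rule integral_directional_derivative_zero[where F="\<lambda>x. \<phi> x * \<psi> x" and e="axis i 1" and K=K])
    fix x
    have 1: "((\<lambda>x. \<phi> x * \<psi> x) has_derivative (\<lambda>v. \<phi> x * g' x v + f' x v * \<psi> x)) (at x)"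
      by (rule has_derivative_mult[OF f'(1) g'(1)])
    have 2: "((\<lambda>t. x + t *\<^sub>R axis i 1) has_derivative (\<lambda>t. t *\<^sub>R axis i 1)) (at 0)"
      by (auto intro!: derivative_eq_intros)
    have "((\<lambda>t. \<phi> (x + t *\<^sub>R axis i 1) * \<psi> (x + t *\<^sub>R axis i 1)) has_derivative
       (\<lambda>t. \<phi> x * g' x (t *\<^sub>R axis i 1) + f' x (t *\<^sub>R axis i 1) * \<psi> x)) (at 0)"
      using has_derivative_compose[OF 2, of "\<lambda>x. \<phi> x * \<psi> x"] 1 by simp
    moreover have "g' x (t *\<^sub>R axis i 1) = t * g' x (axis i 1)" "f' x (t *\<^sub>R axis i 1) = t * f' x (axis i 1)" for t
      using f'(1)[of x] g'(1)[of x]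
      by (simp_all add: has_derivative_bounded_linear bounded_linear.linear linear_scale)
    then have "(\<lambda>t. \<phi> x * g' x (t *\<^sub>R axis i 1) + f' x (t *\<^sub>R axis i 1) * \<psi> x) = (*) (?A x + ?B x)"
      by (simp add: gradient_eq[OF f'(1)] gradient_eq[OF g'(1)] fun_eq_iff algebra_simps)
    ultimately show "((\<lambda>t. \<phi> (x + t *\<^sub>R axis i 1) * \<psi> (x + t *\<^sub>R axis i 1)) has_real_derivative ?A x + ?B x) (at 0)"
      unfolding has_field_derivative_def by simp
  next
    show "continuous_on UNIV (\<lambda>x. ?A x + ?B x)" using cA cB by (rule continuous_on_add)
    show "continuous_on UNIV (\<lambda>x. \<phi> x * \<psi> x)" using c(1,2) by (rule continuous_on_mult)
    show "compact K" by fact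
    show "\<phi> x * \<psi> x = 0" if "x \<notin> K" for x using K(3)[OF that] by simp
  qed simp
  then have "(\<integral>x. ?A x \<partial>lborel) = - (\<integral>x. ?B x \<partial>lborel)"
    using integrable_continuous_compact_supp[OF cA K(1) zA] integrable_continuous_compact_supp[OF cB K(1) zB] by simp
  moreover have "(\<integral>x. ?A x \<partial>lebesgue_on W) = (\<integral>x. ?A x \<partial>lborel)"
    by (rule integral_lebesgue_on_supp[OF W cA zA]) (use K(2) in blast)
  moreover have "(\<integral>x. ?B x \<partial>lebesgue_on W) = (\<integral>x. ?B x \<partial>lborel)"
    by (rule integral_lebesgue_on_supp[OF W cB zB]) (use K(2) in blast)
  ultimately show "(\<integral>x. ?A x \<partial>lebesgue_on W) = - (\<integral>x. ?B x \<partial>lebesgue_on W)" by (simp only:)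
qed

lemma L2_const:
  fixes c :: "'b::euclidean_space"
  assumes W: "W \<in> lmeasurable" shows "(\<lambda>_. c) \<in> L2 W"
proof -
  have "integrable lebesgue (indicat_real W)" using W lmeasurable_iff_integrable by blast
  then show ?thesis using W unfolding L2_iff by (simp add: lebesgue_on_integrable_iff fmeasurableD)
qed

lemma weak_gradient_unique:
  assumes W: "open W" "bounded W" and L: "g \<in> L2 W" "g' \<in> L2 W"
    and wg: "is_weak_gradient W u g" "is_weak_gradient W u g'"
  shows "AE x in lebesgue_on W. g x = g' x"
proof -
  have Wl: "W \<in> lmeasurable" using W by (simp add: bounded_set_imp_lmeasurable borel_open sets_completionI_sets)
  then have Ws: "W \<in> sets lebesgue" by (simp add: fmeasurableD)
  have "AE x in lebesgue_on W. g x $ i - g' x $ i = 0" for i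
  proof (rule fundamental_lemma_calculus_of_variations[OF W(1)])
    show "integrable (lebesgue_on W) (\<lambda>x. g x $ i - g' x $ i)"
      using ip_integrable[OF L2_diff[OF L] L2_const[OF Wl, of "axis i 1"]] by (simp add: inner_axis)
    fix \<phi> assume \<phi>: "\<phi> \<in> test_functions W"
    obtain K where K: "compact K" "\<And>x. x \<notin> K \<Longrightarrow> \<phi> x = 0" using test_function_supp[OF \<phi>] by metis
    have "(\<lambda>x. \<phi> x *\<^sub>R (axis i 1 :: real^2)) \<in> L2 W"
      by (rule L2_continuous_compact_supp[OF Ws _ K(1)])
         (use K(2) test_function_continuous[OF \<phi>] in \<open>auto intro!: continuous_intros\<close>)
    then have i: "integrable (lebesgue_on W) (\<lambda>x. k x $ i * \<phi> x)" if "k \<in> L2 W" for k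
      using ip_integrable[OF that, of "\<lambda>x. \<phi> x *\<^sub>R axis i 1"] by (simp add: inner_axis mult.commute)
    show "(\<integral>x. (g x $ i - g' x $ i) * \<phi> x \<partial>lebesgue_on W) = 0"
      using wg \<phi> i[OF L(1)] i[OF L(2)] by (simp add: is_weak_gradient_def left_diff_distrib)
  qed
  then have "AE x in lebesgue_on W. \<forall>i. g x $ i - g' x $ i = 0" by (simp add: AE_all_countable)
  then show ?thesis by eventually_elim (simp add: vec_eq_iff)
qed

lemma open_sets_lebesgue: "open (W::'a::euclidean_space set) \<Longrightarrow> W \<in> sets lebesgue"
  by (simp add: borel_open sets_completionI_sets)

lemma C_on_scaled_diff:
  fixes f g :: "'a::euclidean_space \<Rightarrow> real"
  assumes "C_on k S f" "C_on k S g" shows "C_on k S (\<lambda>x. c * (f x - g x))"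
proof -
  have "C_on k S (\<lambda>x. c * (f x + (-1) * g x))"
    by (intro C_on_mult C_on_add C_on_const assms)
  then show ?thesis by simp
qed

lemma test_functions_scaled_diff:
  assumes "\<phi> \<in> test_functions S" "\<psi> \<in> test_functions S"
  shows "(\<lambda>x. c * (\<phi> x - \<psi> x)) \<in> test_functions S"
proof -
  let ?A = "closure {x. \<phi> x \<noteq> 0}" and ?B = "closure {x. \<psi> x \<noteq> 0}" and ?C = "closure {x. c * (\<phi> x - \<psi> x) \<noteq> 0}"
  have "?C \<subseteq> closure ({x. \<phi> x \<noteq> 0} \<union> {x. \<psi> x \<noteq> 0})" by (rule closure_mono) auto
  then have sub: "?C \<subseteq> ?A \<union> ?B" by (simp add: closure_Un)
  have AB: "compact ?A" "compact ?B" "?A \<subseteq> S" "?B \<subseteq> S" using assms unfolding test_functions_def by blast+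
  then have "compact (?A \<union> ?B)" by (intro compact_Un)
  then have "compact ?C" using sub by (meson bounded_subset closed_closure compact_eq_bounded_closed)
  moreover have "C_on k UNIV (\<lambda>x. c * (\<phi> x - \<psi> x))" for k
    using assms unfolding test_functions_def by (intro C_on_scaled_diff) blast+
  moreover have "?C \<subseteq> S" using sub AB(3,4) by (meson Un_least order_trans)
  ultimately show ?thesis unfolding test_functions_def by (intro CollectI conjI allI)
qed

lemma zero_test_function: "(\<lambda>_. 0) \<in> test_functions S"
  by (simp add: test_functions_def C_on_const)

lemma gradient_scaled_diff:
  assumes "\<phi> \<in> test_functions S" "\<psi> \<in> test_functions S"
  shows "gradient (\<lambda>x. c * (\<phi> x - \<psi> x)) x = c *\<^sub>R (gradient \<phi> x - gradient \<psi> x)"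
proof -
  obtain f' where f': "\<And>x. (\<phi> has_derivative f' x) (at x)" "\<And>v. continuous_on UNIV (\<lambda>x. f' x v)"
    using test_function_C1[OF assms(1)] by blast
  obtain g' where g': "\<And>x. (\<psi> has_derivative g' x) (at x)" "\<And>v. continuous_on UNIV (\<lambda>x. g' x v)"
    using test_function_C1[OF assms(2)] by blast
  have d: "((\<lambda>x. c * (\<phi> x - \<psi> x)) has_derivative (\<lambda>v. c * (f' x v - g' x v))) (at x)"
    by (intro has_derivative_mult_right has_derivative_diff f'(1) g'(1))
  show ?thesis
    by (simp add: vec_eq_iff gradient_eq[OF d] gradient_eq[OF f'(1)] gradient_eq[OF g'(1)])
qed

lemma gradient_zero: "gradient (\<lambda>_. 0) = (\<lambda>_. 0)"
  by (auto simp: fun_eq_iff vec_eq_iff gradient_eq[OF has_derivative_const])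

lemma weak_gradient_props:
  assumes "u \<in> elems (H1_space W)"
  shows "weak_gradient W u \<in> L2 W" "is_weak_gradient W u (weak_gradient W u)"
proof -
  have "\<exists>g. g \<in> L2 W \<and> is_weak_gradient W u g" using assms by (auto simp: H1_space_def)
  from someI_ex[OF this] show "weak_gradient W u \<in> L2 W" "is_weak_gradient W u (weak_gradient W u)"
    by (auto simp: weak_gradient_def)
qed

lemma weak_div_props:
  assumes "p \<in> elems (Hdiv_space W)"
  shows "p \<in> L2 W" "weak_div W p \<in> L2 W" "is_weak_div W p (weak_div W p)"
proof -
  have "\<exists>g. g \<in> L2 W \<and> is_weak_div W p g" using assms by (auto simp: Hdiv_space_def)
  from someI_ex[OF this] show "weak_div W p \<in> L2 W" "is_weak_div W p (weak_div W p)"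
    by (auto simp: weak_div_def)
  show "p \<in> L2 W" using assms by (auto simp: Hdiv_space_def)
qed

lemma is_weak_div_ip:
  "is_weak_div W p d \<longleftrightarrow> (\<forall>\<phi>\<in>test_functions W. ip W p (gradient \<phi>) = - ip W d \<phi>)"
  by (simp add: is_weak_div_def ip_def)

text \<open>The graph of the gradient on \<open>H\<^sub>0\<^sup>1\<close>, written as a limit of test functions. As a relation it is
linear, whereas the chosen representative \<^const>\<open>weak_gradient\<close> is linear only up to null sets.\<close>

definition H10_grad :: "(real^2) set \<Rightarrow> (real^2 \<Rightarrow> real) \<Rightarrow> (real^2 \<Rightarrow> real^2) \<Rightarrow> bool" where
  "H10_grad W u G \<longleftrightarrow> u \<in> L2 W \<and> G \<in> L2 W \<and>
     (\<exists>\<phi>. (\<forall>n::nat. \<phi> n \<in> test_functions W) \<and> (\<lambda>n. dst W u (\<phi> n)) \<longlonglongrightarrow> 0 \<and>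
          (\<lambda>n. dst W G (gradient (\<phi> n))) \<longlonglongrightarrow> 0)"

lemma is_weak_gradient_diff:
  assumes W: "W \<in> sets lebesgue" and L: "u \<in> L2 W" "v \<in> L2 W" "g \<in> L2 W" "h \<in> L2 W"
    and wg: "is_weak_gradient W u g" "is_weak_gradient W v h"
  shows "is_weak_gradient W (\<lambda>x. u x - v x) (\<lambda>x. g x - h x)"
  unfolding is_weak_gradient_def
proof (intro ballI allI)
  fix \<psi> i assume \<psi>: "\<psi> \<in> test_functions W"
  have grad: "(\<lambda>x. gradient \<psi> x $ i) \<in> L2 W"
  proof -
    obtain K where K: "compact K" "K = closure {x. \<psi> x \<noteq> 0}" using test_function_supp[OF \<psi>] by metis
    show ?thesis
      by (rule L2_continuous_compact_supp[OF W _ K(1)])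
         (use gradient_continuous[OF \<psi>] gradient_supp K in \<open>auto intro!: continuous_intros\<close>)
  qed
  have psi: "(\<lambda>x. \<psi> x *\<^sub>R (axis i 1::real^2)) \<in> L2 W"
  proof -
    obtain K where K: "compact K" "\<And>x. x \<notin> K \<Longrightarrow> \<psi> x = 0" using test_function_supp[OF \<psi>] by metis
    show ?thesis
      by (rule L2_continuous_compact_supp[OF W _ K(1)])
         (use test_function_continuous[OF \<psi>] K in \<open>auto intro!: continuous_intros\<close>)
  qed
  have 1: "integrable (lebesgue_on W) (\<lambda>x. w x * gradient \<psi> x $ i)" if "w \<in> L2 W" for w
    using ip_integrable[OF that grad] by simp
  have 2: "integrable (lebesgue_on W) (\<lambda>x. k x $ i * \<psi> x)" if "k \<in> L2 W" for k
    using ip_integrable[OF that psi] by (simp add: inner_axis mult.commute)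
  show "(\<integral>x. (u x - v x) * gradient \<psi> x $ i \<partial>lebesgue_on W) = - (\<integral>x. (g x - h x) $ i * \<psi> x \<partial>lebesgue_on W)"
    using wg \<psi> by (simp add: is_weak_gradient_def left_diff_distrib 1 2 L)
qed

text \<open>The distance in \<open>H\<^sup>1\<close> refers to the chosen weak gradient of \<open>u - \<phi>\<close>. By uniqueness of weak gradients
it is almost everywhere the chosen gradient of \<open>u\<close> minus the classical gradient of \<open>\<phi>\<close>.\<close>

lemma H10_grad_weak_gradient:
  assumes W: "open W" "bounded W" and u: "u \<in> elems (H10_space W)"
  shows "H10_grad W u (weak_gradient W u)"
proof -
  have Ws: "W \<in> sets lebesgue" by (rule open_sets_lebesgue[OF W(1)])
  have uH1: "u \<in> elems (H1_space W)" using u by (simp add: H10_space_def)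
  have uL: "u \<in> L2 W" using uH1 by (simp add: H1_space_def)
  note wu = weak_gradient_props[OF uH1]
  have "\<forall>n. \<exists>\<phi>\<in>test_functions W. fdist (H1_space W) u \<phi> < 1 / real (Suc n)"
    using u by (simp add: H10_space_def)
  then obtain \<phi> where \<phi>: "\<And>n. \<phi> n \<in> test_functions W" "\<And>n. fdist (H1_space W) u (\<phi> n) < 1 / real (Suc n)"
    by metis
  have both: "dst W u (\<phi> n) \<le> 1 / real (Suc n) \<and> dst W (weak_gradient W u) (gradient (\<phi> n)) \<le> 1 / real (Suc n)" for n
  proof -
    let ?w = "\<lambda>x. u x - \<phi> n x" and ?g = "\<lambda>x. weak_gradient W u x - gradient (\<phi> n) x"
    note L = test_function_L2[OF Ws \<phi>(1)] gradient_L2[OF Ws \<phi>(1)]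
    have gL: "?g \<in> L2 W" using wu L by (intro L2_diff)
    have wg: "is_weak_gradient W ?w ?g"
      by (rule is_weak_gradient_diff[OF Ws uL L(1) wu(1) L(2) wu(2) gradient_is_weak_gradient[OF W(1) \<phi>(1)]])
    have w: "?w \<in> elems (H1_space W)"
      using L2_diff[OF uL L(1)] gL wg by (auto simp: H1_space_def)
    note ww = weak_gradient_props[OF w]
    have "AE x in lebesgue_on W. weak_gradient W ?w x = ?g x"
      by (rule weak_gradient_unique[OF W ww(1) gL ww(2) wg])
    then have "dst W (weak_gradient W ?w) ?g = 0"
      by (intro nrm_AE_zero) (auto elim: eventually_mono)
    then have eq: "nrm W (weak_gradient W ?w) = nrm W ?g" by (rule nrm_cong_dist0[OF ww(1) gL])
    have lt: "sqrt ((nrm W ?w)\<^sup>2 + (nrm W (weak_gradient W ?w))\<^sup>2) < 1 / real (Suc n)"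
      using \<phi>(2)[of n] by (simp add: fdist_def H1_space_def)
    have "nrm W ?w \<le> sqrt ((nrm W ?w)\<^sup>2 + (nrm W (weak_gradient W ?w))\<^sup>2)" by (rule real_sqrt_sum_squares_ge1)
    moreover have "nrm W (weak_gradient W ?w) \<le> sqrt ((nrm W ?w)\<^sup>2 + (nrm W (weak_gradient W ?w))\<^sup>2)" by (rule real_sqrt_sum_squares_ge2)
    ultimately show ?thesis using lt eq by linarith
  qed
  have lim: "(\<lambda>n. 1 / real (Suc n)) \<longlonglongrightarrow> 0" using LIMSEQ_inverse_real_of_nat by (simp add: inverse_eq_divide)
  have "(\<lambda>n. dst W u (\<phi> n)) \<longlonglongrightarrow> 0" "(\<lambda>n. dst W (weak_gradient W u) (gradient (\<phi> n))) \<longlonglongrightarrow> 0"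
    by (rule tendsto_sandwich[OF _ _ tendsto_const lim]; use both in \<open>intro always_eventually allI; simp\<close>)+
  then show ?thesis unfolding H10_grad_def using uL wu(1) \<phi>(1) by blast
qed

lemma H10_grad_scaled_diff:
  assumes W: "W \<in> sets lebesgue" and 1: "H10_grad W u G" and 2: "H10_grad W v H"
  shows "H10_grad W (\<lambda>x. c * (u x - v x)) (\<lambda>x. c *\<^sub>R (G x - H x))"
proof -
  obtain \<phi> where u: "u \<in> L2 W" "G \<in> L2 W" and \<phi>: "\<And>n::nat. \<phi> n \<in> test_functions W"
    "(\<lambda>n. dst W u (\<phi> n)) \<longlonglongrightarrow> 0" "(\<lambda>n. dst W G (gradient (\<phi> n))) \<longlonglongrightarrow> 0"
    using 1 unfolding H10_grad_def by blast
  obtain \<psi> where v: "v \<in> L2 W" "H \<in> L2 W" and \<psi>: "\<And>n::nat. \<psi> n \<in> test_functions W"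
    "(\<lambda>n. dst W v (\<psi> n)) \<longlonglongrightarrow> 0" "(\<lambda>n. dst W H (gradient (\<psi> n))) \<longlonglongrightarrow> 0"
    using 2 unfolding H10_grad_def by blast
  note L = test_function_L2[OF W \<phi>(1)] test_function_L2[OF W \<psi>(1)] gradient_L2[OF W \<phi>(1)] gradient_L2[OF W \<psi>(1)]
  have key: "nrm W (\<lambda>x. c *\<^sub>R (a x - b x) - c *\<^sub>R (a' x - b' x)) \<le> \<bar>c\<bar> * (dst W a a' + dst W b b')"
    if "a \<in> L2 W" "b \<in> L2 W" "a' \<in> L2 W" "b' \<in> L2 W" for a b a' b' :: "real^2 \<Rightarrow> 'b::euclidean_space"
  proof -
    have "(\<lambda>x. c *\<^sub>R (a x - b x) - c *\<^sub>R (a' x - b' x)) = (\<lambda>x. c *\<^sub>R ((a x - a' x) - (b x - b' x)))"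
      by (simp add: algebra_simps)
    then have "nrm W (\<lambda>x. c *\<^sub>R (a x - b x) - c *\<^sub>R (a' x - b' x)) = \<bar>c\<bar> * nrm W (\<lambda>x. (a x - a' x) - (b x - b' x))"
      by (simp only: nrm_scale)
    also have "\<dots> \<le> \<bar>c\<bar> * (dst W a a' + dst W b b')"
      using that by (intro mult_left_mono nrm_triangle_diff L2_diff) auto
    finally show ?thesis .
  qed
  let ?\<theta> = "\<lambda>n x. c * (\<phi> n x - \<psi> n x)"
  have z1: "(\<lambda>n. \<bar>c\<bar> * (dst W u (\<phi> n) + dst W v (\<psi> n))) \<longlonglongrightarrow> 0"
    using tendsto_mult_left[OF tendsto_add[OF \<phi>(2) \<psi>(2)], of "\<bar>c\<bar>"] by simp
  have z2: "(\<lambda>n. \<bar>c\<bar> * (dst W G (gradient (\<phi> n)) + dst W H (gradient (\<psi> n)))) \<longlonglongrightarrow> 0"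
    using tendsto_mult_left[OF tendsto_add[OF \<phi>(3) \<psi>(3)], of "\<bar>c\<bar>"] by simp
  have k1: "nrm W (\<lambda>x. c * (u x - v x) - ?\<theta> n x) \<le> \<bar>c\<bar> * (dst W u (\<phi> n) + dst W v (\<psi> n))" for n
    using key[OF u(1) v(1) L(1) L(2)] by simp
  have k2: "nrm W (\<lambda>x. c *\<^sub>R (G x - H x) - gradient (?\<theta> n) x) \<le> \<bar>c\<bar> * (dst W G (gradient (\<phi> n)) + dst W H (gradient (\<psi> n)))" for n
    using key[OF u(2) v(2) L(3) L(4)] by (simp add: gradient_scaled_diff[OF \<phi>(1) \<psi>(1)])
  have "(\<lambda>n. nrm W (\<lambda>x. c * (u x - v x) - ?\<theta> n x)) \<longlonglongrightarrow> 0"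
    by (rule tendsto_sandwich[OF _ _ tendsto_const z1]; intro always_eventually allI; (rule k1)?; simp)
  moreover have "(\<lambda>n. nrm W (\<lambda>x. c *\<^sub>R (G x - H x) - gradient (?\<theta> n) x)) \<longlonglongrightarrow> 0"
    by (rule tendsto_sandwich[OF _ _ tendsto_const z2]; intro always_eventually allI; (rule k2)?; simp)
  moreover have "?\<theta> n \<in> test_functions W" for n by (rule test_functions_scaled_diff[OF \<phi>(1) \<psi>(1)])
  moreover have "(\<lambda>x. c * (u x - v x)) \<in> L2 W" "(\<lambda>x. c *\<^sub>R (G x - H x)) \<in> L2 W"
    using L2_scale[OF L2_diff[OF u(1) v(1)], of c] L2_scale[OF L2_diff[OF u(2) v(2)], of c] by simp_all
  ultimately show ?thesis unfolding H10_grad_def by (intro conjI exI[of _ ?\<theta>]) simp_all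
qed

lemma H10_grad_zero: "H10_grad W (\<lambda>_. 0) (\<lambda>_. 0)"
  unfolding H10_grad_def
  by (auto intro!: exI[of _ "\<lambda>_ _. 0"] simp: zero_test_function gradient_zero)

lemma H10_grad_cong:
  assumes W: "W \<in> sets lebesgue" and 1: "H10_grad W u G" and v: "v \<in> L2 W" and 0: "dst W u v = 0"
  shows "H10_grad W v G"
proof -
  obtain \<phi> where u: "u \<in> L2 W" "G \<in> L2 W" and \<phi>: "\<And>n::nat. \<phi> n \<in> test_functions W"
    "(\<lambda>n. dst W u (\<phi> n)) \<longlonglongrightarrow> 0" "(\<lambda>n. dst W G (gradient (\<phi> n))) \<longlonglongrightarrow> 0"
    using 1 unfolding H10_grad_def by blast
  have "dst W u (\<phi> n) = dst W v (\<phi> n)" for n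
    using 0 u v test_function_L2[OF W \<phi>(1)] by (intro nrm_cong_dist0 L2_diff) auto
  with \<phi>(2) have "(\<lambda>n. dst W v (\<phi> n)) \<longlonglongrightarrow> 0" by simp
  then show ?thesis unfolding H10_grad_def using u v \<phi> by blast
qed

text \<open>For a test function in place of \<open>u\<close> this is the definition of the weak divergence, and both sides
are continuous along the approximating sequence. This is where the boundary condition \<open>u = 0\<close> enters.\<close>

lemma weak_div_adjoint:
  assumes W: "W \<in> sets lebesgue" and G: "H10_grad W u G" and L: "p \<in> L2 W" "d \<in> L2 W"
    and wd: "is_weak_div W p d"
  shows "ip W G p = - ip W u d"
proof -
  obtain \<phi> where u: "u \<in> L2 W" "G \<in> L2 W" and \<phi>: "\<And>n::nat. \<phi> n \<in> test_functions W"
    "(\<lambda>n. dst W u (\<phi> n)) \<longlonglongrightarrow> 0" "(\<lambda>n. dst W G (gradient (\<phi> n))) \<longlonglongrightarrow> 0"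
    using G unfolding H10_grad_def by blast
  note L' = test_function_L2[OF W \<phi>(1)] gradient_L2[OF W \<phi>(1)]
  have "(\<lambda>n. ip W (gradient (\<phi> n)) p) \<longlonglongrightarrow> ip W G p"
    by (rule tendsto_ip[OF L'(2) u(2) L(1)]) (use \<phi>(3) in \<open>subst nrm_minus_commute\<close>)
  moreover have "(\<lambda>n. - ip W (\<phi> n) d) \<longlonglongrightarrow> - ip W u d"
    by (intro tendsto_minus tendsto_ip[OF L'(1) u(1) L(2)]) (use \<phi>(2) in \<open>subst nrm_minus_commute\<close>)
  moreover have "ip W (gradient (\<phi> n)) p = - ip W (\<phi> n) d" for n
    using wd \<phi>(1) unfolding is_weak_div_ip by (metis ip_commute)
  ultimately show ?thesis using LIMSEQ_unique by force
qed

lemma is_weak_div_scaled_diff: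
  assumes W: "W \<in> sets lebesgue" and L: "p \<in> L2 W" "q \<in> L2 W" "d \<in> L2 W" "e \<in> L2 W"
    and wd: "is_weak_div W p d" "is_weak_div W q e"
  shows "is_weak_div W (\<lambda>x. c *\<^sub>R (p x - q x)) (\<lambda>x. c * (d x - e x))"
proof -
  have "ip W (\<lambda>x. c *\<^sub>R (p x - q x)) (gradient \<phi>) = - ip W (\<lambda>x. c *\<^sub>R (d x - e x)) \<phi>"
    if \<phi>: "\<phi> \<in> test_functions W" for \<phi>
  proof -
    have "ip W (\<lambda>x. c *\<^sub>R (p x - q x)) (gradient \<phi>) = c * (ip W p (gradient \<phi>) - ip W q (gradient \<phi>))"
      using L gradient_L2[OF W \<phi>] by (simp add: ip_scale_left ip_diff_left)
    moreover have "ip W (\<lambda>x. c *\<^sub>R (d x - e x)) \<phi> = c * (ip W d \<phi> - ip W e \<phi>)"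
      using L test_function_L2[OF W \<phi>] by (simp only: ip_scale_left ip_diff_left)
    ultimately show ?thesis using wd \<phi> unfolding is_weak_div_ip by (simp add: algebra_simps)
  qed
  then show ?thesis unfolding is_weak_div_ip by simp
qed

lemma is_weak_div_cong:
  assumes W: "W \<in> sets lebesgue" and L: "p \<in> L2 W" "q \<in> L2 W" and 0: "dst W p q = 0"
    and wd: "is_weak_div W p d"
  shows "is_weak_div W q d"
  using wd ip_cong_dist0[OF L gradient_L2[OF W] 0] unfolding is_weak_div_ip by simp

section \<open>Scalar weak derivatives in time\<close>

text \<open>The integral starts at \<open>-\<infinity>\<close>: for functions that vanish for negative times the initial value is then
automatically zero, and a shift in time creates no boundary term.\<close>

definition cumul :: "(real \<Rightarrow> real) \<Rightarrow> real \<Rightarrow> real" where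
  "cumul b t = (\<integral>s. indicator {..t} s * b s \<partial>lebesgue)"

lemma integrable_indicator_mult:
  fixes b :: "real \<Rightarrow> real"
  assumes "integrable lebesgue b" "A \<in> sets lebesgue"
  shows "integrable lebesgue (\<lambda>s. indicator A s * b s)"
  using integrable_mult_indicator[OF assms(2,1)] by simp

lemma cumul_diff:
  assumes "integrable lebesgue b" "s \<le> t"
  shows "cumul b t - cumul b s = (\<integral>r. indicator {s<..t} r * b r \<partial>lebesgue)"
proof -
  have "cumul b t - cumul b s = (\<integral>r. indicator {..t} r * b r - indicator {..s} r * b r \<partial>lebesgue)"
    unfolding cumul_def using assms(1) by (subst Bochner_Integration.integral_diff) (auto intro!: integrable_indicator_mult)
  also have "\<dots> = (\<integral>r. indicator {s<..t} r * b r \<partial>lebesgue)"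
    using assms(2) by (intro Bochner_Integration.integral_cong) (auto simp: indicator_def)
  finally show ?thesis .
qed

lemma cumul_bound:
  assumes "integrable lebesgue b" shows "\<bar>cumul b t\<bar> \<le> (\<integral>s. \<bar>b s\<bar> \<partial>lebesgue)"
proof -
  have "\<bar>cumul b t\<bar> \<le> (\<integral>s. \<bar>indicator {..t} s * b s\<bar> \<partial>lebesgue)"
    unfolding cumul_def by (rule integral_abs_bound)
  also have "\<dots> \<le> (\<integral>s. \<bar>b s\<bar> \<partial>lebesgue)"
    using assms by (intro integral_mono integrable_abs integrable_indicator_mult) (auto simp: indicator_def)
  finally show ?thesis .
qed

lemma cumul_continuous:
  assumes b: "integrable lebesgue b" shows "continuous_on UNIV (cumul b)"
proof (rule continuous_at_imp_continuous_on, rule ballI)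
  fix t :: real
  have [measurable]: "b \<in> borel_measurable lebesgue" using b by auto
  show "isCont (cumul b) t"
    unfolding continuous_at_sequentially
  proof (intro allI impI)
    fix x assume x: "x \<longlonglongrightarrow> t"
    show "(cumul b \<circ> x) \<longlonglongrightarrow> cumul b t"
      unfolding comp_def cumul_def
    proof (rule integral_dominated_convergence[where w="\<lambda>s. \<bar>b s\<bar>"])
      have "AE s in lebesgue. s \<notin> {t}" by (rule AE_not_in) auto
      then show "AE s in lebesgue. (\<lambda>n. indicator {..x n} s * b s) \<longlonglongrightarrow> indicator {..t} s * b s"
      proof eventually_elim
        fix s assume "s \<notin> {t}"
        then consider "s < t" | "t < s" by fastforce
        then have "\<forall>\<^sub>F n in sequentially. indicator {..x n} s = (indicator {..t} s :: real)"
        proof cases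
          case 1 show ?thesis using order_tendstoD(1)[OF x 1] by eventually_elim (use 1 in \<open>auto simp: indicator_def\<close>)
        next
          case 2 show ?thesis using order_tendstoD(2)[OF x 2] by eventually_elim (use 2 in \<open>auto simp: indicator_def\<close>)
        qed
        then show "(\<lambda>n. indicator {..x n} s * b s) \<longlonglongrightarrow> indicator {..t} s * b s"
          by (intro tendsto_mult tendsto_const tendsto_eventually)
      qed
      show "AE s in lebesgue. norm (indicator {..x n} s * b s) \<le> \<bar>b s\<bar>" for n by (auto simp: indicator_def)
      show "integrable lebesgue (\<lambda>s. \<bar>b s\<bar>)" using b by simp
    qed (intro borel_measurable_times borel_measurable_indicator; simp)+
  qed
qed

lemma cumul_eq_imp_AE_eq:
  assumes b: "integrable lebesgue b" "integrable lebesgue c" and eq: "\<And>t. cumul b t = cumul c t"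
  shows "AE t in lebesgue. b t = c t"
proof -
  have i: "integrable lebesgue (\<lambda>s. b s - c s)" using b by simp
  have "AE t in lebesgue. b t - c t = 0"
  proof (rule integral_zero_on_boxes_imp_zero[OF i])
    fix p q :: real
    show "(\<integral>x. (b x - c x) * indicator (box p q) x \<partial>lebesgue) = 0"
    proof (cases "p \<le> q")
      case True
      have "AE s in lebesgue. s \<notin> {q}" by (rule AE_not_in) auto
      then have "AE x in lebesgue. (b x - c x) * indicator (box p q) x = indicator {p<..q} x * (b x - c x)"
        by eventually_elim (auto simp: indicator_def)
      then have "(\<integral>x. (b x - c x) * indicator (box p q) x \<partial>lebesgue) = (\<integral>x. indicator {p<..q} x * (b x - c x) \<partial>lebesgue)"
        using i by (intro integral_cong_AE borel_measurable_times borel_measurable_indicator) auto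
      also have "\<dots> = (\<integral>x. indicator {p<..q} x * b x - indicator {p<..q} x * c x \<partial>lebesgue)" by (simp add: algebra_simps)
      also have "\<dots> = (\<integral>x. indicator {p<..q} x * b x \<partial>lebesgue) - (\<integral>x. indicator {p<..q} x * c x \<partial>lebesgue)"
        using b by (intro Bochner_Integration.integral_diff integrable_indicator_mult) auto
      also have "\<dots> = 0" using cumul_diff[OF b(1) True] cumul_diff[OF b(2) True] eq by simp
      finally show ?thesis .
    qed simp
  qed
  then show ?thesis by eventually_elim simp
qed

lemma deriv_test_function:
  fixes \<phi> :: "real \<Rightarrow> real"
  assumes "\<phi> \<in> test_functions S"
  shows "(\<phi> has_real_derivative deriv \<phi> t) (at t)" "continuous_on UNIV (deriv \<phi>)"
proof -
  obtain f' where f': "\<And>x. (\<phi> has_derivative f' x) (at x)" "\<And>v. continuous_on UNIV (\<lambda>x. f' x v)"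
    using test_function_C1[OF assms] by blast
  have D: "(\<phi> has_real_derivative f' x 1) (at x)" for x
  proof -
    interpret bounded_linear "f' x" using f'(1) by (rule has_derivative_bounded_linear)
    have "f' x v = f' x 1 * v" for v using scale[of v 1] by (simp add: mult.commute)
    then have "f' x = (*) (f' x 1)" by (rule ext)
    then show ?thesis using f'(1)[of x] by (simp add: has_field_derivative_def)
  qed
  then have eq: "deriv \<phi> = (\<lambda>x. f' x 1)" using DERIV_imp_deriv by blast
  show "(\<phi> has_real_derivative deriv \<phi> t) (at t)" using D by (simp add: eq)
  show "continuous_on UNIV (deriv \<phi>)" using f'(2) by (simp add: eq)
qed

lemma deriv_test_function_supp:
  fixes \<phi> :: "real \<Rightarrow> real"
  assumes "t \<notin> closure {x. \<phi> x \<noteq> 0}" shows "deriv \<phi> t = 0"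
proof -
  have 0: "0 = \<phi> y" if "y \<in> - closure {x. \<phi> x \<noteq> 0}" for y
    using that closure_subset[of "{x. \<phi> x \<noteq> 0}"] by auto
  have "((\<lambda>_. 0) has_real_derivative 0) (at t)" by simp
  then have "(\<phi> has_real_derivative 0) (at t)"
    by (rule has_field_derivative_transform_within_open[of _ _ _ "- closure {x. \<phi> x \<noteq> 0}"])
       (use assms 0 in blast)+
  then show ?thesis by (rule DERIV_imp_deriv)
qed

text \<open>Both sides are iterated integrals of \<open>\<phi>'(t) b(s)\<close> over \<open>s \<le> t\<close>, in the two orders.\<close>

lemma integral_deriv_test_cumul:
  fixes b :: "real \<Rightarrow> real"
  assumes b: "integrable lebesgue b" and \<phi>: "\<phi> \<in> test_functions S"
  shows "(\<integral>t. deriv \<phi> t * cumul b t \<partial>lebesgue) = - (\<integral>s. \<phi> s * b s \<partial>lebesgue)"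
proof -
  obtain b1 where b1[measurable]: "b1 \<in> borel_measurable lborel" and bb: "AE x in lborel. b x = b1 x"
    using completion_ex_borel_measurable_real[of b lborel] b by (auto simp: borel_measurable_integrable)
  have bb': "AE x in lebesgue. b x = b1 x" using bb by (rule AE_completion)
  have [measurable]: "b1 \<in> borel_measurable lebesgue" "b \<in> borel_measurable lebesgue"
    using b by (auto intro: measurable_completion)
  have b1i: "integrable lborel b1"
  proof -
    have "integrable lebesgue b1" by (rule integrable_cong_AE_imp[OF b _ bb']) simp
    then show ?thesis by (simp add: integrable_completion)
  qed
  have cum: "cumul b t = (\<integral>s. indicator {..t} s * b1 s \<partial>lborel)" for t
  proof -
    have "cumul b t = (\<integral>s. indicator {..t} s * b1 s \<partial>lebesgue)" unfolding cumul_def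
      using bb' by (intro integral_cong_AE borel_measurable_times borel_measurable_indicator) auto
    then show ?thesis by (simp add: integral_completion)
  qed
  let ?d = "deriv \<phi>"
  obtain K where K: "compact K" "\<And>x. x \<notin> K \<Longrightarrow> \<phi> x = 0" "K = closure {x. \<phi> x \<noteq> 0}" using test_function_supp[OF \<phi>] by metis
  have dK: "?d t = 0" if "t \<notin> K" for t using deriv_test_function_supp that K(3) by blast
  have [measurable]: "?d \<in> borel_measurable borel" "\<phi> \<in> borel_measurable borel"
    using deriv_test_function(2)[OF \<phi>] test_function_continuous[OF \<phi>] by (auto intro: borel_measurable_continuous_onI)
  have di: "integrable lborel ?d"
    by (rule integrable_continuous_compact_supp[OF deriv_test_function(2)[OF \<phi>] K(1) dK])
  obtain M where M: "\<And>x. x \<in> K \<Longrightarrow> \<bar>x\<bar> \<le> M" using compact_imp_bounded[OF K(1)] by (auto simp: bounded_iff)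
  let ?f = "\<lambda>t s. ?d t * (indicator {..t} s * b1 s)"
  have inner: "(\<integral>t. ?f t s \<partial>lborel) = - \<phi> s * b1 s" for s
  proof -
    \<comment> \<open>\<open>N\<close> lies to the right of the support of \<open>\<phi>\<close>\<close>
    define N where "N = max s (M + 1)"
    have "(\<integral>t. indicator {s..N} t *\<^sub>R ?d t \<partial>lborel) = \<phi> N - \<phi> s"
      by (rule integral_FTC_atLeastAtMost)
         (auto simp: N_def has_real_derivative_iff_has_vector_derivative[symmetric]
           intro!: has_field_derivative_at_within deriv_test_function(1)[OF \<phi>] continuous_on_subset[OF deriv_test_function(2)[OF \<phi>]])
    moreover have "\<phi> N = 0"
    proof (rule K(2))
      show "N \<notin> K" using M[of N] by (auto simp: N_def)
    qed
    moreover have eq: "?f t s = (indicator {s..N} t *\<^sub>R ?d t) * b1 s" for t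
    proof (cases "t \<le> N")
      case True then show ?thesis by (auto simp: indicator_def)
    next
      case False
      then have "t \<notin> K" using M[of t] by (auto simp: N_def)
      then show ?thesis by (simp add: dK)
    qed
    have "(\<integral>t. ?f t s \<partial>lborel) = (\<integral>t. (indicator {s..N} t *\<^sub>R ?d t) * b1 s \<partial>lborel)" by (simp only: eq)
    ultimately show ?thesis by simp
  qed
  have Fub: "integrable (lborel \<Otimes>\<^sub>M lborel) (\<lambda>(t, s). ?f t s)"
  proof (rule lborel_pair.Fubini_integrable)
    have "(\<lambda>(t, s). ?f t s) = (\<lambda>x. ?d (fst x) * ((if snd x \<le> fst x then 1 else 0) * b1 (snd x)))"
      by (auto simp: indicator_def fun_eq_iff)
    then show "(\<lambda>(t, s). ?f t s) \<in> borel_measurable (lborel \<Otimes>\<^sub>M lborel)" by simp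
    have "integrable lborel (\<lambda>t. \<bar>?d t\<bar> * (\<integral>s. indicator {..t} s * \<bar>b1 s\<bar> \<partial>lborel))"
    proof (rule Bochner_Integration.integrable_bound[where f="\<lambda>t. \<bar>?d t\<bar> * (\<integral>s. \<bar>b1 s\<bar> \<partial>lborel)"])
      show "integrable lborel (\<lambda>t. \<bar>?d t\<bar> * (\<integral>s. \<bar>b1 s\<bar> \<partial>lborel))" using di by simp
      have "(\<lambda>t. \<integral>s. indicator {..t} s * \<bar>b1 s\<bar> \<partial>lborel) = (\<lambda>t. \<integral>s. (if s \<le> t then 1 else 0) * \<bar>b1 s\<bar> \<partial>lborel)"
        by (intro ext Bochner_Integration.integral_cong) (auto simp: indicator_def)
      moreover have "(\<lambda>t::real. \<integral>s. (if s \<le> t then 1 else 0) * \<bar>b1 s\<bar> \<partial>lborel) \<in> borel_measurable lborel"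
        by measurable
      ultimately have "(\<lambda>t. \<integral>s. indicator {..t} s * \<bar>b1 s\<bar> \<partial>lborel) \<in> borel_measurable lborel" by (simp only:)
      then show "(\<lambda>t. \<bar>?d t\<bar> * (\<integral>s. indicator {..t} s * \<bar>b1 s\<bar> \<partial>lborel)) \<in> borel_measurable lborel" by measurable
      have "(\<integral>s. indicator {..t} s * \<bar>b1 s\<bar> \<partial>lborel) \<le> (\<integral>s. \<bar>b1 s\<bar> \<partial>lborel)" for t
      proof (rule integral_mono)
        show "integrable lborel (\<lambda>s. indicator {..t} s * \<bar>b1 s\<bar>)"
          using integrable_mult_indicator[of "{..t}" lborel "\<lambda>s. \<bar>b1 s\<bar>"] b1i by simp
      qed (use b1i in \<open>auto simp: indicator_def\<close>)
      moreover have "0 \<le> (\<integral>s. indicator {..t} s * \<bar>b1 s\<bar> \<partial>lborel)" for t by (rule integral_nonneg_AE) auto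
      ultimately show "AE t in lborel. norm (\<bar>?d t\<bar> * (\<integral>s. indicator {..t} s * \<bar>b1 s\<bar> \<partial>lborel)) \<le> norm (\<bar>?d t\<bar> * (\<integral>s. \<bar>b1 s\<bar> \<partial>lborel))"
        by (intro AE_I2) (simp add: abs_mult mult_left_mono)
    qed
    then show "integrable lborel (\<lambda>x. \<integral>y. norm (case (x, y) of (t, s) \<Rightarrow> ?f t s) \<partial>lborel)"
      by (simp add: abs_mult)
    show "AE x in lborel. integrable lborel (\<lambda>y. case (x, y) of (t, s) \<Rightarrow> ?f t s)"
    proof (rule AE_I2)
      fix x
      have "integrable lborel (\<lambda>s. indicator {..x} s * b1 s)"
        using integrable_mult_indicator[of "{..x}" lborel b1] b1i by simp
      then show "integrable lborel (\<lambda>y. case (x, y) of (t, s) \<Rightarrow> ?f t s)" by simp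
    qed
  qed
  have "(\<integral>t. deriv \<phi> t * cumul b t \<partial>lebesgue) = (\<integral>t. deriv \<phi> t * cumul b t \<partial>lborel)"
    using borel_measurable_continuous_onI[OF cumul_continuous[OF b]] by (intro integral_completion) measurable
  also have "\<dots> = (\<integral>t. (\<integral>s. ?f t s \<partial>lborel) \<partial>lborel)" by (simp add: cum)
  also have "\<dots> = (\<integral>s. (\<integral>t. ?f t s \<partial>lborel) \<partial>lborel)" by (rule lborel_pair.Fubini_integral[OF Fub, symmetric])
  also have "\<dots> = (\<integral>s. - \<phi> s * b1 s \<partial>lborel)" by (simp only: inner)
  also have "\<dots> = (\<integral>s. - \<phi> s * b1 s \<partial>lebesgue)" by (rule integral_completion[symmetric]) measurable
  also have "\<dots> = (\<integral>s. - \<phi> s * b s \<partial>lebesgue)"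
  proof (rule integral_cong_AE)
    have [measurable]: "\<phi> \<in> borel_measurable lebesgue" by (rule measurable_completion) simp
    show "(\<lambda>s. - \<phi> s * b1 s) \<in> borel_measurable lebesgue" "(\<lambda>s. - \<phi> s * b s) \<in> borel_measurable lebesgue" by measurable
    show "AE s in lebesgue. - \<phi> s * b1 s = - \<phi> s * b s" using bb' by eventually_elim simp
  qed
  finally show ?thesis by simp
qed

text \<open>The antiderivative that vanishes to the left of the support vanishes also to its right, because the
mean is zero.\<close>

lemma test_function_antiderivative:
  fixes \<psi> :: "real \<Rightarrow> real"
  assumes \<psi>: "\<psi> \<in> test_functions {0<..<T}" and 0: "(\<integral>t. \<psi> t \<partial>lborel) = 0"
  obtains \<phi> where "\<phi> \<in> test_functions {0<..<T}" "\<And>t. deriv \<phi> t = \<psi> t"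
proof -
  obtain K where K: "compact K" "K \<subseteq> {0<..<T}" "\<And>x. x \<notin> K \<Longrightarrow> \<psi> x = 0" using test_function_supp[OF \<psi>] by metis
  note c = test_function_continuous[OF \<psi>]
  have "\<exists>a b. 0 < a \<and> b < T \<and> K \<subseteq> {a..b}"
  proof (cases "K = {}")
    case True then show ?thesis by (rule_tac exI[of _ 1], rule_tac exI[of _ "T-1"]) simp
  next
    case False
    obtain a where a: "a \<in> K" "\<And>t. t \<in> K \<Longrightarrow> a \<le> t" using compact_attains_inf[OF K(1) False] by blast
    obtain b where b: "b \<in> K" "\<And>t. t \<in> K \<Longrightarrow> t \<le> b" using compact_attains_sup[OF K(1) False] by blast
    have "0 < a" "b < T" using a(1) b(1) K(2) by auto
    moreover have "K \<subseteq> {a..b}" using a(2) b(2) by auto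
    ultimately show ?thesis by blast
  qed
  then obtain a b where ab: "0 < a" "b < T" "K \<subseteq> {a..b}" by blast
  define \<phi> where "\<phi> t = integral {0..t} \<psi>" for t
  have z: "\<phi> t = 0" if "t < a" for t
  proof -
    have "\<phi> t = integral {0..t} (\<lambda>_. 0)" unfolding \<phi>_def
      by (rule Henstock_Kurzweil_Integration.integral_cong) (use K(3) ab that in force)
    then show ?thesis by simp
  qed
  have D: "(\<phi> has_real_derivative \<psi> t) (at t)" for t
  proof (cases "t < a")
    case True
    have "((\<lambda>_. 0) has_real_derivative 0) (at t)" by simp
    then have "(\<phi> has_real_derivative 0) (at t)"
      by (rule has_field_derivative_transform_within_open[of _ _ _ "{..<a}"]) (use True z in auto)
    moreover have "\<psi> t = 0" using K(3) ab True by force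
    ultimately show ?thesis by simp
  next
    case False
    then have t: "t \<in> {0<..<t+1}" using ab by auto
    have "((\<lambda>u. integral {0..u} \<psi>) has_vector_derivative \<psi> t) (at t within {0..t+1})"
      using t by (intro integral_has_vector_derivative continuous_on_subset[OF c]) auto
    then show ?thesis using t at_within_interior[of t "{0..t+1}"]
      by (simp add: \<phi>_def[abs_def] has_real_derivative_iff_has_vector_derivative interior_atLeastAtMost_real)
  qed
  have z2: "\<phi> t = 0" if "b < t" for t
  proof (cases "t < a")
    case False
    have "\<phi> t = integral {0..t} \<psi>" by (simp add: \<phi>_def)
    also have "\<dots> = (\<integral>x. indicator {0..t} x *\<^sub>R \<psi> x \<partial>lborel)"
    proof -
      have "set_integrable lborel {0..t} \<psi>" unfolding set_integrable_def
        by (intro borel_integrable_compact) (auto intro: continuous_on_subset[OF c])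
      from set_borel_integral_eq_integral(2)[OF this] show ?thesis by (simp add: set_lebesgue_integral_def)
    qed
    also have "\<dots> = (\<integral>x. \<psi> x \<partial>lborel)"
    proof (rule Bochner_Integration.integral_cong)
      fix x show "indicator {0..t} x *\<^sub>R \<psi> x = \<psi> x"
      proof (cases "x \<in> {0..t}")
        case False
        then have "x \<notin> {a..b}" using ab that by auto
        then have "\<psi> x = 0" using K(3) ab(3) by blast
        then show ?thesis by simp
      qed simp
    qed simp
    finally show ?thesis using 0 by simp
  qed (use z in auto)
  have "closure {x. \<phi> x \<noteq> 0} \<subseteq> {a..b}"
  proof (rule closure_minimal)
    show "{x. \<phi> x \<noteq> 0} \<subseteq> {a..b}" using z z2 by force
  qed simp
  then have S: "compact (closure {x. \<phi> x \<noteq> 0})" "closure {x. \<phi> x \<noteq> 0} \<subseteq> {0<..<T}"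
    using ab by (meson bounded_closed_interval bounded_subset closed_closure compact_eq_bounded_closed, auto)
  have "C_on (Suc k) UNIV \<phi>" for k
  proof (rule C_on_SucI[where f'="\<lambda>t v. \<psi> t * v"])
    show "(\<phi> has_derivative (\<lambda>v. \<psi> x * v)) (at x)" for x using D[of x] by (simp add: has_field_derivative_def)
    show "C_on k UNIV (\<lambda>x. \<psi> x * v)" for v
      using \<psi> unfolding test_functions_def by (intro C_on_mult C_on_const) blast
  qed
  then have "C_on k UNIV \<phi>" for k using C_on_Suc_imp by blast
  with S have "\<phi> \<in> test_functions {0<..<T}" unfolding test_functions_def by blast
  moreover have "deriv \<phi> t = \<psi> t" for t using D by (rule DERIV_imp_deriv)
  ultimately show thesis using that by blast
qed

text \<open>Put \<open>A = a - cumul b\<close>; then \<open>A\<close> is orthogonal to all derivatives of test functions, that is, to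
all test functions of mean zero. Subtracting the right multiple of one fixed bump makes the mean
of an arbitrary test function zero, so \<open>A\<close> minus a constant is orthogonal to all test functions.\<close>

lemma du_Bois_Reymond:
  fixes a b :: "real \<Rightarrow> real"
  assumes T: "0 < T" and a: "integrable (lebesgue_on {0<..<T}) a" and b: "integrable lebesgue b"
    and eq: "\<And>\<phi>. \<phi> \<in> test_functions {0<..<T} \<Longrightarrow>
      (\<integral>t. deriv \<phi> t * a t \<partial>lebesgue_on {0<..<T}) = - (\<integral>t. \<phi> t * b t \<partial>lebesgue)"
  obtains c where "AE t in lebesgue_on {0<..<T}. a t = c + cumul b t"
proof -
  let ?I = "{0<..<T}"
  let ?M = "lebesgue_on ?I"
  have Ci: "integrable ?M (cumul b)"
  proof -
    have "integrable lborel (\<lambda>x. indicator {0..T} x *\<^sub>R cumul b x)"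
      by (intro borel_integrable_compact continuous_on_subset[OF cumul_continuous[OF b]]) auto
    then have "integrable lebesgue (\<lambda>x. indicator {0..T} x *\<^sub>R cumul b x)"
      using borel_measurable_continuous_onI[OF cumul_continuous[OF b]] by (subst integrable_completion) measurable
    from integrable_mult_indicator[OF _ this, of ?I]
    have "integrable lebesgue (\<lambda>x. indicator ?I x *\<^sub>R indicator {0..T} x *\<^sub>R cumul b x)" by simp
    moreover have "(\<lambda>x. indicator ?I x *\<^sub>R indicator {0..T} x *\<^sub>R cumul b x) = (\<lambda>x. indicator ?I x *\<^sub>R cumul b x)"
      by (auto simp: indicator_def fun_eq_iff)
    ultimately show ?thesis by (simp add: lebesgue_on_integrable_iff)
  qed
  define A where "A t = a t - cumul b t" for t
  have Ai: "integrable ?M A" unfolding A_def[abs_def] using a Ci by simp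
  have mult: "integrable ?M (\<lambda>t. h t * k t)" if k: "integrable ?M k" and h: "continuous_on UNIV h" "bounded (range h)" for h k :: "real \<Rightarrow> real"
  proof -
    obtain B where B: "\<And>t. \<bar>h t\<bar> \<le> B" using h(2) by (auto simp: bounded_iff)
    show ?thesis
    proof (rule Bochner_Integration.integrable_bound[where f="\<lambda>t. B * k t"])
      show "(\<lambda>t. h t * k t) \<in> borel_measurable ?M"
        using k test_function_measurable_lebesgue_on[OF h(1)] by (intro borel_measurable_times) auto
      have "\<bar>h t\<bar> * \<bar>k t\<bar> \<le> \<bar>B\<bar> * \<bar>k t\<bar>" for t using B[of t] by (intro mult_right_mono) auto
      then show "AE t in ?M. norm (h t * k t) \<le> norm (B * k t)" by (simp add: abs_mult)
    qed (use k in simp)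
  qed
  have bdd: "bounded (range h)" if "continuous_on UNIV h" "compact K" "\<And>x. x \<notin> K \<Longrightarrow> h x = 0" for h :: "real \<Rightarrow> real" and K
  proof -
    have "bounded (insert 0 (h ` K))" using compact_imp_bounded[OF compact_continuous_image[OF continuous_on_subset[OF that(1)] that(2)]] by simp
    moreover have "range h \<subseteq> insert 0 (h ` K)" using that(3) by blast
    ultimately show ?thesis by (rule bounded_subset)
  qed
  have testb: "continuous_on UNIV \<phi>" "bounded (range \<phi>)" "integrable lborel \<phi>"
    "continuous_on UNIV (deriv \<phi>)" "bounded (range (deriv \<phi>))" "\<And>t. t \<notin> ?I \<Longrightarrow> deriv \<phi> t = 0" if \<phi>: "\<phi> \<in> test_functions ?I" for \<phi>
  proof -
    obtain K where K: "compact K" "K \<subseteq> ?I" "\<And>x. x \<notin> K \<Longrightarrow> \<phi> x = 0" "K = closure {x. \<phi> x \<noteq> 0}" using test_function_supp[OF \<phi>] by metis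
    have dK: "deriv \<phi> t = 0" if "t \<notin> K" for t using deriv_test_function_supp that K(4) by blast
    show c: "continuous_on UNIV \<phi>" by (rule test_function_continuous[OF \<phi>])
    show "bounded (range \<phi>)" by (rule bdd[OF c K(1,3)])
    show "integrable lborel \<phi>" by (rule integrable_continuous_compact_supp[OF c K(1,3)])
    show c': "continuous_on UNIV (deriv \<phi>)" by (rule deriv_test_function[OF \<phi>])
    show "bounded (range (deriv \<phi>))" by (rule bdd[OF c' K(1) dK])
    show "deriv \<phi> t = 0" if "t \<notin> ?I" for t using dK that K(2) by blast
  qed
  have zero: "(\<integral>t. deriv \<phi> t * A t \<partial>?M) = 0" if \<phi>: "\<phi> \<in> test_functions ?I" for \<phi>
  proof -
    note tb = testb[OF \<phi>]
    have "(\<integral>t. deriv \<phi> t * A t \<partial>?M) = (\<integral>t. deriv \<phi> t * a t - deriv \<phi> t * cumul b t \<partial>?M)"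
      by (simp add: A_def algebra_simps)
    also have "\<dots> = (\<integral>t. deriv \<phi> t * a t \<partial>?M) - (\<integral>t. deriv \<phi> t * cumul b t \<partial>?M)"
      by (intro Bochner_Integration.integral_diff mult a Ci tb)
    also have "(\<integral>t. deriv \<phi> t * cumul b t \<partial>?M) = (\<integral>t. indicator ?I t *\<^sub>R (deriv \<phi> t * cumul b t) \<partial>lebesgue)"
      by (simp add: integral_restrict_space)
    also have "\<dots> = (\<integral>t. deriv \<phi> t * cumul b t \<partial>lebesgue)"
    proof (rule Bochner_Integration.integral_cong)
      fix t show "indicator ?I t *\<^sub>R (deriv \<phi> t * cumul b t) = deriv \<phi> t * cumul b t"
        using tb(6)[of t] by (cases "t \<in> ?I") auto
    qed simp
    also have "\<dots> = - (\<integral>s. \<phi> s * b s \<partial>lebesgue)" by (rule integral_deriv_test_cumul[OF b \<phi>])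
    finally show ?thesis using eq[OF \<phi>] by simp
  qed
  \<comment> \<open>the fixed bump that corrects the mean\<close>
  define \<eta>0 where "\<eta>0 = box_bump 0 (T/4) (3*T/4)"
  have e0: "\<eta>0 \<in> test_functions ?I" unfolding \<eta>0_def using T by (intro box_bump_test) auto
  define m where "m = (\<integral>t. \<eta>0 t \<partial>lborel)"
  have m: "m > 0"
  proof -
    have "m \<noteq> 0"
    proof
      assume "m = 0"
      have nn: "AE t in lborel. 0 \<le> \<eta>0 t" by (simp add: \<eta>0_def box_bump_bounds)
      from integral_nonneg_eq_0_iff_AE[OF testb(3)[OF e0] nn] \<open>m = 0\<close>
      have "AE t in lborel. \<eta>0 t = 0" by (simp add: m_def)
      then have "AE t in lborel. t \<notin> box (T/4) (3*T/4)"
        unfolding \<eta>0_def by (rule eventually_mono) (use box_bump_nonzero[of 0 "T/4" "3*T/4"] in blast)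
      then have "negligible (box (T/4) (3*T/4))"
        unfolding negligible_iff_null_sets
        by (intro null_sets_completionI AE_iff_null_sets[THEN iffD2]) (simp_all only: sets_lborel borel_open open_box)
      then show False using open_not_negligible[OF open_box, of "T/4" "3*T/4"] T by (auto simp: box_eq_empty)
    qed
    moreover have "m \<ge> 0" unfolding m_def \<eta>0_def by (intro integral_nonneg_AE AE_I2 box_bump_bounds)
    ultimately show ?thesis by simp
  qed
  define c where "c = (\<integral>t. \<eta>0 t * A t \<partial>?M) / m"
  have "AE t in ?M. A t - c = 0"
  proof (rule fundamental_lemma_calculus_of_variations)
    show "open ?I" by simp
    have fin: "finite_measure ?M" by (rule finite_measure_lebesgue_on) (use lmeasurable_box[of 0 T] in simp)
    show Aci: "integrable ?M (\<lambda>t. A t - c)" by (rule Bochner_Integration.integrable_diff[OF Ai finite_measure.integrable_const[OF fin]])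
    fix \<psi> assume \<psi>: "\<psi> \<in> test_functions ?I"
    define j where "j = (\<integral>t. \<psi> t \<partial>lborel)"
    \<comment> \<open>written so as to be an instance of the closure of test functions under scaled differences\<close>
    define \<zeta> where "\<zeta> t = 1 * (\<psi> t - (j / m) * (\<eta>0 t - 0))" for t
    have zt: "\<zeta> \<in> test_functions ?I" unfolding \<zeta>_def[abs_def]
      by (intro test_functions_scaled_diff \<psi> e0 zero_test_function)
    have z0: "(\<integral>t. \<zeta> t \<partial>lborel) = 0"
      using testb(3)[OF \<psi>] testb(3)[OF e0] m unfolding \<zeta>_def by (simp add: j_def[symmetric] m_def[symmetric])
    obtain \<phi> where \<phi>: "\<phi> \<in> test_functions ?I" "\<And>t. deriv \<phi> t = \<zeta> t"
      using test_function_antiderivative[OF zt z0] by blast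
    have 1: "(\<integral>t. \<psi> t * A t \<partial>?M) - (j / m) * (\<integral>t. \<eta>0 t * A t \<partial>?M) = 0"
      using zero[OF \<phi>(1)] mult[OF Ai testb(1,2)[OF \<psi>]] mult[OF Ai testb(1,2)[OF e0]]
      by (simp add: \<phi>(2) \<zeta>_def left_diff_distrib mult.assoc)
    obtain K where K: "compact K" "K \<subseteq> ?I" "\<And>x. x \<notin> K \<Longrightarrow> \<psi> x = 0" using test_function_supp[OF \<psi>] by metis
    have "(\<integral>t. \<psi> t \<partial>?M) = j"
      unfolding j_def
    proof (rule integral_lebesgue_on_supp)
      show "\<psi> x = 0" if "x \<notin> ?I" for x using K(2,3) that by blast
    qed (use testb[OF \<psi>] in simp_all)
    then have "(\<integral>t. c * \<psi> t \<partial>?M) = (j / m) * (\<integral>t. \<eta>0 t * A t \<partial>?M)" by (simp add: c_def)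
    moreover have "integrable ?M (\<lambda>t. c * \<psi> t)"
      using mult[OF finite_measure.integrable_const[OF fin, of c] testb(1,2)[OF \<psi>]] by (simp add: mult.commute)
    moreover have "(\<integral>t. (A t - c) * \<psi> t \<partial>?M) = (\<integral>t. \<psi> t * A t - c * \<psi> t \<partial>?M)" by (simp add: algebra_simps)
    ultimately show "(\<integral>t. (A t - c) * \<psi> t \<partial>?M) = 0"
      using 1 mult[OF Ai testb(1,2)[OF \<psi>]] by simp
  qed
  then have "AE t in ?M. a t = c + cumul b t" by eventually_elim (simp add: A_def)
  then show thesis by (rule that)
qed

section \<open>Functions of time with values in a space of square-integrable functions\<close>

lemma simple_into_in: "simple_into I X s \<Longrightarrow> t \<in> I \<Longrightarrow> s t \<in> elems X"
  by (auto simp: simple_into_def)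

text \<open>Two simple functions together take finitely many values, each pair of values on a measurable set.\<close>

lemma simple_into_measurable2:
  assumes "simple_into I X s" "simple_into I Y s'" "I \<in> sets lebesgue"
  shows "(\<lambda>t. H (s t) (s' t) :: real) \<in> borel_measurable (lebesgue_on I)"
proof -
  let ?M = "lebesgue_on I"
  have fin: "finite (s ` I \<times> s' ` I)" using assms by (simp add: simple_into_def)
  have sets: "{t \<in> I. s t = y \<and> s' t = y'} \<in> sets ?M" for y y'
  proof -
    have "{t \<in> I. s t = y \<and> s' t = y'} = {t \<in> I. s t = y} \<inter> {t \<in> I. s' t = y'}" by auto
    then show ?thesis using assms by (auto simp: sets_restrict_space_iff simple_into_def)
  qed
  have "(\<lambda>t. (s t, s' t)) \<in> measurable ?M (count_space (s ` I \<times> s' ` I))"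
    unfolding measurable_count_space_eq2[OF fin]
  proof (intro conjI ballI)
    fix a assume "a \<in> s ` I \<times> s' ` I"
    have "(\<lambda>t. (s t, s' t)) -` {a} \<inter> space ?M = {t \<in> I. s t = fst a \<and> s' t = snd a}"
      by (auto simp: space_restrict_space)
    then show "(\<lambda>t. (s t, s' t)) -` {a} \<inter> space ?M \<in> sets ?M" using sets by simp
  qed (auto simp: space_restrict_space)
  from measurable_compose[OF this, of "\<lambda>z. H (fst z) (snd z)" borel] show ?thesis by simp
qed

lemma borel_measurable_AE_limit:
  fixes F :: "nat \<Rightarrow> real \<Rightarrow> real"
  assumes I: "I \<in> sets lebesgue" and F: "\<And>n. F n \<in> borel_measurable (lebesgue_on I)"
    and lim: "AE t in lebesgue_on I. (\<lambda>n. F n t) \<longlonglongrightarrow> G t"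
  shows "G \<in> borel_measurable (lebesgue_on I)"
proof (rule borel_measurable_AE_lebesgue_on[OF I])
  show "(\<lambda>t. lim (\<lambda>n. F n t)) \<in> borel_measurable (lebesgue_on I)"
    by (intro borel_measurable_lim_metric F)
  show "AE t in lebesgue_on I. lim (\<lambda>n. F n t) = G t" using lim by eventually_elim (rule limI)
qed

lemma strongly_measurableE:
  fixes u :: "real \<Rightarrow> real^2 \<Rightarrow> 'b::euclidean_space"
  assumes "strongly_measurable I (L2_space W) u"
  obtains s where "\<And>n::nat. simple_into I (L2_space W) (s n)"
    "AE t in lebesgue_on I. (\<lambda>n. dst W (s n t) (u t)) \<longlonglongrightarrow> 0"
  using assms unfolding strongly_measurable_def fdist_L2 by blast

lemma strongly_measurable_ip:
  fixes u :: "real \<Rightarrow> real^2 \<Rightarrow> 'b::euclidean_space"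
  assumes I: "I \<in> sets lebesgue" and u: "strongly_measurable I (L2_space W) u"
    and L: "AE t in lebesgue_on I. u t \<in> L2 W" and g: "g \<in> L2 W"
  shows "(\<lambda>t. ip W (u t) g) \<in> borel_measurable (lebesgue_on I)"
proof -
  obtain s where s: "\<And>n::nat. simple_into I (L2_space W) (s n)"
    "AE t in lebesgue_on I. (\<lambda>n. dst W (s n t) (u t)) \<longlonglongrightarrow> 0"
    using strongly_measurableE[OF u] by blast
  show ?thesis
  proof (rule borel_measurable_AE_limit[OF I])
    show "(\<lambda>t. ip W (s n t) g) \<in> borel_measurable (lebesgue_on I)" for n
      by (rule simple_into_measurable2[OF s(1) s(1) I, where H="\<lambda>y y'. ip W y g"])
    show "AE t in lebesgue_on I. (\<lambda>n. ip W (s n t) g) \<longlonglongrightarrow> ip W (u t) g"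
      using s(2) L AE_space
    proof eventually_elim
      fix t assume "(\<lambda>n. dst W (s n t) (u t)) \<longlonglongrightarrow> 0" "u t \<in> L2 W" "t \<in> space (lebesgue_on I)"
      then show "(\<lambda>n. ip W (s n t) g) \<longlonglongrightarrow> ip W (u t) g"
        by (intro tendsto_ip g) (simp_all add: simple_into_in[OF s(1)] space_restrict_space)
    qed
  qed
qed

lemma strongly_measurable_nrm:
  fixes u :: "real \<Rightarrow> real^2 \<Rightarrow> 'b::euclidean_space"
  assumes I: "I \<in> sets lebesgue" and u: "strongly_measurable I (L2_space W) u"
    and L: "AE t in lebesgue_on I. u t \<in> L2 W"
    and s': "simple_into I (L2_space W) s'"
  shows "(\<lambda>t. dst W (s' t) (u t)) \<in> borel_measurable (lebesgue_on I)"
    and "(\<lambda>t. nrm W (u t)) \<in> borel_measurable (lebesgue_on I)"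
proof -
  obtain s where s: "\<And>n::nat. simple_into I (L2_space W) (s n)"
    "AE t in lebesgue_on I. (\<lambda>n. dst W (s n t) (u t)) \<longlonglongrightarrow> 0"
    using strongly_measurableE[OF u] by blast
  show "(\<lambda>t. dst W (s' t) (u t)) \<in> borel_measurable (lebesgue_on I)"
  proof (rule borel_measurable_AE_limit[OF I])
    show "(\<lambda>t. dst W (s' t) (s n t)) \<in> borel_measurable (lebesgue_on I)" for n
      by (rule simple_into_measurable2[OF s' s(1) I, where H="\<lambda>y y'. dst W y y'"])
    show "AE t in lebesgue_on I. (\<lambda>n. dst W (s' t) (s n t)) \<longlonglongrightarrow> dst W (s' t) (u t)"
      using s(2) L AE_space
    proof eventually_elim
      fix t assume lim: "(\<lambda>n. dst W (s n t) (u t)) \<longlonglongrightarrow> 0" and ut: "u t \<in> L2 W" and "t \<in> space (lebesgue_on I)"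
      then have tI: "t \<in> I" by (simp add: space_restrict_space)
      have "nrm W (\<lambda>x. (s' t x - s n t x) - (s' t x - u t x)) = dst W (s n t) (u t)" for n
        by (subst nrm_minus_commute) simp
      with lim show "(\<lambda>n. dst W (s' t) (s n t)) \<longlonglongrightarrow> dst W (s' t) (u t)"
        by (intro tendsto_nrm L2_diff simple_into_in[OF s(1)] simple_into_in[OF s'] tI ut) simp
    qed
  qed
  show "(\<lambda>t. nrm W (u t)) \<in> borel_measurable (lebesgue_on I)"
  proof (rule borel_measurable_AE_limit[OF I])
    show "(\<lambda>t. nrm W (s n t)) \<in> borel_measurable (lebesgue_on I)" for n
      by (rule simple_into_measurable2[OF s(1) s(1) I, where H="\<lambda>y y'. nrm W y"])
    show "AE t in lebesgue_on I. (\<lambda>n. nrm W (s n t)) \<longlonglongrightarrow> nrm W (u t)"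
      using s(2) L AE_space
    proof eventually_elim
      fix t assume "(\<lambda>n. dst W (s n t) (u t)) \<longlonglongrightarrow> 0" "u t \<in> L2 W" "t \<in> space (lebesgue_on I)"
      then show "(\<lambda>n. nrm W (s n t)) \<longlonglongrightarrow> nrm W (u t)"
        by (intro tendsto_nrm) (simp_all add: simple_into_in[OF s(1)] space_restrict_space)
    qed
  qed
qed

text \<open>Convergence in the mean gives convergence almost everywhere along a subsequence.\<close>

lemma has_time_integral_strongly_measurable:
  fixes u :: "real \<Rightarrow> real^2 \<Rightarrow> 'b::euclidean_space"
  assumes u: "has_time_integral I (L2_space W) u y"
  shows "strongly_measurable I (L2_space W) u"
proof -
  obtain s where s: "\<And>n::nat. simple_into I (L2_space W) (s n)"
    "\<And>n. integrable (lebesgue_on I) (\<lambda>t. fdist (L2_space W) (s n t) (u t))"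
    "(\<lambda>n. \<integral>t. fdist (L2_space W) (s n t) (u t) \<partial>lebesgue_on I) \<longlonglongrightarrow> 0"
    using u unfolding has_time_integral_def by blast
  have "(\<lambda>n. \<integral>t. norm (fdist (L2_space W) (s n t) (u t)) \<partial>lebesgue_on I) \<longlonglongrightarrow> 0"
    using s(3) by (simp add: fdist_L2)
  from tendsto_L1_AE_subseq[OF s(2) this]
  obtain r :: "nat \<Rightarrow> nat" where "AE t in lebesgue_on I. (\<lambda>n. fdist (L2_space W) (s (r n) t) (u t)) \<longlonglongrightarrow> 0" by blast
  with s(1) show ?thesis unfolding strongly_measurable_def by (intro exI[of _ "\<lambda>n. s (r n)"]) blast
qed

lemma simple_integral_ip:
  fixes s :: "real \<Rightarrow> real^2 \<Rightarrow> 'b::euclidean_space"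
  assumes I: "I \<in> lmeasurable" and s: "simple_into I (L2_space W) s" and g: "g \<in> L2 W"
  shows "integrable (lebesgue_on I) (\<lambda>t. ip W (s t) g)"
    and "(\<integral>t. ip W (s t) g \<partial>lebesgue_on I) = ip W (simple_integral I s) g"
    and "simple_integral I s \<in> L2 W"
proof -
  have fin: "finite (s ` I)" and mem: "s ` I \<subseteq> L2 W" and sets: "\<And>y. {t \<in> I. s t = y} \<in> sets lebesgue"
    using s by (auto simp: simple_into_def)
  have Is: "I \<in> sets lebesgue" using I by (simp add: fmeasurableD)
  have meas: "{t \<in> I. s t = y} \<in> lmeasurable" for y
    by (rule fmeasurableI2[OF I _ sets]) auto
  have eq: "indicator I t *\<^sub>R ip W (s t) g = (\<Sum>y\<in>s ` I. indicator {t \<in> I. s t = y} t * ip W y g)" for t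
  proof (cases "t \<in> I")
    case True
    have "(\<Sum>y\<in>s ` I. indicator {t \<in> I. s t = y} t * ip W y g) = (\<Sum>y\<in>s ` I. if y = s t then ip W y g else 0)"
      by (rule sum.cong) (auto simp: indicator_def True)
    then show ?thesis using fin True by (simp add: sum.delta)
  qed simp
  have i: "integrable lebesgue (\<lambda>t. indicator {t \<in> I. s t = y} t * ip W y g)" for y
    using meas[of y] lmeasurable_iff_integrable by (intro integrable_mult_left) blast
  show "integrable (lebesgue_on I) (\<lambda>t. ip W (s t) g)"
    unfolding lebesgue_on_integrable_iff[OF Is] eq by (intro Bochner_Integration.integrable_sum i)
  have scl: "(\<lambda>x. measure lebesgue {t \<in> I. s t = y} *\<^sub>R y x) \<in> L2 W" if "y \<in> s ` I" for y
    using mem that by (intro L2_scale) blast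
  show "simple_integral I s \<in> L2 W"
    unfolding simple_integral_def[abs_def] by (rule L2_sum) (rule scl)
  have sumip: "ip W (\<lambda>x. \<Sum>y\<in>A. measure lebesgue {t \<in> I. s t = y} *\<^sub>R y x) g = (\<Sum>y\<in>A. measure lebesgue {t \<in> I. s t = y} * ip W y g)"
    if "A \<subseteq> s ` I" "finite A" for A
    using that(2,1)
  proof (induction A rule: finite_induct)
    case (insert y A)
    have "ip W (\<lambda>x. measure lebesgue {t \<in> I. s t = y} *\<^sub>R y x + (\<Sum>y\<in>A. measure lebesgue {t \<in> I. s t = y} *\<^sub>R y x)) g
      = ip W (\<lambda>x. measure lebesgue {t \<in> I. s t = y} *\<^sub>R y x) g + ip W (\<lambda>x. \<Sum>y\<in>A. measure lebesgue {t \<in> I. s t = y} *\<^sub>R y x) g"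
      using insert.prems by (intro ip_add_left scl L2_sum g) auto
    then show ?case using insert by (simp add: ip_scale_left)
  qed simp
  have "(\<integral>t. ip W (s t) g \<partial>lebesgue_on I) = (\<integral>t. indicator I t *\<^sub>R ip W (s t) g \<partial>lebesgue)"
    using Is by (simp add: integral_restrict_space)
  also have "\<dots> = (\<Sum>y\<in>s ` I. \<integral>t. indicator {t \<in> I. s t = y} t * ip W y g \<partial>lebesgue)"
    unfolding eq by (intro Bochner_Integration.integral_sum i)
  also have "\<dots> = (\<Sum>y\<in>s ` I. measure lebesgue {t \<in> I. s t = y} * ip W y g)"
    using meas lmeasurable_iff_integrable by (intro sum.cong refl) (simp add: integral_mult_left)
  also have "\<dots> = ip W (simple_integral I s) g"
    unfolding simple_integral_def[abs_def] by (rule sumip[OF subset_refl fin, symmetric])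
  finally show "(\<integral>t. ip W (s t) g \<partial>lebesgue_on I) = ip W (simple_integral I s) g" .
qed

text \<open>Both the integral and the inner product with \<open>g\<close> are continuous along the approximating simple
functions, for which the identity is a finite sum.\<close>

lemma has_time_integral_ip:
  fixes u :: "real \<Rightarrow> real^2 \<Rightarrow> 'b::euclidean_space"
  assumes I: "I \<in> lmeasurable" and u: "has_time_integral I (L2_space W) u y" and g: "g \<in> L2 W"
  shows "(\<integral>t. ip W (u t) g \<partial>lebesgue_on I) = ip W y g"
proof -
  have Is: "I \<in> sets lebesgue" using I by (simp add: fmeasurableD)
  obtain s where y: "y \<in> L2 W" and uL: "AE t in lebesgue_on I. u t \<in> L2 W"
    and s: "\<And>n::nat. simple_into I (L2_space W) (s n)"
    "\<And>n. integrable (lebesgue_on I) (\<lambda>t. dst W (s n t) (u t))"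
    "(\<lambda>n. \<integral>t. dst W (s n t) (u t) \<partial>lebesgue_on I) \<longlonglongrightarrow> 0"
    "(\<lambda>n. dst W (simple_integral I (s n)) y) \<longlonglongrightarrow> 0"
    using u unfolding has_time_integral_def fdist_L2 by blast
  note si = simple_integral_ip[OF I s(1)]
  have m: "(\<lambda>t. ip W (u t) g) \<in> borel_measurable (lebesgue_on I)"
    by (rule strongly_measurable_ip[OF Is has_time_integral_strongly_measurable[OF u] uL g])
  have bd: "AE t in lebesgue_on I. \<bar>ip W (s n t) g - ip W (u t) g\<bar> \<le> dst W (s n t) (u t) * nrm W g" for n
    using uL AE_space
  proof eventually_elim
    fix t assume ut: "u t \<in> L2 W" and "t \<in> space (lebesgue_on I)"
    then have st: "s n t \<in> L2 W" using simple_into_in[OF s(1)] by (simp add: space_restrict_space)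
    show "\<bar>ip W (s n t) g - ip W (u t) g\<bar> \<le> dst W (s n t) (u t) * nrm W g"
      using ip_Cauchy_Schwarz[OF L2_diff[OF st ut] g] ip_diff_left[OF st ut g] by simp
  qed
  have id: "integrable (lebesgue_on I) (\<lambda>t. ip W (s n t) g - ip W (u t) g)" for n
  proof (rule Bochner_Integration.integrable_bound)
    show "integrable (lebesgue_on I) (\<lambda>t. dst W (s n t) (u t) * nrm W g)" using s(2) by simp
    show "(\<lambda>t. ip W (s n t) g - ip W (u t) g) \<in> borel_measurable (lebesgue_on I)"
      using m si(1)[OF g] by (intro borel_measurable_diff) auto
    show "AE t in lebesgue_on I. norm (ip W (s n t) g - ip W (u t) g) \<le> norm (dst W (s n t) (u t) * nrm W g)"
      using bd[of n] by simp
  qed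
  have iu: "integrable (lebesgue_on I) (\<lambda>t. ip W (u t) g)"
    using Bochner_Integration.integrable_diff[OF si(1)[OF g] id[of 0], of 0] by simp
  have le: "\<bar>ip W (simple_integral I (s n)) g - (\<integral>t. ip W (u t) g \<partial>lebesgue_on I)\<bar> \<le> (\<integral>t. dst W (s n t) (u t) \<partial>lebesgue_on I) * nrm W g" for n
  proof -
    have "ip W (simple_integral I (s n)) g - (\<integral>t. ip W (u t) g \<partial>lebesgue_on I) = (\<integral>t. ip W (s n t) g - ip W (u t) g \<partial>lebesgue_on I)"
      using si(1)[OF g, of n] iu by (simp add: si(2)[OF g, symmetric])
    also have "\<bar>\<dots>\<bar> \<le> (\<integral>t. \<bar>ip W (s n t) g - ip W (u t) g\<bar> \<partial>lebesgue_on I)" by (rule integral_abs_bound)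
    also have "\<dots> \<le> (\<integral>t. dst W (s n t) (u t) * nrm W g \<partial>lebesgue_on I)"
      using id[of n] s(2)[of n] bd[of n] by (intro integral_mono_AE) auto
    finally show ?thesis by simp
  qed
  have "(\<lambda>n. ip W (simple_integral I (s n)) g) \<longlonglongrightarrow> (\<integral>t. ip W (u t) g \<partial>lebesgue_on I)"
  proof (rule LIM_zero_cancel, rule Lim_null_comparison)
    show "(\<lambda>n. (\<integral>t. dst W (s n t) (u t) \<partial>lebesgue_on I) * nrm W g) \<longlonglongrightarrow> 0"
      using tendsto_mult_right[OF s(3), of "nrm W g"] by simp
  qed (use le in simp)
  moreover have "(\<lambda>n. ip W (simple_integral I (s n)) g) \<longlonglongrightarrow> ip W y g"
    by (rule tendsto_ip[OF si(3) y g s(4)]) (rule g)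
  ultimately show ?thesis by (rule LIMSEQ_unique)
qed

text \<open>Taking inner products with a fixed \<open>g\<close> turns the derivative of a function with values in \<open>L\<^sup>2\<close> into a
scalar weak derivative. From here on functions of time are studied through their inner products.\<close>

lemma is_time_deriv_ip:
  fixes u v :: "real \<Rightarrow> real^2 \<Rightarrow> 'b::euclidean_space"
  assumes I: "I \<in> lmeasurable" and d: "is_time_deriv I (L2_space W) u v" and g: "g \<in> L2 W"
    and \<phi>: "\<phi> \<in> test_functions I"
  shows "(\<integral>t. deriv \<phi> t * ip W (u t) g \<partial>lebesgue_on I) = - (\<integral>t. \<phi> t * ip W (v t) g \<partial>lebesgue_on I)"
proof -
  obtain y where y: "has_time_integral I (L2_space W) (\<lambda>t x. deriv \<phi> t *\<^sub>R u t x) y"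
    "has_time_integral I (L2_space W) (\<lambda>t x. \<phi> t *\<^sub>R v t x) (\<lambda>x. - y x)"
    using d \<phi> unfolding is_time_deriv_def by blast
  have "(\<integral>t. deriv \<phi> t * ip W (u t) g \<partial>lebesgue_on I) = ip W y g"
    using has_time_integral_ip[OF I y(1) g] by (simp add: ip_scale_left)
  moreover have "(\<integral>t. \<phi> t * ip W (v t) g \<partial>lebesgue_on I) = ip W (\<lambda>x. - y x) g"
    using has_time_integral_ip[OF I y(2) g] by (simp add: ip_scale_left)
  ultimately show ?thesis by (simp add: ip_def)
qed

context
  fixes W B :: "(real^2) set"
  assumes WB: "W \<subseteq> B" and Ws: "W \<in> sets lebesgue" and Bs: "B \<in> sets lebesgue"
begin

lemma L2_restrict:
  fixes g :: "real^2 \<Rightarrow> 'b::euclidean_space"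
  assumes "g \<in> L2 B" shows "g \<in> L2 W" "nrm W g \<le> nrm B g"
proof -
  have m: "g \<in> borel_measurable (lebesgue_on W)"
    using L2_measurable[OF assms] WB Ws Bs by (metis measurable_restrict_mono)
  have iB: "integrable lebesgue (\<lambda>x. indicator B x *\<^sub>R (norm (g x))\<^sup>2)"
    using assms Bs by (simp add: L2_iff lebesgue_on_integrable_iff)
  from integrable_mult_indicator[OF Ws this]
  have "integrable lebesgue (\<lambda>x. indicator W x *\<^sub>R indicator B x *\<^sub>R (norm (g x))\<^sup>2)" .
  moreover have "(\<lambda>x. indicator W x *\<^sub>R indicator B x *\<^sub>R (norm (g x))\<^sup>2) = (\<lambda>x. indicator W x *\<^sub>R (norm (g x))\<^sup>2)"
    using WB by (auto simp: indicator_def fun_eq_iff)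
  ultimately have iW: "integrable lebesgue (\<lambda>x. indicator W x *\<^sub>R (norm (g x))\<^sup>2)" by (simp only:)
  then show "g \<in> L2 W" using m Ws by (simp add: L2_iff lebesgue_on_integrable_iff)
  have "(\<integral>x. indicator W x *\<^sub>R (norm (g x))\<^sup>2 \<partial>lebesgue) \<le> (\<integral>x. indicator B x *\<^sub>R (norm (g x))\<^sup>2 \<partial>lebesgue)"
    using iW iB WB by (intro integral_mono) (auto simp: indicator_def)
  then show "nrm W g \<le> nrm B g"
    using Ws Bs unfolding nrm_def' by (simp add: integral_restrict_space)
qed

lemma simple_into_restrict:
  fixes s :: "real \<Rightarrow> real^2 \<Rightarrow> 'b::euclidean_space"
  assumes "simple_into I (L2_space B) s" shows "simple_into I (L2_space W) s"
  using assms L2_restrict(1) unfolding simple_into_def by blast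

lemma nrm_restrict_lim:
  fixes a :: "nat \<Rightarrow> real^2 \<Rightarrow> 'b::euclidean_space"
  assumes "\<And>n. a n \<in> L2 B" "(\<lambda>n. nrm B (a n)) \<longlonglongrightarrow> 0"
  shows "(\<lambda>n. nrm W (a n)) \<longlonglongrightarrow> 0"
  by (rule tendsto_sandwich[OF _ _ tendsto_const assms(2)]) (simp_all add: L2_restrict(2)[OF assms(1)])

lemma strongly_measurable_restrict:
  fixes u :: "real \<Rightarrow> real^2 \<Rightarrow> 'b::euclidean_space"
  assumes u: "strongly_measurable I (L2_space B) u" and L: "AE t in lebesgue_on I. u t \<in> L2 B"
  shows "strongly_measurable I (L2_space W) u"
proof -
  obtain s where s: "\<And>n::nat. simple_into I (L2_space B) (s n)"
    "AE t in lebesgue_on I. (\<lambda>n. dst B (s n t) (u t)) \<longlonglongrightarrow> 0"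
    using strongly_measurableE[OF u] by blast
  have "AE t in lebesgue_on I. (\<lambda>n. dst W (s n t) (u t)) \<longlonglongrightarrow> 0"
    using s(2) L AE_space
  proof eventually_elim
    fix t assume "(\<lambda>n. dst B (s n t) (u t)) \<longlonglongrightarrow> 0" "u t \<in> L2 B" "t \<in> space (lebesgue_on I)"
    then show "(\<lambda>n. dst W (s n t) (u t)) \<longlonglongrightarrow> 0"
      by (intro nrm_restrict_lim L2_diff) (simp_all add: simple_into_in[OF s(1)] space_restrict_space)
  qed
  with simple_into_restrict[OF s(1)] show ?thesis unfolding strongly_measurable_def fdist_L2 by blast
qed

lemma L2_time_restrict:
  fixes u :: "real \<Rightarrow> real^2 \<Rightarrow> 'b::euclidean_space"
  assumes I: "I \<in> sets lebesgue" and u: "u \<in> L2_time I (L2_space B)"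
  shows "u \<in> L2_time I (L2_space W)"
proof -
  have sm: "strongly_measurable I (L2_space B) u" and LB: "AE t in lebesgue_on I. u t \<in> L2 B"
    and i: "integrable (lebesgue_on I) (\<lambda>t. (nrm B (u t))\<^sup>2)"
    using u by (auto simp: L2_time_def)
  note smW = strongly_measurable_restrict[OF sm LB]
  have LW: "AE t in lebesgue_on I. u t \<in> L2 W" using LB by eventually_elim (rule L2_restrict)
  obtain s where s: "\<And>n::nat. simple_into I (L2_space W) (s n)"
    "AE t in lebesgue_on I. (\<lambda>n. dst W (s n t) (u t)) \<longlonglongrightarrow> 0"
    using strongly_measurableE[OF smW] by blast
  have "integrable (lebesgue_on I) (\<lambda>t. (nrm W (u t))\<^sup>2)"
  proof (rule Bochner_Integration.integrable_bound[OF i])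
    show "(\<lambda>t. (nrm W (u t))\<^sup>2) \<in> borel_measurable (lebesgue_on I)"
      using strongly_measurable_nrm(2)[OF I smW LW s(1)[of 0]] by (intro borel_measurable_power)
    show "AE t in lebesgue_on I. norm ((nrm W (u t))\<^sup>2) \<le> norm ((nrm B (u t))\<^sup>2)"
      using LB by eventually_elim (simp add: L2_restrict(2) power_mono)
  qed
  with smW LW show ?thesis by (simp add: L2_time_def)
qed

lemma has_time_integral_restrict:
  fixes u :: "real \<Rightarrow> real^2 \<Rightarrow> 'b::euclidean_space"
  assumes I: "I \<in> lmeasurable" and u: "has_time_integral I (L2_space B) u y"
  shows "has_time_integral I (L2_space W) u y"
proof -
  have Is: "I \<in> sets lebesgue" using I by (simp add: fmeasurableD)
  obtain s where y: "y \<in> L2 B" and uL: "AE t in lebesgue_on I. u t \<in> L2 B"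
    and s: "\<And>n::nat. simple_into I (L2_space B) (s n)"
    "\<And>n. integrable (lebesgue_on I) (\<lambda>t. dst B (s n t) (u t))"
    "(\<lambda>n. \<integral>t. dst B (s n t) (u t) \<partial>lebesgue_on I) \<longlonglongrightarrow> 0"
    "(\<lambda>n. dst B (simple_integral I (s n)) y) \<longlonglongrightarrow> 0"
    using u unfolding has_time_integral_def fdist_L2 by blast
  have sm: "strongly_measurable I (L2_space W) u"
    by (rule strongly_measurable_restrict[OF has_time_integral_strongly_measurable[OF u] uL])
  have uLW: "AE t in lebesgue_on I. u t \<in> L2 W" using uL by eventually_elim (rule L2_restrict)
  note sW = simple_into_restrict[OF s(1)]
  have le: "AE t in lebesgue_on I. dst W (s n t) (u t) \<le> dst B (s n t) (u t)" for n
    using uL AE_space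
    by eventually_elim (intro L2_restrict(2) L2_diff, simp_all add: simple_into_in[OF s(1)] space_restrict_space)
  have i: "integrable (lebesgue_on I) (\<lambda>t. dst W (s n t) (u t))" for n
    by (rule Bochner_Integration.integrable_bound[OF s(2) strongly_measurable_nrm(1)[OF Is sm uLW sW]])
       (use le[of n] in simp)
  have lim: "(\<lambda>n. \<integral>t. dst W (s n t) (u t) \<partial>lebesgue_on I) \<longlonglongrightarrow> 0"
  proof (rule tendsto_sandwich[OF _ _ tendsto_const s(3)]; intro always_eventually allI)
    fix n
    show "0 \<le> (\<integral>t. dst W (s n t) (u t) \<partial>lebesgue_on I)" by (rule integral_nonneg_AE) simp
    show "(\<integral>t. dst W (s n t) (u t) \<partial>lebesgue_on I) \<le> (\<integral>t. dst B (s n t) (u t) \<partial>lebesgue_on I)"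
      by (rule integral_mono_AE[OF i s(2) le])
  qed
  have "(\<lambda>n. dst W (simple_integral I (s n)) y) \<longlonglongrightarrow> 0"
    by (rule nrm_restrict_lim[OF L2_diff[OF simple_integral_ip(3)[OF I s(1) L2_zero] y] s(4)])
  then show ?thesis
    unfolding has_time_integral_def fdist_L2 using L2_restrict(1)[OF y] uLW sW i lim by blast
qed

lemma is_time_deriv_restrict:
  fixes u v :: "real \<Rightarrow> real^2 \<Rightarrow> 'b::euclidean_space"
  assumes "I \<in> lmeasurable" "is_time_deriv I (L2_space B) u v"
  shows "is_time_deriv I (L2_space W) u v"
  using assms has_time_integral_restrict[OF assms(1)] unfolding is_time_deriv_def by blast

end

section \<open>Continuous representatives\<close>

lemma AE_interval_dense:
  fixes T :: real
  assumes T: "0 < T" and P: "AE t in lebesgue_on {0<..<T}. P t"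
  shows "{0..T} \<subseteq> closure {t \<in> {0<..<T}. P t}"
proof -
  let ?E = "{t \<in> {0<..<T}. P t}" and ?I = "{0<..<T::real}"
  have "AE t in lebesgue. t \<in> ?I \<longrightarrow> P t" using P by (simp add: AE_restrict_space_iff)
  then have "{t. \<not> (t \<in> ?I \<longrightarrow> P t)} \<in> null_sets lebesgue"
    by (simp add: completion.AE_iff_null_sets)
  then have neg: "negligible {t. \<not> (t \<in> ?I \<longrightarrow> P t)}" by (simp add: negligible_iff_null_sets)
  have "?I \<subseteq> closure ?E"
  proof (rule ccontr)
    assume "\<not> ?I \<subseteq> closure ?E"
    then have "?I \<inter> - closure ?E \<noteq> {}" by blast
    moreover have "open (?I \<inter> - closure ?E)" by (intro open_Int) auto
    moreover have "negligible (?I \<inter> - closure ?E)"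
      by (rule negligible_subset[OF neg]) (use closure_subset[of ?E] in blast)
    ultimately show False using open_not_negligible by blast
  qed
  then have "closure ?I \<subseteq> closure ?E" by (rule closure_minimal) simp
  then show ?thesis using T by simp
qed

text \<open>Membership in the closure of \<open>G\<close>. It is used with countable \<open>G\<close>: a strongly measurable function has
almost all its values in the closure of the countable set of values of its approximating simple
functions.\<close>

definition approximable :: "(real^2) set \<Rightarrow> (real^2 \<Rightarrow> 'b::real_normed_vector) set \<Rightarrow> (real^2 \<Rightarrow> 'b) \<Rightarrow> bool" where
  "approximable W G g \<longleftrightarrow> (\<forall>e>0. \<exists>h\<in>G. dst W g h < e)"

lemma strongly_measurable_separable:
  fixes u :: "real \<Rightarrow> real^2 \<Rightarrow> 'b::euclidean_space"
  assumes u: "strongly_measurable I (L2_space W) u"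
  obtains G where "countable G" "G \<subseteq> L2 W" "AE t in lebesgue_on I. approximable W G (u t)"
proof -
  obtain s where s: "\<And>n::nat. simple_into I (L2_space W) (s n)"
    "AE t in lebesgue_on I. (\<lambda>n. dst W (s n t) (u t)) \<longlonglongrightarrow> 0"
    using strongly_measurableE[OF u] by blast
  let ?G = "\<Union>n. s n ` I"
  show thesis
  proof (rule that[of ?G])
    have "finite (s n ` I)" for n using s(1)[of n] by (simp add: simple_into_def)
    then show "countable ?G" by (intro countable_UN) (simp_all add: countable_finite)
    show "?G \<subseteq> L2 W" using simple_into_in[OF s(1)] by blast
    show "AE t in lebesgue_on I. approximable W ?G (u t)"
      using s(2) AE_space
    proof eventually_elim
      fix t assume lim: "(\<lambda>n. dst W (s n t) (u t)) \<longlonglongrightarrow> 0" and "t \<in> space (lebesgue_on I)"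
      then have t: "t \<in> I" by (simp add: space_restrict_space)
      show "approximable W ?G (u t)" unfolding approximable_def
      proof (intro allI impI)
        fix e :: real assume "e > 0"
        from LIMSEQ_D[OF lim this] obtain n where "dst W (s n t) (u t) < e" by auto
        then have "dst W (u t) (s n t) < e" by (subst nrm_minus_commute)
        then show "\<exists>h\<in>?G. dst W (u t) h < e" using t by blast
      qed
    qed
  qed
qed

lemma approximable_diff:
  fixes g h :: "real^2 \<Rightarrow> 'b::euclidean_space"
  assumes "approximable W G g" "approximable W H h" "G \<subseteq> L2 W" "H \<subseteq> L2 W" "g \<in> L2 W" "h \<in> L2 W"
  shows "approximable W ((\<lambda>(a, b) x. a x - b x) ` (G \<times> H)) (\<lambda>x. g x - h x)"
  unfolding approximable_def
proof (intro allI impI)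
  fix e :: real assume e: "e > 0"
  obtain a where a: "a \<in> G" "dst W g a < e/2" using assms(1) e unfolding approximable_def by (meson half_gt_zero)
  obtain b where b: "b \<in> H" "dst W h b < e/2" using assms(2) e unfolding approximable_def by (meson half_gt_zero)
  have L: "a \<in> L2 W" "b \<in> L2 W" using a b assms by auto
  have "nrm W (\<lambda>x. (g x - h x) - (a x - b x)) = nrm W (\<lambda>x. (g x - a x) - (h x - b x))"
    by (simp add: algebra_simps)
  also have "\<dots> \<le> dst W g a + dst W h b"
    using assms L by (intro nrm_triangle_diff L2_diff)
  also have "\<dots> < e" using a b by linarith
  finally have "nrm W (\<lambda>x. (g x - h x) - (a x - b x)) < e" .
  then show "\<exists>k\<in>(\<lambda>(a, b) x. a x - b x) ` (G \<times> H). nrm W (\<lambda>x. g x - h x - k x) < e"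
    using a(1) b(1) by (intro bexI[of _ "\<lambda>x. a x - b x"]) auto
qed

text \<open>The norm of \<open>d\<close> can be computed by testing with elements of \<open>G\<close> near \<open>d\<close>. Since \<open>G\<close> may be countable,
an inequality that holds at almost every time for each test function separately yields a bound
of the norm at almost every time.\<close>

lemma approximable_bound:
  fixes d :: "real^2 \<Rightarrow> 'b::euclidean_space"
  assumes d: "d \<in> L2 W" and G: "G \<subseteq> L2 W" "approximable W G d" and m: "0 \<le> m"
    and le: "\<And>g. g \<in> G \<Longrightarrow> ip W d g \<le> m * nrm W g"
  shows "nrm W d \<le> m"
proof -
  have "(nrm W d)\<^sup>2 - nrm W d * m \<le> e" if e: "e > 0" for e
  proof -
    \<comment> \<open>any positive number above \<open>m + \<parallel>d\<parallel>\<close> serves to scale the error\<close>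
    define c where "c = m + nrm W d + 1"
    have c: "c > 0" using m unfolding c_def by (smt (verit) nrm_nonneg)
    obtain g where g: "g \<in> G" "dst W d g < e / c"
      using G(2) e c unfolding approximable_def by (meson divide_pos_pos)
    have gL: "g \<in> L2 W" using g G by blast
    have "(nrm W d)\<^sup>2 = ip W d g + ip W d (\<lambda>x. d x - g x)"
      using d gL by (simp add: nrm_sq ip_diff_right)
    also have "\<dots> \<le> m * nrm W g + nrm W d * dst W d g"
      using le[OF g(1)] ip_Cauchy_Schwarz[OF d L2_diff[OF d gL]] by linarith
    also have "nrm W g \<le> nrm W d + dst W d g"
      using nrm_diff_abs[OF d gL] by linarith
    then have "m * nrm W g \<le> m * (nrm W d + dst W d g)" using m by (rule mult_left_mono)
    finally have "(nrm W d)\<^sup>2 - nrm W d * m \<le> (m + nrm W d) * dst W d g" by (simp add: algebra_simps)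
    also have "\<dots> \<le> c * (e / c)" using g(2) c m by (intro mult_mono) (auto simp: c_def)
    finally show ?thesis using c by simp
  qed
  then have "(nrm W d)\<^sup>2 - nrm W d * m \<le> 0" by (rule field_le_epsilon[of _ 0, simplified])
  then have "nrm W d * (nrm W d - m) \<le> 0" by (simp add: power2_eq_square algebra_simps)
  then show ?thesis using m by (smt (verit) mult_pos_pos nrm_nonneg)
qed

text \<open>Replacing the values outside \<open>L\<^sup>2\<close>, which occur on a null set of times, makes all statements about
\<open>L\<^sup>2\<close> hold at every time; the zero values for other times suit integration from \<open>-\<infinity>\<close>.\<close>

definition zero_ext :: "real \<Rightarrow> (real^2) set \<Rightarrow> (real \<Rightarrow> real^2 \<Rightarrow> 'b::real_normed_vector) \<Rightarrow> real \<Rightarrow> real^2 \<Rightarrow> 'b" where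
  "zero_ext T W v t = (if t \<in> {0<..<T} \<and> v t \<in> L2 W then v t else (\<lambda>_. 0))"

lemma zero_ext_L2[simp]: "zero_ext T W v t \<in> L2 W"
  by (simp add: zero_ext_def)

lemma L2_time_zero_ext:
  fixes v :: "real \<Rightarrow> real^2 \<Rightarrow> 'b::euclidean_space"
  assumes v: "v \<in> L2_time {0<..<T} (L2_space W)"
  shows "AE t in lebesgue. t \<in> {0<..<T} \<longrightarrow> zero_ext T W v t = v t"
    and "integrable lebesgue (\<lambda>t. nrm W (zero_ext T W v t))"
    and "g \<in> L2 W \<Longrightarrow> (\<lambda>t. ip W (zero_ext T W v t) g) \<in> borel_measurable lebesgue"
    and "g \<in> L2 W \<Longrightarrow> integrable lebesgue (\<lambda>t. ip W (zero_ext T W v t) g)"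
proof -
  let ?I = "{0<..<T}" and ?v = "zero_ext T W v"
  have Is: "?I \<in> sets lebesgue" by simp
  have sm: "strongly_measurable ?I (L2_space W) v" and L: "AE t in lebesgue_on ?I. v t \<in> L2 W"
    and i: "integrable (lebesgue_on ?I) (\<lambda>t. (nrm W (v t))\<^sup>2)"
    using v by (auto simp: L2_time_def)
  have L': "AE t in lebesgue. t \<in> ?I \<longrightarrow> v t \<in> L2 W" using L Is by (simp add: AE_restrict_space_iff)
  then show eq: "AE t in lebesgue. t \<in> ?I \<longrightarrow> ?v t = v t" by eventually_elim (simp add: zero_ext_def)
  have tr: "(\<lambda>t. H (?v t)) \<in> borel_measurable lebesgue"
    if "(\<lambda>t. H (v t)) \<in> borel_measurable (lebesgue_on ?I)" "H (\<lambda>_. 0) = 0" for H :: "(real^2 \<Rightarrow> 'b) \<Rightarrow> real"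
  proof (rule borel_measurable_AE)
    show "(\<lambda>t. if t \<in> ?I then H (v t) else 0) \<in> borel_measurable lebesgue"
      by (rule borel_measurable_if_I[OF that(1) Is])
    show "AE t in lebesgue. (if t \<in> ?I then H (v t) else 0) = H (?v t)"
      using eq by eventually_elim (use that(2) in \<open>auto simp: zero_ext_def\<close>)
  qed
  obtain s where s: "\<And>n::nat. simple_into ?I (L2_space W) (s n)"
    "AE t in lebesgue_on ?I. (\<lambda>n. dst W (s n t) (v t)) \<longlonglongrightarrow> 0"
    using strongly_measurableE[OF sm] by blast
  have nm: "(\<lambda>t. nrm W (?v t)) \<in> borel_measurable lebesgue"
    by (rule tr[where H="nrm W", OF strongly_measurable_nrm(2)[OF Is sm L s(1)[of 0]]]) simp
  have "integrable lebesgue (indicat_real ?I)" using lmeasurable_iff_integrable by blast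
  moreover have "integrable lebesgue (\<lambda>t. indicator ?I t *\<^sub>R (nrm W (v t))\<^sup>2)"
    using i Is by (simp add: lebesgue_on_integrable_iff)
  ultimately have "integrable lebesgue (\<lambda>t. indicator ?I t + indicator ?I t *\<^sub>R (nrm W (v t))\<^sup>2)"
    by (rule Bochner_Integration.integrable_add)
  then show ni: "integrable lebesgue (\<lambda>t. nrm W (?v t))"
  proof (rule Bochner_Integration.integrable_bound[OF _ nm])
    have le: "a \<le> 1 + a\<^sup>2" for a :: real using sum_squares_bound[of a 1] by (smt (verit) one_power2 mult_1_right zero_le_power2)
    show "AE t in lebesgue. norm (nrm W (?v t)) \<le> norm (indicator ?I t + indicator ?I t *\<^sub>R (nrm W (v t))\<^sup>2 :: real)"
    proof (rule AE_I2)
      fix t show "norm (nrm W (?v t)) \<le> norm (indicator ?I t + indicator ?I t *\<^sub>R (nrm W (v t))\<^sup>2 :: real)"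
        using le[of "nrm W (v t)"] by (cases "t \<in> ?I \<and> v t \<in> L2 W") (auto simp: zero_ext_def)
    qed
  qed
  assume g: "g \<in> L2 W"
  show m: "(\<lambda>t. ip W (?v t) g) \<in> borel_measurable lebesgue"
    by (rule tr[where H="\<lambda>y. ip W y g", OF strongly_measurable_ip[OF Is sm L g]]) simp
  show "integrable lebesgue (\<lambda>t. ip W (?v t) g)"
  proof (rule Bochner_Integration.integrable_bound[OF _ m])
    show "integrable lebesgue (\<lambda>t. nrm W (?v t) * nrm W g)" using ni by simp
    show "AE t in lebesgue. norm (ip W (?v t) g) \<le> norm (nrm W (?v t) * nrm W g)"
      using ip_Cauchy_Schwarz[OF zero_ext_L2 g] by (intro AE_I2) simp
  qed
qed

lemma weak_time_derivative_ip:
  fixes u v :: "real \<Rightarrow> real^2 \<Rightarrow> 'b::euclidean_space"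
  assumes T: "0 < T" and u: "u \<in> L2_time {0<..<T} (L2_space W)" and v: "v \<in> L2_time {0<..<T} (L2_space W)"
    and d: "is_time_deriv {0<..<T} (L2_space W) u v" and g: "g \<in> L2 W"
  obtains c where "AE t in lebesgue_on {0<..<T}. ip W (u t) g = c + cumul (\<lambda>s. ip W (zero_ext T W v s) g) t"
proof -
  let ?I = "{0<..<T}" and ?v = "zero_ext T W v" and ?u = "zero_ext T W u"
  have Is: "?I \<in> sets lebesgue" by simp
  note U = L2_time_zero_ext[OF u] and V = L2_time_zero_ext[OF v]
  have ui: "integrable (lebesgue_on ?I) (\<lambda>t. ip W (u t) g)"
  proof (rule integrable_cong_AE_imp)
    have "integrable lebesgue (\<lambda>t. indicator ?I t *\<^sub>R ip W (?u t) g)" by (rule integrable_mult_indicator[OF Is U(4)[OF g]])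
    then show "integrable (lebesgue_on ?I) (\<lambda>t. ip W (?u t) g)" using Is by (simp add: lebesgue_on_integrable_iff)
    show "AE t in lebesgue_on ?I. ip W (?u t) g = ip W (u t) g"
      using U(1) Is by (auto simp: AE_restrict_space_iff elim: eventually_mono)
    have "strongly_measurable ?I (L2_space W) u" "AE t in lebesgue_on ?I. u t \<in> L2 W" using u by (auto simp: L2_time_def)
    then show "(\<lambda>t. ip W (u t) g) \<in> borel_measurable (lebesgue_on ?I)" by (rule strongly_measurable_ip[OF Is _ _ g])
  qed
  show thesis
  proof (rule du_Bois_Reymond[OF T ui V(4)[OF g] _ that])
    fix \<phi> assume \<phi>: "\<phi> \<in> test_functions ?I"
    obtain K where K: "compact K" "K \<subseteq> ?I" "\<And>x. x \<notin> K \<Longrightarrow> \<phi> x = 0" using test_function_supp[OF \<phi>] by metis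
    have vm: "(\<lambda>t. ip W (v t) g) \<in> borel_measurable (lebesgue_on ?I)"
      using v by (intro strongly_measurable_ip[OF Is _ _ g]) (auto simp: L2_time_def)
    have pm: "\<phi> \<in> borel_measurable (lebesgue_on ?I)"
      by (rule test_function_measurable_lebesgue_on[OF test_function_continuous[OF \<phi>]])
    have vm': "(\<lambda>t. ip W (?v t) g) \<in> borel_measurable (lebesgue_on ?I)"
      by (rule measurable_restrict_space1[OF V(3)[OF g]])
    have "(\<integral>t. \<phi> t * ip W (v t) g \<partial>lebesgue_on ?I) = (\<integral>t. \<phi> t * ip W (?v t) g \<partial>lebesgue_on ?I)"
    proof (rule integral_cong_AE)
      show "AE t in lebesgue_on ?I. \<phi> t * ip W (v t) g = \<phi> t * ip W (?v t) g"
        using V(1) Is by (auto simp: AE_restrict_space_iff elim: eventually_mono)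
    qed (intro borel_measurable_times pm vm vm')+
    also have "\<dots> = (\<integral>t. indicator ?I t *\<^sub>R (\<phi> t * ip W (?v t) g) \<partial>lebesgue)"
      by (simp add: integral_restrict_space)
    also have "\<dots> = (\<integral>t. \<phi> t * ip W (?v t) g \<partial>lebesgue)"
    proof (rule Bochner_Integration.integral_cong[OF refl])
      fix t show "indicator ?I t *\<^sub>R (\<phi> t * ip W (?v t) g) = \<phi> t * ip W (?v t) g"
        by (cases "t \<in> ?I") (auto simp: zero_ext_def)
    qed
    finally show "(\<integral>t. deriv \<phi> t * ip W (u t) g \<partial>lebesgue_on ?I) = - (\<integral>t. \<phi> t * ip W (?v t) g \<partial>lebesgue)"
      using is_time_deriv_ip[OF _ d g \<phi>] by simp
  qed
qed

text \<open>By the lemma of du Bois-Reymond, for each \<open>g\<close> the increments of \<open>\<langle>u, g\<rangle>\<close> are integrals of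
\<open>\<langle>v, g\<rangle>\<close> off a null set depending on \<open>g\<close>. Countably many \<open>g\<close> suffice to conclude that, on a dense
set \<open>E\<close> of times, \<open>\<parallel>u(t) - u(s)\<parallel> \<le> m(t) - m(s)\<close> where \<open>m\<close> is the continuous function
\<open>cumul \<parallel>v\<parallel>\<close>. By completeness \<open>u\<close> extends from \<open>E\<close> to \<open>[0,T]\<close> with this modulus of continuity.\<close>

lemma H1_time_continuous_version:
  fixes u v :: "real \<Rightarrow> real^2 \<Rightarrow> 'b::euclidean_space"
  assumes T: "0 < T" and u: "u \<in> L2_time {0<..<T} (L2_space W)" and v: "v \<in> L2_time {0<..<T} (L2_space W)"
    and d: "is_time_deriv {0<..<T} (L2_space W) u v"
  obtains w where "continuous_version T (L2_space W) u w"
proof -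
  let ?I = "{0<..<T}" and ?v = "zero_ext T W v"
  note V = L2_time_zero_ext[OF v]
  define m where "m = cumul (\<lambda>t. nrm W (?v t))"
  have mc: "continuous_on UNIV m" unfolding m_def by (rule cumul_continuous[OF V(2)])
  have sm: "strongly_measurable ?I (L2_space W) u" and L: "AE t in lebesgue_on ?I. u t \<in> L2 W" using u by (auto simp: L2_time_def)
  obtain G where G: "countable G" "G \<subseteq> L2 W" "AE t in lebesgue_on ?I. approximable W G (u t)"
    by (rule strongly_measurable_separable[OF sm])
  define G' where "G' = (\<lambda>(a, b) x. a x - b x) ` (G \<times> G)"
  have G': "countable G'" "G' \<subseteq> L2 W" unfolding G'_def using G(1,2) by (auto intro!: L2_diff)
  have "\<forall>g\<in>G'. \<exists>c. AE t in lebesgue_on ?I. ip W (u t) g = c + cumul (\<lambda>s. ip W (?v s) g) t"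
  proof
    fix g assume "g \<in> G'"
    then have gL: "g \<in> L2 W" using G'(2) by blast
    obtain c where "AE t in lebesgue_on ?I. ip W (u t) g = c + cumul (\<lambda>s. ip W (?v s) g) t"
      by (rule weak_time_derivative_ip[OF T u v d gL])
    then show "\<exists>c. AE t in lebesgue_on ?I. ip W (u t) g = c + cumul (\<lambda>s. ip W (?v s) g) t" ..
  qed
  from bchoice[OF this] obtain c where
    c: "\<forall>g\<in>G'. AE t in lebesgue_on ?I. ip W (u t) g = c g + cumul (\<lambda>s. ip W (?v s) g) t" ..
  define P where "P t \<longleftrightarrow> u t \<in> L2 W \<and> approximable W G (u t) \<and> (\<forall>g\<in>G'. ip W (u t) g = c g + cumul (\<lambda>s. ip W (?v s) g) t)" for t
  have "AE t in lebesgue_on ?I. \<forall>g\<in>G'. ip W (u t) g = c g + cumul (\<lambda>s. ip W (?v s) g) t"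
    by (subst AE_ball_countable[OF G'(1)]) (use c in blast)
  with L G(3) have PA: "AE t in lebesgue_on ?I. P t" unfolding P_def by eventually_elim blast
  define E where "E = {t \<in> ?I. P t}"
  have dense: "{0..T} \<subseteq> closure E" unfolding E_def by (rule AE_interval_dense[OF T PA])
  have EL: "u t \<in> L2 W" and EA: "approximable W G (u t)"
    and EG: "\<And>g. g \<in> G' \<Longrightarrow> ip W (u t) g = c g + cumul (\<lambda>s. ip W (?v s) g) t" if "t \<in> E" for t
    using that unfolding E_def P_def by blast+
  have ord: "dst W (u t) (u s) \<le> m t - m s" if st: "s \<in> E" "t \<in> E" "s \<le> t" for s t
  proof (rule approximable_bound[OF L2_diff[OF EL[OF st(2)] EL[OF st(1)]] G'(2)])
    show "approximable W G' (\<lambda>x. u t x - u s x)"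
      unfolding G'_def using st G(2) by (intro approximable_diff EL EA)
    have mts: "m t - m s = (\<integral>r. indicator {s<..t} r * nrm W (?v r) \<partial>lebesgue)"
      unfolding m_def by (rule cumul_diff[OF V(2) st(3)])
    show "0 \<le> m t - m s" unfolding mts by (rule integral_nonneg_AE) auto
    fix g assume g: "g \<in> G'"
    then have gL: "g \<in> L2 W" using G' by blast
    have "ip W (\<lambda>x. u t x - u s x) g = cumul (\<lambda>s. ip W (?v s) g) t - cumul (\<lambda>s. ip W (?v s) g) s"
      by (simp add: ip_diff_left EL[OF st(1)] EL[OF st(2)] gL EG[OF st(1) g] EG[OF st(2) g])
    also have "\<dots> = (\<integral>r. indicator {s<..t} r * ip W (?v r) g \<partial>lebesgue)"
      by (rule cumul_diff[OF V(4)[OF gL] st(3)])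
    also have "\<dots> \<le> (\<integral>r. indicator {s<..t} r * nrm W (?v r) * nrm W g \<partial>lebesgue)"
    proof (rule integral_mono)
      show "integrable lebesgue (\<lambda>r. indicator {s<..t} r * ip W (?v r) g)" by (rule integrable_indicator_mult[OF V(4)[OF gL]]) simp
      show "integrable lebesgue (\<lambda>r. indicator {s<..t} r * nrm W (?v r) * nrm W g)"
        using integrable_indicator_mult[OF V(2), of "{s<..t}"] by simp
      show "indicator {s<..t} r * ip W (?v r) g \<le> indicator {s<..t} r * nrm W (?v r) * nrm W g" for r
        using ip_Cauchy_Schwarz[OF zero_ext_L2[of T W v r] gL] by (auto simp: indicator_def)
    qed
    also have "\<dots> = (m t - m s) * nrm W g" by (simp add: mts)
    finally show "ip W (\<lambda>x. u t x - u s x) g \<le> (m t - m s) * nrm W g" .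
  qed
  have lip: "dst W (u t) (u s) \<le> \<bar>m t - m s\<bar>" if "s \<in> E" "t \<in> E" for s t
    using ord[OF that] ord[OF that(2,1)] nrm_minus_commute[of W "u t" "u s"] by (cases "s \<le> t") auto
  have "\<exists>w. w \<in> L2 W \<and> (\<forall>s\<in>E. dst W (u s) w \<le> \<bar>m s - m t\<bar>)" if t: "t \<in> {0..T}" for t
  proof -
    have "t \<in> closure E" using dense t by blast
    then obtain \<tau> where tau: "\<And>n. \<tau> n \<in> E" "\<tau> \<longlonglongrightarrow> t" unfolding closure_sequential by blast
    have mt: "(\<lambda>n. m (\<tau> n)) \<longlonglongrightarrow> m t"
      using mc tau(2) by (auto simp: continuous_on_eq_continuous_at intro: isCont_tendsto_compose)
    have "\<exists>N. \<forall>k\<ge>N. \<forall>n\<ge>N. dst W (u (\<tau> k)) (u (\<tau> n)) < e" if e: "e > 0" for e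
    proof -
      obtain N where N: "\<forall>k\<ge>N. \<forall>n\<ge>N. dist (m (\<tau> k)) (m (\<tau> n)) < e"
        using metric_CauchyD[OF LIMSEQ_imp_Cauchy[OF mt] e] by blast
      have "dst W (u (\<tau> k)) (u (\<tau> n)) < e" if "k \<ge> N" "n \<ge> N" for k n
        using lip[OF tau(1)[of n] tau(1)[of k]] N that by (auto simp: dist_real_def intro: le_less_trans)
      then show ?thesis by blast
    qed
    from L2_complete[OF EL[OF tau(1)] this]
    obtain w where w: "w \<in> L2 W" "(\<lambda>n. dst W (u (\<tau> n)) w) \<longlonglongrightarrow> 0" by blast
    have "dst W (u s) w \<le> \<bar>m s - m t\<bar>" if s: "s \<in> E" for s
    proof (rule LIMSEQ_le)
      have "nrm W (\<lambda>x. (u s x - u (\<tau> n) x) - (u s x - w x)) = dst W (u (\<tau> n)) w" for n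
        by (subst nrm_minus_commute) simp
      with w(2) show "(\<lambda>n. dst W (u s) (u (\<tau> n))) \<longlonglongrightarrow> dst W (u s) w"
        by (intro tendsto_nrm L2_diff EL[OF s] EL[OF tau(1)] w(1)) simp
      show "(\<lambda>n. \<bar>m s - m (\<tau> n)\<bar>) \<longlonglongrightarrow> \<bar>m s - m t\<bar>" by (intro tendsto_intros mt)
      show "\<exists>N. \<forall>n\<ge>N. dst W (u s) (u (\<tau> n)) \<le> \<bar>m s - m (\<tau> n)\<bar>"
        using lip[OF tau(1) s] by blast
    qed
    with w(1) show ?thesis by blast
  qed
  then obtain w where w: "\<And>t. t \<in> {0..T} \<Longrightarrow> w t \<in> L2 W"
    "\<And>t s. t \<in> {0..T} \<Longrightarrow> s \<in> E \<Longrightarrow> dst W (u s) (w t) \<le> \<bar>m s - m t\<bar>" by metis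
  have ww: "dst W (w s) (w t) \<le> \<bar>m s - m t\<bar>" if st: "s \<in> {0..T}" "t \<in> {0..T}" for s t
  proof -
    have "s \<in> closure E" using dense st by blast
    then obtain \<tau> where tau: "\<And>n. \<tau> n \<in> E" "\<tau> \<longlonglongrightarrow> s" unfolding closure_sequential by blast
    have mt: "(\<lambda>n. m (\<tau> n)) \<longlonglongrightarrow> m s"
      using mc tau(2) by (auto simp: continuous_on_eq_continuous_at intro: isCont_tendsto_compose)
    have "dst W (w s) (w t) \<le> \<bar>m (\<tau> n) - m s\<bar> + \<bar>m (\<tau> n) - m t\<bar>" for n
      using nrm_triangle3[OF w(1)[OF st(1)] EL[OF tau(1)] w(1)[OF st(2)], of n] w(2)[OF st(1) tau(1), of n] w(2)[OF st(2) tau(1), of n]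
        nrm_minus_commute[of W "w s" "u (\<tau> n)"] by linarith
    moreover have "(\<lambda>n. \<bar>m (\<tau> n) - m s\<bar> + \<bar>m (\<tau> n) - m t\<bar>) \<longlonglongrightarrow> \<bar>m s - m s\<bar> + \<bar>m s - m t\<bar>"
      by (intro tendsto_intros mt)
    ultimately have "dst W (w s) (w t) \<le> \<bar>m s - m s\<bar> + \<bar>m s - m t\<bar>"
      by (intro LIMSEQ_le_const) auto
    then show ?thesis by simp
  qed
  have "continuous_version T (L2_space W) u w"
    unfolding continuous_version_def fdist_L2
  proof (intro conjI ballI)
    fix t assume t: "t \<in> {0..T}"
    show "w t \<in> L2 W" by (rule w(1)[OF t])
    have "((\<lambda>s. \<bar>m s - m t\<bar>) \<longlongrightarrow> \<bar>m t - m t\<bar>) (at t within {0..T})"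
      using mc by (intro tendsto_intros) (simp add: continuous_on_eq_continuous_at continuous_at_imp_continuous_within continuous_within[symmetric])
    then have "((\<lambda>s. \<bar>m s - m t\<bar>) \<longlongrightarrow> 0) (at t within {0..T})" by simp
    then show "((\<lambda>s. dst W (w s) (w t)) \<longlongrightarrow> 0) (at t within {0..T})"
    proof (rule Lim_null_comparison[rotated])
      show "\<forall>\<^sub>F s in at t within {0..T}. norm (dst W (w s) (w t)) \<le> \<bar>m s - m t\<bar>"
        using ww t by (auto simp: eventually_at_filter)
    qed
  next
    show "AE t in lebesgue_on ?I. u t \<in> L2 W \<and> dst W (u t) (w t) = 0"
      using PA AE_space
    proof eventually_elim
      fix t assume "P t" "t \<in> space (lebesgue_on ?I)"
      then have t: "t \<in> E" "t \<in> {0..T}" by (auto simp: E_def space_restrict_space)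
      then show "u t \<in> L2 W \<and> dst W (u t) (w t) = 0"
        using w(2)[OF t(2,1)] EL[OF t(1)] by (simp add: order_antisym)
    qed
  qed
  then show thesis by (rule that)
qed

section \<open>Energy estimates for primitives\<close>

text \<open>\<open>U\<close> is the integral of \<open>V\<close> from \<open>-\<infinity>\<close>, tested with elements of \<open>L\<^sup>2\<close>. Domination by an integrable \<open>w\<close>,
rather than integrability of \<open>\<parallel>V\<parallel>\<close>, is required because it passes to linear combinations without
measurability of their norms.\<close>

definition primitive :: "(real^2) set \<Rightarrow> (real \<Rightarrow> real^2 \<Rightarrow> 'b::euclidean_space) \<Rightarrow> (real \<Rightarrow> real^2 \<Rightarrow> 'b) \<Rightarrow> bool" where
  "primitive W U V \<longleftrightarrow> (\<forall>t. U t \<in> L2 W) \<and> (\<forall>t. V t \<in> L2 W) \<and> (\<forall>t\<le>0. V t = (\<lambda>_. 0)) \<and>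
     (\<exists>w. integrable lebesgue w \<and> (\<forall>t. nrm W (V t) \<le> w t)) \<and>
     (\<forall>g\<in>L2 W. (\<lambda>t. ip W (V t) g) \<in> borel_measurable lebesgue) \<and>
     (\<forall>g\<in>L2 W. \<forall>t. ip W (U t) g = cumul (\<lambda>s. ip W (V s) g) t)"

text \<open>For each \<open>g\<close> the function \<open>\<langle>w, g\<rangle>\<close> and the integral of \<open>\<langle>v, g\<rangle>\<close> are continuous and differ by a
constant almost everywhere, hence on \<open>[0,T]\<close>; at time \<open>0\<close> both vanish.\<close>

lemma H1_time_primitive:
  fixes u v w :: "real \<Rightarrow> real^2 \<Rightarrow> 'b::euclidean_space"
  assumes T: "0 < T" and u: "u \<in> L2_time {0<..<T} (L2_space W)" and v: "v \<in> L2_time {0<..<T} (L2_space W)"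
    and d: "is_time_deriv {0<..<T} (L2_space W) u v"
    and w: "continuous_version T (L2_space W) u w" and w0: "nrm W (w 0) = 0"
  shows "primitive W (\<lambda>t. if t \<le> 0 then (\<lambda>_. 0) else w (min t T)) (zero_ext T W v)"
proof -
  let ?I = "{0<..<T}" and ?v = "zero_ext T W v"
  note V = L2_time_zero_ext[OF v]
  have wL: "w t \<in> L2 W" if "t \<in> {0..T}" for t using w that by (simp add: continuous_version_def)
  have eq: "ip W (if t \<le> 0 then (\<lambda>_. 0) else w (min t T)) g = cumul (\<lambda>s. ip W (?v s) g) t" if g: "g \<in> L2 W" for g t
  proof -
    obtain c where c: "AE t in lebesgue_on ?I. ip W (u t) g = c + cumul (\<lambda>s. ip W (?v s) g) t"
      by (rule weak_time_derivative_ip[OF T u v d g])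
    let ?h = "\<lambda>t. ip W (w t) g - cumul (\<lambda>s. ip W (?v s) g) t"
    have uw: "AE t in lebesgue_on ?I. u t \<in> L2 W \<and> dst W (u t) (w t) = 0"
      using w by (simp add: continuous_version_def fdist_L2)
    have "AE t in lebesgue_on ?I. ?h t = c"
      using c uw AE_space
    proof eventually_elim
      fix t assume 1: "ip W (u t) g = c + cumul (\<lambda>s. ip W (?v s) g) t"
        and 2: "u t \<in> L2 W \<and> dst W (u t) (w t) = 0" and t: "t \<in> space (lebesgue_on ?I)"
      have "ip W (u t) g = ip W (w t) g"
        using 2 t by (intro ip_cong_dist0 g wL) (auto simp: space_restrict_space)
      then show "?h t = c" using 1 by simp
    qed
    from AE_interval_dense[OF T this]
    have dense: "{0..T} \<subseteq> closure {t \<in> ?I. ?h t = c}" .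
    have sub: "closure {t \<in> ?I. ?h t = c} \<subseteq> {0..T}" by (rule closure_minimal) auto
    have hc: "continuous_on (closure {t \<in> ?I. ?h t = c}) ?h"
      using continuous_on_subset[OF L2_continuous_ip[OF continuous_version_L2_continuous[OF w] g] sub]
        continuous_on_subset[OF cumul_continuous[OF V(4)[OF g]], of "closure {t \<in> ?I. ?h t = c}"]
      by (intro continuous_on_diff) auto
    have hT: "?h t = c" if "t \<in> {0..T}" for t
      by (rule continuous_constant_on_closure[OF hc]) (use dense that in auto)
    have cle: "cumul (\<lambda>s. ip W (?v s) g) t = 0" if "t \<le> 0" for t
    proof -
      have "(\<lambda>s. indicator {..t} s * ip W (?v s) g) = (\<lambda>_. 0)"
        using that by (auto simp: indicator_def zero_ext_def fun_eq_iff)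
      then show ?thesis by (simp add: cumul_def)
    qed
    have cge: "cumul (\<lambda>s. ip W (?v s) g) t = cumul (\<lambda>s. ip W (?v s) g) T" if "T \<le> t" for t
    proof -
      have "(\<lambda>s. indicator {..t} s * ip W (?v s) g) = (\<lambda>s. indicator {..T} s * ip W (?v s) g)"
        using that by (auto simp: indicator_def zero_ext_def fun_eq_iff)
      then show ?thesis by (simp add: cumul_def)
    qed
    have i0: "ip W (w 0) g = 0"
      using ip_Cauchy_Schwarz[OF wL[of 0] g] w0 T by simp
    then have c0: "c = 0" using hT[of 0] cle[of 0] T by simp
    consider "t \<le> 0" | "0 < t" "t \<le> T" | "T \<le> t" "0 < t" using T by linarith
    then show ?thesis
    proof cases
      case 1 then show ?thesis using cle by simp
    next
      case 2 then show ?thesis using hT[of t] c0 by simp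
    next
      case 3 then show ?thesis using hT[of T] c0 cge[OF 3(1)] T by (simp add: min_absorb2)
    qed
  qed
  show ?thesis unfolding primitive_def
  proof (intro conjI allI impI ballI)
    have "w (min t T) \<in> L2 W" if "0 < t" for t using T that by (intro wL) auto
    then show "(if t \<le> 0 then (\<lambda>_. 0) else w (min t T)) \<in> L2 W" for t by simp
    show "?v t = (\<lambda>_. 0)" if "t \<le> 0" for t using that by (simp add: zero_ext_def)
    show "\<exists>w. integrable lebesgue w \<and> (\<forall>t. nrm W (?v t) \<le> w t)"
      by (intro exI[of _ "\<lambda>t. nrm W (?v t)"] conjI allI V(2) order_refl)
  qed (use V(3) eq in simp_all)
qed

lemma primitiveD:
  assumes "primitive W U V"
  shows "U t \<in> L2 W" "V t \<in> L2 W" "t \<le> 0 \<Longrightarrow> V t = (\<lambda>_. 0)"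
    "g \<in> L2 W \<Longrightarrow> (\<lambda>t. ip W (V t) g) \<in> borel_measurable lebesgue"
    "g \<in> L2 W \<Longrightarrow> ip W (U t) g = cumul (\<lambda>s. ip W (V s) g) t"
  using assms unfolding primitive_def by blast+

lemma primitive_dominated:
  assumes "primitive W U V"
  obtains w where "integrable lebesgue w" "\<And>t. nrm W (V t) \<le> w t" "\<And>t. 0 \<le> w t"
proof -
  obtain w where w: "integrable lebesgue w" "\<forall>t. nrm W (V t) \<le> w t" using assms unfolding primitive_def by blast
  moreover have "0 \<le> w t" for t using w(2) nrm_nonneg order_trans by blast
  ultimately show thesis using that by blast
qed

lemma primitive_ip_integrable:
  fixes U V :: "real \<Rightarrow> real^2 \<Rightarrow> 'b::euclidean_space"
  assumes P: "primitive W U V" and g: "g \<in> L2 W"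
  shows "integrable lebesgue (\<lambda>t. ip W (V t) g)"
proof -
  obtain w where w: "integrable lebesgue w" "\<And>t. nrm W (V t) \<le> w t" "\<And>t. 0 \<le> w t" using primitive_dominated[OF P] by blast
  show ?thesis
  proof (rule Bochner_Integration.integrable_bound[OF _ primitiveD(4)[OF P g]])
    show "integrable lebesgue (\<lambda>t. w t * nrm W g)" using w by simp
    have "\<bar>ip W (V t) g\<bar> \<le> w t * nrm W g" for t
      using ip_Cauchy_Schwarz[OF primitiveD(2)[OF P] g, of t] mult_right_mono[OF w(2)[of t], of "nrm W g"] by simp
    then show "AE t in lebesgue. norm (ip W (V t) g) \<le> norm (w t * nrm W g)" using w(3) by (intro AE_I2) simp
  qed
qed

lemma primitive_increment:
  fixes U V :: "real \<Rightarrow> real^2 \<Rightarrow> 'b::euclidean_space"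
  assumes P: "primitive W U V" and g: "g \<in> L2 W" and st: "s \<le> t"
  shows "ip W (\<lambda>x. U t x - U s x) g = (\<integral>r. indicator {s<..t} r * ip W (V r) g \<partial>lebesgue)"
  using cumul_diff[OF primitive_ip_integrable[OF P g] st]
  by (simp add: ip_diff_left primitiveD[OF P] g)

text \<open>Test the increment with itself.\<close>

lemma primitive_nrm_increment:
  fixes U V :: "real \<Rightarrow> real^2 \<Rightarrow> 'b::euclidean_space"
  assumes P: "primitive W U V" and w: "integrable lebesgue w" "\<And>r. nrm W (V r) \<le> w r" and st: "s \<le> t"
  shows "dst W (U t) (U s) \<le> cumul w t - cumul w s"
proof -
  let ?d = "\<lambda>x. U t x - U s x"
  have dL: "?d \<in> L2 W" by (intro L2_diff primitiveD[OF P])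
  have w0: "0 \<le> w r" for r using w(2) nrm_nonneg order_trans by blast
  have mts: "cumul w t - cumul w s = (\<integral>r. indicator {s<..t} r * w r \<partial>lebesgue)" by (rule cumul_diff[OF w(1) st])
  have "(nrm W ?d)\<^sup>2 = (\<integral>r. indicator {s<..t} r * ip W (V r) ?d \<partial>lebesgue)"
    unfolding nrm_sq by (rule primitive_increment[OF P dL st])
  also have "\<dots> \<le> (\<integral>r. indicator {s<..t} r * w r * nrm W ?d \<partial>lebesgue)"
  proof (rule integral_mono)
    show "integrable lebesgue (\<lambda>r. indicator {s<..t} r * ip W (V r) ?d)" by (rule integrable_indicator_mult[OF primitive_ip_integrable[OF P dL]]) simp
    show "integrable lebesgue (\<lambda>r. indicator {s<..t} r * w r * nrm W ?d)"
      using integrable_indicator_mult[OF w(1), of "{s<..t}"] by simp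
    fix r
    have "ip W (V r) ?d \<le> nrm W (V r) * nrm W ?d"
      using ip_Cauchy_Schwarz[OF primitiveD(2)[OF P] dL, of r] by simp
    also have "\<dots> \<le> w r * nrm W ?d" using w(2) by (intro mult_right_mono) simp_all
    finally show "indicator {s<..t} r * ip W (V r) ?d \<le> indicator {s<..t} r * w r * nrm W ?d"
      by (auto simp: indicator_def)
  qed
  also have "\<dots> = (cumul w t - cumul w s) * nrm W ?d" by (simp add: mts)
  finally have le: "nrm W ?d * nrm W ?d \<le> (cumul w t - cumul w s) * nrm W ?d" by (simp add: power2_eq_square)
  have "0 \<le> cumul w t - cumul w s" unfolding mts by (rule integral_nonneg_AE) (simp add: w0)
  then show ?thesis using le nrm_nonneg[of W ?d] by (cases "nrm W ?d = 0") (auto simp: mult_le_cancel_right)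
qed

lemma primitive_zero:
  fixes U V :: "real \<Rightarrow> real^2 \<Rightarrow> 'b::euclidean_space"
  assumes P: "primitive W U V" and t: "t \<le> 0"
  shows "nrm W (U t) = 0"
proof -
  have "ip W (U t) (U t) = cumul (\<lambda>s. ip W (V s) (U t)) t" by (rule primitiveD(5)[OF P primitiveD(1)[OF P]])
  also have "\<dots> = 0"
  proof -
    have "indicator {..t} s * ip W (V s) (U t) = 0" for s
      using t primitiveD(3)[OF P, of s] by (cases "s \<le> t") auto
    then show ?thesis unfolding cumul_def by (intro integral_eq_zero_AE AE_I2)
  qed
  finally show ?thesis by (simp add: nrm_sq[symmetric])
qed

lemma primitive_bounded:
  fixes U V :: "real \<Rightarrow> real^2 \<Rightarrow> 'b::euclidean_space"
  assumes P: "primitive W U V"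
  obtains M where "M > 0" "\<And>t. nrm W (U t) \<le> M"
proof -
  obtain w where w: "integrable lebesgue w" "\<And>t. nrm W (V t) \<le> w t" "\<And>t. 0 \<le> w t" using primitive_dominated[OF P] by blast
  let ?M = "2 * (\<integral>s. \<bar>w s\<bar> \<partial>lebesgue) + 1"
  have pos: "0 \<le> (\<integral>s. \<bar>w s\<bar> \<partial>lebesgue)" by (rule integral_nonneg_AE) simp
  have "nrm W (U t) \<le> ?M" for t
  proof (cases "t \<le> 0")
    case True then show ?thesis using primitive_zero[OF P] pos by simp
  next
    case False
    have "nrm W (U t) \<le> dst W (U t) (U 0)"
      using nrm_diff_abs[OF primitiveD(1)[OF P] primitiveD(1)[OF P], of t 0] primitive_zero[OF P, of 0] by simp
    also have "\<dots> \<le> cumul w t - cumul w 0" using False by (intro primitive_nrm_increment[OF P w(1,2)]) simp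
    also have "\<dots> \<le> ?M" using cumul_bound[OF w(1), of t] cumul_bound[OF w(1), of 0] by linarith
    finally show ?thesis .
  qed
  moreover have "?M > 0" using pos by linarith
  ultimately show thesis using that by blast
qed

lemma primitive_L2_continuous:
  fixes U V :: "real \<Rightarrow> real^2 \<Rightarrow> 'b::euclidean_space"
  assumes P: "primitive W U V" shows "L2_continuous W UNIV U"
proof -
  obtain w where w: "integrable lebesgue w" "\<And>t. nrm W (V t) \<le> w t" "\<And>t. 0 \<le> w t" using primitive_dominated[OF P] by blast
  have le: "dst W (U s) (U t) \<le> \<bar>cumul w s - cumul w t\<bar>" for s t
    using primitive_nrm_increment[OF P w(1,2), of s t] primitive_nrm_increment[OF P w(1,2), of t s]
      nrm_minus_commute[of W "U s" "U t"] by (cases "s \<le> t") auto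
  have "((\<lambda>s. dst W (U s) (U t)) \<longlongrightarrow> 0) (at t)" for t
  proof (rule Lim_null_comparison)
    have "isCont (cumul w) t" using cumul_continuous[OF w(1)] by (simp add: continuous_on_eq_continuous_at)
    then have "((\<lambda>s. \<bar>cumul w s - cumul w t\<bar>) \<longlongrightarrow> \<bar>cumul w t - cumul w t\<bar>) (at t)"
      by (intro tendsto_intros) (simp add: isCont_def)
    then show "((\<lambda>s. \<bar>cumul w s - cumul w t\<bar>) \<longlongrightarrow> 0) (at t)" by simp
  qed (simp add: le)
  then show ?thesis unfolding L2_continuous_def using primitiveD(1)[OF P] by blast
qed

lemma primitive_shift:
  fixes U V :: "real \<Rightarrow> real^2 \<Rightarrow> 'b::euclidean_space"
  assumes P: "primitive W U V" and h: "0 \<le> h"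
  shows "primitive W (\<lambda>t. U (t - h)) (\<lambda>t. V (t - h))"
proof -
  obtain w where w: "integrable lebesgue w" "\<And>t. nrm W (V t) \<le> w t" "\<And>t. 0 \<le> w t" using primitive_dominated[OF P] by blast
  have sh: "integrable lebesgue (\<lambda>t. b (t - h))" "(\<integral>t. b (t - h) \<partial>lebesgue) = (\<integral>t. b t \<partial>lebesgue)"
    if "integrable lebesgue b" for b :: "real \<Rightarrow> real"
    using lebesgue_integrable_real_affine[OF that, of 1 "-h"] lebesgue_integral_real_affine[of 1 b "-h"] by simp_all
  show ?thesis unfolding primitive_def
  proof (intro conjI allI impI ballI)
    show "U (t - h) \<in> L2 W" "V (t - h) \<in> L2 W" for t using primitiveD[OF P] by simp_all
    show "V (t - h) = (\<lambda>_. 0)" if "t \<le> 0" for t using primitiveD(3)[OF P] that h by simp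
    show "\<exists>w. integrable lebesgue w \<and> (\<forall>t. nrm W (V (t - h)) \<le> w t)"
      by (intro exI[of _ "\<lambda>t. w (t - h)"] conjI allI sh w)
    fix g :: "real^2 \<Rightarrow> 'b" assume g: "g \<in> L2 W"
    note i = primitive_ip_integrable[OF P g]
    show "(\<lambda>t. ip W (V (t - h)) g) \<in> borel_measurable lebesgue" using sh(1)[OF i] by (rule borel_measurable_integrable)
    fix t
    have "ip W (U (t - h)) g = (\<integral>s. indicator {..t - h} s * ip W (V s) g \<partial>lebesgue)"
      using primitiveD(5)[OF P g] by (simp add: cumul_def)
    also have "\<dots> = (\<integral>s. indicator {..t - h} (s - h) * ip W (V (s - h)) g \<partial>lebesgue)"
      by (rule sh(2)[symmetric, OF integrable_indicator_mult[OF i]]) simp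
    also have "\<dots> = cumul (\<lambda>s. ip W (V (s - h)) g) t"
      unfolding cumul_def by (intro Bochner_Integration.integral_cong) (auto simp: indicator_def)
    finally show "ip W (U (t - h)) g = cumul (\<lambda>s. ip W (V (s - h)) g) t" .
  qed
qed

lemma cumul_scaled_diff:
  assumes "integrable lebesgue a" "integrable lebesgue b"
  shows "cumul (\<lambda>s. c * (a s - b s)) t = c * (cumul a t - cumul b t)"
proof -
  have "cumul (\<lambda>s. c * (a s - b s)) t = (\<integral>s. c * (indicator {..t} s * a s - indicator {..t} s * b s) \<partial>lebesgue)"
    unfolding cumul_def by (intro Bochner_Integration.integral_cong) (auto simp: algebra_simps)
  also have "\<dots> = c * (cumul a t - cumul b t)"
    using assms unfolding cumul_def by (simp add: integrable_indicator_mult)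
  finally show ?thesis .
qed

lemma primitive_scaled_diff:
  fixes U V U' V' :: "real \<Rightarrow> real^2 \<Rightarrow> 'b::euclidean_space"
  assumes P: "primitive W U V" and P': "primitive W U' V'"
  shows "primitive W (\<lambda>t x. c *\<^sub>R (U t x - U' t x)) (\<lambda>t x. c *\<^sub>R (V t x - V' t x))"
proof -
  obtain w where w: "integrable lebesgue w" "\<And>t. nrm W (V t) \<le> w t" "\<And>t. 0 \<le> w t" using primitive_dominated[OF P] by blast
  obtain w' where w': "integrable lebesgue w'" "\<And>t. nrm W (V' t) \<le> w' t" "\<And>t. 0 \<le> w' t" using primitive_dominated[OF P'] by blast
  show ?thesis unfolding primitive_def
  proof (intro conjI allI impI ballI)
    show "(\<lambda>x. c *\<^sub>R (U t x - U' t x)) \<in> L2 W" "(\<lambda>x. c *\<^sub>R (V t x - V' t x)) \<in> L2 W" for t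
      by (intro L2_scale L2_diff primitiveD[OF P] primitiveD[OF P'])+
    show "(\<lambda>x. c *\<^sub>R (V t x - V' t x)) = (\<lambda>_. 0)" if "t \<le> 0" for t
      using primitiveD(3)[OF P that] primitiveD(3)[OF P' that] by simp
    have "nrm W (\<lambda>x. c *\<^sub>R (V t x - V' t x)) \<le> \<bar>c\<bar> * (w t + w' t)" for t
      unfolding nrm_scale using nrm_triangle_diff[OF primitiveD(2)[OF P] primitiveD(2)[OF P'], of t t] w(2)[of t] w'(2)[of t]
      by (intro mult_left_mono) auto
    then show "\<exists>w. integrable lebesgue w \<and> (\<forall>t. nrm W (\<lambda>x. c *\<^sub>R (V t x - V' t x)) \<le> w t)"
      using w(1) w'(1) by (intro exI[of _ "\<lambda>t. \<bar>c\<bar> * (w t + w' t)"]) simp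
    fix g :: "real^2 \<Rightarrow> 'b" assume g: "g \<in> L2 W"
    have eq: "ip W (\<lambda>x. c *\<^sub>R (V t x - V' t x)) g = c * (ip W (V t) g - ip W (V' t) g)"
      "ip W (\<lambda>x. c *\<^sub>R (U t x - U' t x)) g = c * (ip W (U t) g - ip W (U' t) g)" for t
      by (simp_all add: ip_scale_left ip_diff_left primitiveD[OF P] primitiveD[OF P'] g)
    show "(\<lambda>t. ip W (\<lambda>x. c *\<^sub>R (V t x - V' t x)) g) \<in> borel_measurable lebesgue"
      unfolding eq using primitiveD(4)[OF P g] primitiveD(4)[OF P' g] by simp
    show "ip W (\<lambda>x. c *\<^sub>R (U t x - U' t x)) g = cumul (\<lambda>s. ip W (\<lambda>x. c *\<^sub>R (V s x - V' s x)) g) t" for t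
      unfolding eq cumul_scaled_diff[OF primitive_ip_integrable[OF P g] primitive_ip_integrable[OF P' g]]
      using primitiveD(5)[OF P g] primitiveD(5)[OF P' g] by simp
  qed
qed

text \<open>Since \<open>U\<close> is only a primitive in the tested sense, the identity is obtained
from partitions. Over a partition of \<open>[0,t]\<close> the differences of \<open>\<parallel>U\<parallel>\<^sup>2\<close> telescope, and each of them equals
\<open>\<langle>U(t\<^sub>i\<^sub>+\<^sub>1) - U(t\<^sub>i), U(t\<^sub>i\<^sub>+\<^sub>1) + U(t\<^sub>i)\<rangle>\<close>, the integral of \<open>V\<close> over the subinterval tested with the sum
of the two values. As the partition is refined this sum tends to \<open>2 U\<close>, by continuity.\<close>

lemma energy_identity:
  fixes U V :: "real \<Rightarrow> real^2 \<Rightarrow> 'b::euclidean_space"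
  assumes P: "primitive W U V" and t: "0 < t"
  shows "integrable lebesgue (\<lambda>s. indicator {0<..t} s * ip W (V s) (U s))"
    and "(nrm W (U t))\<^sup>2 = 2 * (\<integral>s. indicator {0<..t} s * ip W (V s) (U s) \<partial>lebesgue)"
proof -
  obtain w where w: "integrable lebesgue w" "\<And>t. nrm W (V t) \<le> w t" "\<And>t. 0 \<le> w t" using primitive_dominated[OF P] by blast
  obtain M where M: "M > 0" "\<And>t. nrm W (U t) \<le> M" using primitive_bounded[OF P] by blast
  define \<tau> where "\<tau> n i = t * real i / real (Suc n)" for n i
  have tau_mono: "\<tau> n i \<le> \<tau> n (Suc i)" for n i unfolding \<tau>_def using t by (intro divide_right_mono mult_left_mono) auto
  define g where "g n i = (\<lambda>x. U (\<tau> n (Suc i)) x + U (\<tau> n i) x)" for n i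
  have gL: "g n i \<in> L2 W" for n i unfolding g_def by (intro L2_add primitiveD[OF P])
  define Q where "Q n s = (\<Sum>i<Suc n. indicator {\<tau> n i<..\<tau> n (Suc i)} s * ip W (V s) (g n i))" for n s
  have Qi1: "integrable lebesgue (\<lambda>s. indicator {\<tau> n i<..\<tau> n (Suc i)} s * ip W (V s) (g n i))" for n i
    by (rule integrable_indicator_mult[OF primitive_ip_integrable[OF P gL]]) simp
  have Qi: "integrable lebesgue (Q n)" for n
    unfolding Q_def[abs_def] by (intro Bochner_Integration.integrable_sum Qi1)
  have Qint: "(\<integral>s. Q n s \<partial>lebesgue) = (nrm W (U t))\<^sup>2" for n
  proof -
    have "(\<integral>s. Q n s \<partial>lebesgue) = (\<Sum>i<Suc n. \<integral>s. indicator {\<tau> n i<..\<tau> n (Suc i)} s * ip W (V s) (g n i) \<partial>lebesgue)"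
      unfolding Q_def by (intro Bochner_Integration.integral_sum Qi1)
    also have "\<dots> = (\<Sum>i<Suc n. ip W (\<lambda>x. U (\<tau> n (Suc i)) x - U (\<tau> n i) x) (g n i))"
      by (intro sum.cong refl primitive_increment[OF P gL tau_mono, symmetric])
    also have "\<dots> = (\<Sum>i<Suc n. (nrm W (U (\<tau> n (Suc i))))\<^sup>2 - (nrm W (U (\<tau> n i)))\<^sup>2)"
    proof (intro sum.cong refl)
      fix i
      let ?a = "U (\<tau> n (Suc i))" and ?b = "U (\<tau> n i)"
      have "ip W (\<lambda>x. ?a x - ?b x) (g n i) = ip W ?a ?a + ip W ?a ?b - (ip W ?b ?a + ip W ?b ?b)"
        unfolding g_def by (simp add: ip_diff_left ip_add_right L2_add primitiveD(1)[OF P])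
      then show "ip W (\<lambda>x. ?a x - ?b x) (g n i) = (nrm W ?a)\<^sup>2 - (nrm W ?b)\<^sup>2"
        using ip_commute[of W ?a ?b] by (simp add: nrm_sq)
    qed
    also have "\<dots> = (nrm W (U (\<tau> n (Suc n))))\<^sup>2 - (nrm W (U (\<tau> n 0)))\<^sup>2"
      by (rule sum_lessThan_telescope)
    also have "\<dots> = (nrm W (U t))\<^sup>2"
      using primitive_zero[OF P, of 0] by (simp add: \<tau>_def del: of_nat_Suc)
    finally show ?thesis .
  qed
  have loc: "\<exists>i. Q n s = ip W (V s) (g n i) \<and> \<tau> n i \<le> s \<and> s \<le> \<tau> n (Suc i)" if s: "s \<in> {0<..t}" for n s
  proof -
    \<comment> \<open>the index of the subinterval \<open>(\<tau> n (k - 1), \<tau> n k]\<close> that contains \<open>s\<close>\<close>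
    define k where "k = \<lceil>s * real (Suc n) / t\<rceil>"
    have kp: "0 < k" "k \<le> int (Suc n)" unfolding k_def using s t
      by (auto simp: less_ceiling_iff ceiling_le_iff field_simps simp del: of_nat_Suc)
    define i0 where "i0 = nat (k - 1)"
    have i0: "int i0 = k - 1" "i0 < Suc n" using kp by (auto simp: i0_def)
    have iff: "s \<in> {\<tau> n i<..\<tau> n (Suc i)} \<longleftrightarrow> i = i0" for i
    proof -
      have "s \<in> {\<tau> n i<..\<tau> n (Suc i)} \<longleftrightarrow> real i < s * real (Suc n) / t \<and> s * real (Suc n) / t \<le> real i + 1"
        using t by (simp add: \<tau>_def field_simps del: of_nat_Suc) (simp add: algebra_simps)
      also have "\<dots> \<longleftrightarrow> k = int i + 1" unfolding k_def by (subst ceiling_eq_iff) auto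
      finally show ?thesis using i0 by auto
    qed
    have "Q n s = (\<Sum>i<Suc n. if i = i0 then ip W (V s) (g n i) else 0)"
      unfolding Q_def by (intro sum.cong refl) (simp only: indicator_def iff, simp)
    then have "Q n s = ip W (V s) (g n i0)" using i0(2) by (simp add: sum.delta del: sum.lessThan_Suc)
    then show ?thesis using iff[of i0] by auto
  qed
  have Qout: "Q n s = 0" if s: "s \<notin> {0<..t}" for n s
  proof -
    have "s \<notin> {\<tau> n i<..\<tau> n (Suc i)}" if i: "i < Suc n" for i
    proof
      assume si: "s \<in> {\<tau> n i<..\<tau> n (Suc i)}"
      have "0 \<le> \<tau> n i" using t by (simp add: \<tau>_def)
      moreover have "\<tau> n (Suc i) \<le> t"
        using t i by (simp add: \<tau>_def divide_le_eq del: of_nat_Suc)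
      ultimately show False using si s by auto
    qed
    then show ?thesis unfolding Q_def by (intro sum.neutral) (auto simp: indicator_def)
  qed
  have lim: "(\<lambda>n. Q n s) \<longlonglongrightarrow> 2 * (indicator {0<..t} s * ip W (V s) (U s))" for s
  proof (cases "s \<in> {0<..t}")
    case True
    have "\<forall>n. \<exists>i. Q n s = ip W (V s) (g n i) \<and> \<tau> n i \<le> s \<and> s \<le> \<tau> n (Suc i)" using loc[OF True] by blast
    then obtain i where i: "\<And>n. Q n s = ip W (V s) (g n (i n))" "\<And>n. \<tau> n (i n) \<le> s" "\<And>n. s \<le> \<tau> n (Suc (i n))" by metis
    have z: "(\<lambda>n. t / real (Suc n)) \<longlonglongrightarrow> 0" using LIMSEQ_Suc[OF lim_const_over_n[of t]] by simp
    have gap: "\<tau> n (Suc k) = \<tau> n k + t / real (Suc n)" for n k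
      unfolding \<tau>_def of_nat_Suc[of k] by (simp add: distrib_left add_divide_distrib del: of_nat_Suc)
    have l1: "(\<lambda>n. \<tau> n (i n)) \<longlonglongrightarrow> s"
    proof (rule tendsto_sandwich[of "\<lambda>n. s - t / real (Suc n)" _ _ "\<lambda>_. s"])
      show "\<forall>\<^sub>F n in sequentially. s - t / real (Suc n) \<le> \<tau> n (i n)" using i(3) gap by (simp add: algebra_simps)
      show "(\<lambda>n. s - t / real (Suc n)) \<longlonglongrightarrow> s" using tendsto_diff[OF tendsto_const z] by simp
    qed (use i(2) in auto)
    have l2: "(\<lambda>n. \<tau> n (Suc (i n))) \<longlonglongrightarrow> s"
      unfolding gap using tendsto_add[OF l1 z] by simp
    have Uc: "(\<lambda>n. dst W (U (\<xi> n)) (U s)) \<longlonglongrightarrow> 0" if "\<xi> \<longlonglongrightarrow> s" for \<xi>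
    proof -
      have "isCont (\<lambda>r. dst W (U r) (U s)) s"
        using primitive_L2_continuous[OF P] by (simp add: isCont_def L2_continuous_def)
      from isCont_tendsto_compose[OF this that] show ?thesis by simp
    qed
    have "(\<lambda>n. nrm W (\<lambda>x. g n (i n) x - 2 *\<^sub>R U s x)) \<longlonglongrightarrow> 0"
    proof (rule Lim_null_comparison)
      show "(\<lambda>n. nrm W (\<lambda>x. U (\<tau> n (Suc (i n))) x - U s x) + dst W (U (\<tau> n (i n))) (U s)) \<longlonglongrightarrow> 0"
        using tendsto_add[OF Uc[OF l2] Uc[OF l1]] by simp
      have "nrm W (\<lambda>x. g n (i n) x - 2 *\<^sub>R U s x) \<le> nrm W (\<lambda>x. U (\<tau> n (Suc (i n))) x - U s x) + dst W (U (\<tau> n (i n))) (U s)" for n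
      proof -
        have "(\<lambda>x. g n (i n) x - 2 *\<^sub>R U s x) = (\<lambda>x. (U (\<tau> n (Suc (i n))) x - U s x) + (U (\<tau> n (i n)) x - U s x))"
          by (simp add: g_def scaleR_2 algebra_simps)
        then show ?thesis
          using nrm_triangle[OF L2_diff[OF primitiveD(1)[OF P] primitiveD(1)[OF P]] L2_diff[OF primitiveD(1)[OF P] primitiveD(1)[OF P]]] by simp
      qed
      then show "\<forall>\<^sub>F n in sequentially. norm (nrm W (\<lambda>x. g n (i n) x - 2 *\<^sub>R U s x)) \<le> nrm W (\<lambda>x. U (\<tau> n (Suc (i n))) x - U s x) + dst W (U (\<tau> n (i n))) (U s)" by simp
    qed
    then have "(\<lambda>n. ip W (g n (i n)) (V s)) \<longlonglongrightarrow> ip W (\<lambda>x. 2 *\<^sub>R U s x) (V s)"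
      by (intro tendsto_ip gL L2_scale primitiveD[OF P])
    then show ?thesis using True i(1) by (simp add: ip_commute[of W "V s"] ip_scale_left)
  next
    case False
    then show ?thesis using Qout by simp
  qed
  have bound: "norm (Q n s) \<le> 2 * M * w s" for n s
  proof (cases "s \<in> {0<..t}")
    case True
    then obtain i where i: "Q n s = ip W (V s) (g n i)" using loc by blast
    have "nrm W (g n i) \<le> 2 * M"
      using nrm_triangle[OF primitiveD(1)[OF P] primitiveD(1)[OF P], of "\<tau> n (Suc i)" "\<tau> n i"] M(2)[of "\<tau> n (Suc i)"] M(2)[of "\<tau> n i"]
      by (simp add: g_def)
    then have "nrm W (V s) * nrm W (g n i) \<le> w s * (2 * M)" using w(2,3) by (intro mult_mono) auto
    then show ?thesis using ip_Cauchy_Schwarz[OF primitiveD(2)[OF P] gL, of s n i] i by (simp add: mult_ac)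
  qed (use Qout M w(3) in auto)
  have Qm: "Q n \<in> borel_measurable lebesgue" for n using Qi by (rule borel_measurable_integrable)
  have Lm: "(\<lambda>s. 2 * (indicator {0<..t} s * ip W (V s) (U s))) \<in> borel_measurable lebesgue"
    by (rule borel_measurable_LIMSEQ_real[OF lim Qm])
  have wi: "integrable lebesgue (\<lambda>s. 2 * M * w s)" using w(1) by simp
  note dc = integrable_dominated_convergence[OF Lm Qm wi AE_I2[OF lim] AE_I2[OF bound]]
    integral_dominated_convergence[OF Lm Qm wi AE_I2[OF lim] AE_I2[OF bound]]
  show "integrable lebesgue (\<lambda>s. indicator {0<..t} s * ip W (V s) (U s))"
    using dc(1) by simp
  have "(\<lambda>n. (nrm W (U t))\<^sup>2) \<longlonglongrightarrow> (\<integral>s. 2 * (indicator {0<..t} s * ip W (V s) (U s)) \<partial>lebesgue)"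
    using dc(2) by (simp add: Qint)
  then show "(nrm W (U t))\<^sup>2 = 2 * (\<integral>s. indicator {0<..t} s * ip W (V s) (U s) \<partial>lebesgue)"
    by (simp add: LIMSEQ_const_iff)
qed

lemma primitive_nrm_integrable:
  fixes U V :: "real \<Rightarrow> real^2 \<Rightarrow> 'b::euclidean_space"
  assumes P: "primitive W U V"
  shows "integrable lebesgue (\<lambda>t. indicator {0<..T} t * nrm W (U t))"
proof -
  have c: "continuous_on UNIV (\<lambda>t. nrm W (U t))" by (rule L2_continuous_nrm[OF primitive_L2_continuous[OF P]])
  have "integrable lborel (\<lambda>t. indicator {0..T} t *\<^sub>R nrm W (U t))"
    by (intro borel_integrable_compact continuous_on_subset[OF c]) auto
  then have "integrable lebesgue (\<lambda>t. indicator {0..T} t *\<^sub>R nrm W (U t))"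
    using borel_measurable_continuous_onI[OF c] by (subst integrable_completion) measurable
  from integrable_mult_indicator[OF _ this, of "{0<..T}"]
  have "integrable lebesgue (\<lambda>t. indicator {0<..T} t *\<^sub>R indicator {0..T} t *\<^sub>R nrm W (U t))" by simp
  moreover have "(\<lambda>t. indicator {0<..T} t *\<^sub>R indicator {0..T} t *\<^sub>R nrm W (U t)) = (\<lambda>t. indicator {0<..T} t * nrm W (U t))"
    by (auto simp: indicator_def fun_eq_iff)
  ultimately show ?thesis by (simp only:)
qed

text \<open>With \<open>M = sup \<parallel>U\<parallel>\<close> the energy identity gives \<open>M\<^sup>2 \<le> 2 M \<integral>\<parallel>F\<parallel>\<close>; this is the origin of the factor 2.\<close>

lemma energy_estimate:
  fixes U V F Fd :: "real \<Rightarrow> real^2 \<Rightarrow> 'b::euclidean_space"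
  assumes P: "primitive W U V" and PF: "primitive W F Fd"
    and le: "AE s in lebesgue. s \<in> {0<..<T} \<longrightarrow> ip W (V s) (U s) \<le> ip W (F s) (U s)"
    and t: "t \<le> T"
  shows "nrm W (U t) \<le> 2 * (\<integral>s. indicator {0<..T} s * nrm W (F s) \<partial>lebesgue)"
proof -
  let ?N = "\<integral>s. indicator {0<..T} s * nrm W (F s) \<partial>lebesgue"
  have N0: "0 \<le> ?N" by (rule integral_nonneg_AE) simp
  obtain M0 where M0: "M0 > 0" "\<And>t. nrm W (U t) \<le> M0" using primitive_bounded[OF P] by blast
  define M where "M = (SUP s\<in>{..T}. nrm W (U s))"
  have bdd: "bdd_above ((\<lambda>s. nrm W (U s)) ` {..T})" by (rule bdd_aboveI2[of _ _ M0]) (rule M0(2))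
  have M: "nrm W (U s) \<le> M" if "s \<le> T" for s unfolding M_def using bdd that by (intro cSUP_upper) auto
  have Mpos: "0 \<le> M" using M[OF t] nrm_nonneg order_trans by blast
  have sq: "(nrm W (U s))\<^sup>2 \<le> 2 * M * ?N" if s: "s \<le> T" for s
  proof (cases "s \<le> 0")
    case True then show ?thesis using primitive_zero[OF P True] Mpos N0 by simp
  next
    case False
    then have s0: "0 < s" by simp
    note E = energy_identity[OF P s0]
    have "(\<integral>r. indicator {0<..s} r * ip W (V r) (U r) \<partial>lebesgue) \<le> (\<integral>r. indicator {0<..T} r * nrm W (F r) * M \<partial>lebesgue)"
    proof (rule integral_mono_AE[OF E(1)])
      show "integrable lebesgue (\<lambda>r. indicator {0<..T} r * nrm W (F r) * M)"
        using primitive_nrm_integrable[OF PF, of T] by simp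
      have "AE r in lebesgue. r \<notin> {T}" by (rule AE_not_in) auto
      then show "AE r in lebesgue. indicator {0<..s} r * ip W (V r) (U r) \<le> indicator {0<..T} r * nrm W (F r) * M"
        using le
      proof eventually_elim
        fix r assume rT: "r \<notin> {T}" and l: "r \<in> {0<..<T} \<longrightarrow> ip W (V r) (U r) \<le> ip W (F r) (U r)"
        show "indicator {0<..s} r * ip W (V r) (U r) \<le> indicator {0<..T} r * nrm W (F r) * M"
        proof (cases "r \<in> {0<..s}")
          case True
          then have rI: "r \<in> {0<..<T}" using rT s by auto
          then have "ip W (V r) (U r) \<le> ip W (F r) (U r)" using l by blast
          also have "\<dots> \<le> nrm W (F r) * nrm W (U r)"
            using ip_Cauchy_Schwarz[OF primitiveD(1)[OF PF] primitiveD(1)[OF P], of r r] by simp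
          also have "\<dots> \<le> nrm W (F r) * M" using rI by (intro mult_left_mono M) auto
          finally show ?thesis using True rI by simp
        qed (use Mpos in simp)
      qed
    qed
    then show ?thesis using E(2) by (simp add: mult_ac)
  qed
  have "nrm W (U s) \<le> sqrt (2 * M * ?N)" if "s \<le> T" for s using sq[OF that] by (rule real_le_rsqrt)
  then have "M \<le> sqrt (2 * M * ?N)" unfolding M_def by (intro cSUP_least) auto
  then have "M\<^sup>2 \<le> (sqrt (2 * M * ?N))\<^sup>2" using Mpos by (intro power_mono) auto
  then have "M * M \<le> 2 * ?N * M" using Mpos N0 by (simp add: power2_eq_square mult_ac)
  then have "M \<le> 2 * ?N" using Mpos N0 by (cases "M = 0") (auto simp: mult_le_cancel_right)
  then show ?thesis using M[OF t] by linarith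
qed

section \<open>Time regularity of dissipative evolutions\<close>

lemma AE_lebesgue_shift:
  fixes P :: "real \<Rightarrow> bool"
  assumes "AE t in lebesgue. P t" shows "AE t in lebesgue. P (t - h)"
proof -
  from assms obtain N where N: "N \<in> null_sets lborel" "{t. \<not> P t} \<subseteq> N"
    by (auto simp: eventually_ae_filter null_sets_completion_iff2)
  have "{t. \<not> P (t - h)} \<subseteq> {t. t - h \<in> N}" using N(2) by auto
  moreover have "{t. t - h \<in> N} \<in> null_sets lebesgue"
    using null_sets_translation[OF N(1)] by (rule null_sets_completionI)
  ultimately show ?thesis by (auto simp: eventually_ae_filter)
qed

text \<open>Backward quotients involve only earlier times, so an equation valid up to time \<open>T\<close> is inherited.\<close>

definition diff_quotient :: "real \<Rightarrow> (real \<Rightarrow> 'a \<Rightarrow> 'b::real_vector) \<Rightarrow> real \<Rightarrow> 'a \<Rightarrow> 'b" where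
  "diff_quotient h U t = (\<lambda>x. (1 / h) *\<^sub>R (U t x - U (t - h) x))"

lemma primitive_diff_quotient:
  fixes U V :: "real \<Rightarrow> real^2 \<Rightarrow> 'b::euclidean_space"
  assumes "primitive W U V" "0 < h"
  shows "primitive W (diff_quotient h U) (diff_quotient h V)"
  unfolding diff_quotient_def[abs_def]
  by (rule primitive_scaled_diff[OF assms(1) primitive_shift[OF assms(1)]]) (use assms in simp)

lemma lmeasurable_Ioc: "{a<..b::real} \<in> lmeasurable"
proof (rule fmeasurableI2)
  show "{a..b} \<in> lmeasurable" by simp
  show "{a<..b} \<subseteq> {a..b}" by (simp add: greaterThanAtMost_subseteq_atLeastAtMost_iff)
  show "{a<..b} \<in> sets lebesgue" by simp
qed

lemma cumul_average:
  assumes b: "integrable lebesgue b" and h: "0 < h" and e: "\<And>s. s \<in> {t - h<..t} \<Longrightarrow> \<bar>b s - L\<bar> \<le> e"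
  shows "\<bar>(1 / h) * (cumul b t - cumul b (t - h)) - L\<bar> \<le> e"
proof -
  let ?A = "{t - h<..t}"
  have Ai: "integrable lebesgue (indicat_real ?A)" "(\<integral>s. indicat_real ?A s \<partial>lebesgue) = h"
  proof -
    have "?A \<in> lmeasurable" by (rule lmeasurable_Ioc)
    then show "integrable lebesgue (indicat_real ?A)" using lmeasurable_iff_integrable by blast
    show "(\<integral>s. indicat_real ?A s \<partial>lebesgue) = h" using h by (simp add: measure_def)
  qed
  have bi: "integrable lebesgue (\<lambda>s. indicator ?A s * b s)" by (rule integrable_indicator_mult[OF b]) simp
  have eq: "cumul b t - cumul b (t - h) - h * L = (\<integral>s. indicator ?A s * b s - indicator ?A s * L \<partial>lebesgue)"
    using cumul_diff[OF b, of "t - h" t] h bi Ai by simp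
  have "\<bar>cumul b t - cumul b (t - h) - h * L\<bar> \<le> (\<integral>s. \<bar>indicator ?A s * b s - indicator ?A s * L\<bar> \<partial>lebesgue)"
    unfolding eq by (rule integral_abs_bound)
  also have "\<dots> \<le> (\<integral>s. indicator ?A s * e \<partial>lebesgue)"
  proof (rule integral_mono)
    show "integrable lebesgue (\<lambda>s. \<bar>indicator ?A s * b s - indicator ?A s * L\<bar>)" using bi Ai by simp
    show "integrable lebesgue (\<lambda>s. indicator ?A s * e)" using Ai by simp
    show "\<bar>indicator ?A s * b s - indicator ?A s * L\<bar> \<le> indicator ?A s * e" for s
      using e[of s] by (auto simp: indicator_def)
  qed
  also have "\<dots> = h * e" using Ai by simp
  finally have le: "\<bar>cumul b t - cumul b (t - h) - h * L\<bar> \<le> h * e" .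
  have "(1 / h) * (cumul b t - cumul b (t - h)) - L = (cumul b t - cumul b (t - h) - h * L) / h"
    using h by (simp add: field_simps)
  then have "\<bar>(1 / h) * (cumul b t - cumul b (t - h)) - L\<bar> = \<bar>cumul b t - cumul b (t - h) - h * L\<bar> / h"
    using h by (simp add: abs_divide)
  also have "\<dots> \<le> e" using le h by (simp add: divide_le_eq mult.commute)
  finally show ?thesis .
qed

lemma diff_quotient_near:
  fixes F Fd :: "real \<Rightarrow> real^2 \<Rightarrow> 'b::euclidean_space"
  assumes P: "primitive W F Fd" and h: "0 < h" and e: "0 \<le> e"
    and near: "\<And>s. s \<in> {t - h<..t} \<Longrightarrow> dst W (Fd s) (Fd t) \<le> e"
  shows "dst W (diff_quotient h F t) (Fd t) \<le> e"
proof -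
  let ?D = "\<lambda>x. diff_quotient h F t x - Fd t x"
  have qL: "diff_quotient h F t \<in> L2 W" unfolding diff_quotient_def by (intro L2_scale L2_diff primitiveD[OF P])
  have dL: "?D \<in> L2 W" by (intro L2_diff qL primitiveD[OF P])
  let ?b = "\<lambda>s. ip W (Fd s) ?D"
  have eq: "ip W ?D ?D = (1 / h) * (cumul ?b t - cumul ?b (t - h)) - ip W (Fd t) ?D"
    unfolding ip_diff_left[OF qL primitiveD(2)[OF P] dL]
    by (simp add: diff_quotient_def ip_scale_left ip_diff_left primitiveD(1)[OF P] dL[unfolded diff_quotient_def])
       (simp add: primitiveD(5)[OF P dL[unfolded diff_quotient_def]])
  have le: "\<bar>(1 / h) * (cumul ?b t - cumul ?b (t - h)) - ip W (Fd t) ?D\<bar> \<le> e * nrm W ?D"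
  proof (rule cumul_average[OF primitive_ip_integrable[OF P dL] h])
    fix s assume s: "s \<in> {t - h<..t}"
    have "\<bar>ip W (Fd s) ?D - ip W (Fd t) ?D\<bar> \<le> dst W (Fd s) (Fd t) * nrm W ?D"
      using ip_Cauchy_Schwarz[OF L2_diff[OF primitiveD(2)[OF P] primitiveD(2)[OF P]] dL, of s t]
      by (simp add: ip_diff_left primitiveD(2)[OF P] dL)
    also have "\<dots> \<le> e * nrm W ?D" by (intro mult_right_mono near s) simp
    finally show "\<bar>ip W (Fd s) ?D - ip W (Fd t) ?D\<bar> \<le> e * nrm W ?D" .
  qed
  have "(nrm W ?D)\<^sup>2 \<le> e * nrm W ?D" unfolding nrm_sq eq using le by linarith
  then have "nrm W ?D * nrm W ?D \<le> e * nrm W ?D" by (simp add: power2_eq_square)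
  then show ?thesis using e nrm_nonneg[of W ?D] by (cases "nrm W ?D = 0") (auto simp: mult_le_cancel_right)
qed

lemma indicator_continuous_measurable:
  fixes f :: "real \<Rightarrow> real"
  assumes "continuous_on {0<..T} f" shows "(\<lambda>s. indicator {0<..T} s * f s) \<in> borel_measurable lebesgue"
proof -
  have "(\<lambda>s. indicator {0<..T} s *\<^sub>R f s) \<in> borel_measurable borel"
    by (rule borel_measurable_continuous_on_indicator[OF _ assms]) simp
  then show ?thesis by (simp add: measurable_completion)
qed

lemma indicator_bounded_integrable:
  fixes f :: "real \<Rightarrow> real"
  assumes m: "(\<lambda>s. indicator {0<..T} s * f s) \<in> borel_measurable lebesgue" and B: "\<And>s. s \<in> {0<..T} \<Longrightarrow> \<bar>f s\<bar> \<le> B"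
  shows "integrable lebesgue (\<lambda>s. indicator {0<..T} s * f s)"
proof (rule Bochner_Integration.integrable_bound[OF _ m])
  have "{0<..T} \<in> lmeasurable" by (rule lmeasurable_Ioc)
  then have "integrable lebesgue (indicat_real {0<..T})" using lmeasurable_iff_integrable by blast
  then show "integrable lebesgue (\<lambda>s. indicator {0<..T} s * B)" by simp
  show "AE s in lebesgue. norm (indicator {0<..T} s * f s) \<le> norm (indicator {0<..T} s * B)"
    using B by (intro AE_I2) (force simp: indicator_def)
qed

text \<open>The quotient at \<open>s\<close> is an average of \<open>Fd\<close> over \<open>(s - h, s]\<close>. For fixed \<open>s > 0\<close> and small \<open>h\<close> it is
close to \<open>Fd s\<close>. Nothing is claimed for \<open>s < h\<close>, where the average crosses a possible jump of \<open>Fd\<close> at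
\<open>0\<close>; there the uniform bound \<open>2 K\<close> suffices for convergence of the integrals.\<close>

lemma diff_quotients_converge_in_mean:
  fixes F Fd :: "real \<Rightarrow> real^2 \<Rightarrow> 'b::euclidean_space"
  assumes P: "primitive W F Fd" and K: "\<And>t. nrm W (Fd t) \<le> K"
    and c: "L2_continuous W {0<..T} Fd"
  defines "e n \<equiv> (\<integral>s. indicator {0<..T} s * dst W (diff_quotient (1 / real (Suc n)) F s) (Fd s) \<partial>lebesgue)"
  shows "\<And>n. integrable lebesgue (\<lambda>s. indicator {0<..T} s * dst W (diff_quotient (1 / real (Suc n)) F s) (Fd s))"
    and "e \<longlonglongrightarrow> 0"
proof -
  let ?q = "\<lambda>n. diff_quotient (1 / real (Suc n)) F"
  let ?f = "\<lambda>n s. dst W (?q n s) (Fd s)"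
  have hp: "0 < 1 / real (Suc n)" for n by simp
  have K0: "0 \<le> K" using K[of 0] nrm_nonneg order_trans by blast
  have le: "?f n s \<le> 2 * K" for n s
  proof (rule diff_quotient_near[OF P hp])
    show "dst W (Fd r) (Fd s) \<le> 2 * K" for r
      using nrm_triangle_diff[OF primitiveD(2)[OF P] primitiveD(2)[OF P], of r s] K[of r] K[of s] by linarith
  qed (use K0 in simp)
  have m: "(\<lambda>s. indicator {0<..T} s * ?f n s) \<in> borel_measurable lebesgue" for n
    by (intro indicator_continuous_measurable L2_continuous_nrm L2_continuous_diff c
        L2_continuous_subset[OF primitive_L2_continuous[OF primitive_diff_quotient[OF P hp]]]) simp
  show int: "integrable lebesgue (\<lambda>s. indicator {0<..T} s * ?f n s)" for n
    by (rule indicator_bounded_integrable[OF m, of _ "2 * K"]) (use le in simp)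
  have lim: "(\<lambda>n. indicator {0<..T} s * ?f n s) \<longlonglongrightarrow> 0" for s
  proof (cases "s \<in> {0<..T}")
    case True
    have "(\<lambda>n. ?f n s) \<longlonglongrightarrow> 0"
    proof (rule LIMSEQ_I)
      fix r :: real assume r: "0 < r"
      have "((\<lambda>u. dst W (Fd u) (Fd s)) \<longlongrightarrow> 0) (at s within {0<..T})"
        using c True by (simp add: L2_continuous_def)
      then have "\<forall>\<^sub>F u in at s within {0<..T}. dst W (Fd u) (Fd s) < r / 2"
        using r by (intro order_tendstoD) auto
      then obtain d where d: "d > 0" "\<And>u. u \<in> {0<..T} \<Longrightarrow> u \<noteq> s \<Longrightarrow> dist u s < d \<Longrightarrow> dst W (Fd u) (Fd s) < r / 2"
        unfolding eventually_at by blast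
      \<comment> \<open>a step below \<open>s\<close> keeps the average away from negative times\<close>
      obtain N where N: "1 / real (Suc N) < min d s" using nat_approx_posE[of "min d s"] d(1) True by auto
      have "?f n s \<le> r / 2" if n: "n \<ge> N" for n
      proof (rule diff_quotient_near[OF P hp])
        fix u assume u: "u \<in> {s - 1 / real (Suc n)<..s}"
        have "1 / real (Suc n) \<le> 1 / real (Suc N)" using n by (intro divide_left_mono) auto
        then have "u > 0" "u > s - d" "u \<le> s" using u N by auto
        then show "dst W (Fd u) (Fd s) \<le> r / 2"
          using d(2)[of u] True r by (cases "u = s") (auto simp: dist_real_def)
      qed (use r in simp)
      then show "\<exists>no. \<forall>n\<ge>no. norm (?f n s - 0) < r" using r
        by (intro exI[of _ N] allI impI) (smt (verit) field_sum_of_halves nrm_nonneg real_norm_def)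
    qed
    then show ?thesis using True by simp
  qed simp
  have "(\<lambda>n. \<integral>s. indicator {0<..T} s * ?f n s \<partial>lebesgue) \<longlonglongrightarrow> (\<integral>s. 0 \<partial>(lebesgue::real measure))"
  proof (rule integral_dominated_convergence[where f="\<lambda>_. 0" and w="\<lambda>s. indicator {0<..T} s * (2 * K)"])
    show "(\<lambda>s. indicator {0<..T} s * ?f n s) \<in> borel_measurable lebesgue" for n by (rule m)
    show "AE s in lebesgue. (\<lambda>n. indicator {0<..T} s * ?f n s) \<longlonglongrightarrow> 0" by (intro AE_I2 lim)
    show "integrable lebesgue (\<lambda>s. indicator {0<..T} s * (2 * K))"
      by (rule indicator_bounded_integrable[of _ _ "2 * K"]) (use K0 in \<open>auto intro!: borel_measurable_times borel_measurable_indicator\<close>)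
    show "AE s in lebesgue. norm (indicator {0<..T} s * ?f n s) \<le> indicator {0<..T} s * (2 * K)" for n
      using le by (intro AE_I2) (simp add: indicator_def)
  qed simp
  then show "e \<longlonglongrightarrow> 0" by (simp add: e_def[abs_def])
qed

lemma L2_continuous_separable:
  fixes V :: "real \<Rightarrow> real^2 \<Rightarrow> 'b::euclidean_space"
  assumes V: "L2_continuous W {..T} V"
  obtains G where "countable G" "G \<subseteq> L2 W" "\<And>t. t \<le> T \<Longrightarrow> approximable W G (V t)"
proof
  let ?G = "V ` (\<rat> \<inter> {..T})"
  show "countable ?G" using countable_rat by (intro countable_image countable_Int1)
  show "?G \<subseteq> L2 W" using V by (auto simp: L2_continuous_def)
  fix t assume t: "t \<le> T"
  show "approximable W ?G (V t)" unfolding approximable_def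
  proof (intro allI impI)
    fix e :: real assume e: "e > 0"
    have "((\<lambda>u. dst W (V u) (V t)) \<longlongrightarrow> 0) (at t within {..T})"
      using V t by (simp add: L2_continuous_def)
    then have "\<forall>\<^sub>F u in at t within {..T}. dst W (V u) (V t) < e"
      using e by (intro order_tendstoD) auto
    then obtain d where d: "d > 0" "\<And>u. u \<in> {..T} \<Longrightarrow> u \<noteq> t \<Longrightarrow> dist u t < d \<Longrightarrow> dst W (V u) (V t) < e"
      unfolding eventually_at by blast
    obtain q where q: "q \<in> \<rat>" "t - d < q" "q < t" using Rats_dense_in_real[of "t - d" t] d(1) by auto
    then have "dst W (V q) (V t) < e" using d(2)[of q] t by (auto simp: dist_real_def)
    then have "dst W (V t) (V q) < e" by (subst nrm_minus_commute)
    then show "\<exists>h\<in>?G. dst W (V t) h < e" using q t by (intro bexI[of _ "V q"]) auto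
  qed
qed


text \<open>Integrating the difference quotient of the scalar function \<open>\<langle>U, g\<rangle>\<close> up to time \<open>t\<close> gives its average
over \<open>(t - h, t]\<close>, which tends to \<open>\<langle>U(t), g\<rangle>\<close>. So \<open>\<langle>V', g\<rangle>\<close> and \<open>\<langle>V, g\<rangle>\<close> have the same integral up to
every time \<open>t \<le> T\<close>.\<close>

lemma diff_quotients_limit_ip:
  fixes U V V' :: "real \<Rightarrow> real^2 \<Rightarrow> 'b::euclidean_space"
  assumes PU: "primitive W U V" and hp: "\<And>n. 0 < h n" and h0: "h \<longlonglongrightarrow> 0"
    and V': "\<And>t. t \<le> T \<Longrightarrow> V' t \<in> L2 W"
      "\<And>t. t \<le> T \<Longrightarrow> (\<lambda>n. dst W (diff_quotient (h n) U t) (V' t)) \<longlonglongrightarrow> 0"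
    and bound: "\<And>n t. t \<le> T \<Longrightarrow> nrm W (diff_quotient (h n) U t) \<le> M" and g: "g \<in> L2 W"
  shows "AE t in lebesgue. t \<le> T \<longrightarrow> ip W (V t) g = ip W (V' t) g"
proof -
  note PDU = primitive_diff_quotient[OF PU hp]
  have DL: "diff_quotient (h n) U t \<in> L2 W" for n t by (rule primitiveD(1)[OF PDU])
  let ?A = "\<lambda>f s. indicator {..T} s * f s :: real"
  let ?v = "\<lambda>s. ip W (V s) g" and ?v' = "\<lambda>s. ip W (V' s) g" and ?d = "\<lambda>n s. ip W (diff_quotient (h n) U s) g" and ?a = "\<lambda>s. ip W (U s) g"
  note vi = integrable_indicator_mult[OF primitive_ip_integrable[OF PU g], of "{..T}"]
  have zero: "?d n s = 0" if "s \<le> 0" for n s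
    using ip_Cauchy_Schwarz[OF DL g, of n s] primitive_zero[OF PDU that, of n] by simp
  define C where "C = M * nrm W g"
  have dC: "\<bar>?d n s\<bar> \<le> C" if s: "s \<le> T" for n s
  proof -
    have "\<bar>?d n s\<bar> \<le> nrm W (diff_quotient (h n) U s) * nrm W g" by (rule ip_Cauchy_Schwarz[OF DL g])
    also have "\<dots> \<le> C" unfolding C_def using bound[OF s, of n] by (intro mult_right_mono) auto
    finally show ?thesis .
  qed
  have dlim: "(\<lambda>n. ?d n s) \<longlonglongrightarrow> ?v' s" if "s \<le> T" for s
    by (rule tendsto_ip[OF DL V'(1)[OF that] g V'(2)[OF that]])
  have ptw: "(\<lambda>n. indicator {0<..T} s * ?d n s) \<longlonglongrightarrow> ?A ?v' s" for s
  proof (cases "s \<le> T")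
    case True
    have "(\<lambda>n. indicator {0<..T} s * ?d n s) = (\<lambda>n. ?d n s)" using True zero by (auto simp: indicator_def fun_eq_iff)
    then show ?thesis using dlim[OF True] True by simp
  qed simp
  have dcont: "continuous_on A (?d n)" for n A
    by (rule continuous_on_subset[OF L2_continuous_ip[OF primitive_L2_continuous[OF PDU] g]]) simp
  have dm: "(\<lambda>s. indicator {0<..T} s * ?d n s) \<in> borel_measurable lebesgue" for n
    by (rule indicator_continuous_measurable[OF dcont])
  have v'm: "?A ?v' \<in> borel_measurable lebesgue" by (rule borel_measurable_LIMSEQ_real[OF ptw dm])
  have wi: "integrable lebesgue (\<lambda>s. indicator {0<..T} s * C)"
  proof -
    have "integrable lebesgue (indicat_real {0<..T})" using lmeasurable_iff_integrable lmeasurable_Ioc by blast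
    then show ?thesis by simp
  qed
  have dbound: "\<bar>indicator {0<..T} s * ?d n s\<bar> \<le> indicator {0<..T} s * C" for n s
    using dC[of s n] by (auto simp: indicator_def)
  have v'i: "integrable lebesgue (?A ?v')"
    by (rule integrable_dominated_convergence[OF v'm dm wi AE_I2[OF ptw]]) (use dbound in \<open>intro AE_I2; simp\<close>)
  have ai: "integrable lebesgue (\<lambda>s. indicator {0<..T} s * ?a s)"
  proof -
    obtain N where N: "N > 0" "\<And>t. nrm W (U t) \<le> N" using primitive_bounded[OF PU] by blast
    have "continuous_on {0<..T} ?a" by (rule continuous_on_subset[OF L2_continuous_ip[OF primitive_L2_continuous[OF PU] g]]) simp
    moreover have "\<bar>?a s\<bar> \<le> N * nrm W g" for s
      using ip_Cauchy_Schwarz[OF primitiveD(1)[OF PU] g, of s] mult_right_mono[OF N(2)[of s], of "nrm W g"] by simp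
    ultimately show ?thesis by (intro indicator_bounded_integrable[OF indicator_continuous_measurable])
  qed
  let ?b = "\<lambda>s. indicator {0<..T} s * ?a s"
  have az: "?a s = 0" if "s \<le> 0" for s
    using ip_Cauchy_Schwarz[OF primitiveD(1)[OF PU] g, of s] primitive_zero[OF PU that] by simp
  have avg: "cumul (\<lambda>s. indicator {0<..T} s * ?d n s) t = (1 / h n) * (cumul ?b t - cumul ?b (t - h n))" if t: "t \<le> T" for n t
  proof -
    have shi: "integrable lebesgue (\<lambda>s. ?b (s - h n))"
      using lebesgue_integrable_real_affine[OF ai, of 1 "- h n"] by simp
    have sh: "cumul ?b (t - h n) = cumul (\<lambda>s. ?b (s - h n)) t"
    proof -
      have "cumul ?b (t - h n) = (\<integral>s. indicator {..t - h n} (s - h n) * ?b (s - h n) \<partial>lebesgue)"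
        unfolding cumul_def using lebesgue_integral_real_affine[of 1 "\<lambda>s. indicator {..t - h n} s * ?b s" "- h n"] by simp
      then show ?thesis unfolding cumul_def
        by (simp add: indicator_def algebra_simps)
    qed
    have "cumul (\<lambda>s. indicator {0<..T} s * ?d n s) t = cumul (\<lambda>s. (1 / h n) * (?b s - ?b (s - h n))) t"
      unfolding cumul_def
    proof (rule Bochner_Integration.integral_cong[OF refl])
      fix s
      have dd: "?d n s = (1 / h n) * (?a s - ?a (s - h n))"
        by (simp add: diff_quotient_def ip_scale_left ip_diff_left primitiveD(1)[OF PU] g)
      show "indicator {..t} s * (indicator {0<..T} s * ?d n s) = indicator {..t} s * ((1 / h n) * (?b s - ?b (s - h n)))"
      proof (cases "s \<le> t")
        case True
        then have s: "s \<le> T" "s - h n \<le> T" using t hp[of n] by auto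
        have b1: "?b s = ?a s" using s az[of s] by (auto simp: indicator_def)
        have b2: "?b (s - h n) = ?a (s - h n)" using s az[of "s - h n"] by (auto simp: indicator_def)
        have b3: "indicator {0<..T} s * ?d n s = ?d n s" using s zero[of s n] by (auto simp: indicator_def)
        show ?thesis unfolding b3 b1 b2 unfolding dd ..
      qed simp
    qed
    then show ?thesis using cumul_scaled_diff[OF ai shi, of "1 / h n" t] sh by simp
  qed
  have eq1: "cumul (?A ?v') t = ?a t" if t: "t \<le> T" for t
  proof -
    have "(\<lambda>n. cumul (\<lambda>s. indicator {0<..T} s * ?d n s) t) \<longlonglongrightarrow> cumul (?A ?v') t"
      unfolding cumul_def
    proof (rule integral_dominated_convergence[where w="\<lambda>s. indicator {0<..T} s * C"])
      show "(\<lambda>s. indicator {..t} s * (?A ?v' s)) \<in> borel_measurable lebesgue"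
        by (intro borel_measurable_times borel_measurable_indicator v'm) simp
      show "(\<lambda>s. indicator {..t} s * (indicator {0<..T} s * ?d n s)) \<in> borel_measurable lebesgue" for n
        by (intro borel_measurable_times[OF borel_measurable_indicator dm]) simp
      show "AE s in lebesgue. (\<lambda>n. indicator {..t} s * (indicator {0<..T} s * ?d n s)) \<longlonglongrightarrow> indicator {..t} s * (?A ?v' s)"
        by (intro AE_I2 tendsto_mult_left ptw)
      have "\<bar>indicator {..t} s * (indicator {0<..T} s * ?d n s)\<bar> \<le> indicator {0<..T} s * C" for n s
        using dbound[of s n] dC[of s n] by (cases "s \<le> t"; cases "s \<in> {0<..T}") auto
      then show "AE s in lebesgue. norm (indicator {..t} s * (indicator {0<..T} s * ?d n s)) \<le> indicator {0<..T} s * C" for n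
        by (intro AE_I2) simp
    qed (rule wi)
    moreover have "(\<lambda>n. cumul (\<lambda>s. indicator {0<..T} s * ?d n s) t) \<longlonglongrightarrow> ?a t"
    proof (rule LIMSEQ_I)
      fix r :: real assume r: "0 < r"
      have "isCont ?a t" using L2_continuous_ip[OF primitive_L2_continuous[OF PU] g] by (simp add: continuous_on_eq_continuous_at)
      then obtain d where d: "d > 0" "\<And>s. dist s t < d \<Longrightarrow> dist (?a s) (?a t) < r / 2"
        using r unfolding continuous_at_eps_delta by (metis half_gt_zero)
      obtain N where N: "\<And>n. n \<ge> N \<Longrightarrow> \<bar>h n\<bar> < d" using LIMSEQ_D[OF h0 d(1)] by auto
      have "\<bar>(1 / h n) * (cumul ?b t - cumul ?b (t - h n)) - ?a t\<bar> \<le> r / 2" if n: "n \<ge> N" for n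
      proof (rule cumul_average[OF ai hp])
        fix s assume s: "s \<in> {t - h n<..t}"
        then have "dist s t < d" using N[OF n] by (auto simp: dist_real_def)
        then have "\<bar>?a s - ?a t\<bar> \<le> r / 2" using d(2)[of s] by (simp add: dist_real_def)
        moreover have "?b s = ?a s" using s t az[of s] by (auto simp: indicator_def)
        ultimately show "\<bar>?b s - ?a t\<bar> \<le> r / 2" by (simp only:)
      qed
      then show "\<exists>no. \<forall>n\<ge>no. norm (cumul (\<lambda>s. indicator {0<..T} s * ?d n s) t - ?a t) < r"
        unfolding avg[OF t] using r by (intro exI[of _ N] allI impI) (smt (verit) field_sum_of_halves real_norm_def)
    qed
    ultimately show ?thesis by (rule LIMSEQ_unique)
  qed
  have cT: "cumul (?A f) t = cumul (?A f) (min t T)" for f t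
    unfolding cumul_def by (intro Bochner_Integration.integral_cong) (auto simp: indicator_def)
  have eq2: "cumul (?A ?v) t = ?a t" if t: "t \<le> T" for t
  proof -
    have "cumul (?A ?v) t = cumul ?v t"
      unfolding cumul_def by (intro Bochner_Integration.integral_cong) (use t in \<open>auto simp: indicator_def\<close>)
    then show ?thesis using primitiveD(5)[OF PU g] by simp
  qed
  have "AE s in lebesgue. ?A ?v s = ?A ?v' s"
  proof (rule cumul_eq_imp_AE_eq[OF vi v'i])
    show "cumul (?A ?v) t = cumul (?A ?v') t" for t
      using eq1[of "min t T"] eq2[of "min t T"] cT[of ?v t] cT[of ?v' t] by simp
  qed simp
  then show ?thesis by eventually_elim auto
qed

text \<open>The null set in the assumption depends on \<open>g\<close>; separability reduces the matter to countably many \<open>g\<close>.\<close>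

lemma AE_eq_of_AE_ip_eq:
  fixes V V' :: "real \<Rightarrow> real^2 \<Rightarrow> 'b::euclidean_space"
  assumes G: "countable G" "G \<subseteq> L2 W" "AE t in lebesgue. Q t \<longrightarrow> approximable W G (V t)"
    and H: "countable H" "H \<subseteq> L2 W" "AE t in lebesgue. Q t \<longrightarrow> approximable W H (V' t)"
    and L: "\<And>t. Q t \<Longrightarrow> V t \<in> L2 W" "\<And>t. Q t \<Longrightarrow> V' t \<in> L2 W"
    and eq: "\<And>g. g \<in> L2 W \<Longrightarrow> AE t in lebesgue. Q t \<longrightarrow> ip W (V t) g = ip W (V' t) g"
  shows "AE t in lebesgue. Q t \<longrightarrow> dst W (V t) (V' t) = 0"
proof -
  let ?G = "(\<lambda>(a, b) x. a x - b x) ` (G \<times> H)"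
  have GL: "?G \<subseteq> L2 W" using G(2) H(2) by (auto intro!: L2_diff)
  have "AE t in lebesgue. \<forall>g\<in>?G. Q t \<longrightarrow> ip W (V t) g = ip W (V' t) g"
  proof (subst AE_ball_countable)
    show "countable ?G" using G(1) H(1) by simp
    show "\<forall>g\<in>?G. AE t in lebesgue. Q t \<longrightarrow> ip W (V t) g = ip W (V' t) g" using eq GL by blast
  qed
  then show ?thesis using G(3) H(3)
  proof eventually_elim
    fix t assume 1: "\<forall>g\<in>?G. Q t \<longrightarrow> ip W (V t) g = ip W (V' t) g"
      and 2: "Q t \<longrightarrow> approximable W G (V t)" and 3: "Q t \<longrightarrow> approximable W H (V' t)"
    show "Q t \<longrightarrow> dst W (V t) (V' t) = 0"
    proof
      assume t: "Q t"
      have "dst W (V t) (V' t) \<le> 0"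
      proof (rule approximable_bound[OF L2_diff[OF L(1)[OF t] L(2)[OF t]] GL])
        show "approximable W ?G (\<lambda>x. V t x - V' t x)"
          using 2 3 t by (intro approximable_diff G(2) H(2) L[OF t]) blast+
        fix g assume g: "g \<in> ?G"
        then have gL: "g \<in> L2 W" using GL by blast
        have "ip W (V t) g = ip W (V' t) g" using 1 g t by blast
        then show "ip W (\<lambda>x. V t x - V' t x) g \<le> 0 * nrm W g"
          by (simp add: ip_diff_left[OF L(1)[OF t] L(2)[OF t] gL])
      qed simp
      then show "dst W (V t) (V' t) = 0" by (simp add: order_antisym)
    qed
  qed
qed

text \<open>The relation \<open>rel u v f\<close> abstracts the equation ``\<open>v\<close> is the time derivative of the
state \<open>u\<close> under the source \<open>f\<close>'': it is linear and dissipative. The difference quotients of \<open>U\<close>,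
and their differences, satisfy the equation with the corresponding combinations of \<open>F\<close> as sources.
The energy estimate therefore bounds \<open>D\<^sub>n U - D\<^sub>m U\<close>, uniformly in time, by the mean of
\<open>D\<^sub>n F - D\<^sub>m F\<close>, which is small since \<open>D\<^sub>n F\<close> converges to \<open>Fd\<close>. The uniform limit \<open>V'\<close> is continuous,
inherits the bound, and coincides with \<open>V\<close>.\<close>

lemma dissipative_evolution_time_derivative:
  fixes U V F Fd :: "real \<Rightarrow> real^2 \<Rightarrow> 'b::euclidean_space"
    and rel :: "(real^2 \<Rightarrow> 'b) \<Rightarrow> (real^2 \<Rightarrow> 'b) \<Rightarrow> (real^2 \<Rightarrow> 'b) \<Rightarrow> bool"
  assumes PU: "primitive W U V" and PF: "primitive W F Fd"
    and K: "\<And>t. nrm W (Fd t) \<le> K" and Fc: "L2_continuous W {0<..T} Fd"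
    and lin: "\<And>u v f u' v' f' c. rel u v f \<Longrightarrow> rel u' v' f' \<Longrightarrow>
      rel (\<lambda>x. c *\<^sub>R (u x - u' x)) (\<lambda>x. c *\<^sub>R (v x - v' x)) (\<lambda>x. c *\<^sub>R (f x - f' x))"
    and diss: "\<And>u v f. rel u v f \<Longrightarrow> ip W v u \<le> ip W f u"
    and ae: "AE t in lebesgue. t < T \<longrightarrow> rel (U t) (V t) (F t)"
    and G: "countable G" "G \<subseteq> L2 W" "AE t in lebesgue. t < T \<longrightarrow> approximable W G (V t)"
  obtains V' where "L2_continuous W {..T} V'" "AE t in lebesgue. t < T \<longrightarrow> dst W (V t) (V' t) = 0"
    "\<And>t. t \<le> T \<Longrightarrow> nrm W (V' t) \<le> 2 * (\<integral>s. indicator {0<..T} s * nrm W (Fd s) \<partial>lebesgue)"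
proof -
  define h where "h n = 1 / real (Suc n)" for n
  have hp: "0 < h n" for n by (simp add: h_def)
  have h0: "h \<longlonglongrightarrow> 0" unfolding h_def[abs_def] using LIMSEQ_inverse_real_of_nat by (simp add: inverse_eq_divide)
  let ?DU = "\<lambda>n. diff_quotient (h n) U" and ?DV = "\<lambda>n. diff_quotient (h n) V"
  let ?DF = "\<lambda>n. diff_quotient (h n) F" and ?DG = "\<lambda>n. diff_quotient (h n) Fd"
  note PDU = primitive_diff_quotient[OF PU hp] and PDF = primitive_diff_quotient[OF PF hp]
  \<comment> \<open>the equation holds at almost every \<open>t\<close>, hence at almost every \<open>t - h n\<close>\<close>
  have relD: "AE t in lebesgue. t < T \<longrightarrow> rel (?DU n t) (?DV n t) (?DF n t)" for n
    using ae AE_lebesgue_shift[OF ae, of "h n"]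
  proof eventually_elim
    fix t assume 1: "t < T \<longrightarrow> rel (U t) (V t) (F t)" and 2: "t - h n < T \<longrightarrow> rel (U (t - h n)) (V (t - h n)) (F (t - h n))"
    show "t < T \<longrightarrow> rel (?DU n t) (?DV n t) (?DF n t)"
    proof
      assume "t < T"
      then have "rel (U t) (V t) (F t)" "rel (U (t - h n)) (V (t - h n)) (F (t - h n))" using 1 2 hp[of n] by auto
      then show "rel (?DU n t) (?DV n t) (?DF n t)" unfolding diff_quotient_def by (rule lin)
    qed
  qed
  define e where "e n = (\<integral>s. indicator {0<..T} s * dst W (?DF n s) (Fd s) \<partial>lebesgue)" for n
  have ei: "integrable lebesgue (\<lambda>s. indicator {0<..T} s * dst W (?DF n s) (Fd s))" for n
    unfolding h_def by (rule diff_quotients_converge_in_mean(1)[OF PF K Fc])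
  have e0: "e \<longlonglongrightarrow> 0"
    unfolding e_def[abs_def] h_def by (rule diff_quotients_converge_in_mean(2)[OF PF K Fc])
  have epos: "0 \<le> e n" for n unfolding e_def by (rule integral_nonneg_AE) simp
  define J where "J = (\<integral>s. indicator {0<..T} s * nrm W (Fd s) \<partial>lebesgue)"
  have Ji: "integrable lebesgue (\<lambda>s. indicator {0<..T} s * nrm W (Fd s))"
    by (rule indicator_bounded_integrable[OF indicator_continuous_measurable[OF L2_continuous_nrm[OF Fc]], of K]) (use K in simp)
  have DL: "?DU n t \<in> L2 W" for n t by (rule primitiveD(1)[OF PDU])
  have DFL: "?DF n t \<in> L2 W" for n t by (rule primitiveD(1)[OF PDF])
  have FdL: "Fd t \<in> L2 W" for t by (rule primitiveD(2)[OF PF])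
  have diffU: "dst W (?DU n t) (?DU m t) \<le> 2 * (e n + e m)" if t: "t \<le> T" for n m t
  proof -
    have P1: "primitive W (\<lambda>t x. 1 *\<^sub>R (?DU n t x - ?DU m t x)) (\<lambda>t x. 1 *\<^sub>R (?DV n t x - ?DV m t x))"
      by (rule primitive_scaled_diff[OF PDU PDU])
    have P2: "primitive W (\<lambda>t x. 1 *\<^sub>R (?DF n t x - ?DF m t x)) (\<lambda>t x. 1 *\<^sub>R (?DG n t x - ?DG m t x))"
      by (rule primitive_scaled_diff[OF PDF PDF])
    have "nrm W (\<lambda>x. 1 *\<^sub>R (?DU n t x - ?DU m t x)) \<le> 2 * (\<integral>s. indicator {0<..T} s * nrm W (\<lambda>x. 1 *\<^sub>R (?DF n s x - ?DF m s x)) \<partial>lebesgue)"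
    proof (rule energy_estimate[OF P1 P2 _ t])
      show "AE s in lebesgue. s \<in> {0<..<T} \<longrightarrow>
        ip W (\<lambda>x. 1 *\<^sub>R (?DV n s x - ?DV m s x)) (\<lambda>x. 1 *\<^sub>R (?DU n s x - ?DU m s x))
        \<le> ip W (\<lambda>x. 1 *\<^sub>R (?DF n s x - ?DF m s x)) (\<lambda>x. 1 *\<^sub>R (?DU n s x - ?DU m s x))"
        using relD[of n] relD[of m]
      proof eventually_elim
        fix s assume 1: "s < T \<longrightarrow> rel (?DU n s) (?DV n s) (?DF n s)" and 2: "s < T \<longrightarrow> rel (?DU m s) (?DV m s) (?DF m s)"
        show "s \<in> {0<..<T} \<longrightarrow> ip W (\<lambda>x. 1 *\<^sub>R (?DV n s x - ?DV m s x)) (\<lambda>x. 1 *\<^sub>R (?DU n s x - ?DU m s x))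
        \<le> ip W (\<lambda>x. 1 *\<^sub>R (?DF n s x - ?DF m s x)) (\<lambda>x. 1 *\<^sub>R (?DU n s x - ?DU m s x))"
        proof
          assume "s \<in> {0<..<T}"
          then have "rel (?DU n s) (?DV n s) (?DF n s)" "rel (?DU m s) (?DV m s) (?DF m s)" using 1 2 by auto
          from diss[OF lin[OF this, of 1]]
          show "ip W (\<lambda>x. 1 *\<^sub>R (?DV n s x - ?DV m s x)) (\<lambda>x. 1 *\<^sub>R (?DU n s x - ?DU m s x))
            \<le> ip W (\<lambda>x. 1 *\<^sub>R (?DF n s x - ?DF m s x)) (\<lambda>x. 1 *\<^sub>R (?DU n s x - ?DU m s x))" .
        qed
      qed
    qed
    moreover have "(\<integral>s. indicator {0<..T} s * nrm W (\<lambda>x. 1 *\<^sub>R (?DF n s x - ?DF m s x)) \<partial>lebesgue)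
      \<le> (\<integral>s. indicator {0<..T} s * dst W (?DF n s) (Fd s) + indicator {0<..T} s * dst W (?DF m s) (Fd s) \<partial>lebesgue)"
    proof (rule integral_mono[OF primitive_nrm_integrable[OF P2]])
      show "integrable lebesgue (\<lambda>s. indicator {0<..T} s * dst W (?DF n s) (Fd s) + indicator {0<..T} s * dst W (?DF m s) (Fd s))"
        by (intro Bochner_Integration.integrable_add ei)
      show "indicator {0<..T} s * nrm W (\<lambda>x. 1 *\<^sub>R (?DF n s x - ?DF m s x)) \<le>
        indicator {0<..T} s * dst W (?DF n s) (Fd s) + indicator {0<..T} s * dst W (?DF m s) (Fd s)" for s
        using nrm_triangle3[OF DFL[of n s] FdL[of s] DFL[of m s]] nrm_minus_commute[of W "Fd s" "?DF m s"]
        by (auto simp: indicator_def)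
    qed
    ultimately show ?thesis using ei[of n] ei[of m] by (simp add: e_def)
  qed
  have boundU: "nrm W (?DU n t) \<le> 2 * (J + e n)" if t: "t \<le> T" for n t
  proof -
    have "nrm W (?DU n t) \<le> 2 * (\<integral>s. indicator {0<..T} s * nrm W (?DF n s) \<partial>lebesgue)"
    proof (rule energy_estimate[OF PDU PDF _ t])
      show "AE s in lebesgue. s \<in> {0<..<T} \<longrightarrow> ip W (?DV n s) (?DU n s) \<le> ip W (?DF n s) (?DU n s)"
        using relD[of n] by eventually_elim (auto intro: diss)
    qed
    moreover have "(\<integral>s. indicator {0<..T} s * nrm W (?DF n s) \<partial>lebesgue)
      \<le> (\<integral>s. indicator {0<..T} s * nrm W (Fd s) + indicator {0<..T} s * dst W (?DF n s) (Fd s) \<partial>lebesgue)"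
    proof (rule integral_mono[OF primitive_nrm_integrable[OF PDF]])
      show "integrable lebesgue (\<lambda>s. indicator {0<..T} s * nrm W (Fd s) + indicator {0<..T} s * dst W (?DF n s) (Fd s))"
        by (intro Bochner_Integration.integrable_add ei Ji)
      show "indicator {0<..T} s * nrm W (?DF n s) \<le> indicator {0<..T} s * nrm W (Fd s) + indicator {0<..T} s * dst W (?DF n s) (Fd s)" for s
        using nrm_diff_abs[OF DFL[of n s] FdL[of s]] by (auto simp: indicator_def)
    qed
    ultimately show ?thesis using ei[of n] Ji by (simp add: e_def J_def)
  qed
  have ex: "\<exists>v. v \<in> L2 W \<and> (\<lambda>n. dst W (?DU n t) v) \<longlonglongrightarrow> 0" if t: "t \<le> T" for t
  proof -
    have "\<exists>N. \<forall>m\<ge>N. \<forall>n\<ge>N. dst W (?DU m t) (?DU n t) < r" if r: "0 < r" for r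
    proof -
      obtain N where N: "\<And>n. n \<ge> N \<Longrightarrow> \<bar>e n\<bar> < r / 4" using LIMSEQ_D[OF e0, of "r/4"] r by auto
      have "dst W (?DU m t) (?DU n t) < r" if "m \<ge> N" "n \<ge> N" for m n
      proof -
        have "e m < r / 4" "e n < r / 4" using N[OF that(1)] N[OF that(2)] epos[of m] epos[of n] by simp_all
        then have "2 * (e m + e n) < r" by simp
        with diffU[OF t, of m n] show ?thesis by simp
      qed
      then show ?thesis by blast
    qed
    from L2_complete[OF DL this] show ?thesis by blast
  qed
  define V' where "V' t = (SOME v. v \<in> L2 W \<and> (\<lambda>n. dst W (?DU n t) v) \<longlonglongrightarrow> 0)" for t
  have V': "V' t \<in> L2 W" "(\<lambda>n. dst W (?DU n t) (V' t)) \<longlonglongrightarrow> 0" if "t \<le> T" for t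
    using someI_ex[OF ex[OF that]] unfolding V'_def by blast+
  \<comment> \<open>let \<open>m\<close> tend to infinity in \<open>diffU\<close>: the convergence is uniform in time\<close>
  have close: "dst W (?DU n t) (V' t) \<le> 2 * e n" if t: "t \<le> T" for n t
  proof (rule LIMSEQ_le)
    have "nrm W (\<lambda>x. (?DU n t x - ?DU m t x) - (?DU n t x - V' t x)) = dst W (?DU m t) (V' t)" for m
      by (subst nrm_minus_commute) simp
    with V'(2)[OF t] show "(\<lambda>m. dst W (?DU n t) (?DU m t)) \<longlonglongrightarrow> dst W (?DU n t) (V' t)"
      by (intro tendsto_nrm L2_diff DL V'(1)[OF t]) simp
    have "(\<lambda>m. 2 * (e n + e m)) \<longlonglongrightarrow> 2 * (e n + 0)" by (intro tendsto_intros e0)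
    then show "(\<lambda>m. 2 * (e n + e m)) \<longlonglongrightarrow> 2 * e n" by simp
    show "\<exists>N. \<forall>m\<ge>N. dst W (?DU n t) (?DU m t) \<le> 2 * (e n + e m)" using diffU[OF t] by blast
  qed
  have bound: "nrm W (V' t) \<le> 2 * J" if t: "t \<le> T" for t
  proof (rule LIMSEQ_le)
    show "(\<lambda>n. nrm W (?DU n t)) \<longlonglongrightarrow> nrm W (V' t)" by (rule tendsto_nrm[OF DL V'(1)[OF t] V'(2)[OF t]])
    have "(\<lambda>n. 2 * (J + e n)) \<longlonglongrightarrow> 2 * (J + 0)" by (intro tendsto_intros e0)
    then show "(\<lambda>n. 2 * (J + e n)) \<longlonglongrightarrow> 2 * J" by simp
    show "\<exists>N. \<forall>n\<ge>N. nrm W (?DU n t) \<le> 2 * (J + e n)" using boundU[OF t] by blast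
  qed
  have cont: "L2_continuous W {..T} V'" unfolding L2_continuous_def
  proof (intro conjI ballI)
    fix t assume "t \<in> {..T}"
    then have t: "t \<le> T" by simp
    show "V' t \<in> L2 W" by (rule V'(1)[OF t])
    show "((\<lambda>s. dst W (V' s) (V' t)) \<longlongrightarrow> 0) (at t within {..T})"
    proof (rule tendstoI)
      fix r :: real assume r: "0 < r"
      obtain n where n: "\<bar>e n\<bar> < r / 8" using LIMSEQ_D[OF e0, of "r/8"] r by auto
      have "L2_continuous W {..T} (?DU n)" by (rule L2_continuous_subset[OF primitive_L2_continuous[OF PDU]]) simp
      then have "((\<lambda>s. dst W (?DU n s) (?DU n t)) \<longlongrightarrow> 0) (at t within {..T})" using t by (simp add: L2_continuous_def)
      then have "\<forall>\<^sub>F s in at t within {..T}. dst W (?DU n s) (?DU n t) < r / 2" using r by (intro order_tendstoD) auto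
      moreover have "\<forall>\<^sub>F s in at t within {..T}. s \<in> {..T}" by (simp add: eventually_at_filter)
      ultimately show "\<forall>\<^sub>F s in at t within {..T}. dist (dst W (V' s) (V' t)) 0 < r"
      proof eventually_elim
        fix s assume 1: "dst W (?DU n s) (?DU n t) < r / 2" and "s \<in> {..T}"
        then have s: "s \<le> T" by simp
        have "dst W (V' s) (V' t) \<le> dst W (V' s) (?DU n s) + dst W (?DU n s) (V' t)"
          by (rule nrm_triangle3[OF V'(1)[OF s] DL V'(1)[OF t]])
        also have "dst W (?DU n s) (V' t) \<le> dst W (?DU n s) (?DU n t) + dst W (?DU n t) (V' t)"
          by (rule nrm_triangle3[OF DL DL V'(1)[OF t]])
        also have "dst W (V' s) (?DU n s) = dst W (?DU n s) (V' s)" by (rule nrm_minus_commute)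
        finally show "dist (dst W (V' s) (V' t)) 0 < r"
          using 1 close[OF s, of n] close[OF t, of n] n by (simp add: dist_real_def)
      qed
    qed
  qed
  obtain B where B: "B > 0" "\<And>n. \<bar>e n\<bar> \<le> B"
    using Bseq_def[of e] convergent_imp_Bseq[of e] e0 by (auto simp: convergent_def)
  have DM: "nrm W (?DU n t) \<le> 2 * (J + B)" if "t \<le> T" for n t
    by (rule order_trans[OF boundU[OF that]]) (use abs_le_D1[OF B(2)[of n]] in simp)
  have ident: "AE t in lebesgue. t \<le> T \<longrightarrow> ip W (V t) g = ip W (V' t) g" if "g \<in> L2 W" for g
    by (rule diff_quotients_limit_ip[OF PU hp h0 V' DM that])
  obtain H where H: "countable H" "H \<subseteq> L2 W" "\<And>t. t \<le> T \<Longrightarrow> approximable W H (V' t)"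
    using L2_continuous_separable[OF cont] by blast
  have "AE t in lebesgue. t < T \<longrightarrow> dst W (V t) (V' t) = 0"
  proof (rule AE_eq_of_AE_ip_eq[OF G(1,2) _ H(1,2)])
    show "V t \<in> L2 W" for t by (rule primitiveD(2)[OF PU])
    show "V' t \<in> L2 W" if "t < T" for t using that by (intro V'(1)) simp
    show "AE t in lebesgue. t < T \<longrightarrow> approximable W G (V t)" by (rule G(3))
    show "AE t in lebesgue. t < T \<longrightarrow> approximable W H (V' t)" using H(3) by (intro AE_I2) simp
    show "AE t in lebesgue. t < T \<longrightarrow> ip W (V t) g = ip W (V' t) g" if "g \<in> L2 W" for g
      using ident[OF that] by eventually_elim simp
  qed
  with cont bound show thesis using that unfolding J_def by blast
qed

section \<open>Weak time derivatives as densities of primitives\<close>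

lemma time_deriv_props:
  assumes "u \<in> H1_time I X"
  shows "u \<in> L2_time I X" "time_deriv I X u \<in> L2_time I X" "is_time_deriv I X u (time_deriv I X u)"
proof -
  have "\<exists>v. v \<in> L2_time I X \<and> is_time_deriv I X u v" using assms by (auto simp: H1_time_def)
  from someI_ex[OF this] show "time_deriv I X u \<in> L2_time I X" "is_time_deriv I X u (time_deriv I X u)"
    by (auto simp: time_deriv_def)
  show "u \<in> L2_time I X" using assms by (simp add: H1_time_def)
qed

lemma zero_ext_separable:
  fixes v :: "real \<Rightarrow> real^2 \<Rightarrow> 'b::euclidean_space"
  assumes v: "v \<in> L2_time {0<..<T} (L2_space W)"
  obtains G where "countable G" "G \<subseteq> L2 W" "AE t in lebesgue. approximable W G (zero_ext T W v t)"
proof -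
  have sm: "strongly_measurable {0<..<T} (L2_space W) v" using v by (simp add: L2_time_def)
  obtain G where G: "countable G" "G \<subseteq> L2 W" "AE t in lebesgue_on {0<..<T}. approximable W G (v t)"
    using strongly_measurable_separable[OF sm] by blast
  have "AE t in lebesgue. t \<in> {0<..<T} \<longrightarrow> approximable W G (v t)" using G(3) by (simp add: AE_restrict_space_iff)
  then have "AE t in lebesgue. approximable W (insert (\<lambda>_. 0) G) (zero_ext T W v t)"
  proof eventually_elim
    fix t assume 1: "t \<in> {0<..<T} \<longrightarrow> approximable W G (v t)"
    show "approximable W (insert (\<lambda>_. 0) G) (zero_ext T W v t)"
      using 1 by (cases "t \<in> {0<..<T} \<and> v t \<in> L2 W") (auto simp: approximable_def zero_ext_def)
  qed
  then show thesis using that[of "insert (\<lambda>_. 0) G"] G by simp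
qed

text \<open>The two densities have the same integrals when tested with any \<open>g\<close>.\<close>

lemma primitive_unique:
  fixes U V V' :: "real \<Rightarrow> real^2 \<Rightarrow> 'b::euclidean_space"
  assumes P: "primitive W U V" and P': "primitive W U V'"
    and G: "countable G" "G \<subseteq> L2 W" "AE t in lebesgue. approximable W G (V t)"
    and H: "countable H" "H \<subseteq> L2 W" "AE t in lebesgue. approximable W H (V' t)"
  shows "AE t in lebesgue. dst W (V t) (V' t) = 0"
proof -
  have "AE t in lebesgue. True \<longrightarrow> dst W (V t) (V' t) = 0"
  proof (rule AE_eq_of_AE_ip_eq[OF G(1,2) _ H(1,2)])
    fix g :: "real^2 \<Rightarrow> 'b" assume g: "g \<in> L2 W"
    have "AE t in lebesgue. ip W (V t) g = ip W (V' t) g"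
      by (rule cumul_eq_imp_AE_eq[OF primitive_ip_integrable[OF P g] primitive_ip_integrable[OF P' g]])
         (simp add: primitiveD(5)[OF P g, symmetric] primitiveD(5)[OF P' g, symmetric])
    then show "AE t in lebesgue. True \<longrightarrow> ip W (V t) g = ip W (V' t) g" by simp
  qed (use G(3) H(3) primitiveD(2)[OF P] primitiveD(2)[OF P'] in simp_all)
  then show ?thesis by simp
qed

lemma primitive_cong:
  fixes U V V' :: "real \<Rightarrow> real^2 \<Rightarrow> 'b::euclidean_space"
  assumes P: "primitive W U V" and L: "\<And>t. V' t \<in> L2 W" and z: "\<And>t. t \<le> 0 \<Longrightarrow> V' t = (\<lambda>_. 0)"
    and w: "integrable lebesgue w" "\<And>t. nrm W (V' t) \<le> w t"
    and eq: "AE t in lebesgue. dst W (V t) (V' t) = 0"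
  shows "primitive W U V'"
  unfolding primitive_def
proof (intro conjI allI impI ballI)
  show "\<exists>w. integrable lebesgue w \<and> (\<forall>t. nrm W (V' t) \<le> w t)" using w by blast
  fix g :: "real^2 \<Rightarrow> 'b" assume g: "g \<in> L2 W"
  have ipeq: "AE t in lebesgue. ip W (V t) g = ip W (V' t) g"
    using eq by eventually_elim (rule ip_cong_dist0[OF primitiveD(2)[OF P] L g])
  show m: "(\<lambda>t. ip W (V' t) g) \<in> borel_measurable lebesgue"
    by (rule borel_measurable_AE[OF primitiveD(4)[OF P g] ipeq])
  fix t
  have "cumul (\<lambda>s. ip W (V s) g) t = cumul (\<lambda>s. ip W (V' s) g) t"
    unfolding cumul_def
  proof (rule integral_cong_AE)
    show "AE s in lebesgue. indicator {..t} s * ip W (V s) g = indicator {..t} s * ip W (V' s) g"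
      using ipeq by eventually_elim simp
  qed (intro borel_measurable_times borel_measurable_indicator m primitiveD(4)[OF P g]; simp)+
  then show "ip W (U t) g = cumul (\<lambda>s. ip W (V' s) g) t" using primitiveD(5)[OF P g] by simp
qed (use primitiveD(1)[OF P] L z in auto)

lemma primitive_const_zero: "primitive W (\<lambda>_ _. 0) (\<lambda>_ _. 0)"
  unfolding primitive_def by (auto simp: cumul_def intro!: exI[of _ "\<lambda>_. 0"])

section \<open>Pairs of square-integrable functions\<close>

lemma L2_pair:
  fixes g :: "real^2 \<Rightarrow> 'b::euclidean_space" and h :: "real^2 \<Rightarrow> 'c::euclidean_space"
  assumes g: "g \<in> L2 W" and h: "h \<in> L2 W" shows "(\<lambda>x. (g x, h x)) \<in> L2 W"
proof -
  have "(\<lambda>x. (g x, h x)) \<in> borel_measurable (lebesgue_on W)"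
    using L2_measurable[OF g] L2_measurable[OF h] by (rule borel_measurable_Pair)
  moreover have "(norm (g x, h x))\<^sup>2 = (norm (g x))\<^sup>2 + (norm (h x))\<^sup>2" for x by (simp add: norm_Pair)
  ultimately show ?thesis using g h by (simp add: L2_iff)
qed

lemma L2_image_le:
  fixes k :: "real^2 \<Rightarrow> 'b::euclidean_space" and p :: "'b \<Rightarrow> 'c::euclidean_space"
  assumes k: "k \<in> L2 W" and p: "p \<in> borel_measurable borel" and le: "\<And>y. norm (p y) \<le> norm y"
  shows "(\<lambda>x. p (k x)) \<in> L2 W" "nrm W (\<lambda>x. p (k x)) \<le> nrm W k"
proof -
  have m: "(\<lambda>x. p (k x)) \<in> borel_measurable (lebesgue_on W)"
    by (rule measurable_compose[OF L2_measurable[OF k] p])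
  have i: "integrable (lebesgue_on W) (\<lambda>x. (norm (k x))\<^sup>2)" using k by (simp add: L2_iff)
  have i': "integrable (lebesgue_on W) (\<lambda>x. (norm (p (k x)))\<^sup>2)"
    by (rule Bochner_Integration.integrable_bound[OF i]) (use m le in \<open>auto intro!: AE_I2 power_mono\<close>)
  with m show "(\<lambda>x. p (k x)) \<in> L2 W" by (simp add: L2_iff)
  have "(\<integral>x. (norm (p (k x)))\<^sup>2 \<partial>lebesgue_on W) \<le> (\<integral>x. (norm (k x))\<^sup>2 \<partial>lebesgue_on W)"
    by (rule integral_mono[OF i' i]) (simp add: le power_mono)
  then show "nrm W (\<lambda>x. p (k x)) \<le> nrm W k" by (simp add: nrm_def')
qed

lemma norm_fst_snd_le: "norm (fst y) \<le> norm y" "norm (snd y) \<le> norm y"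
  by (cases y; simp add: norm_fst_le norm_snd_le)+

lemma L2_fst:
  fixes k :: "real^2 \<Rightarrow> 'b::euclidean_space \<times> 'c::euclidean_space"
  assumes "k \<in> L2 W" shows "(\<lambda>x. fst (k x)) \<in> L2 W" "nrm W (\<lambda>x. fst (k x)) \<le> nrm W k"
  by (rule L2_image_le[OF assms, of fst]; simp add: norm_fst_snd_le borel_measurable_continuous_onI continuous_on_fst)+

lemma L2_snd:
  fixes k :: "real^2 \<Rightarrow> 'b::euclidean_space \<times> 'c::euclidean_space"
  assumes "k \<in> L2 W" shows "(\<lambda>x. snd (k x)) \<in> L2 W" "nrm W (\<lambda>x. snd (k x)) \<le> nrm W k"
  by (rule L2_image_le[OF assms, of snd]; simp add: norm_fst_snd_le borel_measurable_continuous_onI continuous_on_snd)+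

lemma ip_pair:
  fixes g :: "real^2 \<Rightarrow> 'b::euclidean_space" and h :: "real^2 \<Rightarrow> 'c::euclidean_space"
  assumes "g \<in> L2 W" "h \<in> L2 W" "k \<in> L2 W"
  shows "ip W (\<lambda>x. (g x, h x)) k = ip W g (\<lambda>x. fst (k x)) + ip W h (\<lambda>x. snd (k x))"
proof -
  have "(\<lambda>x. (g x, h x) \<bullet> k x) = (\<lambda>x. g x \<bullet> fst (k x) + h x \<bullet> snd (k x))"
    by (simp add: inner_prod_def)
  then show ?thesis
    using ip_integrable[OF assms(1) L2_fst(1)[OF assms(3)]] ip_integrable[OF assms(2) L2_snd(1)[OF assms(3)]]
    by (simp add: ip_def)
qed

lemma nrm_pair_le:
  fixes g :: "real^2 \<Rightarrow> 'b::euclidean_space" and h :: "real^2 \<Rightarrow> 'c::euclidean_space"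
  assumes g: "g \<in> L2 W" and h: "h \<in> L2 W"
  shows "nrm W (\<lambda>x. (g x, h x)) \<le> nrm W g + nrm W h"
proof (rule power2_le_imp_le)
  have "(nrm W (\<lambda>x. (g x, h x)))\<^sup>2 = (nrm W g)\<^sup>2 + (nrm W h)\<^sup>2"
    unfolding nrm_sq using ip_pair[OF g h L2_pair[OF g h]] by simp
  also have "\<dots> \<le> (nrm W g + nrm W h)\<^sup>2" by (simp add: power2_sum)
  finally show "(nrm W (\<lambda>x. (g x, h x)))\<^sup>2 \<le> (nrm W g + nrm W h)\<^sup>2" .
qed simp

lemma cumul_add:
  assumes "integrable lebesgue a" "integrable lebesgue b"
  shows "cumul (\<lambda>s. a s + b s) t = cumul a t + cumul b t"
  using assms unfolding cumul_def by (simp add: distrib_left integrable_indicator_mult)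

lemma primitive_pair:
  fixes U V :: "real \<Rightarrow> real^2 \<Rightarrow> 'b::euclidean_space" and U' V' :: "real \<Rightarrow> real^2 \<Rightarrow> 'c::euclidean_space"
  assumes P: "primitive W U V" and P': "primitive W U' V'"
  shows "primitive W (\<lambda>t x. (U t x, U' t x)) (\<lambda>t x. (V t x, V' t x))"
proof -
  obtain w where w: "integrable lebesgue w" "\<And>t. nrm W (V t) \<le> w t" "\<And>t. 0 \<le> w t" using primitive_dominated[OF P] by blast
  obtain w' where w': "integrable lebesgue w'" "\<And>t. nrm W (V' t) \<le> w' t" "\<And>t. 0 \<le> w' t" using primitive_dominated[OF P'] by blast
  show ?thesis unfolding primitive_def
  proof (intro conjI allI impI ballI)
    show "(\<lambda>x. (U t x, U' t x)) \<in> L2 W" "(\<lambda>x. (V t x, V' t x)) \<in> L2 W" for t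
      by (intro L2_pair primitiveD[OF P] primitiveD[OF P'])+
    show "(\<lambda>x. (V t x, V' t x)) = (\<lambda>_. 0)" if "t \<le> 0" for t
      using primitiveD(3)[OF P that] primitiveD(3)[OF P' that] by (simp add: zero_prod_def)
    have "nrm W (\<lambda>x. (V t x, V' t x)) \<le> w t + w' t" for t
      using nrm_pair_le[OF primitiveD(2)[OF P] primitiveD(2)[OF P'], of t t] w(2)[of t] w'(2)[of t] by linarith
    then show "\<exists>w. integrable lebesgue w \<and> (\<forall>t. nrm W (\<lambda>x. (V t x, V' t x)) \<le> w t)"
      using w(1) w'(1) by (intro exI[of _ "\<lambda>t. w t + w' t"]) simp
    fix g :: "real^2 \<Rightarrow> 'b \<times> 'c" assume g: "g \<in> L2 W"
    note g1 = L2_fst(1)[OF g] and g2 = L2_snd(1)[OF g]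
    have eq: "ip W (\<lambda>x. (V t x, V' t x)) g = ip W (V t) (\<lambda>x. fst (g x)) + ip W (V' t) (\<lambda>x. snd (g x))"
      "ip W (\<lambda>x. (U t x, U' t x)) g = ip W (U t) (\<lambda>x. fst (g x)) + ip W (U' t) (\<lambda>x. snd (g x))" for t
      by (intro ip_pair g primitiveD[OF P] primitiveD[OF P'])+
    show "(\<lambda>t. ip W (\<lambda>x. (V t x, V' t x)) g) \<in> borel_measurable lebesgue"
      unfolding eq using primitiveD(4)[OF P g1] primitiveD(4)[OF P' g2] by simp
    show "ip W (\<lambda>x. (U t x, U' t x)) g = cumul (\<lambda>s. ip W (\<lambda>x. (V s x, V' s x)) g) t" for t
      unfolding eq cumul_add[OF primitive_ip_integrable[OF P g1] primitive_ip_integrable[OF P' g2]]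
      using primitiveD(5)[OF P g1] primitiveD(5)[OF P' g2] by simp
  qed
qed

lemma approximable_pair:
  fixes g :: "real^2 \<Rightarrow> 'b::euclidean_space" and h :: "real^2 \<Rightarrow> 'c::euclidean_space"
  assumes "approximable W G g" "approximable W H h" "G \<subseteq> L2 W" "H \<subseteq> L2 W" "g \<in> L2 W" "h \<in> L2 W"
  shows "approximable W ((\<lambda>(a, b) x. (a x, b x)) ` (G \<times> H)) (\<lambda>x. (g x, h x))"
  unfolding approximable_def
proof (intro allI impI)
  fix e :: real assume e: "e > 0"
  obtain a where a: "a \<in> G" "dst W g a < e/2" using assms(1) e unfolding approximable_def by (meson half_gt_zero)
  obtain b where b: "b \<in> H" "dst W h b < e/2" using assms(2) e unfolding approximable_def by (meson half_gt_zero)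
  have L: "a \<in> L2 W" "b \<in> L2 W" using a b assms by auto
  have "nrm W (\<lambda>x. (g x - a x, h x - b x)) \<le> dst W g a + dst W h b"
    using assms L by (intro nrm_pair_le L2_diff)
  also have "\<dots> < e" using a b by linarith
  finally have "nrm W (\<lambda>x. (g x, h x) - (a x, b x)) < e" by simp
  then show "\<exists>k\<in>(\<lambda>(a, b) x. (a x, b x)) ` (G \<times> H). nrm W (\<lambda>x. (g x, h x) - k x) < e"
    using a(1) b(1) by (intro bexI[of _ "\<lambda>x. (a x, b x)"]) auto
qed

section \<open>The system with equal absorption coefficients\<close>

text \<open>For equal absorption coefficients the diagonal matrix is a multiple of the identity, and the
rotations cancel.\<close>

lemma Lambda_eq_scaling:
  "Lambda1 \<sigma> \<sigma> x *v p = \<sigma> (norm x) *\<^sub>R p" "Lambda2 \<sigma> \<sigma> x *v p = \<sigma> (norm x) *\<^sub>R p"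
proof -
  have D: "diag_matrix c c = c *\<^sub>R mat 1" for c
    by (simp add: diag_matrix_def vec_eq_iff forall_2 mat_def)
  have R: "transpose (rot_matrix \<theta>) ** rot_matrix \<theta> = mat 1" for \<theta>
    by (simp add: rot_matrix_def vec_eq_iff forall_2 mat_def matrix_matrix_mult_def transpose_def sum_2
        power2_eq_square[symmetric])
  have "transpose (rot_matrix \<theta>) ** diag_matrix c c ** rot_matrix \<theta> = c *\<^sub>R mat 1" for c \<theta>
  proof -
    have S: "A ** (c *\<^sub>R mat 1) = c *\<^sub>R A" "(c *\<^sub>R A) ** B = c *\<^sub>R (A ** B)" for A B :: "real^2^2"
      by (simp_all add: vec_eq_iff matrix_matrix_mult_def mat_def sum_distrib_left mult_ac if_distrib if_distribR cong: if_cong)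
    show ?thesis by (simp only: D S R)
  qed
  then show "Lambda1 \<sigma> \<sigma> x *v p = \<sigma> (norm x) *\<^sub>R p" "Lambda2 \<sigma> \<sigma> x *v p = \<sigma> (norm x) *\<^sub>R p"
    by (simp_all add: Lambda1_def Lambda2_def scaleR_matrix_vector_assoc[symmetric])
qed

text \<open>The state is the triple \<open>(u, p, u\<^sup>*)\<close> and \<open>V\<close> its time derivative; \<open>G\<close> and \<open>d\<close> are the gradient of \<open>u\<close> and the
divergence of \<open>p\<close>. The variable \<open>p\<^sup>*\<close> has been eliminated by \<open>p = p\<^sup>*\<close>. Quantifying over \<open>G\<close> and \<open>d\<close>
makes the relation linear, which it would not literally be with chosen weak derivatives.\<close>

definition pml_rel :: "(real^2) set \<Rightarrow> (real \<Rightarrow> real) \<Rightarrow> (real^2 \<Rightarrow> real \<times> (real^2) \<times> real) \<Rightarrow>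
    (real^2 \<Rightarrow> real \<times> (real^2) \<times> real) \<Rightarrow> (real^2 \<Rightarrow> real \<times> (real^2) \<times> real) \<Rightarrow> bool" where
  "pml_rel W \<sigma> U V F \<longleftrightarrow> U \<in> L2 W \<and> V \<in> L2 W \<and> F \<in> L2 W \<and>
     (\<exists>G d. H10_grad W (\<lambda>x. fst (U x)) G \<and> d \<in> L2 W \<and> is_weak_div W (\<lambda>x. fst (snd (U x))) d \<and>
        (AE x in lebesgue_on W.
           fst (V x) = fst (F x) - 2 * \<sigma> (norm x) * fst (U x) - \<sigma> (norm x) * snd (snd (U x)) - d x \<and>
           fst (snd (V x)) = - G x \<and> snd (snd (V x)) = \<sigma> (norm x) * fst (U x) \<and> snd (F x) = 0))"

lemma pml_rel_of_equations:
  assumes W: "open W" "bounded W"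
    and L: "U \<in> L2 W" "P \<in> L2 W" "S \<in> L2 W" "F \<in> L2 W" "du \<in> L2 W" "dp \<in> L2 W" "dus \<in> L2 W"
    and u: "u \<in> elems (H10_space W)" "dst W u U = 0" and p: "p \<in> elems (Hdiv_space W)" "dst W p P = 0"
    and us: "us \<in> L2 W" "dst W us S = 0" and f: "f \<in> L2 W" "dst W f F = 0"
    and eq: "AE x in lebesgue_on W. du x + 2 * \<sigma> (norm x) * u x + \<sigma> (norm x) * us x + weak_div W p x = f x"
      "AE x in lebesgue_on W. dp x = - weak_gradient W u x"
      "AE x in lebesgue_on W. dus x = \<sigma> (norm x) * u x"
  shows "pml_rel W \<sigma> (\<lambda>x. (U x, P x, S x)) (\<lambda>x. (du x, dp x, dus x)) (\<lambda>x. (F x, 0, 0))"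
proof -
  have Ws: "W \<in> sets lebesgue" by (rule open_sets_lebesgue[OF W(1)])
  have uL: "u \<in> L2 W" using u(1) by (simp add: H10_space_def H1_space_def)
  note wd = weak_div_props[OF p(1)]
  have 1: "H10_grad W U (weak_gradient W u)"
    by (rule H10_grad_cong[OF Ws H10_grad_weak_gradient[OF W u(1)] L(1) u(2)])
  have 2: "is_weak_div W P (weak_div W p)" by (rule is_weak_div_cong[OF Ws wd(1) L(2) p(2) wd(3)])
  have e: "AE x in lebesgue_on W. u x = U x" "AE x in lebesgue_on W. us x = S x" "AE x in lebesgue_on W. f x = F x"
    by (rule AE_eq_of_nrm_zero; fact)+
  let ?V = "\<lambda>x. (du x, dp x, dus x)" and ?U = "\<lambda>x. (U x, P x, S x)" and ?F = "\<lambda>x. (F x, 0::real^2, 0::real)"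
  have 3: "AE x in lebesgue_on W. fst (?V x) = fst (?F x) - 2 * \<sigma> (norm x) * fst (?U x) - \<sigma> (norm x) * snd (snd (?U x)) - weak_div W p x \<and>
     fst (snd (?V x)) = - weak_gradient W u x \<and> snd (snd (?V x)) = \<sigma> (norm x) * fst (?U x) \<and> snd (?F x) = 0"
    using e eq by eventually_elim (simp add: zero_prod_def)
  have 4: "?U \<in> L2 W" "?V \<in> L2 W" "?F \<in> L2 W" by (intro L2_pair L L2_zero)+
  show ?thesis unfolding pml_rel_def
    by (intro conjI 4 exI[of _ "weak_gradient W u"] exI[of _ "weak_div W p"] 3 wd(2); simp add: 1 2)
qed

lemma pml_rel_scaled_diff:
  assumes W: "W \<in> sets lebesgue" and 1: "pml_rel W \<sigma> U V F" and 2: "pml_rel W \<sigma> U' V' F'"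
  shows "pml_rel W \<sigma> (\<lambda>x. c *\<^sub>R (U x - U' x)) (\<lambda>x. c *\<^sub>R (V x - V' x)) (\<lambda>x. c *\<^sub>R (F x - F' x))"
proof -
  obtain G d where L: "U \<in> L2 W" "V \<in> L2 W" "F \<in> L2 W" and G: "H10_grad W (\<lambda>x. fst (U x)) G"
    and d: "d \<in> L2 W" "is_weak_div W (\<lambda>x. fst (snd (U x))) d"
    and ae: "AE x in lebesgue_on W.
           fst (V x) = fst (F x) - 2 * \<sigma> (norm x) * fst (U x) - \<sigma> (norm x) * snd (snd (U x)) - d x \<and>
           fst (snd (V x)) = - G x \<and> snd (snd (V x)) = \<sigma> (norm x) * fst (U x) \<and> snd (F x) = 0"
    using 1 unfolding pml_rel_def by blast
  obtain G' d' where L': "U' \<in> L2 W" "V' \<in> L2 W" "F' \<in> L2 W" and G': "H10_grad W (\<lambda>x. fst (U' x)) G'"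
    and d': "d' \<in> L2 W" "is_weak_div W (\<lambda>x. fst (snd (U' x))) d'"
    and ae': "AE x in lebesgue_on W.
           fst (V' x) = fst (F' x) - 2 * \<sigma> (norm x) * fst (U' x) - \<sigma> (norm x) * snd (snd (U' x)) - d' x \<and>
           fst (snd (V' x)) = - G' x \<and> snd (snd (V' x)) = \<sigma> (norm x) * fst (U' x) \<and> snd (F' x) = 0"
    using 2 unfolding pml_rel_def by blast
  have 3: "H10_grad W (\<lambda>x. fst (c *\<^sub>R (U x - U' x))) (\<lambda>x. c *\<^sub>R (G x - G' x))"
    using H10_grad_scaled_diff[OF W G G', of c] by simp
  have 4: "is_weak_div W (\<lambda>x. fst (snd (c *\<^sub>R (U x - U' x)))) (\<lambda>x. c * (d x - d' x))"
    using is_weak_div_scaled_diff[OF W L2_fst(1)[OF L2_snd(1)[OF L(1)]] L2_fst(1)[OF L2_snd(1)[OF L'(1)]] d(1) d'(1) d(2) d'(2), of c] by simp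
  have 5: "(\<lambda>x. c * (d x - d' x)) \<in> L2 W" using L2_scale[OF L2_diff[OF d(1) d'(1)], of c] by simp
  have 6: "AE x in lebesgue_on W.
      fst (c *\<^sub>R (V x - V' x)) = fst (c *\<^sub>R (F x - F' x)) - 2 * \<sigma> (norm x) * fst (c *\<^sub>R (U x - U' x))
        - \<sigma> (norm x) * snd (snd (c *\<^sub>R (U x - U' x))) - c * (d x - d' x) \<and>
      fst (snd (c *\<^sub>R (V x - V' x))) = - (c *\<^sub>R (G x - G' x)) \<and>
      snd (snd (c *\<^sub>R (V x - V' x))) = \<sigma> (norm x) * fst (c *\<^sub>R (U x - U' x)) \<and> snd (c *\<^sub>R (F x - F' x)) = 0"
    using ae ae' by eventually_elim (simp, simp add: algebra_simps)
  have 7: "(\<lambda>x. c *\<^sub>R (U x - U' x)) \<in> L2 W" "(\<lambda>x. c *\<^sub>R (V x - V' x)) \<in> L2 W" "(\<lambda>x. c *\<^sub>R (F x - F' x)) \<in> L2 W"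
    by (intro L2_scale L2_diff L L')+
  show ?thesis unfolding pml_rel_def
    by (intro conjI 7 exI[of _ "\<lambda>x. c *\<^sub>R (G x - G' x)"] exI[of _ "\<lambda>x. c * (d x - d' x)"] 3 4 5 6)
qed

text \<open>In \<open>\<langle>V, U\<rangle>\<close> the couplings between \<open>u\<close> and \<open>u\<^sup>*\<close> cancel pointwise, those between \<open>u\<close> and \<open>p\<close> cancel
after integration because gradient and divergence are adjoint, and the damping contributes
\<open>-2 \<sigma> u\<^sup>2 \<le> 0\<close>.\<close>

lemma pml_rel_dissipative:
  assumes W: "W \<in> sets lebesgue" and \<sigma>: "\<And>r. 0 \<le> \<sigma> r" and rel: "pml_rel W \<sigma> U V F"
  shows "ip W V U \<le> ip W F U"
proof -
  obtain G d where L: "U \<in> L2 W" "V \<in> L2 W" "F \<in> L2 W" and G: "H10_grad W (\<lambda>x. fst (U x)) G"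
    and d: "d \<in> L2 W" "is_weak_div W (\<lambda>x. fst (snd (U x))) d"
    and ae: "AE x in lebesgue_on W.
           fst (V x) = fst (F x) - 2 * \<sigma> (norm x) * fst (U x) - \<sigma> (norm x) * snd (snd (U x)) - d x \<and>
           fst (snd (V x)) = - G x \<and> snd (snd (V x)) = \<sigma> (norm x) * fst (U x) \<and> snd (F x) = 0"
    using rel unfolding pml_rel_def by blast
  note pL = L2_fst(1)[OF L2_snd(1)[OF L(1)]] and uL = L2_fst(1)[OF L(1)]
  have GL: "G \<in> L2 W" using G by (simp add: H10_grad_def)
  have adj: "ip W G (\<lambda>x. fst (snd (U x))) = - ip W (\<lambda>x. fst (U x)) d"
    by (rule weak_div_adjoint[OF W G pL d])
  note i1 = ip_integrable[OF L(3,1)] and i2 = ip_integrable[OF GL pL] and i3 = ip_integrable[OF uL d(1)]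
  have "ip W V U \<le> (\<integral>x. F x \<bullet> U x - (G x \<bullet> fst (snd (U x)) + fst (U x) \<bullet> d x) \<partial>lebesgue_on W)"
    unfolding ip_def
  proof (rule integral_mono_AE)
    show "integrable (lebesgue_on W) (\<lambda>x. V x \<bullet> U x)" by (rule ip_integrable[OF L(2,1)])
    show "integrable (lebesgue_on W) (\<lambda>x. F x \<bullet> U x - (G x \<bullet> fst (snd (U x)) + fst (U x) \<bullet> d x))"
      by (intro Bochner_Integration.integrable_diff Bochner_Integration.integrable_add i1 i2 i3)
    show "AE x in lebesgue_on W. V x \<bullet> U x \<le> F x \<bullet> U x - (G x \<bullet> fst (snd (U x)) + fst (U x) \<bullet> d x)"
      using ae
    proof eventually_elim
      fix x assume e: "fst (V x) = fst (F x) - 2 * \<sigma> (norm x) * fst (U x) - \<sigma> (norm x) * snd (snd (U x)) - d x \<and>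
           fst (snd (V x)) = - G x \<and> snd (snd (V x)) = \<sigma> (norm x) * fst (U x) \<and> snd (F x) = 0"
      obtain a b c where U: "U x = (a, b, c)" by (metis prod.exhaust)
      have V: "V x = (fst (F x) - 2 * \<sigma> (norm x) * a - \<sigma> (norm x) * c - d x, - G x, \<sigma> (norm x) * a)"
        using e U by (simp add: prod_eq_iff)
      have F: "F x = (fst (F x), 0, 0)" using e by (simp add: prod_eq_iff)
      have "V x \<bullet> U x = F x \<bullet> U x - (G x \<bullet> b + a * d x) - 2 * \<sigma> (norm x) * a\<^sup>2"
        unfolding V U by (subst F) (simp add: algebra_simps power2_eq_square)
      moreover have "0 \<le> 2 * \<sigma> (norm x) * a\<^sup>2" using \<sigma> by simp
      ultimately show "V x \<bullet> U x \<le> F x \<bullet> U x - (G x \<bullet> fst (snd (U x)) + fst (U x) \<bullet> d x)" using U by simp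
    qed
  qed
  also have "\<dots> = ip W F U - (ip W G (\<lambda>x. fst (snd (U x))) + ip W (\<lambda>x. fst (U x)) d)"
    using i1 i2 i3 by (simp add: ip_def)
  finally show ?thesis using adj by simp
qed

lemma pml_rel_zero:
  "pml_rel W \<sigma> (\<lambda>_. 0) (\<lambda>_. 0) (\<lambda>_. 0)"
  unfolding pml_rel_def
  using H10_grad_zero[of W]
  by (auto simp: is_weak_div_def intro!: exI[of _ "\<lambda>_. 0"])

lemma continuous_version_restrict:
  fixes u w :: "real \<Rightarrow> real^2 \<Rightarrow> 'b::euclidean_space"
  assumes WB: "W \<subseteq> B" "W \<in> sets lebesgue" "B \<in> sets lebesgue"
    and w: "continuous_version T (L2_space B) u w"
  shows "continuous_version T (L2_space W) u w"
  unfolding continuous_version_def fdist_L2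
proof (intro conjI ballI)
  note R = L2_restrict[OF WB]
  have L: "w t \<in> L2 B" if "t \<in> {0..T}" for t using w that by (simp add: continuous_version_def)
  show "w t \<in> L2 W" if "t \<in> {0..T}" for t by (rule R(1)[OF L[OF that]])
  fix t assume t: "t \<in> {0..T}"
  have lim: "((\<lambda>s. dst B (w s) (w t)) \<longlongrightarrow> 0) (at t within {0..T})"
    using w t by (simp add: continuous_version_def fdist_L2)
  show "((\<lambda>s. dst W (w s) (w t)) \<longlongrightarrow> 0) (at t within {0..T})"
  proof (rule Lim_null_comparison[OF _ lim])
    have "dst W (w s) (w t) \<le> dst B (w s) (w t)" if "s \<in> {0..T}" for s
      by (rule R(2)[OF L2_diff[OF L[OF that] L[OF t]]])
    then show "\<forall>\<^sub>F s in at t within {0..T}. norm (dst W (w s) (w t)) \<le> dst B (w s) (w t)"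
      by (auto simp: eventually_at_filter)
  qed
next
  note R = L2_restrict[OF WB]
  have L: "w t \<in> L2 B" if "t \<in> {0..T}" for t using w that by (simp add: continuous_version_def)
  have "AE t in lebesgue_on {0<..<T}. u t \<in> L2 B \<and> dst B (u t) (w t) = 0"
    using w by (simp add: continuous_version_def fdist_L2)
  then show "AE t in lebesgue_on {0<..<T}. u t \<in> L2 W \<and> dst W (u t) (w t) = 0"
    using AE_space
  proof eventually_elim
    fix t assume 1: "u t \<in> L2 B \<and> dst B (u t) (w t) = 0" and "t \<in> space (lebesgue_on {0<..<T})"
    then have t: "t \<in> {0..T}" by (auto simp: space_restrict_space)
    have "dst W (u t) (w t) \<le> dst B (u t) (w t)" using 1 by (intro R(2) L2_diff L[OF t]) blast
    then show "u t \<in> L2 W \<and> dst W (u t) (w t) = 0" using 1 R(1)[of "u t"] by (simp add: order_antisym)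
  qed
qed

lemma AE_interval_iff: "(AE t in lebesgue_on {0<..<T::real}. P t) \<longleftrightarrow> (AE t in lebesgue. t \<in> {0<..<T} \<longrightarrow> P t)"
  by (simp add: AE_restrict_space_iff)

lemma continuous_version_AE:
  assumes "continuous_version T (L2_space W) u w"
  shows "AE t in lebesgue. t \<in> {0<..<T} \<longrightarrow> u t \<in> L2 W \<and> dst W (u t) (w t) = 0"
  unfolding AE_interval_iff[symmetric] using assms unfolding continuous_version_def fdist_L2 by blast

lemma H1_time_zero_initial:
  fixes u :: "real \<Rightarrow> real^2 \<Rightarrow> 'b::euclidean_space"
  assumes T: "0 < T" and u: "u \<in> H1_time {0<..<T} (L2_space W)" and z: "zero_initial_value T (L2_space W) u"
  obtains U where "primitive W U (zero_ext T W (time_deriv {0<..<T} (L2_space W) u))" "\<And>t. t \<le> 0 \<Longrightarrow> U t = (\<lambda>_. 0)"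
    "AE t in lebesgue. t \<in> {0<..<T} \<longrightarrow> u t \<in> L2 W \<and> dst W (u t) (U t) = 0"
proof -
  obtain w where w: "continuous_version T (L2_space W) u w" "nrm W (w 0) = 0"
    using z unfolding zero_initial_value_def by blast
  let ?U = "\<lambda>t. if t \<le> 0 then (\<lambda>_. 0) else w (min t T)"
  have "AE t in lebesgue. t \<in> {0<..<T} \<longrightarrow> u t \<in> L2 W \<and> dst W (u t) (w t) = 0"
    by (rule continuous_version_AE[OF w(1)])
  then have ae: "AE t in lebesgue. t \<in> {0<..<T} \<longrightarrow> u t \<in> L2 W \<and> dst W (u t) (?U t) = 0"
    by eventually_elim (auto simp: min_absorb1)
  have P: "primitive W ?U (zero_ext T W (time_deriv {0<..<T} (L2_space W) u))"
    by (rule H1_time_primitive[OF T time_deriv_props[OF u] w])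
  show thesis by (rule that[OF P _ ae]) simp
qed

text \<open>The source has two time derivatives on the larger set \<open>B\<close>; the second one makes the first one
continuous in time. This continuity passes to \<open>W\<close>, where the derivative chosen for \<open>B\<close> agrees
with the one chosen for \<open>W\<close> because both have the source as their primitive.\<close>

lemma source_primitive:
  fixes f :: "real \<Rightarrow> real^2 \<Rightarrow> 'b::euclidean_space"
  assumes T: "0 < T" and WB: "W \<subseteq> B" "W \<in> sets lebesgue" "B \<in> sets lebesgue"
    and f: "f \<in> H2_time {0<..<T} (L2_space B)" and z: "zero_initial_value T (L2_space B) f"
  obtains F Fd K where "primitive W F Fd" "\<And>t. nrm W (Fd t) \<le> K" "L2_continuous W {0<..T} Fd"
    "\<And>t. t \<le> 0 \<Longrightarrow> F t = (\<lambda>_. 0)"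
    "AE t in lebesgue. t \<in> {0<..<T} \<longrightarrow> f t \<in> L2 W \<and> dst W (f t) (F t) = 0"
    "AE t in lebesgue. t \<in> {0<..<T} \<longrightarrow> time_deriv {0<..<T} (L2_space W) f t \<in> L2 W \<and>
       nrm W (\<lambda>x. time_deriv {0<..<T} (L2_space W) f t x - Fd t x) = 0"
proof -
  let ?I = "{0<..<T}"
  have Is: "?I \<in> sets lebesgue" and Il: "?I \<in> lmeasurable" by simp_all
  define vB where "vB = time_deriv ?I (L2_space B) f"
  have f1: "f \<in> H1_time ?I (L2_space B)" and v1: "vB \<in> H1_time ?I (L2_space B)"
    using f by (auto simp: H2_time_def vB_def)
  note fB = time_deriv_props[OF f1, folded vB_def] and vvB = time_deriv_props[OF v1]
  obtain vc where "continuous_version T (L2_space B) vB vc"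
    using H1_time_continuous_version[OF T vvB] by blast
  then have vc: "continuous_version T (L2_space W) vB vc" by (rule continuous_version_restrict[OF WB])
  have fW: "f \<in> L2_time ?I (L2_space W)" and vW: "vB \<in> L2_time ?I (L2_space W)" and dW: "is_time_deriv ?I (L2_space W) f vB"
    by (rule L2_time_restrict[OF WB Is fB(1)], rule L2_time_restrict[OF WB Is fB(2)], rule is_time_deriv_restrict[OF WB Il fB(3)])
  have fW1: "f \<in> H1_time ?I (L2_space W)" using fW vW dW by (auto simp: H1_time_def)
  obtain f0 where f0: "continuous_version T (L2_space B) f f0" "nrm B (f0 0) = 0"
    using z unfolding zero_initial_value_def by blast
  have f0W: "continuous_version T (L2_space W) f f0" by (rule continuous_version_restrict[OF WB f0(1)])
  have "f0 0 \<in> L2 B" using f0(1) T by (simp add: continuous_version_def)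
  then have f00: "nrm W (f0 0) = 0" using L2_restrict(2)[OF WB] f0(2) by (metis nrm_nonneg order_antisym)
  let ?F = "\<lambda>t. if t \<le> 0 then (\<lambda>_. 0) else f0 (min t T)"
  define v where "v = time_deriv ?I (L2_space W) f"
  note tv = time_deriv_props[OF fW1, folded v_def]
  have P1: "primitive W ?F (zero_ext T W vB)" by (rule H1_time_primitive[OF T fW vW dW f0W f00])
  have P2: "primitive W ?F (zero_ext T W v)" by (rule H1_time_primitive[OF T tv f0W f00])
  obtain G where G: "countable G" "G \<subseteq> L2 W" "AE t in lebesgue. approximable W G (zero_ext T W vB t)" using zero_ext_separable[OF vW] by blast
  obtain H where H: "countable H" "H \<subseteq> L2 W" "AE t in lebesgue. approximable W H (zero_ext T W v t)" using zero_ext_separable[OF tv(2)] by blast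
  have uniq: "AE t in lebesgue. dst W (zero_ext T W v t) (zero_ext T W vB t) = 0"
    by (rule primitive_unique[OF P2 P1 H G])
  define Fd where "Fd t = (if t \<in> {0<..T} then vc t else (\<lambda>_. 0))" for t
  have cont: "L2_continuous W {0..T} vc" by (rule continuous_version_L2_continuous[OF vc])
  have FdL: "Fd t \<in> L2 W" for t using cont by (auto simp: Fd_def L2_continuous_def)
  have "compact ((\<lambda>t. nrm W (vc t)) ` {0..T})" by (intro compact_continuous_image L2_continuous_nrm[OF cont]) simp
  then obtain K where K: "\<And>t. t \<in> {0..T} \<Longrightarrow> \<bar>nrm W (vc t)\<bar> \<le> K"
    by (force dest: compact_imp_bounded simp: bounded_iff)
  have K0: "0 \<le> K" using order_trans[OF abs_ge_zero K[of 0]] T by simp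
  have FdK: "nrm W (Fd t) \<le> K" for t using K[of t] K0 by (auto simp: Fd_def)
  have Fdc: "L2_continuous W {0<..T} Fd"
  proof -
    have c: "L2_continuous W {0<..T} vc" by (rule L2_continuous_subset[OF cont]) auto
    have "((\<lambda>s. dst W (Fd s) (Fd t)) \<longlongrightarrow> 0) (at t within {0<..T})" if t: "t \<in> {0<..T}" for t
    proof (rule Lim_transform_eventually)
      show "((\<lambda>s. dst W (vc s) (vc t)) \<longlongrightarrow> 0) (at t within {0<..T})" using c t by (simp add: L2_continuous_def)
      show "\<forall>\<^sub>F s in at t within {0<..T}. dst W (vc s) (vc t) = dst W (Fd s) (Fd t)"
        using t by (auto simp: eventually_at_filter Fd_def)
    qed
    then show ?thesis using FdL by (simp add: L2_continuous_def)
  qed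
  have vcae: "AE t in lebesgue. t \<in> ?I \<longrightarrow> vB t \<in> L2 W \<and> dst W (vB t) (vc t) = 0"
    by (rule continuous_version_AE[OF vc])
  have "AE t in lebesgue. t \<notin> {T}" by (rule AE_not_in) auto
  then have near: "AE t in lebesgue. dst W (zero_ext T W vB t) (Fd t) = 0"
    using vcae L2_time_zero_ext(1)[OF vW]
  proof eventually_elim
    fix t assume 1: "t \<notin> {T}" and 2: "t \<in> ?I \<longrightarrow> vB t \<in> L2 W \<and> dst W (vB t) (vc t) = 0"
      and 3: "t \<in> ?I \<longrightarrow> zero_ext T W vB t = vB t"
    show "dst W (zero_ext T W vB t) (Fd t) = 0"
    proof (cases "t \<in> ?I")
      case True then show ?thesis using 2 3 by (simp add: Fd_def)
    next
      case False then show ?thesis using 1 by (auto simp: Fd_def zero_ext_def)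
    qed
  qed
  have PF: "primitive W ?F Fd"
  proof (rule primitive_cong[OF P1 FdL _ _ _ near])
    show "integrable lebesgue (\<lambda>t. indicator {0<..T} t * K)"
      using lmeasurable_Ioc[of 0 T] lmeasurable_iff_integrable by (intro integrable_mult_left) blast
    show "nrm W (Fd t) \<le> indicator {0<..T} t * K" for t using FdK[of t] by (auto simp: Fd_def)
  qed (simp add: Fd_def)
  have ae1: "AE t in lebesgue. t \<in> ?I \<longrightarrow> f t \<in> L2 W \<and> dst W (f t) (?F t) = 0"
  proof -
    have "AE t in lebesgue. t \<in> ?I \<longrightarrow> f t \<in> L2 W \<and> dst W (f t) (f0 t) = 0"
      by (rule continuous_version_AE[OF f0W])
    then show ?thesis by eventually_elim (auto simp: min_absorb1)
  qed
  have "AE t in lebesgue_on ?I. v t \<in> L2 W" using tv(2) by (simp add: L2_time_def)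
  then have "AE t in lebesgue. t \<in> ?I \<longrightarrow> v t \<in> L2 W" by (simp add: AE_interval_iff)
  then have ae2: "AE t in lebesgue. t \<in> ?I \<longrightarrow> v t \<in> L2 W \<and> dst W (v t) (Fd t) = 0"
    using uniq near
  proof eventually_elim
    fix t assume 1: "t \<in> ?I \<longrightarrow> v t \<in> L2 W" and 2: "dst W (zero_ext T W v t) (zero_ext T W vB t) = 0"
      and 3: "dst W (zero_ext T W vB t) (Fd t) = 0"
    have "dst W (zero_ext T W v t) (Fd t) = 0"
      using nrm_triangle3[OF zero_ext_L2[of T W v t] zero_ext_L2[of T W vB t] FdL[of t]] 2 3 by (simp add: order_antisym)
    then show "t \<in> ?I \<longrightarrow> v t \<in> L2 W \<and> dst W (v t) (Fd t) = 0"
      using 1 by (auto simp: zero_ext_def)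
  qed
  show thesis by (rule that[OF PF FdK Fdc _ ae1 ae2[unfolded v_def]]) simp
qed

lemma ip_nonpos:
  assumes "AE x in lebesgue_on W. g x \<bullet> h x \<le> 0" shows "ip W g h \<le> 0"
proof -
  have "0 \<le> (\<integral>x. - (g x \<bullet> h x) \<partial>lebesgue_on W)"
    using assms by (intro integral_nonneg_AE) (auto elim: eventually_mono)
  then show ?thesis by (simp add: ip_def)
qed

lemma damped_difference_zero:
  fixes U V :: "real \<Rightarrow> real^2 \<Rightarrow> 'b::euclidean_space"
  assumes P: "primitive W U V" and t: "t \<le> T"
    and le: "AE s in lebesgue. s \<in> {0<..<T} \<longrightarrow> ip W (V s) (U s) \<le> 0"
  shows "nrm W (U t) = 0"
proof -
  have "nrm W (U t) \<le> 2 * (\<integral>s. indicator {0<..T} s * nrm W (\<lambda>_::real^2. 0::'b) \<partial>lebesgue)"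
    by (rule energy_estimate[OF P primitive_const_zero _ t]) (use le in simp)
  then show ?thesis by (simp add: order_antisym)
qed

text \<open>The difference \<open>w = p - p\<^sup>*\<close> solves \<open>w' = - \<sigma> w\<close> with \<open>w(0) = 0\<close>, so its energy cannot grow.\<close>

lemma pml_p_eq_p_star:
  fixes p ps :: "real \<Rightarrow> real^2 \<Rightarrow> real^2"
  assumes T: "0 < T" and \<sigma>: "\<And>r. 0 \<le> \<sigma> r"
    and p: "p \<in> H1_time {0<..<T} (L2_space W)" "zero_initial_value T (L2_space W) p"
    and ps: "ps \<in> H1_time {0<..<T} (L2_space W)" "zero_initial_value T (L2_space W) ps"
    and eq: "AE t in lebesgue_on {0<..<T}. AE x in lebesgue_on W.
       time_deriv {0<..<T} (L2_space W) p t x + \<sigma> (norm x) *\<^sub>R p t x =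
       time_deriv {0<..<T} (L2_space W) ps t x + \<sigma> (norm x) *\<^sub>R ps t x"
  shows "AE t in lebesgue. t \<in> {0<..<T} \<longrightarrow> (AE x in lebesgue_on W. p t x = ps t x \<and>
       time_deriv {0<..<T} (L2_space W) p t x = time_deriv {0<..<T} (L2_space W) ps t x)"
proof -
  let ?I = "{0<..<T}" and ?dp = "time_deriv {0<..<T} (L2_space W) p" and ?dps = "time_deriv {0<..<T} (L2_space W) ps"
  obtain P where P: "primitive W P (zero_ext T W ?dp)" "AE t in lebesgue. t \<in> ?I \<longrightarrow> p t \<in> L2 W \<and> dst W (p t) (P t) = 0"
    using H1_time_zero_initial[OF T p] by blast
  obtain Q where Q: "primitive W Q (zero_ext T W ?dps)" "AE t in lebesgue. t \<in> ?I \<longrightarrow> ps t \<in> L2 W \<and> dst W (ps t) (Q t) = 0"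
    using H1_time_zero_initial[OF T ps] by blast
  have PQ: "primitive W (\<lambda>t x. 1 *\<^sub>R (P t x - Q t x)) (\<lambda>t x. 1 *\<^sub>R (zero_ext T W ?dp t x - zero_ext T W ?dps t x))"
    by (rule primitive_scaled_diff[OF P(1) Q(1)])
  have eq': "AE t in lebesgue. t \<in> ?I \<longrightarrow> (AE x in lebesgue_on W. ?dp t x + \<sigma> (norm x) *\<^sub>R p t x = ?dps t x + \<sigma> (norm x) *\<^sub>R ps t x)"
    using eq by (simp add: AE_interval_iff)
  note dp = L2_time_zero_ext(1)[OF time_deriv_props(2)[OF p(1)]] and dps = L2_time_zero_ext(1)[OF time_deriv_props(2)[OF ps(1)]]
  have "AE s in lebesgue. s \<in> ?I \<longrightarrow> ip W (\<lambda>x. 1 *\<^sub>R (zero_ext T W ?dp s x - zero_ext T W ?dps s x)) (\<lambda>x. 1 *\<^sub>R (P s x - Q s x)) \<le> 0"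
    using eq' P(2) Q(2) dp dps
  proof eventually_elim
    fix s assume e: "s \<in> ?I \<longrightarrow> (AE x in lebesgue_on W. ?dp s x + \<sigma> (norm x) *\<^sub>R p s x = ?dps s x + \<sigma> (norm x) *\<^sub>R ps s x)"
      and 1: "s \<in> ?I \<longrightarrow> p s \<in> L2 W \<and> dst W (p s) (P s) = 0"
      and 2: "s \<in> ?I \<longrightarrow> ps s \<in> L2 W \<and> dst W (ps s) (Q s) = 0"
      and 3: "s \<in> ?I \<longrightarrow> zero_ext T W ?dp s = ?dp s" and 4: "s \<in> ?I \<longrightarrow> zero_ext T W ?dps s = ?dps s"
    show "s \<in> ?I \<longrightarrow> ip W (\<lambda>x. 1 *\<^sub>R (zero_ext T W ?dp s x - zero_ext T W ?dps s x)) (\<lambda>x. 1 *\<^sub>R (P s x - Q s x)) \<le> 0"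
    proof
      assume s: "s \<in> ?I"
      have a: "AE x in lebesgue_on W. p s x = P s x" using 1 s primitiveD(1)[OF P(1)] by (intro AE_eq_of_nrm_zero) auto
      have b: "AE x in lebesgue_on W. ps s x = Q s x" using 2 s primitiveD(1)[OF Q(1)] by (intro AE_eq_of_nrm_zero) auto
      have c: "AE x in lebesgue_on W. ?dp s x + \<sigma> (norm x) *\<^sub>R p s x = ?dps s x + \<sigma> (norm x) *\<^sub>R ps s x" using e s by blast
      show "ip W (\<lambda>x. 1 *\<^sub>R (zero_ext T W ?dp s x - zero_ext T W ?dps s x)) (\<lambda>x. 1 *\<^sub>R (P s x - Q s x)) \<le> 0"
      proof (rule ip_nonpos)
        show "AE x in lebesgue_on W. (1 *\<^sub>R (zero_ext T W ?dp s x - zero_ext T W ?dps s x)) \<bullet> (1 *\<^sub>R (P s x - Q s x)) \<le> 0"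
          using a b c
        proof eventually_elim
          fix x assume x: "p s x = P s x" "ps s x = Q s x" "?dp s x + \<sigma> (norm x) *\<^sub>R p s x = ?dps s x + \<sigma> (norm x) *\<^sub>R ps s x"
          have "?dp s x - ?dps s x = - (\<sigma> (norm x) *\<^sub>R (P s x - Q s x))"
            using x by (simp add: algebra_simps)
          then have "(?dp s x - ?dps s x) \<bullet> (P s x - Q s x) = - (\<sigma> (norm x) * ((P s x - Q s x) \<bullet> (P s x - Q s x)))" by simp
          moreover have "0 \<le> \<sigma> (norm x) * ((P s x - Q s x) \<bullet> (P s x - Q s x))" using \<sigma> by simp
          ultimately show "(1 *\<^sub>R (zero_ext T W ?dp s x - zero_ext T W ?dps s x)) \<bullet> (1 *\<^sub>R (P s x - Q s x)) \<le> 0"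
            using 3 4 s by simp
        qed
      qed
    qed
  qed
  then have zero: "nrm W (\<lambda>x. 1 *\<^sub>R (P t x - Q t x)) = 0" if "t \<le> T" for t
    by (rule damped_difference_zero[OF PQ that])
  show ?thesis
    using eq' P(2) Q(2)
  proof eventually_elim
    fix s assume e: "s \<in> ?I \<longrightarrow> (AE x in lebesgue_on W. ?dp s x + \<sigma> (norm x) *\<^sub>R p s x = ?dps s x + \<sigma> (norm x) *\<^sub>R ps s x)"
      and 1: "s \<in> ?I \<longrightarrow> p s \<in> L2 W \<and> dst W (p s) (P s) = 0"
      and 2: "s \<in> ?I \<longrightarrow> ps s \<in> L2 W \<and> dst W (ps s) (Q s) = 0"
    show "s \<in> ?I \<longrightarrow> (AE x in lebesgue_on W. p s x = ps s x \<and> ?dp s x = ?dps s x)"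
    proof
      assume s: "s \<in> ?I"
      have a: "AE x in lebesgue_on W. p s x = P s x" using 1 s primitiveD(1)[OF P(1)] by (intro AE_eq_of_nrm_zero) auto
      have b: "AE x in lebesgue_on W. ps s x = Q s x" using 2 s primitiveD(1)[OF Q(1)] by (intro AE_eq_of_nrm_zero) auto
      have c: "AE x in lebesgue_on W. ?dp s x + \<sigma> (norm x) *\<^sub>R p s x = ?dps s x + \<sigma> (norm x) *\<^sub>R ps s x" using e s by blast
      have d: "AE x in lebesgue_on W. P s x = Q s x"
        using zero[of s] s primitiveD(1)[OF P(1)] primitiveD(1)[OF Q(1)] by (intro AE_eq_of_nrm_zero) auto
      show "AE x in lebesgue_on W. p s x = ps s x \<and> ?dp s x = ?dps s x"
        using a b c d by eventually_elim simp
    qed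
  qed
qed

lemma continuous_version_of_component:
  fixes v :: "real \<Rightarrow> real^2 \<Rightarrow> 'c::euclidean_space" and V :: "real \<Rightarrow> real^2 \<Rightarrow> 'b::euclidean_space" and \<pi> :: "'b \<Rightarrow> 'c"
  assumes V: "L2_continuous W {..T} V" and \<pi>: "bounded_linear \<pi>" "\<And>y. norm (\<pi> y) \<le> norm y"
    and ae: "AE t in lebesgue. t \<in> {0<..<T} \<longrightarrow> v t \<in> L2 W \<and> nrm W (\<lambda>x. v t x - \<pi> (V t x)) = 0"
  shows "continuous_version T (L2_space W) v (\<lambda>t x. \<pi> (V t x))"
    and "\<And>t. t \<le> T \<Longrightarrow> nrm W (\<lambda>x. \<pi> (V t x)) \<le> nrm W (V t)"
proof -
  interpret bounded_linear \<pi> by (rule \<pi>(1))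
  have m: "\<pi> \<in> borel_measurable borel"
    by (rule borel_measurable_continuous_onI[OF linear_continuous_on[OF \<pi>(1)]])
  have L: "V t \<in> L2 W" if "t \<le> T" for t using V that by (simp add: L2_continuous_def)
  note im = L2_image_le[OF _ m \<pi>(2)]
  show "\<And>t. t \<le> T \<Longrightarrow> nrm W (\<lambda>x. \<pi> (V t x)) \<le> nrm W (V t)" by (rule im(2)[OF L])
  show "continuous_version T (L2_space W) v (\<lambda>t x. \<pi> (V t x))"
    unfolding continuous_version_def fdist_L2
  proof (intro conjI ballI)
    fix t assume "t \<in> {0..T}"
    then have t: "t \<le> T" by simp
    show "(\<lambda>x. \<pi> (V t x)) \<in> L2 W" by (rule im(1)[OF L[OF t]])
    have "((\<lambda>s. dst W (V s) (V t)) \<longlongrightarrow> 0) (at t within {..T})" using V t by (simp add: L2_continuous_def)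
    then have lim: "((\<lambda>s. dst W (V s) (V t)) \<longlongrightarrow> 0) (at t within {0..T})"
      by (rule tendsto_within_subset) auto
    show "((\<lambda>s. nrm W (\<lambda>x. \<pi> (V s x) - \<pi> (V t x))) \<longlongrightarrow> 0) (at t within {0..T})"
    proof (rule Lim_null_comparison[OF _ lim])
      have "nrm W (\<lambda>x. \<pi> (V s x) - \<pi> (V t x)) \<le> dst W (V s) (V t)" if "s \<in> {0..T}" for s
        using im(2)[OF L2_diff[OF L[of s] L[OF t]]] that by (simp add: diff)
      then show "\<forall>\<^sub>F s in at t within {0..T}. norm (nrm W (\<lambda>x. \<pi> (V s x) - \<pi> (V t x))) \<le> dst W (V s) (V t)"
        by (auto simp: eventually_at_filter)
    qed
  next
    show "AE t in lebesgue_on {0<..<T}. v t \<in> L2 W \<and> nrm W (\<lambda>x. v t x - \<pi> (V t x)) = 0"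
      unfolding AE_interval_iff by (rule ae)
  qed
qed

text \<open>The abstract result applied to the triple \<open>(u, p, u\<^sup>*)\<close>. Each of the four norms, that of \<open>\<partial>\<^sub>t p\<^sup>* = \<partial>\<^sub>t p\<close>
included, is at most the norm of the derivative of the triple; so the constant is four times 2.\<close>

lemma truncated_pml_estimate:
  assumes W: "open W" "bounded W" and T: "0 < T" and \<sigma>: "\<And>r. 0 \<le> \<sigma> r"
    and sol: "truncated_pml_solution W T \<sigma> \<sigma> f u p us ps"
    and PF: "primitive W F Fd" and K: "\<And>t. nrm W (Fd t) \<le> K" and Fc: "L2_continuous W {0<..T} Fd"
    and F0: "\<And>t. t \<le> 0 \<Longrightarrow> F t = (\<lambda>_. 0)"
    and fF: "AE t in lebesgue. t \<in> {0<..<T} \<longrightarrow> f t \<in> L2 W \<and> dst W (f t) (F t) = 0"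
  shows "\<exists>u_t p_t us_t ps_t.
       continuous_version T (L2_space W) (time_deriv {0<..<T} (L2_space W) u) u_t \<and>
       continuous_version T (L2_space W) (time_deriv {0<..<T} (L2_space W) p) p_t \<and>
       continuous_version T (L2_space W) (time_deriv {0<..<T} (L2_space W) us) us_t \<and>
       continuous_version T (L2_space W) (time_deriv {0<..<T} (L2_space W) ps) ps_t \<and>
       (\<forall>t\<in>{0..T}. nrm W (u_t t) + nrm W (p_t t) + nrm W (us_t t) + nrm W (ps_t t)
          \<le> 8 * (\<integral>s. indicator {0<..T} s * nrm W (Fd s) \<partial>lebesgue))"
proof -
  let ?I = "{0<..<T}"
  have Ws: "W \<in> sets lebesgue" by (rule open_sets_lebesgue[OF W(1)])
  let ?du = "time_deriv ?I (L2_space W) u" and ?dp = "time_deriv ?I (L2_space W) p"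
    and ?dus = "time_deriv ?I (L2_space W) us" and ?dps = "time_deriv ?I (L2_space W) ps"
  have sp: "u \<in> L2_time ?I (H10_space W)" "u \<in> H1_time ?I (L2_space W)"
      "p \<in> L2_time ?I (Hdiv_space W)" "p \<in> H1_time ?I (L2_space W)"
      "us \<in> H1_time ?I (L2_space W)" "ps \<in> H1_time ?I (L2_space W)"
    and eq: "AE t in lebesgue_on ?I. AE x in lebesgue_on W.
           ?du t x + (\<sigma> (norm x) + \<sigma> (norm x)) * u t x + \<sigma> (norm x) * us t x + weak_div W (p t) x = f t x"
      "AE t in lebesgue_on ?I. AE x in lebesgue_on W. ?dps t x = - weak_gradient W (u t) x"
      "AE t in lebesgue_on ?I. AE x in lebesgue_on W. ?dus t x = \<sigma> (norm x) * u t x"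
      "AE t in lebesgue_on ?I. AE x in lebesgue_on W.
           ?dp t x + Lambda1 \<sigma> \<sigma> x *v p t x = ?dps t x + Lambda2 \<sigma> \<sigma> x *v ps t x"
    and z: "zero_initial_value T (L2_space W) u" "zero_initial_value T (L2_space W) p"
      "zero_initial_value T (L2_space W) us" "zero_initial_value T (L2_space W) ps"
    using sol unfolding truncated_pml_solution_def Let_def by blast+
  have pps: "AE t in lebesgue. t \<in> ?I \<longrightarrow> (AE x in lebesgue_on W. p t x = ps t x \<and> ?dp t x = ?dps t x)"
    by (rule pml_p_eq_p_star[OF T \<sigma> sp(4) z(2) sp(6) z(4) eq(4)[unfolded Lambda_eq_scaling]])
  obtain U where U: "primitive W U (zero_ext T W ?du)" "\<And>t. t \<le> 0 \<Longrightarrow> U t = (\<lambda>_. 0)"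
    "AE t in lebesgue. t \<in> ?I \<longrightarrow> u t \<in> L2 W \<and> dst W (u t) (U t) = 0"
    using H1_time_zero_initial[OF T sp(2) z(1)] by blast
  obtain P where P: "primitive W P (zero_ext T W ?dp)" "\<And>t. t \<le> 0 \<Longrightarrow> P t = (\<lambda>_. 0)"
    "AE t in lebesgue. t \<in> ?I \<longrightarrow> p t \<in> L2 W \<and> dst W (p t) (P t) = 0"
    using H1_time_zero_initial[OF T sp(4) z(2)] by blast
  obtain S where S: "primitive W S (zero_ext T W ?dus)" "\<And>t. t \<le> 0 \<Longrightarrow> S t = (\<lambda>_. 0)"
    "AE t in lebesgue. t \<in> ?I \<longrightarrow> us t \<in> L2 W \<and> dst W (us t) (S t) = 0"
    using H1_time_zero_initial[OF T sp(5) z(3)] by blast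
  obtain Gu where Gu: "countable Gu" "Gu \<subseteq> L2 W" "AE t in lebesgue. approximable W Gu (zero_ext T W ?du t)"
    using zero_ext_separable[OF time_deriv_props(2)[OF sp(2)]] by blast
  obtain Gp where Gp: "countable Gp" "Gp \<subseteq> L2 W" "AE t in lebesgue. approximable W Gp (zero_ext T W ?dp t)"
    using zero_ext_separable[OF time_deriv_props(2)[OF sp(4)]] by blast
  obtain Gs where Gs: "countable Gs" "Gs \<subseteq> L2 W" "AE t in lebesgue. approximable W Gs (zero_ext T W ?dus t)"
    using zero_ext_separable[OF time_deriv_props(2)[OF sp(5)]] by blast
  let ?U = "\<lambda>t x. (U t x, P t x, S t x)"
  let ?V = "\<lambda>t x. (zero_ext T W ?du t x, zero_ext T W ?dp t x, zero_ext T W ?dus t x)"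
  let ?F = "\<lambda>t x. (F t x, (0::real^2), (0::real))"
  let ?Fd = "\<lambda>t x. (Fd t x, (0::real^2), (0::real))"
  have PU: "primitive W ?U ?V" by (rule primitive_pair[OF U(1) primitive_pair[OF P(1) S(1)]])
  have PFF: "primitive W ?F ?Fd" by (rule primitive_pair[OF PF primitive_pair[OF primitive_const_zero primitive_const_zero]])
  have nF: "nrm W (\<lambda>x. (g x, (0::real^2), (0::real))) = nrm W g" for g :: "real^2 \<Rightarrow> real"
    by (simp add: nrm_def' norm_Pair)
  have FcF: "L2_continuous W {0<..T} ?Fd"
  proof -
    have "dst W (?Fd s) (?Fd t) = dst W (Fd s) (Fd t)" for s t
      using nF[of "\<lambda>x. Fd s x - Fd t x"] by (simp add: zero_prod_def)
    then show ?thesis using Fc primitiveD(2)[OF PFF] unfolding L2_continuous_def by (simp only:) blast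
  qed
  define G3 where "G3 = (\<lambda>(a, b) x. (a x, b x)) ` (Gu \<times> ((\<lambda>(a, b) x. (a x, b x)) ` (Gp \<times> Gs)))"
  have G2L: "(\<lambda>(a, b) x. (a x, b x)) ` (Gp \<times> Gs) \<subseteq> L2 W" using Gp(2) Gs(2) by (auto intro!: L2_pair)
  have G3: "countable G3" "G3 \<subseteq> L2 W" unfolding G3_def using Gu(1,2) Gp(1,2) Gs(1,2) by (auto intro!: L2_pair)
  have G3ae: "AE t in lebesgue. t < T \<longrightarrow> approximable W G3 (?V t)"
    using Gu(3) Gp(3) Gs(3)
  proof eventually_elim
    fix t assume 1: "approximable W Gu (zero_ext T W ?du t)" and 2: "approximable W Gp (zero_ext T W ?dp t)"
      and 3: "approximable W Gs (zero_ext T W ?dus t)"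
    have "approximable W G3 (?V t)" unfolding G3_def
      by (intro approximable_pair 1 2 3 Gu(2) Gp(2) Gs(2) G2L zero_ext_L2 L2_pair)
    then show "t < T \<longrightarrow> approximable W G3 (?V t)" by blast
  qed
  have H10: "AE t in lebesgue. t \<in> ?I \<longrightarrow> u t \<in> elems (H10_space W)"
    using sp(1) by (simp add: L2_time_def AE_interval_iff)
  have Hdiv: "AE t in lebesgue. t \<in> ?I \<longrightarrow> p t \<in> elems (Hdiv_space W)"
    using sp(3) by (simp add: L2_time_def AE_interval_iff)
  note eqs = eq(1-3)[unfolded AE_interval_iff]
  note ze = L2_time_zero_ext(1)[OF time_deriv_props(2)[OF sp(2)]] L2_time_zero_ext(1)[OF time_deriv_props(2)[OF sp(4)]]
     L2_time_zero_ext(1)[OF time_deriv_props(2)[OF sp(5)]]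
  have rel: "AE t in lebesgue. t < T \<longrightarrow> pml_rel W \<sigma> (?U t) (?V t) (?F t)"
    using H10 Hdiv eqs ze U(3) P(3) S(3) fF pps
  proof eventually_elim
    fix t
    assume a1: "t \<in> ?I \<longrightarrow> u t \<in> elems (H10_space W)" and a2: "t \<in> ?I \<longrightarrow> p t \<in> elems (Hdiv_space W)"
      and a3: "t \<in> ?I \<longrightarrow> (AE x in lebesgue_on W. ?du t x + (\<sigma> (norm x) + \<sigma> (norm x)) * u t x + \<sigma> (norm x) * us t x + weak_div W (p t) x = f t x)"
      and a4: "t \<in> ?I \<longrightarrow> (AE x in lebesgue_on W. ?dps t x = - weak_gradient W (u t) x)"
      and a5: "t \<in> ?I \<longrightarrow> (AE x in lebesgue_on W. ?dus t x = \<sigma> (norm x) * u t x)"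
      and a6: "t \<in> ?I \<longrightarrow> zero_ext T W ?du t = ?du t" and a7: "t \<in> ?I \<longrightarrow> zero_ext T W ?dp t = ?dp t"
      and a8: "t \<in> ?I \<longrightarrow> zero_ext T W ?dus t = ?dus t"
      and a9: "t \<in> ?I \<longrightarrow> u t \<in> L2 W \<and> dst W (u t) (U t) = 0"
      and a10: "t \<in> ?I \<longrightarrow> p t \<in> L2 W \<and> dst W (p t) (P t) = 0"
      and a11: "t \<in> ?I \<longrightarrow> us t \<in> L2 W \<and> dst W (us t) (S t) = 0"
      and a12: "t \<in> ?I \<longrightarrow> f t \<in> L2 W \<and> dst W (f t) (F t) = 0"
      and a13: "t \<in> ?I \<longrightarrow> (AE x in lebesgue_on W. p t x = ps t x \<and> ?dp t x = ?dps t x)"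
    show "t < T \<longrightarrow> pml_rel W \<sigma> (?U t) (?V t) (?F t)"
    proof
      assume tT: "t < T"
      show "pml_rel W \<sigma> (?U t) (?V t) (?F t)"
      proof (cases "t \<le> 0")
        case True
        then have "?U t = (\<lambda>_. 0)" "?V t = (\<lambda>_. 0)" "?F t = (\<lambda>_. 0)"
          using U(2) P(2) S(2) F0 by (auto simp: zero_ext_def zero_prod_def)
        then show ?thesis using pml_rel_zero by (simp only:)
      next
        case False
        then have t: "t \<in> ?I" using tT by simp
        have zz: "zero_ext T W ?du t = ?du t" "zero_ext T W ?dp t = ?dp t" "zero_ext T W ?dus t = ?dus t"
          using a6 a7 a8 t by blast+
        show ?thesis
        proof (rule pml_rel_of_equations[OF W primitiveD(1)[OF U(1)] primitiveD(1)[OF P(1)] primitiveD(1)[OF S(1)] primitiveD(1)[OF PF]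
              zero_ext_L2 zero_ext_L2 zero_ext_L2])
          show "u t \<in> elems (H10_space W)" "dst W (u t) (U t) = 0" "p t \<in> elems (Hdiv_space W)" "dst W (p t) (P t) = 0"
            "us t \<in> L2 W" "dst W (us t) (S t) = 0" "f t \<in> L2 W" "dst W (f t) (F t) = 0"
            using a1 a2 a9 a10 a11 a12 t by blast+
          show "AE x in lebesgue_on W. zero_ext T W ?du t x + 2 * \<sigma> (norm x) * u t x + \<sigma> (norm x) * us t x + weak_div W (p t) x = f t x"
            unfolding zz(1) mult_2 using a3 t by blast
          have "AE x in lebesgue_on W. ?dps t x = - weak_gradient W (u t) x" "AE x in lebesgue_on W. p t x = ps t x \<and> ?dp t x = ?dps t x"
            using a4 a13 t by blast+
          then show "AE x in lebesgue_on W. zero_ext T W ?dp t x = - weak_gradient W (u t) x"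
            unfolding zz(2) by eventually_elim simp
          show "AE x in lebesgue_on W. zero_ext T W ?dus t x = \<sigma> (norm x) * u t x"
            unfolding zz(3) using a5 t by blast
        qed
      qed
    qed
  qed
  obtain V' where V': "L2_continuous W {..T} V'" "AE t in lebesgue. t < T \<longrightarrow> dst W (?V t) (V' t) = 0"
    "\<And>t. t \<le> T \<Longrightarrow> nrm W (V' t) \<le> 2 * (\<integral>s. indicator {0<..T} s * nrm W (?Fd s) \<partial>lebesgue)"
  proof (rule dissipative_evolution_time_derivative[where rel="pml_rel W \<sigma>", OF PU PFF _ FcF _ _ rel G3 G3ae])
    show "nrm W (?Fd t) \<le> K" for t using K by (simp add: nF)
    show "pml_rel W \<sigma> (\<lambda>x. c *\<^sub>R (u x - u' x)) (\<lambda>x. c *\<^sub>R (v x - v' x)) (\<lambda>x. c *\<^sub>R (f x - f' x))"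
      if "pml_rel W \<sigma> u v f" "pml_rel W \<sigma> u' v' f'" for u v f u' v' f' c
      by (rule pml_rel_scaled_diff[OF Ws that])
    show "ip W v u \<le> ip W f u" if "pml_rel W \<sigma> u v f" for u v f by (rule pml_rel_dissipative[OF Ws \<sigma> that])
  qed blast
  have V'L: "V' t \<in> L2 W" if "t \<le> T" for t using V'(1) that by (simp add: L2_continuous_def)
  have comp: "AE t in lebesgue. t \<in> ?I \<longrightarrow> nrm W (\<lambda>x. \<pi> (?V t x) - \<pi> (V' t x)) = 0"
    if \<pi>: "bounded_linear \<pi>" "\<And>y. norm (\<pi> y) \<le> norm y" for \<pi> :: "real \<times> (real^2) \<times> real \<Rightarrow> 'd::euclidean_space"
    using V'(2)
  proof eventually_elim
    fix t assume 1: "t < T \<longrightarrow> dst W (?V t) (V' t) = 0"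
    show "t \<in> ?I \<longrightarrow> nrm W (\<lambda>x. \<pi> (?V t x) - \<pi> (V' t x)) = 0"
    proof
      assume t: "t \<in> ?I"
      interpret bounded_linear \<pi> by (rule \<pi>(1))
      have m: "\<pi> \<in> borel_measurable borel" by (rule borel_measurable_continuous_onI[OF linear_continuous_on[OF \<pi>(1)]])
      have "nrm W (\<lambda>x. \<pi> (?V t x - V' t x)) \<le> dst W (?V t) (V' t)"
        using t by (intro L2_image_le(2)[OF L2_diff[OF primitiveD(2)[OF PU] V'L] m \<pi>(2)]) simp
      then show "nrm W (\<lambda>x. \<pi> (?V t x) - \<pi> (V' t x)) = 0" using 1 t by (simp add: diff order_antisym)
    qed
  qed
  have L2v: "AE t in lebesgue. t \<in> ?I \<longrightarrow> ?du t \<in> L2 W" "AE t in lebesgue. t \<in> ?I \<longrightarrow> ?dp t \<in> L2 W"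
    "AE t in lebesgue. t \<in> ?I \<longrightarrow> ?dus t \<in> L2 W" "AE t in lebesgue. t \<in> ?I \<longrightarrow> ?dps t \<in> L2 W"
    using time_deriv_props(2)[OF sp(2)] time_deriv_props(2)[OF sp(4)] time_deriv_props(2)[OF sp(5)] time_deriv_props(2)[OF sp(6)]
    by (simp_all add: L2_time_def AE_interval_iff)
  let ?p1 = "fst :: real \<times> (real^2) \<times> real \<Rightarrow> real"
  let ?p2 = "(\<lambda>y. fst (snd y)) :: real \<times> (real^2) \<times> real \<Rightarrow> real^2"
  let ?p3 = "(\<lambda>y. snd (snd y)) :: real \<times> (real^2) \<times> real \<Rightarrow> real"
  have b1: "bounded_linear ?p1" "\<And>y. norm (?p1 y) \<le> norm y" by (rule bounded_linear_fst, rule norm_fst_snd_le)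
  have b2: "bounded_linear ?p2" "\<And>y. norm (?p2 y) \<le> norm y"
    by (rule bounded_linear_compose[OF bounded_linear_fst bounded_linear_snd],
        rule order_trans[OF norm_fst_snd_le(1) norm_fst_snd_le(2)])
  have b3: "bounded_linear ?p3" "\<And>y. norm (?p3 y) \<le> norm y"
    by (rule bounded_linear_compose[OF bounded_linear_snd bounded_linear_snd],
        rule order_trans[OF norm_fst_snd_le(2) norm_fst_snd_le(2)])
  have c1: "AE t in lebesgue. t \<in> ?I \<longrightarrow> ?du t \<in> L2 W \<and> nrm W (\<lambda>x. ?du t x - ?p1 (V' t x)) = 0"
    using comp[OF b1] ze(1) L2v(1) by eventually_elim auto
  have c2: "AE t in lebesgue. t \<in> ?I \<longrightarrow> ?dp t \<in> L2 W \<and> nrm W (\<lambda>x. ?dp t x - ?p2 (V' t x)) = 0"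
    using comp[OF b2] ze(2) L2v(2) by eventually_elim auto
  have c3: "AE t in lebesgue. t \<in> ?I \<longrightarrow> ?dus t \<in> L2 W \<and> nrm W (\<lambda>x. ?dus t x - ?p3 (V' t x)) = 0"
    using comp[OF b3] ze(3) L2v(3) by eventually_elim auto
  have c4: "AE t in lebesgue. t \<in> ?I \<longrightarrow> ?dps t \<in> L2 W \<and> nrm W (\<lambda>x. ?dps t x - ?p2 (V' t x)) = 0"
    using c2 L2v(4) pps
  proof eventually_elim
    fix t assume 1: "t \<in> ?I \<longrightarrow> ?dp t \<in> L2 W \<and> nrm W (\<lambda>x. ?dp t x - ?p2 (V' t x)) = 0"
      and 2: "t \<in> ?I \<longrightarrow> ?dps t \<in> L2 W" and 3: "t \<in> ?I \<longrightarrow> (AE x in lebesgue_on W. p t x = ps t x \<and> ?dp t x = ?dps t x)"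
    show "t \<in> ?I \<longrightarrow> ?dps t \<in> L2 W \<and> nrm W (\<lambda>x. ?dps t x - ?p2 (V' t x)) = 0"
    proof
      assume t: "t \<in> ?I"
      have "AE x in lebesgue_on W. p t x = ps t x \<and> ?dp t x = ?dps t x" using 3 t by blast
      then have "AE x in lebesgue_on W. ?dps t x = ?dp t x" by eventually_elim simp
      then have 0: "dst W (?dps t) (?dp t) = 0" by (rule nrm_eq_0_of_AE_eq)
      have L: "?dps t \<in> L2 W" "?dp t \<in> L2 W" using 1 2 t by blast+
      have vL: "(\<lambda>x. ?p2 (V' t x)) \<in> L2 W" using t by (intro L2_fst(1) L2_snd(1) V'L) simp
      have "nrm W (\<lambda>x. ?dp t x - ?p2 (V' t x)) = 0" using 1 t by blast
      then have "nrm W (\<lambda>x. ?dps t x - ?p2 (V' t x)) \<le> 0"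
        using nrm_triangle3[OF L vL] 0 by linarith
      then show "?dps t \<in> L2 W \<and> nrm W (\<lambda>x. ?dps t x - ?p2 (V' t x)) = 0" using L(1) by (simp add: order_antisym)
    qed
  qed
  note C1 = continuous_version_of_component[OF V'(1) b1 c1] and C2 = continuous_version_of_component[OF V'(1) b2 c2]
    and C3 = continuous_version_of_component[OF V'(1) b3 c3] and C4 = continuous_version_of_component[OF V'(1) b2 c4]
  show ?thesis
  proof (intro exI conjI ballI)
    show "continuous_version T (L2_space W) ?du (\<lambda>t x. ?p1 (V' t x))" by (rule C1(1))
    show "continuous_version T (L2_space W) ?dp (\<lambda>t x. ?p2 (V' t x))" by (rule C2(1))
    show "continuous_version T (L2_space W) ?dus (\<lambda>t x. ?p3 (V' t x))" by (rule C3(1))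
    show "continuous_version T (L2_space W) ?dps (\<lambda>t x. ?p2 (V' t x))" by (rule C4(1))
    fix t assume "t \<in> {0..T}"
    then have t: "t \<le> T" by simp
    show "nrm W (\<lambda>x. ?p1 (V' t x)) + nrm W (\<lambda>x. ?p2 (V' t x)) + nrm W (\<lambda>x. ?p3 (V' t x)) + nrm W (\<lambda>x. ?p2 (V' t x))
          \<le> 8 * (\<integral>s. indicator {0<..T} s * nrm W (Fd s) \<partial>lebesgue)"
      using C1(2)[OF t] C2(2)[OF t] C3(2)[OF t] V'(3)[OF t] unfolding nF by linarith
  qed
qed

text \<open>The term \<open>\<sigma> f\<close> vanishes, since \<open>\<sigma> = 0\<close> on the support of \<open>f\<close>.\<close>

lemma source_norm_integral:
  fixes f v Fd :: "real \<Rightarrow> real^2 \<Rightarrow> real"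
  assumes W: "W \<in> sets lebesgue" and K: "\<And>t. nrm W (Fd t) \<le> K" and Fc: "L2_continuous W {0<..T} Fd"
    and v: "AE t in lebesgue. t \<in> {0<..<T} \<longrightarrow> v t \<in> L2 W \<and> dst W (v t) (Fd t) = 0"
    and sf: "AE t in lebesgue. t \<in> {0<..<T} \<longrightarrow> (AE x in lebesgue_on W. \<sigma> (norm x) * f t x = 0)"
  shows "(\<integral>t. nrm W (\<lambda>x. v t x + \<sigma> (norm x) * f t x) \<partial>lebesgue_on {0<..<T})
     = (\<integral>s. indicator {0<..T} s * nrm W (Fd s) \<partial>lebesgue)"
proof -
  let ?h = "\<lambda>t. nrm W (\<lambda>x. v t x + \<sigma> (norm x) * f t x)"
  have m: "(\<lambda>s. indicator {0<..T} s * nrm W (Fd s)) \<in> borel_measurable lebesgue"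
    by (rule indicator_continuous_measurable[OF L2_continuous_nrm[OF Fc]])
  have "AE t in lebesgue. t \<notin> {T}" by (rule AE_not_in) auto
  then have eq: "AE t in lebesgue. indicator {0<..T} t * nrm W (Fd t) = indicator {0<..<T} t *\<^sub>R ?h t"
    using v sf
  proof eventually_elim
    fix t assume 1: "t \<notin> {T}" and 2: "t \<in> {0<..<T} \<longrightarrow> v t \<in> L2 W \<and> dst W (v t) (Fd t) = 0"
      and 3: "t \<in> {0<..<T} \<longrightarrow> (AE x in lebesgue_on W. \<sigma> (norm x) * f t x = 0)"
    show "indicator {0<..T} t * nrm W (Fd t) = indicator {0<..<T} t *\<^sub>R ?h t"
    proof (cases "t \<in> {0<..<T}")
      case True
      have FL: "Fd t \<in> L2 W" using Fc True by (simp add: L2_continuous_def)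
      have vL: "v t \<in> L2 W" using 2 True by blast
      have "AE x in lebesgue_on W. \<sigma> (norm x) * f t x = 0" using 3 True by blast
      then have ae: "AE x in lebesgue_on W. v t x = v t x + \<sigma> (norm x) * f t x" by eventually_elim simp
      have "nrm W (v t) = ?h t"
        by (rule nrm_cong_dist0[OF vL L2_cong_AE[OF W vL ae] nrm_eq_0_of_AE_eq[OF ae]])
      moreover have "nrm W (v t) = nrm W (Fd t)"
        by (rule nrm_cong_dist0[OF vL FL]) (use 2 True in blast)
      ultimately show ?thesis using True by simp
    next
      case False then show ?thesis using 1 by (auto simp: indicator_def)
    qed
  qed
  have "(\<integral>t. ?h t \<partial>lebesgue_on {0<..<T}) = (\<integral>t. indicator {0<..<T} t *\<^sub>R ?h t \<partial>lebesgue)"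
    by (simp add: integral_restrict_space)
  also have "\<dots> = (\<integral>s. indicator {0<..T} s * nrm W (Fd s) \<partial>lebesgue)"
    by (rule integral_cong_AE[symmetric, OF m borel_measurable_AE[OF m eq] eq])
  finally show ?thesis .
qed

theorem theorem3p3:
  fixes R \<rho> T \<sigma>R \<sigma>\<rho> :: real
    and \<Gamma>0 \<Omega> D \<Omega>\<rho> :: "(real^2) set"
    and \<sigma> \<sigma>h :: "real \<Rightarrow> real"
  assumes "0 < R" and "R < \<rho>" and "0 < T"
    and "local_perturbation_of_line R \<Gamma>0"
    and "is_domain_above \<Gamma>0 \<Omega>"
    and "bounded_domain D" and "lipschitz_boundary D" and "connected (- closure D)"
    and "D \<subseteq> half_ball \<Omega> R"
    and "\<Omega>\<rho> = truncated_domain \<Omega> D \<rho>"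
    and "\<And>r. r \<le> R \<Longrightarrow> \<sigma> r = 0" and "\<And>r. r > R \<Longrightarrow> \<sigma> r > 0"
    and "mono_on {R..\<rho>} \<sigma>"
    and "\<And>r. r \<in> {R..\<rho>} \<Longrightarrow> \<sigma>R \<le> \<sigma> r \<and> \<sigma> r \<le> \<sigma>\<rho>"
    and "\<sigma>h = \<sigma>"
  shows "\<exists>C>0. \<forall>f u p us ps.
    admissible_source \<Omega> D R T f \<and> truncated_pml_solution \<Omega>\<rho> T \<sigma> \<sigma>h f u p us ps \<longrightarrow>
    (\<exists>u_t p_t us_t ps_t.
       continuous_version T (L2_space \<Omega>\<rho>) (time_deriv {0<..<T} (L2_space \<Omega>\<rho>) u) u_t \<and>
       continuous_version T (L2_space \<Omega>\<rho>) (time_deriv {0<..<T} (L2_space \<Omega>\<rho>) p) p_t \<and>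
       continuous_version T (L2_space \<Omega>\<rho>) (time_deriv {0<..<T} (L2_space \<Omega>\<rho>) us) us_t \<and>
       continuous_version T (L2_space \<Omega>\<rho>) (time_deriv {0<..<T} (L2_space \<Omega>\<rho>) ps) ps_t \<and>
       (\<forall>t\<in>{0..T}.
          fnorm (L2_space \<Omega>\<rho>) (u_t t) + fnorm (L2_space \<Omega>\<rho>) (p_t t) +
          fnorm (L2_space \<Omega>\<rho>) (us_t t) + fnorm (L2_space \<Omega>\<rho>) (ps_t t)
          \<le> C * (\<integral>t. fnorm (L2_space \<Omega>\<rho>)
                    (\<lambda>x. time_deriv {0<..<T} (L2_space \<Omega>\<rho>) f t x + \<sigma> (norm x) * f t x)
                  \<partial>lebesgue_on {0<..<T})))"
proof (intro exI[of _ 8] conjI allI impI)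
  fix f :: "real \<Rightarrow> real^2 \<Rightarrow> real" and u p us ps
  assume *: "admissible_source \<Omega> D R T f \<and> truncated_pml_solution \<Omega>\<rho> T \<sigma> \<sigma>h f u p us ps"
  let ?W = "\<Omega>\<rho>" and ?B = "ball 0 \<rho> :: (real^2) set" and ?I = "{0<..<T}"
  have \<rho>: "0 < \<rho>" using assms(1,2) by linarith
  have sig: "0 \<le> \<sigma> r" for r using assms(11,12)[of r] by (cases "r \<le> R") auto
  have Wdef: "?W = (\<Omega> \<inter> ?B) \<inter> - closure D"
    using assms(10) by (auto simp: truncated_domain_def half_ball_def)
  have "open \<Omega>" using assms(5) by (simp add: is_domain_above_def)
  then have Wo: "open ?W" unfolding Wdef by (intro open_Int) auto
  have WB: "?W \<subseteq> ?B" unfolding Wdef by blast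
  then have Wb: "bounded ?W" using bounded_subset bounded_ball by blast
  note Ws = open_sets_lebesgue[OF Wo] and Bs = open_sets_lebesgue[OF open_ball, of "0::real^2" \<rho>]
  \<comment> \<open>the truncated domain may be disconnected, whereas the ball around it is a bounded domain in the sense of the assumption on \<open>f\<close>\<close>
  have Bdom: "bounded_domain ?B" using \<rho> by (auto simp: bounded_domain_def)
  have src: "admissible_source \<Omega> D R T f" and sol: "truncated_pml_solution ?W T \<sigma> \<sigma> f u p us ps"
    using * assms(15) by auto
  obtain C where C: "compact C" "C \<subseteq> half_ball \<Omega> R - closure D"
    "AE t in lebesgue_on ?I. AE x in lebesgue_on (- C). f t x = 0"
    using src unfolding admissible_source_def by blast
  have f2: "f \<in> H2_time ?I (L2_space ?B)" and f0: "zero_initial_value T (L2_space ?B) f"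
    using src Bdom unfolding admissible_source_def by blast+
  obtain F Fd K where F: "primitive ?W F Fd" "\<And>t. nrm ?W (Fd t) \<le> K" "L2_continuous ?W {0<..T} Fd"
    "\<And>t. t \<le> 0 \<Longrightarrow> F t = (\<lambda>_. 0)"
    "AE t in lebesgue. t \<in> ?I \<longrightarrow> f t \<in> L2 ?W \<and> dst ?W (f t) (F t) = 0"
    "AE t in lebesgue. t \<in> ?I \<longrightarrow> time_deriv ?I (L2_space ?W) f t \<in> L2 ?W \<and>
       dst ?W (time_deriv ?I (L2_space ?W) f t) (Fd t) = 0"
    using source_primitive[OF assms(3) WB Ws Bs f2 f0] by blast
  have Cs: "- C \<in> sets lebesgue" using C(1) by (intro open_sets_lebesgue) (simp add: compact_imp_closed open_Compl)
  have sf: "AE t in lebesgue. t \<in> ?I \<longrightarrow> (AE x in lebesgue_on ?W. \<sigma> (norm x) * f t x = 0)"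
    using C(3)[unfolded AE_interval_iff]
  proof eventually_elim
    fix t assume 1: "t \<in> ?I \<longrightarrow> (AE x in lebesgue_on (- C). f t x = 0)"
    show "t \<in> ?I \<longrightarrow> (AE x in lebesgue_on ?W. \<sigma> (norm x) * f t x = 0)"
    proof
      assume "t \<in> ?I"
      then have "AE x in lebesgue. x \<in> - C \<longrightarrow> f t x = 0" using 1 Cs by (simp add: AE_restrict_space_iff)
      then have "AE x in lebesgue. x \<in> ?W \<longrightarrow> \<sigma> (norm x) * f t x = 0"
      proof eventually_elim
        fix x assume 2: "x \<in> - C \<longrightarrow> f t x = 0"
        show "x \<in> ?W \<longrightarrow> \<sigma> (norm x) * f t x = 0"
        proof (cases "x \<in> C")
          case True
          then have "norm x \<le> R" using C(2) by (auto simp: half_ball_def)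
          then show ?thesis using assms(11) by simp
        qed (use 2 in simp)
      qed
      then show "AE x in lebesgue_on ?W. \<sigma> (norm x) * f t x = 0" using Ws by (simp add: AE_restrict_space_iff)
    qed
  qed
  show "\<exists>u_t p_t us_t ps_t.
       continuous_version T (L2_space ?W) (time_deriv ?I (L2_space ?W) u) u_t \<and>
       continuous_version T (L2_space ?W) (time_deriv ?I (L2_space ?W) p) p_t \<and>
       continuous_version T (L2_space ?W) (time_deriv ?I (L2_space ?W) us) us_t \<and>
       continuous_version T (L2_space ?W) (time_deriv ?I (L2_space ?W) ps) ps_t \<and>
       (\<forall>t\<in>{0..T}. nrm ?W (u_t t) + nrm ?W (p_t t) + nrm ?W (us_t t) + nrm ?W (ps_t t)
          \<le> 8 * (\<integral>t. nrm ?W (\<lambda>x. time_deriv ?I (L2_space ?W) f t x + \<sigma> (norm x) * f t x) \<partial>lebesgue_on ?I))"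
    unfolding source_norm_integral[OF Ws F(2,3,6) sf]
    by (rule truncated_pml_estimate[OF Wo Wb assms(3) sig sol F(1-5)])
qed simp

end
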